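(* Let $U=H^1_{\Gamma_u}(\Omega)$, $\hat U=H^{-1/2}_{\Gamma_\sigma}(\partial\mathcal{T})$, $U_{\mathcal{T}}=U\times\hat U$ and $V_{\mathcal{T}}=H^1(\mathcal{T})$. Let $$b_0(u,v)=-\omega^2\rho(u,v)_{\mathcal{T}}+(\mathsf{C}^*:\nabla u,\nabla v)_{\mathcal{T}},\qquad \hat b(\hat\sigma_n,v)=-\langle\hat\sigma_n,\mathrm{tr}_{0,\mathcal{T}}v\rangle_{\partial\mathcal{T}},$$ $$b_{\mathcal{T}}\big((u,\hat\sigma_n),v\big)=b_0(u,v)+\hat b(\hat\sigma_n,v).$$ Consider the broken problem: given $\ell_{\mathcal{T}}\in V_{\mathcal{T}}'$, find $(u,\hat\sigma_n)\in U_{\mathcal{T}}$ such that $b_{\mathcal{T}}((u,\hat\sigma_n),v)=\ell_{\mathcal{T}}(v)$ for all $v\in V_{\mathcal{T}}$; and the classical problem: given $\ell\in U'$, find $u\in U$ such that $b_0(u,v)=\ell(v)$ for all $v\in U$. Then the broken problem is well-posed if and only if the classical problem is well-posed. In case of being well-posed, given any $\ell_{\mathcal{T}}\in V_{\mathcal{T}}'$ there exists a unique $(u,\hat\sigma_n)\in U_{\mathcal{T}}$ with $b_{\mathcal{T}}((u,\hat\sigma_n),v)=\ell_{\mathcal{T}}(v)$ for all $v\in V_{\mathcal{T}}$, and it satisfies $\|(u,\hat\sigma_n)\|_{U_{\mathcal{T}}}\le C\|\ell_{\mathcal{T}}\|_{V_{\mathcal{T}}'}$ for a constant $C>0$ independent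 of the choice of $\ell_{\mathcal{T}}$ and of the mesh $\mathcal{T}$.
   Context: $\Omega\subseteq\mathbb{R}^3$ is a bounded Lipschitz domain; $\Gamma_u,\Gamma_\sigma\subseteq\partial\Omega$ are relatively open with $\overline{\Gamma_u\cup\Gamma_\sigma}=\partial\Omega$, $\Gamma_u\cap\Gamma_\sigma=\varnothing$, $\Gamma_u\ne\varnothing$. $\omega\in\mathbb{R}$, $\rho>0$ is constant, and $\mathsf{C}^*$ is a bounded measurable field on $\Omega$ of complex fourth-order tensors with symmetries $\mathsf{C}^*_{ijkl}=\mathsf{C}^*_{ijlk}=\mathsf{C}^*_{jikl}=\mathsf{C}^*_{klij}$; $(\mathsf{C}^*:\tau)_{ij}=\sum_{k,l}\mathsf{C}^*_{ijkl}\tau_{kl}$. A mesh $\mathcal{T}$ is a finite family of disjoint open Lipschitz subdomains $K\subseteq\Omega$ with $\bigcup_{K\in\mathcal{T}}\overline K=\overline\Omega$. $\Omega,\Gamma_u,\Gamma_\sigma,\omega,\rho,\mathsf{C}^*$ are fixed while $\mathcal{T}$ may vary. Inner products: $(w_1,w_2)_K=\int_K\mathrm{tr}(w_2^\dagger w_1)\,dK$ for complex scalar, vector or matrix functions; $(w_1,w_2)_{\mathcal{T}}=\sum_{K\in\mathcal{T}}(w_1|_K,w_2|_K)_K$, with gradients taken elementwise. Primes denote spaces of continuous conjugate-linear functionals with dual norm. Spaces: $H^1(K)$ is the space of $u:K\to\mathbb{C}^3$ with $\|u\|_{H^1(K)}^2=(u,u)_K+(\nabla u,\nabla u)_K<\infty$;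 $H^1_{\Gamma_u}(\Omega)=\{u\in H^1(\Omega):u|_{\Gamma_u}=0\}$; $H^1(\mathcal{T})=\{u:\Omega\to\mathbb{C}^3:\|u\|^2_{H^1(\mathcal{T})}=\sum_K\|u|_K\|^2_{H^1(K)}<\infty\}$. $H(\mathrm{div},K)$ is the space of $\sigma:K\to\mathbb{C}^{3\times3}$ with $\|\sigma\|^2_{H(\mathrm{div},K)}=(\sigma,\sigma)_K+(\mathrm{div}\,\sigma,\mathrm{div}\,\sigma)_K<\infty$ (row-wise divergence). $H_{\Gamma_\sigma}(\mathrm{div},\Omega)=\{\sigma\in H(\mathrm{div},\Omega):\sigma|_{\Gamma_\sigma}\cdot\hat n=0\}$, the condition meaning $\langle\sigma\cdot\hat n,v\rangle_{\partial\Omega}=0$ for all $v\in H^1_{\Gamma_u}(\Omega)$. Traces: $H^{1/2}(\partial K)=\{u|_{\partial K}:u\in H^1(K)\}$ and $H^{-1/2}(\partial K)=\{\sigma|_{\partial K}\cdot\hat n_K:\sigma\in H(\mathrm{div},K)\}$ are in duality through $\langle\cdot,\cdot\rangle_{\partial K}$ (linear in the first argument, conjugate-linear in the second), with $\langle\sigma|_{\partial K}\cdot\hat n_K,v|_{\partial K}\rangle_{\partial K}=(\sigma,\nabla v)_K+(\mathrm{div}\,\sigma,v)_K$; $\hat n_K$ is the outward normal. $\mathrm{tr}_{0,\mathcal{T}}u=(u|_K|_{\partial K})_{K\in\mathcal{T}}$ and $\mathrm{tr}_{2,\mathcal{T}}\sigma=(\sigma|_K|_{\partial K}\cdot\hat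 n_K)_{K\in\mathcal{T}}$; $\langle\hat\sigma_n,\hat v\rangle_{\partial\mathcal{T}}=\sum_K\langle\hat\sigma_{n,K},\hat v_K\rangle_{\partial K}$. $H^{-1/2}_{\Gamma_\sigma}(\partial\mathcal{T})=\mathrm{tr}_{2,\mathcal{T}}(H_{\Gamma_\sigma}(\mathrm{div},\Omega))$ with norm $\|\hat\sigma_n\|=\inf\{\|\sigma\|_{H(\mathrm{div},\Omega)}:\sigma\in H_{\Gamma_\sigma}(\mathrm{div},\Omega),\ \mathrm{tr}_{2,\mathcal{T}}\sigma=\hat\sigma_n\}$. $U_{\mathcal{T}}$ has the Hilbert norm $\|(u,\hat\sigma_n)\|^2_{U_{\mathcal{T}}}=\|u\|^2_{H^1(\Omega)}+\|\hat\sigma_n\|^2$. A problem is well-posed if for every right-hand side in the dual of its test space there is a unique solution depending continuously on the right-hand side (norm of solution bounded by a constant times the dual norm of the right-hand side). *)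

theory Defs
  imports "HOL-Analysis.Analysis"
begin

text \<open>
  Functions on a subset \<open>K\<close> of space are represented by total functions whose values outside
  \<open>K\<close> are irrelevant; elements of Lebesgue and Sobolev spaces are represented by functions
  rather than by classes modulo equality almost everywhere.
\<close>

type_synonym point = "real^3"
type_synonym vfield = "point \<Rightarrow> complex^3"
type_synonym mfield = "point \<Rightarrow> complex^3^3"

section \<open>Lipschitz domains and surface measure\<close>

text \<open>
  Near every boundary point the domain is, after an orthogonal change of coordinates, the set
  above the graph of a Lipschitz function (the translation is absorbed in \<open>\<gamma>\<close>).
\<close>

definition lipschitz_domain :: "point set \<Rightarrow> bool" where
  "lipschitz_domain K \<longleftrightarrow>
     open K \<and> connected K \<and> K \<noteq> {} \<and> bounded K \<and>
     (\<forall>x\<in>frontier K. \<exists>r>0. \<exists>\<Phi>::point \<Rightarrow> point. \<exists>\<gamma>::real \<times> real \<Rightarrow> real. \<exists>L.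
        orthogonal_transformation \<Phi> \<and> L-lipschitz_on UNIV \<gamma> \<and>
        K \<inter> ball x r = {y \<in> ball x r. \<gamma> (\<Phi> y $ 1, \<Phi> y $ 2) < \<Phi> y $ 3})"

text \<open>
  Two-dimensional Hausdorff measure; the factor \<open>pi / 4\<close> normalises it to surface area.
\<close>

definition hausdorff2_delta :: "real \<Rightarrow> point set \<Rightarrow> ennreal" where
  "hausdorff2_delta \<delta> A =
     (INF C \<in> {C :: nat \<Rightarrow> point set.
                 A \<subseteq> (\<Union>i. C i) \<and> (\<forall>i. bounded (C i) \<and> diameter (C i) \<le> \<delta>)}.
        \<Sum>i. ennreal (pi / 4 * (diameter (C i))\<^sup>2))"

definition hausdorff2 :: "point set \<Rightarrow> ennreal" where
  "hausdorff2 A = (SUP \<delta> \<in> {0<..}. hausdorff2_delta \<delta> A)"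

definition surface :: "point measure" where
  "surface = measure_of UNIV (sets borel) hausdorff2"

section \<open>Weak derivatives\<close>

definition C1 :: "(point \<Rightarrow> 'b::real_normed_vector) \<Rightarrow> bool" where
  "C1 f \<longleftrightarrow> f differentiable_on UNIV \<and>
     (\<forall>h. continuous_on UNIV (\<lambda>x. frechet_derivative f (at x) h))"

definition partial :: "3 \<Rightarrow> (point \<Rightarrow> real) \<Rightarrow> point \<Rightarrow> real" where
  "partial j \<phi> x = frechet_derivative \<phi> (at x) (axis j 1)"

text \<open>
  Test functions are \<open>C1\<close> with compact support in \<open>K\<close>, which for first-order weak derivatives
  is as good as smooth (Gilbarg and Trudinger, Section 7.3).
\<close>

definition test_fun :: "point set \<Rightarrow> (point \<Rightarrow> real) \<Rightarrow> bool" where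
  "test_fun K \<phi> \<longleftrightarrow> C1 \<phi> \<and> compact (closure {x. \<phi> x \<noteq> 0}) \<and> closure {x. \<phi> x \<noteq> 0} \<subseteq> K"

definition L2 :: "point set \<Rightarrow> (point \<Rightarrow> 'b::real_normed_vector) set" where
  "L2 K = {f. f \<in> borel_measurable (lebesgue_on K) \<and>
              integrable (lebesgue_on K) (\<lambda>x. (norm (f x))\<^sup>2)}"

definition weak_grad :: "point set \<Rightarrow> vfield \<Rightarrow> mfield \<Rightarrow> bool" where
  "weak_grad K u G \<longleftrightarrow> (\<forall>\<phi>. test_fun K \<phi> \<longrightarrow> (\<forall>i j.
     (LINT x|lebesgue_on K. u x $ i * of_real (partial j \<phi> x)) =
     - (LINT x|lebesgue_on K. G x $ i $ j * of_real (\<phi> x))))"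

definition weak_div :: "point set \<Rightarrow> mfield \<Rightarrow> vfield \<Rightarrow> bool" where
  "weak_div K \<sigma> d \<longleftrightarrow> (\<forall>\<phi>. test_fun K \<phi> \<longrightarrow> (\<forall>i.
     (LINT x|lebesgue_on K. (\<Sum>j\<in>UNIV. \<sigma> x $ i $ j * of_real (partial j \<phi> x))) =
     - (LINT x|lebesgue_on K. d x $ i * of_real (\<phi> x))))"

text \<open>
  Weak gradient and weak divergence are unique up to equality almost everywhere on \<open>K\<close>, so the
  choice of representative below does not matter.
\<close>

definition grad :: "point set \<Rightarrow> vfield \<Rightarrow> mfield" where
  "grad K u = (SOME G. G \<in> L2 K \<and> weak_grad K u G)"

definition dvg :: "point set \<Rightarrow> mfield \<Rightarrow> vfield" where
  "dvg K \<sigma> = (SOME d. d \<in> L2 K \<and> weak_div K \<sigma> d)"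

section \<open>Energy spaces\<close>

text \<open>The integrands are \<open>tr (w2\<dagger> w1)\<close> written out.\<close>

definition ipv :: "point set \<Rightarrow> vfield \<Rightarrow> vfield \<Rightarrow> complex" where
  "ipv K w1 w2 = (LINT x|lebesgue_on K. (\<Sum>i\<in>UNIV. w1 x $ i * cnj (w2 x $ i)))"

definition ipm :: "point set \<Rightarrow> mfield \<Rightarrow> mfield \<Rightarrow> complex" where
  "ipm K w1 w2 = (LINT x|lebesgue_on K. (\<Sum>i\<in>UNIV. \<Sum>j\<in>UNIV. w1 x $ i $ j * cnj (w2 x $ i $ j)))"

definition H1 :: "point set \<Rightarrow> vfield set" where
  "H1 K = {u \<in> L2 K. \<exists>G. G \<in> L2 K \<and> weak_grad K u G}"

definition H1_norm :: "point set \<Rightarrow> vfield \<Rightarrow> real" where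
  "H1_norm K u = sqrt (Re (ipv K u u) + Re (ipm K (grad K u) (grad K u)))"

definition Hdiv :: "point set \<Rightarrow> mfield set" where
  "Hdiv K = {\<sigma> \<in> L2 K. \<exists>d. d \<in> L2 K \<and> weak_div K \<sigma> d}"

definition Hdiv_norm :: "point set \<Rightarrow> mfield \<Rightarrow> real" where
  "Hdiv_norm K \<sigma> = sqrt (Re (ipm K \<sigma> \<sigma>) + Re (ipv K (dvg K \<sigma>) (dvg K \<sigma>)))"

section \<open>Traces\<close>

text \<open>
  \<open>has_trace K \<Gamma> u g\<close> says \<open>u|\<^sub>\<Gamma> = g\<close> for \<open>u \<in> H1 K\<close> and a portion \<open>\<Gamma>\<close> of the boundary
  of \<open>K\<close>: the trace is the extension by continuity, from \<open>H1 K\<close> to the square integrable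
  functions on \<open>\<Gamma>\<close>, of the restriction of functions that are \<open>C1\<close> up to the boundary.
\<close>

definition has_trace :: "point set \<Rightarrow> point set \<Rightarrow> vfield \<Rightarrow> vfield \<Rightarrow> bool" where
  "has_trace K \<Gamma> u g \<longleftrightarrow> g \<in> borel_measurable surface \<and>
     (\<exists>w :: nat \<Rightarrow> vfield. (\<forall>n. C1 (w n)) \<and>
        (\<lambda>n. H1_norm K (\<lambda>x. w n x - u x)) \<longlonglongrightarrow> 0 \<and>
        (\<lambda>n. \<integral>\<^sup>+x\<in>\<Gamma>. ennreal ((norm (w n x - g x))\<^sup>2) \<partial>surface) \<longlonglongrightarrow> 0)"

definition H1_zero_on :: "point set \<Rightarrow> point set \<Rightarrow> vfield set" where
  "H1_zero_on \<Omega> \<Gamma> = {u \<in> H1 \<Omega>. has_trace \<Omega> \<Gamma> u (\<lambda>x. 0)}"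

text \<open>
  The boundary value of \<open>u\<close> on the whole boundary of \<open>K\<close> is represented by the class of all
  functions in \<open>H1 K\<close> with the same boundary value, so that \<open>tr0 K u = tr0 K v\<close> means that
  \<open>u - v\<close> has trace zero.
\<close>

definition tr0 :: "point set \<Rightarrow> vfield \<Rightarrow> vfield set" where
  "tr0 K u = {w \<in> H1 K. has_trace K (frontier K) (\<lambda>x. w x - u x) (\<lambda>x. 0)}"

definition Hhalf :: "point set \<Rightarrow> vfield set set" where
  "Hhalf K = tr0 K ` H1 K"

text \<open>
  The normal trace of \<open>\<sigma>\<close> is the functional on the trace space \<open>Hhalf K\<close> given by Green's
  formula; its value at \<open>vh\<close> is the duality pairing of the two on the boundary of \<open>K\<close>.
\<close>

definition normal_trace :: "point set \<Rightarrow> mfield \<Rightarrow> vfield set \<Rightarrow> complex" where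
  "normal_trace K \<sigma> = (\<lambda>vh\<in>Hhalf K. THE c. \<forall>v\<in>H1 K. tr0 K v = vh \<longrightarrow>
     c = ipm K \<sigma> (grad K v) + ipv K (dvg K \<sigma>) v)"

text \<open>
  The condition of zero normal trace on \<open>\<Gamma>\<^sub>\<sigma>\<close> is posed by testing with all functions that
  vanish on the complementary portion \<open>\<Gamma>\<^sub>u\<close>, hence the parameter is \<open>\<Gamma>\<^sub>u\<close>.
\<close>

definition Hdiv_Gamma :: "point set \<Rightarrow> point set \<Rightarrow> mfield set" where
  "Hdiv_Gamma \<Omega> \<Gamma>u =
     {\<sigma> \<in> Hdiv \<Omega>. \<forall>v\<in>H1_zero_on \<Omega> \<Gamma>u. normal_trace \<Omega> \<sigma> (tr0 \<Omega> v) = 0}"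

section \<open>Meshes and broken spaces\<close>

definition mesh :: "point set \<Rightarrow> point set set \<Rightarrow> bool" where
  "mesh \<Omega> T \<longleftrightarrow> finite T \<and> disjoint T \<and> (\<forall>K\<in>T. lipschitz_domain K \<and> K \<subseteq> \<Omega>) \<and>
     (\<Union>K\<in>T. closure K) = closure \<Omega>"

definition H1_broken :: "point set set \<Rightarrow> vfield set" where
  "H1_broken T = {v. \<forall>K\<in>T. v \<in> H1 K}"

definition H1_broken_norm :: "point set set \<Rightarrow> vfield \<Rightarrow> real" where
  "H1_broken_norm T v = sqrt (\<Sum>K\<in>T. (H1_norm K v)\<^sup>2)"

type_synonym ntraces = "point set \<Rightarrow> vfield set \<Rightarrow> complex"

definition tr0_mesh :: "point set set \<Rightarrow> vfield \<Rightarrow> point set \<Rightarrow> vfield set" where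
  "tr0_mesh T v = (\<lambda>K\<in>T. tr0 K v)"

definition tr2_mesh :: "point set set \<Rightarrow> mfield \<Rightarrow> ntraces" where
  "tr2_mesh T \<sigma> = (\<lambda>K\<in>T. normal_trace K \<sigma>)"

definition pair_mesh :: "point set set \<Rightarrow> ntraces \<Rightarrow> (point set \<Rightarrow> vfield set) \<Rightarrow> complex" where
  "pair_mesh T s vh = (\<Sum>K\<in>T. s K (vh K))"

definition Hmhalf_mesh :: "point set \<Rightarrow> point set \<Rightarrow> point set set \<Rightarrow> ntraces set" where
  "Hmhalf_mesh \<Omega> \<Gamma>u T = tr2_mesh T ` Hdiv_Gamma \<Omega> \<Gamma>u"

definition Hmhalf_mesh_norm :: "point set \<Rightarrow> point set \<Rightarrow> point set set \<Rightarrow> ntraces \<Rightarrow> real" where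
  "Hmhalf_mesh_norm \<Omega> \<Gamma>u T s =
     Inf {Hdiv_norm \<Omega> \<sigma> | \<sigma>. \<sigma> \<in> Hdiv_Gamma \<Omega> \<Gamma>u \<and> tr2_mesh T \<sigma> = s}"

definition U_mesh :: "point set \<Rightarrow> point set \<Rightarrow> point set set \<Rightarrow> (vfield \<times> ntraces) set" where
  "U_mesh \<Omega> \<Gamma>u T = H1_zero_on \<Omega> \<Gamma>u \<times> Hmhalf_mesh \<Omega> \<Gamma>u T"

definition U_mesh_norm :: "point set \<Rightarrow> point set \<Rightarrow> point set set \<Rightarrow> vfield \<times> ntraces \<Rightarrow> real" where
  "U_mesh_norm \<Omega> \<Gamma>u T = (\<lambda>(u, s). sqrt ((H1_norm \<Omega> u)\<^sup>2 + (Hmhalf_mesh_norm \<Omega> \<Gamma>u T s)\<^sup>2))"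

definition same_on :: "point set \<Rightarrow> vfield \<Rightarrow> vfield \<Rightarrow> bool" where
  "same_on \<Omega> u v \<longleftrightarrow> (AE x in lebesgue_on \<Omega>. u x = v x)"

definition same_U_mesh :: "point set \<Rightarrow> vfield \<times> ntraces \<Rightarrow> vfield \<times> ntraces \<Rightarrow> bool" where
  "same_U_mesh \<Omega> = (\<lambda>(u, s) (u', s'). same_on \<Omega> u u' \<and> s = s')"

section \<open>Variational problems\<close>

definition antidual :: "vfield set \<Rightarrow> (vfield \<Rightarrow> real) \<Rightarrow> (vfield \<Rightarrow> complex) set" where
  "antidual V nV = {l.
     (\<forall>v\<in>V. \<forall>w\<in>V. l (\<lambda>x. v x + w x) = l v + l w) \<and>
     (\<forall>c. \<forall>v\<in>V. l (\<lambda>x. c *s v x) = cnj c * l v) \<and>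
     (\<exists>M. \<forall>v\<in>V. cmod (l v) \<le> M * nV v)}"

definition antidual_norm :: "vfield set \<Rightarrow> (vfield \<Rightarrow> real) \<Rightarrow> (vfield \<Rightarrow> complex) \<Rightarrow> real" where
  "antidual_norm V nV l = Sup {cmod (l v) | v. v \<in> V \<and> nV v \<le> 1}"

definition solves ::
  "'x set \<Rightarrow> vfield set \<Rightarrow> ('x \<Rightarrow> vfield \<Rightarrow> complex) \<Rightarrow> (vfield \<Rightarrow> complex) \<Rightarrow> 'x \<Rightarrow> bool" where
  "solves X V b l x \<longleftrightarrow> x \<in> X \<and> (\<forall>v\<in>V. b x v = l v)"

text \<open>\<open>eq\<close> is the equality of the elements of the trial space represented by two functions.\<close>

definition well_posed ::
  "'x set \<Rightarrow> ('x \<Rightarrow> real) \<Rightarrow> ('x \<Rightarrow> 'x \<Rightarrow> bool) \<Rightarrow> vfield set \<Rightarrow> (vfield \<Rightarrow> real) \<Rightarrow>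
   ('x \<Rightarrow> vfield \<Rightarrow> complex) \<Rightarrow> bool" where
  "well_posed X nX eq V nV b \<longleftrightarrow>
     (\<forall>l\<in>antidual V nV. \<exists>x. solves X V b l x \<and> (\<forall>y. solves X V b l y \<longrightarrow> eq x y)) \<and>
     (\<exists>C. \<forall>l\<in>antidual V nV. \<forall>x. solves X V b l x \<longrightarrow> nX x \<le> C * antidual_norm V nV l)"

type_synonym tensor4 = "complex^3^3^3^3"

definition ddot :: "tensor4 \<Rightarrow> complex^3^3 \<Rightarrow> complex^3^3" where
  "ddot A \<tau> = (\<chi> i j. \<Sum>k\<in>UNIV. \<Sum>l\<in>UNIV. A $ i $ j $ k $ l * \<tau> $ k $ l)"

definition stiffness_field :: "point set \<Rightarrow> (point \<Rightarrow> tensor4) \<Rightarrow> bool" where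
  "stiffness_field \<Omega> A \<longleftrightarrow>
     A \<in> borel_measurable (lebesgue_on \<Omega>) \<and> bounded (A ` \<Omega>) \<and>
     (\<forall>x\<in>\<Omega>. \<forall>i j k l. A x $ i $ j $ k $ l = A x $ i $ j $ l $ k \<and>
        A x $ i $ j $ k $ l = A x $ j $ i $ k $ l \<and>
        A x $ i $ j $ k $ l = A x $ k $ l $ i $ j)"

definition b0 ::
  "real \<Rightarrow> real \<Rightarrow> (point \<Rightarrow> tensor4) \<Rightarrow> point set set \<Rightarrow> vfield \<Rightarrow> vfield \<Rightarrow> complex" where
  "b0 \<omega> \<rho> A T u v =
     - of_real (\<omega>\<^sup>2 * \<rho>) * (\<Sum>K\<in>T. ipv K u v) +
     (\<Sum>K\<in>T. ipm K (\<lambda>x. ddot (A x) (grad K u x)) (grad K v))"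

definition b_hat :: "point set set \<Rightarrow> ntraces \<Rightarrow> vfield \<Rightarrow> complex" where
  "b_hat T s v = - pair_mesh T s (tr0_mesh T v)"

definition b_mesh ::
  "real \<Rightarrow> real \<Rightarrow> (point \<Rightarrow> tensor4) \<Rightarrow> point set set \<Rightarrow> vfield \<times> ntraces \<Rightarrow> vfield \<Rightarrow> complex" where
  "b_mesh \<omega> \<rho> A T = (\<lambda>(u, s) v. b0 \<omega> \<rho> A T u v + b_hat T s v)"

definition broken_well_posed ::
  "point set \<Rightarrow> point set \<Rightarrow> real \<Rightarrow> real \<Rightarrow> (point \<Rightarrow> tensor4) \<Rightarrow> point set set \<Rightarrow> bool" where
  "broken_well_posed \<Omega> \<Gamma>u \<omega> \<rho> A T \<longleftrightarrow>
     well_posed (U_mesh \<Omega> \<Gamma>u T) (U_mesh_norm \<Omega> \<Gamma>u T) (same_U_mesh \<Omega>)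
       (H1_broken T) (H1_broken_norm T) (b_mesh \<omega> \<rho> A T)"

definition classical_well_posed ::
  "point set \<Rightarrow> point set \<Rightarrow> real \<Rightarrow> real \<Rightarrow> (point \<Rightarrow> tensor4) \<Rightarrow> point set set \<Rightarrow> bool" where
  "classical_well_posed \<Omega> \<Gamma>u \<omega> \<rho> A T \<longleftrightarrow>
     well_posed (H1_zero_on \<Omega> \<Gamma>u) (H1_norm \<Omega>) (same_on \<Omega>)
       (H1_zero_on \<Omega> \<Gamma>u) (H1_norm \<Omega>) (b0 \<omega> \<rho> A T)"

end

theory Submission
  imports Defs
begin

text \<open>
  The argument is short once traces and Green's formula are at hand. Let \<open>U\<close> be the space
  \<open>H1_zero_on \<Omega> \<Gamma>u\<close> and \<open>V\<close> the broken space, which contains \<open>U\<close>.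

  \<^item> If \<open>\<sigma>\<close> belongs to \<open>Hdiv \<Omega>\<close>, the pairings of its normal traces with a broken field \<open>v\<close> add up to
    \<open>(\<sigma>, \<nabla>v) + (div \<sigma>, v)\<close> with the elementwise gradient (\<open>b_hat_tr2_mesh\<close>). For \<open>v \<in> U\<close> this is the
    pairing on the boundary of \<open>\<Omega>\<close>, which is zero by the boundary condition on \<open>\<sigma>\<close>. So the first
    component of a broken solution solves the classical problem.
  \<^item> Conversely let \<open>u\<close> be a classical solution for the restriction to \<open>U\<close> of a functional \<open>l\<close> on
    \<open>V\<close>. The residual \<open>r v = b0 u v - l v\<close> vanishes for \<open>v \<in> U\<close>. Its Riesz representative in \<open>V\<close> is a
    broken field \<open>d\<close>, with elementwise gradient \<open>\<sigma>\<close>, such that \<open>r v = (\<sigma>, \<nabla>v) + (d, v)\<close>. Testing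
    with fields of compact support in \<open>\<Omega>\<close> shows \<open>div \<sigma> = d\<close> on the whole of \<open>\<Omega>\<close>, and testing with all
    of \<open>U\<close> shows that the normal trace of \<open>\<sigma>\<close> vanishes as required (\<open>annihilator_normal_trace\<close>).
    So \<open>r\<close> is the pairing with the normal traces of \<open>\<sigma>\<close>, which complete \<open>u\<close> to a broken solution,
    and the norm of \<open>\<sigma>\<close> in \<open>Hdiv \<Omega>\<close> is at most that of \<open>r\<close>. The normal traces are determined by
    their pairings, since broken fields can be localised to one element.

  Hence the solutions of the two problems correspond to each other. To pass from the broken to the
  classical problem, functionals on \<open>U\<close> are extended to \<open>V\<close> by their representation in \<open>L2\<close>. In the
  other direction, if \<open>C\<close> is a stability constant of the classical problem and \<open>M\<close> bounds the
  material law, then \<open>C + 2 M C + 1\<close> is one of the broken problem. On \<open>U\<close> the form \<open>b0\<close> is an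
  integral over \<open>\<Omega>\<close>, the same for all meshes, so neither \<open>C\<close> nor \<open>M\<close> depends on the mesh.

  The work lies in the foundations. The pairing of a normal trace with boundary values is well
  defined only if \<open>(\<sigma>, \<nabla>v) + (div \<sigma>, v) = 0\<close> whenever \<open>v\<close> has zero trace on the boundary of a
  Lipschitz domain (\<open>green_trace_zero\<close>). Zero trace means that \<open>C1\<close> functions converge to \<open>v\<close> in \<open>H1\<close>
  while their boundary values tend to zero in \<open>L2\<close> of the surface. These have to be replaced by
  functions of compact support. A cutoff of width \<open>\<delta>\<close> has a gradient of size \<open>1 / \<delta>\<close>, which is compensated
  by the smallness of the functions in a boundary strip: integrating along the vertical
  lines of the charts bounds them there by their boundary values and by \<open>\<delta>\<close> times their
  gradient (\<open>strip_estimate\<close>). This uses that surface measure dominates a multiple of the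
  area of the shadow of a piece of the boundary (\<open>graph_shadow_le\<close>), and that Hausdorff measure is
  countably additive on Borel sets, by Caratheodory's criterion. Uniqueness of weak gradients
  and divergences rests on the fundamental lemma of the calculus of variations, and
  the representation theorem on completeness of \<open>L2\<close>.
\<close>


section \<open>Two-dimensional Hausdorff measure\<close>

lemma hausdorff2_delta_le:
  assumes "A \<subseteq> (\<Union>i. C i)" "\<And>i. bounded (C i)" "\<And>i. diameter (C i) \<le> \<delta>"
  shows "hausdorff2_delta \<delta> A \<le> (\<Sum>i. ennreal (pi / 4 * (diameter (C i))\<^sup>2))"
  unfolding hausdorff2_delta_def using assms by (intro INF_lower) auto

lemma hausdorff2_delta_antimono:
  assumes "\<delta> \<le> \<delta>'" shows "hausdorff2_delta \<delta>' A \<le> hausdorff2_delta \<delta> A"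
  unfolding hausdorff2_delta_def
  by (rule INF_superset_mono) (use assms in \<open>auto intro: order_trans\<close>)

lemma hausdorff2_delta_mono: "A \<subseteq> B \<Longrightarrow> hausdorff2_delta \<delta> A \<le> hausdorff2_delta \<delta> B"
  unfolding hausdorff2_delta_def by (rule INF_superset_mono) auto

lemma hausdorff2_mono: "A \<subseteq> B \<Longrightarrow> hausdorff2 A \<le> hausdorff2 B"
  unfolding hausdorff2_def by (rule SUP_mono) (use hausdorff2_delta_mono in blast)

lemma hausdorff2_delta_le_hausdorff2: "\<delta> > 0 \<Longrightarrow> hausdorff2_delta \<delta> A \<le> hausdorff2 A"
  unfolding hausdorff2_def by (rule SUP_upper) auto

lemma hausdorff2_empty: "hausdorff2 {} = 0"
proof -
  have "hausdorff2_delta \<delta> {} \<le> 0" if "\<delta> > 0" for \<delta>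
    using hausdorff2_delta_le[of "{}" "\<lambda>_. {}" \<delta>] that by simp
  then have "hausdorff2 {} \<le> 0"
    unfolding hausdorff2_def by (intro SUP_least) auto
  then show ?thesis by simp
qed

lemma hausdorff2_delta_countable_subadditive:
  "hausdorff2_delta \<delta> (\<Union>n. A n) \<le> (\<Sum>n. hausdorff2_delta \<delta> (A n))"
proof (rule ennreal_le_epsilon)
  fix e :: real assume e: "0 < e" and fin: "(\<Sum>n. hausdorff2_delta \<delta> (A n)) < top"
  let ?w = "\<lambda>C. ennreal (pi / 4 * (diameter C)\<^sup>2)"
  have lt: "hausdorff2_delta \<delta> (A n) < hausdorff2_delta \<delta> (A n) + ennreal (e * (1/2)^Suc n)" for n
  proof -
    have "hausdorff2_delta \<delta> (A n) < top" using fin by (rule ennreal_suminf_lessD)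
    moreover have "e * (1/2)^Suc n > 0" using e by simp
    ultimately show ?thesis
      by (cases "hausdorff2_delta \<delta> (A n)")
         (auto simp: ennreal_plus[symmetric] ennreal_less_iff simp del: ennreal_plus)
  qed
  define P where "P n B \<longleftrightarrow> A n \<subseteq> (\<Union>i. B i) \<and> (\<forall>i. bounded (B i) \<and> diameter (B i) \<le> \<delta>) \<and>
      (\<Sum>i. ?w (B i)) \<le> hausdorff2_delta \<delta> (A n) + ennreal (e * (1/2)^Suc n)" for n and B :: "nat \<Rightarrow> point set"
  have "\<exists>B. P n B" for n
  proof -
    obtain B where "B \<in> {C. A n \<subseteq> (\<Union>i. C i) \<and> (\<forall>i. bounded (C i) \<and> diameter (C i) \<le> \<delta>)}"
        "(\<Sum>i. ?w (B i)) < hausdorff2_delta \<delta> (A n) + ennreal (e * (1/2)^Suc n)"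
      using lt[of n] unfolding hausdorff2_delta_def[of \<delta> "A n"] by (subst (asm) INF_less_iff) blast
    then show ?thesis by (intro exI[of _ B]) (simp add: P_def less_imp_le)
  qed
  then obtain B where PB: "\<And>n. P n (B n)" by metis
  have B: "A n \<subseteq> (\<Union>i. B n i)" "bounded (B n i) \<and> diameter (B n i) \<le> \<delta>"
      "(\<Sum>i. ?w (B n i)) \<le> hausdorff2_delta \<delta> (A n) + ennreal (e * (1/2)^Suc n)" for n i
    using PB[of n] unfolding P_def by blast+
  define C where "C = case_prod B o prod_decode"
  have "(\<Union>n. A n) \<subseteq> (\<Union>i. C i)"
  proof
    fix x assume "x \<in> (\<Union>n. A n)"
    then obtain n where "x \<in> A n" by blast
    with B(1)[of n] obtain i where "x \<in> B n i" by blast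
    then have "x \<in> C (prod_encode (n, i))" by (simp add: C_def)
    then show "x \<in> (\<Union>i. C i)" by blast
  qed
  then have "hausdorff2_delta \<delta> (\<Union>n. A n) \<le> (\<Sum>i. ?w (C i))"
  proof (rule hausdorff2_delta_le)
    fix i
    have "bounded (B (fst (prod_decode i)) (snd (prod_decode i))) \<and>
        diameter (B (fst (prod_decode i)) (snd (prod_decode i))) \<le> \<delta>" by (rule B(2))
    then show "bounded (C i)" "diameter (C i) \<le> \<delta>" by (simp_all add: C_def split_def)
  qed
  also have "\<dots> = (\<Sum>n. \<Sum>i. ?w (B n i))"
    using suminf_ennreal_2dimen[of "\<lambda>n. \<Sum>i. ?w (B n i)" "\<lambda>(n,i). ?w (B n i)"]
    by (simp only: C_def comp_def split_def fst_conv snd_conv simp_thms)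
  also have "\<dots> \<le> (\<Sum>n. hausdorff2_delta \<delta> (A n) + ennreal (e * (1/2) ^ Suc n))"
    by (rule suminf_le[OF B(3) summableI summableI])
  also have "\<dots> = (\<Sum>n. hausdorff2_delta \<delta> (A n)) + (\<Sum>n. ennreal e * ennreal ((1/2) ^ Suc n))"
    using \<open>0 < e\<close> by (subst suminf_add[symmetric])
      (auto simp del: ennreal_suminf_cmult simp add: ennreal_mult[symmetric])
  also have "\<dots> = (\<Sum>n. hausdorff2_delta \<delta> (A n)) + e"
    unfolding ennreal_suminf_cmult
    by (subst suminf_ennreal_eq[OF zero_le_power power_half_series]) auto
  finally show "hausdorff2_delta \<delta> (\<Union>n. A n) \<le> (\<Sum>n. hausdorff2_delta \<delta> (A n)) + e" .
qed

lemma hausdorff2_countable_subadditive: "hausdorff2 (\<Union>n. A n) \<le> (\<Sum>n. hausdorff2 (A n))"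
  unfolding hausdorff2_def[of "\<Union>n. A n"]
proof (rule SUP_least)
  fix \<delta> :: real assume "\<delta> \<in> {0<..}"
  have "hausdorff2_delta \<delta> (\<Union>n. A n) \<le> (\<Sum>n. hausdorff2_delta \<delta> (A n))"
    by (rule hausdorff2_delta_countable_subadditive)
  also have "\<dots> \<le> (\<Sum>n. hausdorff2 (A n))"
    using \<open>\<delta> \<in> {0<..}\<close> by (intro suminf_le hausdorff2_delta_le_hausdorff2) auto
  finally show "hausdorff2_delta \<delta> (\<Union>n. A n) \<le> (\<Sum>n. hausdorff2 (A n))" .
qed

lemma outer_measure_space_hausdorff2: "outer_measure_space (Pow UNIV) hausdorff2"
  unfolding outer_measure_space_def positive_def increasing_def countably_subadditive_def
  using hausdorff2_empty hausdorff2_mono hausdorff2_countable_subadditive by auto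

lemma hausdorff2_subadditive: "hausdorff2 (A \<union> B) \<le> hausdorff2 A + hausdorff2 B"
proof -
  have "subadditive (Pow UNIV) hausdorff2"
    using outer_measure_space_hausdorff2 unfolding outer_measure_space_def
    using algebra.axioms(1)[OF algebra_Pow[of UNIV]]
    by (intro ring_of_sets.countably_subadditive_subadditive[of UNIV]) auto
  then have "hausdorff2 (A \<union> (B - A)) \<le> hausdorff2 A + hausdorff2 (B - A)"
    by (intro subadditiveD[of "Pow UNIV"]) auto
  also have "\<dots> \<le> hausdorff2 A + hausdorff2 B"
    by (intro add_left_mono hausdorff2_mono) auto
  finally show ?thesis by simp
qed

text \<open>
  A set of diameter smaller than the distance of \<open>A\<close> and \<open>B\<close> meets only one of the two, so a fine
  cover of the union splits into disjoint subfamilies covering \<open>A\<close> and \<open>B\<close>.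
\<close>

lemma hausdorff2_delta_metric_additive:
  assumes "\<delta> < d" "\<And>x y. x \<in> A \<Longrightarrow> y \<in> B \<Longrightarrow> d \<le> dist x y"
  shows "hausdorff2_delta \<delta> A + hausdorff2_delta \<delta> B \<le> hausdorff2_delta \<delta> (A \<union> B)"
  unfolding hausdorff2_delta_def[of \<delta> "A \<union> B"]
proof (rule INF_greatest, clarify)
  fix C :: "nat \<Rightarrow> point set"
  assume C: "A \<union> B \<subseteq> (\<Union>i. C i)" "\<forall>i. bounded (C i) \<and> diameter (C i) \<le> \<delta>"
  let ?w = "\<lambda>C. ennreal (pi / 4 * (diameter C)\<^sup>2)"
  have \<delta>: "\<delta> \<ge> 0" using C(2) diameter_ge_0[of "C 0"] by (meson order_trans)
  define CA where "CA i = (if C i \<inter> A = {} then {} else C i)" for i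
  define CB where "CB i = (if C i \<inter> B = {} then {} else C i)" for i
  have "hausdorff2_delta \<delta> A \<le> (\<Sum>i. ?w (CA i))"
    using C \<delta> by (intro hausdorff2_delta_le) (auto simp: CA_def, blast)
  moreover have "hausdorff2_delta \<delta> B \<le> (\<Sum>i. ?w (CB i))"
    using C \<delta> by (intro hausdorff2_delta_le) (auto simp: CB_def, blast)
  ultimately have "hausdorff2_delta \<delta> A + hausdorff2_delta \<delta> B \<le> (\<Sum>i. ?w (CA i)) + (\<Sum>i. ?w (CB i))"
    by (rule add_mono)
  also have "\<dots> = (\<Sum>i. ?w (CA i) + ?w (CB i))"
    by (simp add: suminf_add)
  also have "\<dots> \<le> (\<Sum>i. ?w (C i))"
  proof (intro suminf_le)
    fix i
    have "C i \<inter> A = {} \<or> C i \<inter> B = {}"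
    proof (rule ccontr)
      assume "\<not> (C i \<inter> A = {} \<or> C i \<inter> B = {})"
      then obtain x y where "x \<in> C i" "x \<in> A" "y \<in> C i" "y \<in> B" by blast
      then have "d \<le> dist x y" "dist x y \<le> diameter (C i)"
        using assms(2) C(2) diameter_bounded_bound[of "C i" x y] by auto
      with C(2) \<open>\<delta> < d\<close> show False by (meson not_le order_trans)
    qed
    then show "?w (CA i) + ?w (CB i) \<le> ?w (C i)" by (auto simp: CA_def CB_def)
  qed auto
  finally show "hausdorff2_delta \<delta> A + hausdorff2_delta \<delta> B \<le> (\<Sum>i. ?w (C i))" .
qed

lemma hausdorff2_metric_additive:
  assumes "d > 0" "\<And>x y. x \<in> A \<Longrightarrow> y \<in> B \<Longrightarrow> d \<le> dist x y"
  shows "hausdorff2 A + hausdorff2 B \<le> hausdorff2 (A \<union> B)"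
proof -
  have "hausdorff2 A + hausdorff2 B
      = (SUP \<delta>\<in>{0<..}. hausdorff2_delta \<delta> A + hausdorff2_delta \<delta> B)"
    unfolding hausdorff2_def
  proof (rule SUP_add_directed_ennreal[symmetric])
    fix i j :: real assume ij: "i \<in> {0<..}" "j \<in> {0<..}"
    show "\<exists>k\<in>{0<..}. hausdorff2_delta i A + hausdorff2_delta j B
        \<le> hausdorff2_delta k A + hausdorff2_delta k B"
      using ij by (intro bexI[of _ "min i j"] add_mono hausdorff2_delta_antimono) auto
  qed
  also have "\<dots> \<le> hausdorff2 (A \<union> B)"
  proof (rule SUP_least)
    fix \<delta> :: real assume \<delta>: "\<delta> \<in> {0<..}"
    let ?\<delta> = "min \<delta> (d/2)"
    have "hausdorff2_delta \<delta> A + hausdorff2_delta \<delta> B \<le> hausdorff2_delta ?\<delta> A + hausdorff2_delta ?\<delta> B"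
      by (intro add_mono hausdorff2_delta_antimono) auto
    also have "\<dots> \<le> hausdorff2_delta ?\<delta> (A \<union> B)"
      using assms by (intro hausdorff2_delta_metric_additive[of _ d]) auto
    also have "\<dots> \<le> hausdorff2 (A \<union> B)"
      using \<delta> assms by (intro hausdorff2_delta_le_hausdorff2) auto
    finally show "hausdorff2_delta \<delta> A + hausdorff2_delta \<delta> B \<le> hausdorff2 (A \<union> B)" .
  qed
  finally show ?thesis .
qed

text \<open>
  The sets are peeled off one at a time from the left: each is at positive distance from the union
  of all later ones, which is more than pairwise separation.
\<close>

lemma hausdorff2_metric_additive_seq:
  fixes R :: "nat \<Rightarrow> point set"
  assumes "\<And>i j. i < j \<Longrightarrow> \<exists>d>0. \<forall>k\<ge>j. \<forall>x\<in>R i. \<forall>y\<in>R k. d \<le> dist x y"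
  shows "(\<Sum>i<n. hausdorff2 (R i)) \<le> hausdorff2 (\<Union>i<n. R i)"
proof -
  have "(\<Sum>i\<in>{m..<m+k}. hausdorff2 (R i)) \<le> hausdorff2 (\<Union>i\<in>{m..<m+k}. R i)" for m k
  proof (induction k arbitrary: m)
    case 0 then show ?case by simp
  next
    case (Suc k)
    obtain d where d: "d > 0" "\<forall>l\<ge>Suc m. \<forall>x\<in>R m. \<forall>y\<in>R l. d \<le> dist x y"
      using assms[of m "Suc m"] by auto
    have split: "{m..<m + Suc k} = insert m {Suc m..<Suc m + k}" by auto
    have "(\<Sum>i\<in>{m..<m+Suc k}. hausdorff2 (R i))
        = hausdorff2 (R m) + (\<Sum>i\<in>{Suc m..<Suc m+k}. hausdorff2 (R i))"
      unfolding split by (rule sum.insert) auto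
    also have "\<dots> \<le> hausdorff2 (R m) + hausdorff2 (\<Union>i\<in>{Suc m..<Suc m+k}. R i)"
      by (intro add_mono Suc.IH order_refl)
    also have "\<dots> \<le> hausdorff2 (R m \<union> (\<Union>i\<in>{Suc m..<Suc m+k}. R i))"
      using d by (intro hausdorff2_metric_additive[of d]) auto
    also have "R m \<union> (\<Union>i\<in>{Suc m..<Suc m+k}. R i) = (\<Union>i\<in>{m..<m+Suc k}. R i)"
      unfolding split by (rule UN_insert[symmetric])
    finally show ?case .
  qed
  from this[of 0 n] show ?thesis by (simp add: lessThan_atLeast0)
qed

text \<open>
  Caratheodory's argument for metric outer measures: the part of \<open>A\<close> off a closed set \<open>F\<close> is cut
  into layers according to the distance from \<open>F\<close>. Layers of the same parity are separated from
  each other, hence the measures of all layers are summable if \<open>A\<close> has finite measure, and the part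
  of \<open>A\<close> closer than \<open>1 / n\<close> to \<open>F\<close> has measure tending to zero.
\<close>

lemma closed_in_lambda_system_hausdorff2:
  assumes "closed F"
  shows "F \<in> lambda_system UNIV (Pow UNIV) hausdorff2"
proof (cases "F = {}")
  case True
  then show ?thesis by (simp add: lambda_system_def hausdorff2_empty)
next
  case False
  have "hausdorff2 (A \<inter> F) + hausdorff2 (A - F) \<le> hausdorff2 A" for A
  proof (cases "hausdorff2 A = top")
    case True then show ?thesis by simp
  next
    case fin: False
    define A' where "A' n = {x\<in>A. infdist x F \<ge> 1 / Suc n}" for n :: nat
    define R where "R n = {x\<in>A. 1 / Suc (Suc n) \<le> infdist x F \<and> infdist x F < 1 / Suc n}" for n :: nat
    have infd: "infdist x F - infdist y F \<le> dist x y" for x y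
      using infdist_triangle[of x F y] by simp
    have sep: "1 / real (Suc (Suc i)) - 1 / real (Suc k) \<le> dist x y"
      if "x \<in> R i" "y \<in> R k" for x y i k
      using that infd[of x y] by (auto simp: R_def)
    have lay: "(\<Sum>i<n. hausdorff2 (R (2*i+b))) \<le> hausdorff2 A" for n b
    proof -
      have "(\<Sum>i<n. hausdorff2 (R (2*i+b))) \<le> hausdorff2 (\<Union>i<n. R (2*i+b))"
      proof (rule hausdorff2_metric_additive_seq)
        fix i j :: nat assume "i < j"
        let ?d = "1 / real (Suc (Suc (2*i+b))) - 1 / real (2*i+b+3)"
        have "?d \<le> dist x y" if "k \<ge> j" "x \<in> R (2*i+b)" "y \<in> R (2*k+b)" for k x y
        proof -
          have "real (2*i+b+3) \<le> real (Suc (2*k+b))" using that \<open>i < j\<close> by simp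
          then have "1 / real (Suc (2*k+b)) \<le> 1 / real (2*i+b+3)"
            by (intro divide_left_mono mult_pos_pos) auto
          then show ?thesis using sep[OF that(2,3)] by linarith
        qed
        moreover have "?d > 0" by (simp add: frac_less2)
        ultimately show "\<exists>d>0. \<forall>k\<ge>j. \<forall>x\<in>R (2*i+b). \<forall>y\<in>R (2*k+b). d \<le> dist x y" by blast
      qed
      also have "\<dots> \<le> hausdorff2 A" by (rule hausdorff2_mono) (auto simp: R_def)
      finally show ?thesis .
    qed
    have tot: "(\<Sum>i<n. hausdorff2 (R i)) \<le> 2 * hausdorff2 A" for n
    proof -
      have "(\<Sum>i<n. hausdorff2 (R i)) \<le> (\<Sum>i<2*n. hausdorff2 (R i))"
        by (intro sum_mono2) auto
      also have "\<dots> = (\<Sum>i<n. hausdorff2 (R (2*i+0))) + (\<Sum>i<n. hausdorff2 (R (2*i+1)))"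
        by (induction n) (auto simp: algebra_simps)
      also have "\<dots> \<le> hausdorff2 A + hausdorff2 A"
        by (intro add_mono lay)
      finally show ?thesis by (simp add: mult_2)
    qed
    have sumfin: "(\<Sum>i. hausdorff2 (R i)) \<noteq> top"
    proof -
      have "(\<Sum>i. hausdorff2 (R i)) \<le> 2 * hausdorff2 A"
        by (intro suminf_le_const tot) auto
      also have "\<dots> < top" using fin by (simp add: ennreal_mult_less_top less_top)
      finally show ?thesis by simp
    qed
    have decomp: "A - F = A' n \<union> (\<Union>i. R (i + n))" for n
    proof (intro set_eqI iffI)
      fix x assume x: "x \<in> A - F"
      then have pos: "infdist x F > 0"
        using assms False infdist_pos_not_in_closed by blast
      show "x \<in> A' n \<union> (\<Union>i. R (i + n))"
      proof (cases "infdist x F \<ge> 1 / Suc n")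
        case True then show ?thesis using x by (auto simp: A'_def)
      next
        case le: False
        define P where "P k = (1 / real (Suc k) \<le> infdist x F)" for k
        have ex: "\<exists>k. P k" using reals_Archimedean[OF pos]
          by (auto simp: P_def inverse_eq_divide intro: less_imp_le)
        define k where "k = (LEAST k. P k)"
        have Pk: "P k" unfolding k_def using ex by (rule LeastI_ex)
        have nP: "\<not> P m" if "m < k" for m using that not_less_Least unfolding k_def by blast
        have "k > n"
        proof (rule ccontr)
          assume "\<not> k > n"
          then have "1 / real (Suc n) \<le> 1 / real (Suc k)" by (intro divide_left_mono mult_pos_pos) auto
          with Pk le show False by (auto simp: P_def)
        qed
        then obtain i where i: "k = Suc (i + n)" by (metis add.commute less_iff_Suc_add)
        have "x \<in> R (i + n)" using x Pk nP[of "i+n"] i by (auto simp: R_def P_def)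
        then show ?thesis by blast
      qed
    next
      fix x assume "x \<in> A' n \<union> (\<Union>i. R (i + n))"
      then have "x \<in> A" "infdist x F > 0"
        by (auto simp: A'_def R_def intro: less_le_trans[rotated])
      then show "x \<in> A - F" by auto
    qed
    have bound: "hausdorff2 (A \<inter> F) + hausdorff2 (A - F) \<le> hausdorff2 A + (\<Sum>i. hausdorff2 (R (i + n)))" for n
    proof -
      have "hausdorff2 (A - F) \<le> hausdorff2 (A' n) + hausdorff2 (\<Union>i. R (i + n))"
        unfolding decomp[of n] by (rule hausdorff2_subadditive)
      also have "\<dots> \<le> hausdorff2 (A' n) + (\<Sum>i. hausdorff2 (R (i + n)))"
        by (intro add_mono hausdorff2_countable_subadditive) auto
      finally have "hausdorff2 (A \<inter> F) + hausdorff2 (A - F)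
          \<le> (hausdorff2 (A \<inter> F) + hausdorff2 (A' n)) + (\<Sum>i. hausdorff2 (R (i + n)))"
        by (simp add: add.assoc add_left_mono)
      also have "hausdorff2 (A \<inter> F) + hausdorff2 (A' n) \<le> hausdorff2 ((A \<inter> F) \<union> A' n)"
      proof (rule hausdorff2_metric_additive[of "1 / Suc n"])
        fix x y assume "x \<in> A \<inter> F" "y \<in> A' n"
        then show "1 / real (Suc n) \<le> dist x y"
          using infdist_le[of x F y] by (auto simp: A'_def dist_commute)
      qed simp
      also have "hausdorff2 ((A \<inter> F) \<union> A' n) \<le> hausdorff2 A"
        by (rule hausdorff2_mono) (auto simp: A'_def)
      finally show ?thesis by (simp add: add_right_mono)
    qed
    have lim: "(\<lambda>n. hausdorff2 A + (\<Sum>i. hausdorff2 (R (i + n)))) \<longlonglongrightarrow> hausdorff2 A + 0"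
    proof (intro tendsto_add tendsto_const)
      define f where "f i = enn2real (hausdorff2 (R i))" for i
      have fi: "hausdorff2 (R i) = ennreal (f i)" for i
        using ennreal_suminf_lessD[of "\<lambda>i. hausdorff2 (R i)" top i] sumfin
        by (auto simp: f_def less_top)
      have nn: "f i \<ge> 0" for i by (simp add: f_def)
      have sm: "summable f"
        using sumfin nn unfolding fi by (intro summable_suminf_not_top) auto
      have eq: "(\<Sum>i. hausdorff2 (R (i + n))) = ennreal (\<Sum>i. f (i + n))" for n
        unfolding fi using nn sm by (intro suminf_ennreal2) (auto simp: summable_iff_shift)
      have "(\<lambda>n. \<Sum>i. f (i + n)) \<longlonglongrightarrow> 0" using sm by (rule suminf_exist_split2)
      then show "(\<lambda>n. \<Sum>i. hausdorff2 (R (i + n))) \<longlonglongrightarrow> 0"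
        unfolding eq by (metis ennreal_0 tendsto_ennrealI)
    qed
    show ?thesis
      using LIMSEQ_le_const[OF lim] bound by auto
  qed
  then have "hausdorff2 (A \<inter> F) + hausdorff2 (A - F) = hausdorff2 A" for A
    using hausdorff2_subadditive[of "A \<inter> F" "A - F"]
    by (metis Int_Diff_Un antisym)
  then show ?thesis
    unfolding algebra.lambda_system_eq[OF algebra_Pow] by blast
qed

text \<open>
  The trace condition integrates over the boundary against \<open>surface\<close>, which is generated from
  \<open>hausdorff2\<close> by \<open>measure_of\<close>; had \<open>hausdorff2\<close> failed to be countably additive on the Borel sets,
  that would be the zero measure and the boundary condition would be void.
\<close>

lemma measure_space_hausdorff2: "measure_space UNIV (sets borel) hausdorff2"
proof -
  interpret sigma_algebra UNIV "Pow UNIV :: point set set" by (rule sigma_algebra_Pow)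
  have ms: "measure_space UNIV (lambda_system UNIV (Pow UNIV) hausdorff2) hausdorff2"
    using outer_measure_space_hausdorff2 by (rule caratheodory_lemma)
  have sub: "sets borel \<subseteq> lambda_system UNIV (Pow UNIV) hausdorff2"
  proof -
    have "sigma_sets UNIV {F :: point set. closed F} \<subseteq> lambda_system UNIV (Pow UNIV) hausdorff2"
      using ms closed_in_lambda_system_hausdorff2 unfolding measure_space_def
      by (intro sigma_algebra.sigma_sets_subset) auto
    then show ?thesis by (simp add: borel_eq_closed)
  qed
  show ?thesis
    using ms sub sets.sigma_algebra_axioms[of "borel :: point measure"]
    unfolding measure_space_def countably_additive_def positive_def
    by (auto simp: subset_eq)
qed

lemma sets_surface [simp, measurable_cong]: "sets surface = sets borel"
  unfolding surface_def by (simp add: sigma_algebra.sigma_sets_eq[OF sets.sigma_algebra_axioms[of borel, simplified]])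

lemma space_surface [simp]: "space surface = UNIV"
  by (simp add: surface_def space_measure_of_conv)

lemma emeasure_surface: "A \<in> sets borel \<Longrightarrow> emeasure surface A = hausdorff2 A"
  unfolding surface_def
  by (rule emeasure_measure_of_sigma)
     (use measure_space_hausdorff2 in \<open>auto simp: measure_space_def\<close>)

section \<open>Continuously differentiable functions and cutoffs\<close>

lemma C1I:
  assumes "\<And>x. (f has_derivative f' x) (at x)" "\<And>h. continuous_on UNIV (\<lambda>x. f' x h)"
  shows "C1 f"
proof -
  have "frechet_derivative f (at x) = f' x" for x
    using frechet_derivative_at[OF assms(1)] by simp
  then show ?thesis
    unfolding C1_def differentiable_on_def differentiable_def using assms by auto
qed

lemma C1_has_derivative: "C1 f \<Longrightarrow> (f has_derivative frechet_derivative f (at x)) (at x)"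
  unfolding C1_def differentiable_on_def by (simp add: frechet_derivative_works)

lemma C1_continuous_derivative: "C1 f \<Longrightarrow> continuous_on UNIV (\<lambda>x. frechet_derivative f (at x) h)"
  unfolding C1_def by blast

lemma C1_continuous: "C1 f \<Longrightarrow> continuous_on UNIV f"
  unfolding C1_def by (simp add: differentiable_imp_continuous_on)

lemma C1_const: "C1 (\<lambda>x. c)"
  by (rule C1I[where f' = "\<lambda>x h. 0"]) auto

lemma C1_add: assumes "C1 f" "C1 g" shows "C1 (\<lambda>x. f x + g x)"
  by (rule C1I[where f' = "\<lambda>x h. frechet_derivative f (at x) h + frechet_derivative g (at x) h"])
     (intro has_derivative_add C1_has_derivative continuous_intros C1_continuous_derivative assms)+

lemma C1_linear: assumes "bounded_linear h" "C1 f" shows "C1 (\<lambda>x. h (f x))"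
  by (rule C1I[where f' = "\<lambda>x v. h (frechet_derivative f (at x) v)"])
     (intro bounded_linear.has_derivative[OF assms(1)] C1_has_derivative assms
       continuous_intros bounded_linear.continuous_on[OF assms(1)] C1_continuous_derivative)+

lemma C1_scaleR_has_derivative:
  assumes "C1 \<phi>" "C1 f"
  shows "((\<lambda>x. \<phi> x *\<^sub>R f x) has_derivative
      (\<lambda>h. \<phi> x *\<^sub>R frechet_derivative f (at x) h + frechet_derivative \<phi> (at x) h *\<^sub>R f x)) (at x)"
  by (intro has_derivative_scaleR C1_has_derivative assms)

lemma C1_scaleR: assumes "C1 \<phi>" "C1 f" shows "C1 (\<lambda>x. \<phi> x *\<^sub>R f x)"
  by (rule C1I[OF C1_scaleR_has_derivative[OF assms]])
     (intro continuous_intros C1_continuous C1_continuous_derivative assms)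

lemma C1_sum: "finite I \<Longrightarrow> (\<And>i. i \<in> I \<Longrightarrow> C1 (f i)) \<Longrightarrow> C1 (\<lambda>x. \<Sum>i\<in>I. f i x)"
  by (induction I rule: finite_induct) (auto intro: C1_const C1_add)

lemma C1_diff: assumes "C1 f" "C1 g" shows "C1 (\<lambda>x. f x - g x)"
  using C1_add[OF assms(1) C1_linear[OF bounded_linear_minus[OF bounded_linear_ident] assms(2)]] by simp

text \<open>
  The cutoffs are sums of translated and scaled tensor products of the quadratic B-spline
  \<open>bspline\<close>, a \<open>C1\<close> partition of unity. Writing the spline as a difference of consecutive
  translates of a step function makes its sums and those of its derivative telescope.
\<close>

definition sq_pos :: "real \<Rightarrow> real" where "sq_pos t = (max 0 t)\<^sup>2"
definition sstep :: "real \<Rightarrow> real" where "sstep t = (sq_pos t - 2 * sq_pos (t - 1) + sq_pos (t - 2)) / 2"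
definition hat :: "real \<Rightarrow> real" where "hat t = max 0 t - 2 * max 0 (t - 1) + max 0 (t - 2)"
definition ramp :: "real \<Rightarrow> real" where "ramp t = max 0 t - max 0 (t - 1)"
definition bspline :: "real \<Rightarrow> real" where "bspline t = sstep t - sstep (t - 1)"
definition bspline' :: "real \<Rightarrow> real" where "bspline' t = hat t - hat (t - 1)"

lemma sq_pos_has_derivative: "(sq_pos has_real_derivative 2 * max 0 t) (at t)"
proof (cases t "0::real" rule: linorder_cases)
  case less
  have "((\<lambda>t::real. 0) has_real_derivative 2 * max 0 t) (at t)" using less by simp
  then show ?thesis
    by (rule DERIV_cong_ev[THEN iffD1, rotated 3])
       (use less eventually_nhds_in_open[of "{..<0}" t] in \<open>auto simp: sq_pos_def elim!: eventually_mono\<close>)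
next
  case greater
  have "((\<lambda>t::real. t\<^sup>2) has_real_derivative 2 * max 0 t) (at t)"
    using greater by (auto intro!: derivative_eq_intros)
  then show ?thesis
    by (rule DERIV_cong_ev[THEN iffD1, rotated 3])
       (use greater eventually_nhds_in_open[of "{0<..}" t] in \<open>auto simp: sq_pos_def elim!: eventually_mono\<close>)
next
  case equal
  have "(\<lambda>h. (sq_pos (0 + h) - sq_pos 0) / h) \<midarrow>0\<rightarrow> 0"
  proof (rule Lim_null_comparison)
    show "\<forall>\<^sub>F h in at 0. norm ((sq_pos (0 + h) - sq_pos 0) / h) \<le> \<bar>h\<bar>"
      by (intro always_eventually) (auto simp: sq_pos_def max_def power2_eq_square)
    show "(\<lambda>h::real. \<bar>h\<bar>) \<midarrow>0\<rightarrow> 0" by (rule tendsto_rabs_zero) (rule tendsto_ident_at)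
  qed
  then show ?thesis using equal by (simp add: DERIV_def)
qed

lemma sstep_has_derivative: "(sstep has_real_derivative hat t) (at t)"
proof -
  have sh: "((\<lambda>t. sq_pos (t - c)) has_real_derivative 2 * max 0 (t - c)) (at t)" for c
    using DERIV_shift[of sq_pos "2 * max 0 (t - c)" t "-c"] sq_pos_has_derivative[of "t - c"] by simp
  have "((\<lambda>t. (sq_pos t - 2 * sq_pos (t - 1) + sq_pos (t - 2)) / 2) has_real_derivative
      (2 * max 0 t - 2 * (2 * max 0 (t - 1)) + 2 * max 0 (t - 2)) / 2) (at t)"
    by (intro DERIV_cdivide DERIV_add DERIV_diff DERIV_cmult sq_pos_has_derivative sh)
  moreover have "(2 * max 0 t - 2 * (2 * max 0 (t - 1)) + 2 * max 0 (t - 2)) / 2 = hat t"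
    by (simp add: hat_def)
  moreover have "(\<lambda>t. (sq_pos t - 2 * sq_pos (t - 1) + sq_pos (t - 2)) / 2) = sstep"
    by (simp add: sstep_def fun_eq_iff)
  ultimately show ?thesis by simp
qed

lemma bspline_has_derivative: "(bspline has_real_derivative bspline' t) (at t)"
proof -
  have "((\<lambda>t. sstep (t - 1)) has_real_derivative hat (t - 1)) (at t)"
    using DERIV_shift[of sstep "hat (t - 1)" t "-1"] sstep_has_derivative[of "t - 1"] by simp
  from DERIV_diff[OF sstep_has_derivative this] show ?thesis
    by (simp add: bspline_def[abs_def] bspline'_def)
qed

lemma hat_nonneg: "hat t \<ge> 0" by (auto simp: hat_def max_def)
lemma hat_ramp: "hat t = ramp t - ramp (t - 1)" by (simp add: hat_def ramp_def)
lemma ramp_bounds: "0 \<le> ramp t" "ramp t \<le> 1" by (auto simp: ramp_def max_def)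

lemma sstep_mono: "s \<le> t \<Longrightarrow> sstep s \<le> sstep t"
  by (rule DERIV_nonneg_imp_nondecreasing) (use sstep_has_derivative hat_nonneg in blast)+

lemma sstep_0: "t \<le> 0 \<Longrightarrow> sstep t = 0" by (simp add: sstep_def sq_pos_def)
lemma sstep_1: "t \<ge> 2 \<Longrightarrow> sstep t = 1"
  by (simp add: sstep_def sq_pos_def) (simp add: power2_eq_square algebra_simps)
lemma sstep_bounds: "0 \<le> sstep t" "sstep t \<le> 1"
  using sstep_mono[of "min 0 t" t] sstep_mono[of t "max 2 t"] by (simp_all add: sstep_0 sstep_1)

lemma bspline_nonneg: "bspline t \<ge> 0"
  using sstep_mono[of "t - 1" t] by (simp add: bspline_def)

lemma bspline_support: "bspline t \<noteq> 0 \<Longrightarrow> 0 \<le> t \<and> t \<le> 3"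
  by (rule ccontr) (auto simp: bspline_def sstep_0 sstep_1 not_le)

lemma continuous_bspline': "continuous_on UNIV bspline'"
  unfolding bspline'_def hat_def by (intro continuous_intros)

lemma sum_bspline_telescope: "(\<Sum>m<M. bspline (t - real m)) = sstep t - sstep (t - real M)"
  using sum_lessThan_telescope'[of "\<lambda>m. sstep (t - real m)" M] by (simp add: bspline_def algebra_simps)

lemma sum_bspline_le: "(\<Sum>m<M. bspline (t - real m)) \<le> 1"
  unfolding sum_bspline_telescope using sstep_bounds[of t] sstep_bounds[of "t - real M"] by linarith

lemma sum_bspline_eq: "2 \<le> t \<Longrightarrow> t \<le> real M \<Longrightarrow> (\<Sum>m<M. bspline (t - real m)) = 1"
  unfolding sum_bspline_telescope by (simp add: sstep_0 sstep_1)

lemma sum_hat_le: "(\<Sum>m<M. hat (t - real m)) \<le> 1"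
proof -
  have "(\<Sum>m<M. hat (t - real m)) = ramp t - ramp (t - real M)"
    using sum_lessThan_telescope'[of "\<lambda>m. ramp (t - real m)" M] by (simp add: hat_ramp algebra_simps)
  then show ?thesis using ramp_bounds[of t] ramp_bounds[of "t - real M"] by linarith
qed

lemma sum_abs_bspline'_le: "(\<Sum>m<M. \<bar>bspline' (t - real m)\<bar>) \<le> 2"
proof -
  have "(\<Sum>m<M. \<bar>bspline' (t - real m)\<bar>) \<le> (\<Sum>m<M. hat (t - real m) + hat ((t - 1) - real m))"
  proof (rule sum_mono)
    fix m show "\<bar>bspline' (t - real m)\<bar> \<le> hat (t - real m) + hat ((t - 1) - real m)"
      using hat_nonneg[of "t - real m"] hat_nonneg[of "t - real m - 1"]
      by (simp add: bspline'_def algebra_simps)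
  qed
  also have "\<dots> \<le> 2"
    unfolding sum.distrib using sum_hat_le[of t M] sum_hat_le[of "t - 1" M] by linarith
  finally show ?thesis .
qed

text \<open>
  Bumps are indexed by natural numbers, so the grid of mesh size \<open>\<delta>\<close> is shifted by \<open>N\<close> grid cells
  to cover points with negative coordinates.
\<close>

definition grid_bump :: "real \<Rightarrow> real \<Rightarrow> nat \<times> nat \<times> nat \<Rightarrow> point \<Rightarrow> real" where
  "grid_bump \<delta> N = (\<lambda>(a, b, c) x. bspline (x $ 1 / \<delta> + N - real a) *
     (bspline (x $ 2 / \<delta> + N - real b) * bspline (x $ 3 / \<delta> + N - real c)))"

lemma bspline_coordinate_has_derivative:
  "((\<lambda>x::point. bspline (x $ i / \<delta> + N - c)) has_derivative
     (\<lambda>h. bspline' (x $ i / \<delta> + N - c) * (h $ i / \<delta>))) (at x)"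
proof -
  have "((\<lambda>x::point. x $ i / \<delta> + N - c) has_derivative (\<lambda>h. h $ i / \<delta>)) (at x)"
    using has_derivative_add[OF bounded_linear.has_derivative[OF bounded_linear_mult_left[of "1 / \<delta>"]
        bounded_linear.has_derivative[OF bounded_linear_vec_nth[of i] has_derivative_ident[of "at x"]]] has_derivative_const[of "N - c"]]
    by (simp add: algebra_simps)
  moreover have "(bspline has_derivative (*) (bspline' (x $ i / \<delta> + N - c))) (at (x $ i / \<delta> + N - c))"
    using bspline_has_derivative by (simp add: has_field_derivative_def)
  ultimately show ?thesis by (rule has_derivative_compose)
qed

lemma C1_bspline_coordinate: "C1 (\<lambda>x::point. bspline (x $ i / \<delta> + N - c))"
  by (rule C1I[OF bspline_coordinate_has_derivative])
     (simp only: divide_inverse, intro continuous_intros continuous_on_compose2[OF continuous_bspline'], auto)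

lemma C1_mult:
  fixes f g :: "point \<Rightarrow> real"
  shows "C1 f \<Longrightarrow> C1 g \<Longrightarrow> C1 (\<lambda>x. f x * g x)"
  using C1_scaleR[of f g] by simp

lemma C1_grid_bump: "C1 (grid_bump \<delta> N m)"
  by (cases m) (auto simp: grid_bump_def intro!: C1_mult C1_bspline_coordinate)

lemma grid_bump_nonneg: "grid_bump \<delta> N m x \<ge> 0"
  by (cases m) (simp add: grid_bump_def bspline_nonneg)

lemma grid_sum:
  fixes f g h :: "nat \<Rightarrow> real"
  shows "(\<Sum>(a, b, c)\<in>{..<M} \<times> {..<M} \<times> {..<M}. f a * (g b * h c))
     = (\<Sum>a<M. f a) * ((\<Sum>b<M. g b) * (\<Sum>c<M. h c))"
proof -
  have "(\<Sum>(a, b, c)\<in>{..<M} \<times> {..<M} \<times> {..<M}. f a * (g b * h c))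
      = (\<Sum>a<M. \<Sum>(b, c)\<in>{..<M} \<times> {..<M}. f a * (g b * h c))"
    by (simp only: sum.cartesian_product)
  also have "\<dots> = (\<Sum>a<M. \<Sum>b<M. \<Sum>c<M. f a * (g b * h c))"
    by (simp only: sum.cartesian_product)
  finally show ?thesis
    by (simp only: sum_distrib_left[symmetric] sum_distrib_right[symmetric])
qed

lemma sum_grid_bump:
  "(\<Sum>m\<in>{..<M} \<times> {..<M} \<times> {..<M}. grid_bump \<delta> N m x) =
     (\<Sum>k<M. bspline (x $ 1 / \<delta> + N - real k)) *
     ((\<Sum>k<M. bspline (x $ 2 / \<delta> + N - real k)) * (\<Sum>k<M. bspline (x $ 3 / \<delta> + N - real k)))"
  unfolding grid_sum[symmetric] by (rule sum.cong) (auto simp: grid_bump_def)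

lemma sum_grid_bump_le: "(\<Sum>m\<in>{..<M} \<times> {..<M} \<times> {..<M}. grid_bump \<delta> N m x) \<le> 1"
  unfolding sum_grid_bump
  by (intro mult_le_one mult_nonneg_nonneg sum_nonneg bspline_nonneg sum_bspline_le)

lemma sum_grid_bump_eq:
  assumes "\<And>i. 2 \<le> x $ i / \<delta> + N" "\<And>i. x $ i / \<delta> + N \<le> real M"
  shows "(\<Sum>m\<in>{..<M} \<times> {..<M} \<times> {..<M}. grid_bump \<delta> N m x) = 1"
  unfolding sum_grid_bump by (simp add: sum_bspline_eq assms)

lemma grid_bump_support:
  assumes "grid_bump \<delta> N m x \<noteq> 0" "grid_bump \<delta> N m y \<noteq> 0" "\<delta> > 0"
  shows "dist x y \<le> 9 * \<delta>"
proof -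
  obtain a b c where m: "m = (a, b, c)" by (cases m) auto
  have "\<bar>x $ i - y $ i\<bar> \<le> 3 * \<delta>" for i
  proof -
    have "\<exists>k::real. (0 \<le> x $ i / \<delta> + N - k \<and> x $ i / \<delta> + N - k \<le> 3) \<and> (0 \<le> y $ i / \<delta> + N - k \<and> y $ i / \<delta> + N - k \<le> 3)"
      using assms(1,2) bspline_support[of "x $ 1 / \<delta> + N - real a"] bspline_support[of "y $ 1 / \<delta> + N - real a"]
        bspline_support[of "x $ 2 / \<delta> + N - real b"] bspline_support[of "y $ 2 / \<delta> + N - real b"]
        bspline_support[of "x $ 3 / \<delta> + N - real c"] bspline_support[of "y $ 3 / \<delta> + N - real c"]
        exhaust_3[of i] unfolding m grid_bump_def by (simp only: prod.case mult_eq_0_iff de_Morgan_disj) blast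
    then have "\<bar>x $ i / \<delta> - y $ i / \<delta>\<bar> \<le> 3" by (auto simp: abs_le_iff)
    then show ?thesis using \<open>\<delta> > 0\<close> by (simp add: diff_divide_distrib[symmetric] abs_divide pos_divide_le_eq)
  qed
  then have "(\<Sum>i\<in>UNIV. \<bar>(x - y) $ i\<bar>) \<le> (\<Sum>i\<in>(UNIV::3 set). 3 * \<delta>)"
    by (intro sum_mono) simp
  then show ?thesis using norm_le_l1_cart[of "x - y"] by (simp add: dist_norm)
qed

lemma sum_grid_bump_partial_le:
  assumes "\<delta> > 0"
  shows "(\<Sum>m\<in>{..<M} \<times> {..<M} \<times> {..<M}. \<bar>partial j (grid_bump \<delta> N m) x\<bar>) \<le> 2 / \<delta>"
proof -
  define B where "B i k = bspline (x $ i / \<delta> + N - real k)" for i :: 3 and k :: nat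
  define B' where "B' i k = \<bar>bspline' (x $ i / \<delta> + N - real k)\<bar>" for i :: 3 and k :: nat
  have Bn: "B i k \<ge> 0" "B' i k \<ge> 0" for i k by (simp_all add: B_def B'_def bspline_nonneg)
  have SB: "(\<Sum>k<M. B i k) \<le> 1" "(\<Sum>k<M. B' i k) \<le> 2" for i
    unfolding B_def B'_def by (rule sum_bspline_le sum_abs_bspline'_le)+
  have SB0: "0 \<le> (\<Sum>k<M. B i k)" "0 \<le> (\<Sum>k<M. B' i k)" for i
    using Bn by (simp_all add: sum_nonneg)
  have D: "partial j (grid_bump \<delta> N (a, b, c)) x =
      bspline (x $ 1 / \<delta> + N - real a) * (bspline (x $ 2 / \<delta> + N - real b) * (bspline' (x $ 3 / \<delta> + N - real c) * (axis j 1 $ 3 / \<delta>))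
        + bspline' (x $ 2 / \<delta> + N - real b) * (axis j 1 $ 2 / \<delta>) * bspline (x $ 3 / \<delta> + N - real c))
      + bspline' (x $ 1 / \<delta> + N - real a) * (axis j 1 $ 1 / \<delta>) * (bspline (x $ 2 / \<delta> + N - real b) * bspline (x $ 3 / \<delta> + N - real c))" for a b c
    unfolding partial_def grid_bump_def prod.case
    by (subst frechet_derivative_at[symmetric, OF has_derivative_mult[OF bspline_coordinate_has_derivative
        has_derivative_mult[OF bspline_coordinate_has_derivative bspline_coordinate_has_derivative]]]) simp
  consider "j = 1" | "j = 2" | "j = 3" using exhaust_3[of j] by blast
  then show ?thesis
  proof cases
    case 1
    note D = D[unfolded 1]
    from 1 have eq: "\<bar>partial j (grid_bump \<delta> N m) x\<bar> = (case m of (a, b, c) \<Rightarrow> (B' 1 a / \<delta>) * (B 2 b * B 3 c))" for m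
      using \<open>\<delta> > 0\<close> Bn by (cases m) (simp add: D axis_def B_def[symmetric] abs_mult B'_def)
    have "(\<Sum>a<M. B' 1 a / \<delta>) * ((\<Sum>b<M. B 2 b) * (\<Sum>c<M. B 3 c)) \<le> (2 / \<delta>) * (1 * 1)"
      unfolding sum_divide_distrib[symmetric]
      by (intro mult_mono SB SB0 divide_right_mono mult_nonneg_nonneg) (use \<open>\<delta> > 0\<close> SB0 in auto)
    then show ?thesis unfolding eq by (subst grid_sum) simp
  next
    case 2
    note D = D[unfolded 2]
    from 2 have eq: "\<bar>partial j (grid_bump \<delta> N m) x\<bar> = (case m of (a, b, c) \<Rightarrow> B 1 a * (B' 2 b / \<delta> * B 3 c))" for m
      using \<open>\<delta> > 0\<close> Bn by (cases m) (simp add: D axis_def B_def[symmetric] abs_mult B'_def)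
    have "(\<Sum>a<M. B 1 a) * ((\<Sum>b<M. B' 2 b / \<delta>) * (\<Sum>c<M. B 3 c)) \<le> 1 * ((2 / \<delta>) * 1)"
      unfolding sum_divide_distrib[symmetric]
      by (intro mult_mono SB SB0 divide_right_mono mult_nonneg_nonneg) (use \<open>\<delta> > 0\<close> SB0 in auto)
    then show ?thesis unfolding eq by (subst grid_sum) simp
  next
    case 3
    note D = D[unfolded 3]
    from 3 have eq: "\<bar>partial j (grid_bump \<delta> N m) x\<bar> = (case m of (a, b, c) \<Rightarrow> B 1 a * (B 2 b * (B' 3 c / \<delta>)))" for m
      using \<open>\<delta> > 0\<close> Bn by (cases m) (simp add: D axis_def B_def[symmetric] abs_mult B'_def)
    have "(\<Sum>a<M. B 1 a) * ((\<Sum>b<M. B 2 b) * (\<Sum>c<M. B' 3 c / \<delta>)) \<le> 1 * (1 * (2 / \<delta>))"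
      unfolding sum_divide_distrib[symmetric]
      by (intro mult_mono SB SB0 divide_right_mono mult_nonneg_nonneg) (use \<open>\<delta> > 0\<close> SB0 in auto)
    then show ?thesis unfolding eq by (subst grid_sum) simp
  qed
qed

lemma partial_sum:
  assumes "finite I" "\<And>i. i \<in> I \<Longrightarrow> C1 (f i)"
  shows "partial j (\<lambda>x. \<Sum>i\<in>I. f i x) x = (\<Sum>i\<in>I. partial j (f i) x)"
  unfolding partial_def
  by (subst frechet_derivative_at[symmetric, OF has_derivative_sum])
     (use assms in \<open>auto intro: C1_has_derivative\<close>)

text \<open>
  The cutoff is the sum of those bumps of the partition of unity whose support meets the
  \<open>\<delta>\<close>-neighbourhood of \<open>S\<close>. Near \<open>S\<close> no bump is missing from the sum. A bump has diameter at most
  \<open>9 \<delta>\<close> (three cells in each of three directions, measured in the sum norm), which together with the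
  neighbourhood gives \<open>10 \<delta>\<close>. The gradient bound survives the choice of a subfamily because it is
  proved for the sum of the absolute values of the derivatives.
\<close>

lemma C1_cutoff:
  assumes "bounded S" "\<delta> > 0"
  obtains \<psi> :: "point \<Rightarrow> real" where "C1 \<psi>" "\<And>x. 0 \<le> \<psi> x" "\<And>x. \<psi> x \<le> 1"
    "\<And>x y. y \<in> S \<Longrightarrow> dist x y \<le> \<delta> \<Longrightarrow> \<psi> x = 1"
    "\<And>x. \<psi> x \<noteq> 0 \<Longrightarrow> \<exists>y\<in>S. dist x y \<le> 10 * \<delta>"
    "\<And>j x. \<bar>partial j \<psi> x\<bar> \<le> 2 / \<delta>"
proof -
  obtain R where R: "\<And>y. y \<in> S \<Longrightarrow> norm y \<le> R" using assms(1) by (auto simp: bounded_iff)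
  define N where "N = \<bar>R\<bar> / \<delta> + 3"
  define M where "M = nat \<lceil>2 * N\<rceil>"
  define near where "near x \<longleftrightarrow> (\<exists>y\<in>S. dist x y \<le> \<delta>)" for x
  let ?G = "{..<M} \<times> {..<M} \<times> {..<M}"
  define P where "P = {m \<in> ?G. \<exists>x. near x \<and> grid_bump \<delta> N m x \<noteq> 0}"
  define \<psi> where "\<psi> x = (\<Sum>m\<in>P. grid_bump \<delta> N m x)" for x
  have PG: "P \<subseteq> ?G" "finite P" unfolding P_def by (auto intro: finite_subset[of _ ?G])
  have sub: "(\<Sum>m\<in>P. f m) \<le> (\<Sum>m\<in>?G. f m)" if "\<And>m. f m \<ge> 0" for f :: "_ \<Rightarrow> real"
    using PG that by (intro sum_mono2) auto
  show thesis
  proof (rule that[of \<psi>])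
    show "C1 \<psi>" unfolding \<psi>_def using PG by (intro C1_sum C1_grid_bump)
    show "0 \<le> \<psi> x" for x unfolding \<psi>_def by (intro sum_nonneg grid_bump_nonneg)
    show "\<psi> x \<le> 1" for x
      unfolding \<psi>_def using sub[of "\<lambda>m. grid_bump \<delta> N m x"] sum_grid_bump_le[where M=M and x=x and \<delta>=\<delta> and N=N] grid_bump_nonneg
      by fastforce
    show "\<psi> x = 1" if "y \<in> S" "dist x y \<le> \<delta>" for x y
    proof -
      have nx: "near x" using that by (auto simp: near_def)
      have "norm x \<le> \<bar>R\<bar> + \<delta>"
        using R[OF that(1)] that(2) norm_triangle_sub[of x y] by (simp add: dist_norm)
      then have "\<bar>x $ i\<bar> \<le> \<bar>R\<bar> + \<delta>" for i using component_le_norm_cart[of x i] by linarith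
      then have xi: "\<bar>x $ i / \<delta>\<bar> \<le> \<bar>R\<bar> / \<delta> + 1" for i
        using \<open>\<delta> > 0\<close> by (simp add: abs_divide pos_divide_le_eq distrib_right)
      have MN: "2 * N \<le> real M" unfolding M_def by (simp add: real_nat_ceiling_ge)
      have "\<psi> x = (\<Sum>m\<in>?G. grid_bump \<delta> N m x)"
        unfolding \<psi>_def using nx by (intro sum.mono_neutral_left) (auto simp: P_def)
      also have "\<dots> = 1"
      proof (rule sum_grid_bump_eq)
        fix i show "2 \<le> x $ i / \<delta> + N" using xi[of i] unfolding N_def by linarith
        have "x $ i / \<delta> \<le> N" using xi[of i] unfolding N_def by linarith
        then show "x $ i / \<delta> + N \<le> real M" using MN by linarith
      qed
      finally show ?thesis .
    qed
    show "\<exists>y\<in>S. dist x y \<le> 10 * \<delta>" if nz: "\<psi> x \<noteq> 0" for x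
    proof -
      obtain m where m: "m \<in> P" "grid_bump \<delta> N m x \<noteq> 0"
        using nz sum.neutral[of P "\<lambda>m. grid_bump \<delta> N m x"] unfolding \<psi>_def by blast
      from m(1) obtain z where z: "near z" "grid_bump \<delta> N m z \<noteq> 0" unfolding P_def by blast
      from z(1) obtain y where y: "y \<in> S" "dist z y \<le> \<delta>" unfolding near_def by blast
      have "dist x y \<le> 10 * \<delta>"
        using grid_bump_support[OF m(2) z(2) \<open>\<delta> > 0\<close>] y(2) dist_triangle[of x y z] by linarith
      with y show ?thesis by blast
    qed
    show "\<bar>partial j \<psi> x\<bar> \<le> 2 / \<delta>" for j x
    proof -
      have "\<bar>partial j \<psi> x\<bar> = \<bar>\<Sum>m\<in>P. partial j (grid_bump \<delta> N m) x\<bar>"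
        unfolding \<psi>_def using PG by (subst partial_sum) (auto intro: C1_grid_bump)
      also have "\<dots> \<le> (\<Sum>m\<in>P. \<bar>partial j (grid_bump \<delta> N m) x\<bar>)" by (rule sum_abs)
      also have "\<dots> \<le> 2 / \<delta>"
        using sub[of "\<lambda>m. \<bar>partial j (grid_bump \<delta> N m) x\<bar>"] sum_grid_bump_partial_le[OF \<open>\<delta> > 0\<close>, where M=M and j=j and x=x and N=N] by force
      finally show ?thesis .
    qed
  qed
qed

section \<open>Square integrable functions\<close>

definition l2_inner :: "point set \<Rightarrow> (point \<Rightarrow> 'b::euclidean_space) \<Rightarrow> (point \<Rightarrow> 'b) \<Rightarrow> real" where
  "l2_inner K f g = (LINT x|lebesgue_on K. f x \<bullet> g x)"

definition l2_norm :: "point set \<Rightarrow> (point \<Rightarrow> 'b::euclidean_space) \<Rightarrow> real" where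
  "l2_norm K f = sqrt (l2_inner K f f)"

lemma L2_measurable: "f \<in> L2 K \<Longrightarrow> f \<in> borel_measurable (lebesgue_on K)"
  by (simp add: L2_def)

lemma L2_integrable_sq: "f \<in> L2 K \<Longrightarrow> integrable (lebesgue_on K) (\<lambda>x. (norm (f x))\<^sup>2)"
  by (simp add: L2_def)

lemma L2_dominated:
  fixes f :: "point \<Rightarrow> 'b::euclidean_space"
  assumes "f \<in> borel_measurable (lebesgue_on K)" "integrable (lebesgue_on K) h"
    "\<And>x. x \<in> K \<Longrightarrow> (norm (f x))\<^sup>2 \<le> h x"
  shows "f \<in> L2 K"
proof -
  note [measurable] = assms(1)
  have "integrable (lebesgue_on K) (\<lambda>x. (norm (f x))\<^sup>2)"
    by (rule Bochner_Integration.integrable_bound[OF assms(2)])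
       (use assms(3) in \<open>auto intro!: AE_I2 simp: order.trans[OF _ abs_ge_self]\<close>)
  then show ?thesis using assms(1) by (simp add: L2_def)
qed

lemma norm_add_sq_le: "(norm (a + b :: 'b::real_normed_vector))\<^sup>2 \<le> 2 * (norm a)\<^sup>2 + 2 * (norm b)\<^sup>2"
proof -
  have "(norm (a + b))\<^sup>2 \<le> (norm a + norm b)\<^sup>2" by (intro power_mono norm_triangle_ineq) auto
  also have "\<dots> \<le> 2 * (norm a)\<^sup>2 + 2 * (norm b)\<^sup>2"
    using sum_squares_bound[of "norm a" "norm b"] by (simp add: power2_sum)
  finally show ?thesis .
qed

lemma L2_add:
  fixes f g :: "point \<Rightarrow> 'b::euclidean_space"
  assumes "f \<in> L2 K" "g \<in> L2 K" shows "(\<lambda>x. f x + g x) \<in> L2 K"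
  by (rule L2_dominated[where h = "\<lambda>x. 2 * (norm (f x))\<^sup>2 + 2 * (norm (g x))\<^sup>2"])
     (intro borel_measurable_add Bochner_Integration.integrable_add integrable_mult_right L2_measurable
       L2_integrable_sq norm_add_sq_le assms)+

lemma L2_linear:
  fixes f :: "point \<Rightarrow> 'b::euclidean_space" and T :: "'b \<Rightarrow> 'c::euclidean_space"
  assumes "bounded_linear T" "f \<in> L2 K" shows "(\<lambda>x. T (f x)) \<in> L2 K"
proof -
  obtain C where C: "\<And>x. norm (T x) \<le> norm x * C" using bounded_linear.bounded[OF assms(1)] by blast
  show ?thesis
  proof (rule L2_dominated[where h = "\<lambda>x. C\<^sup>2 * (norm (f x))\<^sup>2"])
    show "(\<lambda>x. T (f x)) \<in> borel_measurable (lebesgue_on K)"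
      using measurable_compose[OF L2_measurable[OF assms(2)] borel_measurable_continuous_onI[of T]]
        linear_continuous_on[OF assms(1)] by blast
    show "(norm (T (f x)))\<^sup>2 \<le> C\<^sup>2 * (norm (f x))\<^sup>2" for x
      using power_mono[OF C[of "f x"], of 2] by (simp add: power_mult_distrib mult.commute)
  qed (use assms L2_integrable_sq in auto)
qed

lemma L2_zero: "(\<lambda>x. 0) \<in> L2 K" by (simp add: L2_def)

lemma L2_scaleR:
  fixes f :: "point \<Rightarrow> 'b::euclidean_space"
  shows "f \<in> L2 K \<Longrightarrow> (\<lambda>x. c *\<^sub>R f x) \<in> L2 K"
  by (rule L2_linear[OF bounded_linear_scaleR_right])

lemma L2_diff:
  fixes f g :: "point \<Rightarrow> 'b::euclidean_space"
  assumes "f \<in> L2 K" "g \<in> L2 K" shows "(\<lambda>x. f x - g x) \<in> L2 K"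
  using L2_add[OF assms(1) L2_scaleR[OF assms(2), of "-1"]] by simp

lemma L2_Pair:
  fixes f :: "point \<Rightarrow> 'b::euclidean_space" and g :: "point \<Rightarrow> 'c::euclidean_space"
  assumes "f \<in> L2 K" "g \<in> L2 K" shows "(\<lambda>x. (f x, g x)) \<in> L2 K"
proof (rule L2_dominated)
  show "integrable (lebesgue_on K) (\<lambda>x. (norm (f x))\<^sup>2 + (norm (g x))\<^sup>2)"
    by (intro Bochner_Integration.integrable_add L2_integrable_sq assms)
  show "(\<lambda>x. (f x, g x)) \<in> borel_measurable (lebesgue_on K)"
    by (intro borel_measurable_Pair L2_measurable assms)
qed (simp add: norm_Pair)

lemma L2_fst: "f \<in> L2 K \<Longrightarrow> (\<lambda>x. fst (f x :: 'b::euclidean_space \<times> 'c::euclidean_space)) \<in> L2 K"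
  by (rule L2_linear[OF bounded_linear_fst])

lemma L2_snd: "f \<in> L2 K \<Longrightarrow> (\<lambda>x. snd (f x :: 'b::euclidean_space \<times> 'c::euclidean_space)) \<in> L2 K"
  by (rule L2_linear[OF bounded_linear_snd])

lemma L2_integrable_mult:
  fixes f :: "point \<Rightarrow> 'b::euclidean_space" and g :: "point \<Rightarrow> 'c::euclidean_space"
    and h :: "point \<Rightarrow> 'd::euclidean_space"
  assumes "f \<in> L2 K" "g \<in> L2 K" "h \<in> borel_measurable (lebesgue_on K)"
    "\<And>x. x \<in> K \<Longrightarrow> norm (h x) \<le> norm (f x) * norm (g x)"
  shows "integrable (lebesgue_on K) h"
proof (rule Bochner_Integration.integrable_bound)
  show "integrable (lebesgue_on K) (\<lambda>x. (norm (f x))\<^sup>2 + (norm (g x))\<^sup>2)"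
    by (intro Bochner_Integration.integrable_add L2_integrable_sq assms)
  have "norm (h x) \<le> (norm (f x))\<^sup>2 + (norm (g x))\<^sup>2" if "x \<in> K" for x
  proof -
    have "0 \<le> norm (f x) * norm (g x)" by simp
    then show ?thesis
      using assms(4)[OF that] sum_squares_bound[of "norm (f x)" "norm (g x)"] by linarith
  qed
  then show "AE x in lebesgue_on K. norm (h x) \<le> norm ((norm (f x))\<^sup>2 + (norm (g x))\<^sup>2)"
    by (intro AE_I2) simp
qed fact

lemma L2_integrable_inner:
  fixes f g :: "point \<Rightarrow> 'b::euclidean_space"
  assumes "f \<in> L2 K" "g \<in> L2 K"
  shows "integrable (lebesgue_on K) (\<lambda>x. f x \<bullet> g x)"
proof -
  note [measurable] = L2_measurable[OF assms(1)] L2_measurable[OF assms(2)]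
  show ?thesis
    by (rule L2_integrable_mult[OF assms]) (auto simp: Cauchy_Schwarz_ineq2)
qed

lemma l2_inner_commute: "l2_inner K f g = l2_inner K g f"
  by (simp add: l2_inner_def inner_commute)

lemma l2_inner_add_left:
  assumes "f \<in> L2 K" "g \<in> L2 K" "h \<in> L2 K"
  shows "l2_inner K (\<lambda>x. f x + g x) h = l2_inner K f h + l2_inner K g h"
  unfolding l2_inner_def using assms by (simp add: inner_add_left L2_integrable_inner)

lemma l2_inner_scaleR_left: "l2_inner K (\<lambda>x. c *\<^sub>R f x) h = c * l2_inner K f h"
  unfolding l2_inner_def by simp

lemma l2_inner_add_right:
  assumes "f \<in> L2 K" "g \<in> L2 K" "h \<in> L2 K"
  shows "l2_inner K h (\<lambda>x. f x + g x) = l2_inner K h f + l2_inner K h g"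
  using l2_inner_add_left[OF assms] by (simp add: l2_inner_commute)

lemma l2_inner_scaleR_right: "l2_inner K h (\<lambda>x. c *\<^sub>R f x) = c * l2_inner K h f"
  using l2_inner_scaleR_left[of K c f h] by (simp add: l2_inner_commute)

lemma l2_inner_diff_right:
  assumes "f \<in> L2 K" "g \<in> L2 K" "h \<in> L2 K"
  shows "l2_inner K h (\<lambda>x. f x - g x) = l2_inner K h f - l2_inner K h g"
  unfolding l2_inner_def using assms by (simp add: inner_diff_right L2_integrable_inner)

lemma l2_inner_self_nonneg: "l2_inner K f f \<ge> 0"
  unfolding l2_inner_def by (intro integral_nonneg_AE) auto

lemma l2_norm_nonneg: "l2_norm K f \<ge> 0"
  by (simp add: l2_norm_def l2_inner_self_nonneg)

lemma l2_norm_sq: "(l2_norm K f)\<^sup>2 = l2_inner K f f"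
  by (simp add: l2_norm_def l2_inner_self_nonneg)

lemma l2_norm_sq_integral: "(l2_norm K f)\<^sup>2 = (LINT x|lebesgue_on K. (norm (f x))\<^sup>2)"
  by (simp add: l2_norm_sq l2_inner_def power2_norm_eq_inner)

lemma l2_norm_scaleR: "l2_norm K (\<lambda>x. c *\<^sub>R f x) = \<bar>c\<bar> * l2_norm K f"
  by (simp add: l2_norm_def l2_inner_scaleR_left l2_inner_scaleR_right real_sqrt_mult mult.assoc[symmetric])

lemma l2_norm_zero: "l2_norm K (\<lambda>x. 0) = 0"
  by (simp add: l2_norm_def l2_inner_def)

lemma l2_norm_add_sq:
  assumes "f \<in> L2 K" "g \<in> L2 K"
  shows "(l2_norm K (\<lambda>x. f x + g x))\<^sup>2 = (l2_norm K f)\<^sup>2 + 2 * l2_inner K f g + (l2_norm K g)\<^sup>2"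
proof -
  have "(l2_norm K (\<lambda>x. f x + g x))\<^sup>2
      = l2_inner K f (\<lambda>x. f x + g x) + l2_inner K g (\<lambda>x. f x + g x)"
    unfolding l2_norm_sq by (rule l2_inner_add_left) (intro assms L2_add)+
  then show ?thesis
    unfolding l2_norm_sq l2_inner_add_right[OF assms assms(1)] l2_inner_add_right[OF assms assms(2)]
    by (simp add: l2_inner_commute[of K g f])
qed

lemma l2_Cauchy_Schwarz:
  assumes "f \<in> L2 K" "g \<in> L2 K"
  shows "\<bar>l2_inner K f g\<bar> \<le> l2_norm K f * l2_norm K g"
proof -
  define a b c where "a = l2_inner K f g" and "b = (l2_norm K f)\<^sup>2" and "c = (l2_norm K g)\<^sup>2"
  have pos: "0 \<le> b + 2 * (t * a) + t\<^sup>2 * c" for t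
  proof -
    have "0 \<le> (l2_norm K (\<lambda>x. f x + t *\<^sub>R g x))\<^sup>2" by simp
    also have "\<dots> = b + 2 * (t * a) + (\<bar>t\<bar> * l2_norm K g)\<^sup>2"
      unfolding l2_norm_add_sq[OF assms(1) L2_scaleR[OF assms(2)]] l2_inner_scaleR_right l2_norm_scaleR
      by (simp add: a_def b_def)
    finally show ?thesis by (simp add: c_def power_mult_distrib)
  qed
  have "a\<^sup>2 \<le> b * c"
  proof (cases "c = 0")
    case True
    have "a = 0"
    proof (rule ccontr)
      assume "a \<noteq> 0"
      have "0 \<le> b + 2 * ((-(b + 1) / a) * a)" using pos[of "-(b+1)/a"] True by simp
      then have "0 \<le> b - 2 * (b + 1)" using \<open>a \<noteq> 0\<close> by simp
      moreover have "b \<ge> 0" by (simp add: b_def)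
      ultimately show False by simp
    qed
    then show ?thesis by (simp add: b_def c_def)
  next
    case False
    then have c: "c > 0" by (simp add: c_def)
    have "0 \<le> b + 2 * ((-a / c) * a) + (-a / c)\<^sup>2 * c" by (rule pos)
    also have "\<dots> = b - a\<^sup>2 / c" using c by (simp add: power2_eq_square field_simps)
    finally show ?thesis using c by (simp add: pos_divide_le_eq)
  qed
  then have "\<bar>a\<bar>\<^sup>2 \<le> (l2_norm K f * l2_norm K g)\<^sup>2" by (simp add: b_def c_def power_mult_distrib)
  then show ?thesis
    unfolding a_def by (rule power2_le_imp_le) (intro mult_nonneg_nonneg l2_norm_nonneg)
qed

lemma l2_triangle:
  assumes "f \<in> L2 K" "g \<in> L2 K"
  shows "l2_norm K (\<lambda>x. f x + g x) \<le> l2_norm K f + l2_norm K g"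
proof (rule power2_le_imp_le)
  show "(l2_norm K (\<lambda>x. f x + g x))\<^sup>2 \<le> (l2_norm K f + l2_norm K g)\<^sup>2"
    unfolding l2_norm_add_sq[OF assms] power2_sum using l2_Cauchy_Schwarz[OF assms] by linarith
qed (use l2_norm_nonneg[of K f] l2_norm_nonneg[of K g] in linarith)

lemma l2_norm_minus_commute: "l2_norm K (\<lambda>x. f x - g x) = l2_norm K (\<lambda>x. g x - f x)"
  using l2_norm_scaleR[of K "-1" "\<lambda>x. f x - g x"] by simp

lemma l2_triangle_diff:
  assumes "f \<in> L2 K" "g \<in> L2 K" "h \<in> L2 K"
  shows "l2_norm K (\<lambda>x. f x - h x) \<le> l2_norm K (\<lambda>x. f x - g x) + l2_norm K (\<lambda>x. g x - h x)"
  using l2_triangle[OF L2_diff[OF assms(1,2)] L2_diff[OF assms(2,3)]] by simp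

lemma l2_norm_diff_le:
  assumes "f \<in> L2 K" "g \<in> L2 K"
  shows "\<bar>l2_norm K f - l2_norm K g\<bar> \<le> l2_norm K (\<lambda>x. f x - g x)"
  using l2_triangle[OF L2_diff[OF assms] assms(2)] l2_triangle[OF L2_diff[OF assms(2,1)] assms(1)]
    l2_norm_minus_commute[of K f g] by simp

lemma l2_inner_cong_AE:
  assumes "f \<in> L2 K" "f' \<in> L2 K" "g \<in> L2 K" "g' \<in> L2 K"
    "AE x in lebesgue_on K. f x = f' x" "AE x in lebesgue_on K. g x = g' x"
  shows "l2_inner K f g = l2_inner K f' g'"
  unfolding l2_inner_def
proof (rule integral_cong_AE)
  show "AE x in lebesgue_on K. f x \<bullet> g x = f' x \<bullet> g' x"
    using assms(5,6) by eventually_elim simp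
qed (intro borel_measurable_integrable L2_integrable_inner assms)+

lemma l2_norm_cong_AE:
  assumes "f \<in> L2 K" "f' \<in> L2 K" "AE x in lebesgue_on K. f x = f' x"
  shows "l2_norm K f = l2_norm K f'"
  unfolding l2_norm_def using l2_inner_cong_AE[OF assms(1,2) assms(1,2) assms(3,3)] by simp

lemma l2_inner_tendsto:
  assumes "\<And>n. s n \<in> L2 K" "f \<in> L2 K" "g \<in> L2 K" "(\<lambda>n. l2_norm K (\<lambda>x. s n x - f x)) \<longlonglongrightarrow> 0"
  shows "(\<lambda>n. l2_inner K g (s n)) \<longlonglongrightarrow> l2_inner K g f"
proof -
  have "(\<lambda>n. l2_inner K g (s n) - l2_inner K g f) \<longlonglongrightarrow> 0"
  proof (rule Lim_null_comparison)
    show "\<forall>\<^sub>F n in sequentially. norm (l2_inner K g (s n) - l2_inner K g f)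
        \<le> l2_norm K g * l2_norm K (\<lambda>x. s n x - f x)"
      using assms l2_Cauchy_Schwarz[OF assms(3) L2_diff[OF assms(1,2)]]
      by (intro always_eventually allI) (simp add: l2_inner_diff_right)
    show "(\<lambda>n. l2_norm K g * l2_norm K (\<lambda>x. s n x - f x)) \<longlonglongrightarrow> 0"
      using tendsto_mult_right_zero[OF assms(4)] by simp
  qed
  then show ?thesis by (simp add: LIM_zero_cancel)
qed

lemma l2_norm_tendsto:
  assumes "\<And>n. s n \<in> L2 K" "f \<in> L2 K" "(\<lambda>n. l2_norm K (\<lambda>x. s n x - f x)) \<longlonglongrightarrow> 0"
  shows "(\<lambda>n. l2_norm K (s n)) \<longlonglongrightarrow> l2_norm K f"
proof -
  have "(\<lambda>n. l2_norm K (s n) - l2_norm K f) \<longlonglongrightarrow> 0"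
    by (rule Lim_null_comparison[OF _ assms(3)])
       (use l2_norm_diff_le[OF assms(1,2)] in \<open>auto intro!: always_eventually\<close>)
  then show ?thesis by (simp add: LIM_zero_cancel)
qed

lemma L2_bounded:
  fixes f :: "point \<Rightarrow> 'b::euclidean_space"
  assumes "K \<in> lmeasurable" "f \<in> borel_measurable (lebesgue_on K)" "\<And>x. x \<in> K \<Longrightarrow> norm (f x) \<le> B"
  shows "f \<in> L2 K"
proof (rule L2_dominated[OF assms(2), where h = "\<lambda>x. B\<^sup>2"])
  interpret finite_measure "lebesgue_on K" using assms(1) by (rule finite_measure_lebesgue_on)
  show "integrable (lebesgue_on K) (\<lambda>x. B\<^sup>2)" by simp
  show "(norm (f x))\<^sup>2 \<le> B\<^sup>2" if "x \<in> K" for x using power_mono[OF assms(3)[OF that], of 2] by simp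
qed

lemma L2_integrable:
  fixes f :: "point \<Rightarrow> 'b::euclidean_space"
  assumes "K \<in> lmeasurable" "f \<in> L2 K"
  shows "integrable (lebesgue_on K) f"
    and "(LINT x|lebesgue_on K. norm (f x)) \<le> sqrt (measure lebesgue K) * l2_norm K f"
proof -
  have one: "(\<lambda>x. 1::real) \<in> L2 K" by (rule L2_bounded[OF assms(1), of _ 1]) auto
  note [measurable] = L2_measurable[OF assms(2)]
  show "integrable (lebesgue_on K) f" by (rule L2_integrable_mult[OF one assms(2)]) auto
  have n: "(\<lambda>x. norm (f x)) \<in> L2 K"
    using assms(2) by (auto simp: L2_def)
  have "l2_inner K (\<lambda>x. 1) (\<lambda>x. norm (f x)) \<le> l2_norm K (\<lambda>x. 1::real) * l2_norm K (\<lambda>x. norm (f x))"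
    using l2_Cauchy_Schwarz[OF one n] by simp
  moreover have "l2_norm K (\<lambda>x. 1::real) = sqrt (measure lebesgue K)"
    using assms(1) by (simp add: l2_norm_def l2_inner_def measure_restrict_space fmeasurableD)
  moreover have "l2_norm K (\<lambda>x. norm (f x)) = l2_norm K f"
    by (simp add: l2_norm_def l2_inner_def power2_norm_eq_inner[symmetric] power2_eq_square[symmetric])
  ultimately show "(LINT x|lebesgue_on K. norm (f x)) \<le> sqrt (measure lebesgue K) * l2_norm K f"
    by (simp add: l2_inner_def)
qed

lemma nn_integral_norm_sq:
  assumes "f \<in> L2 K"
  shows "(\<integral>\<^sup>+x. ennreal ((norm (f x))\<^sup>2) \<partial>lebesgue_on K) = ennreal ((l2_norm K f)\<^sup>2)"
  unfolding l2_norm_sq_integral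
  by (rule nn_integral_eq_integral) (use L2_integrable_sq[OF assms] in auto)

lemma L2_nn_integral:
  fixes f :: "point \<Rightarrow> 'b::euclidean_space"
  assumes "f \<in> borel_measurable (lebesgue_on K)"
    "(\<integral>\<^sup>+x. ennreal ((norm (f x))\<^sup>2) \<partial>lebesgue_on K) \<le> ennreal (e\<^sup>2)" "e \<ge> 0"
  shows "f \<in> L2 K" "l2_norm K f \<le> e"
proof -
  note [measurable] = assms(1)
  have "integrable (lebesgue_on K) (\<lambda>x. (norm (f x))\<^sup>2)"
    by (rule integrableI_bounded) (use assms(2) in \<open>auto intro: le_less_trans\<close>)
  then show f: "f \<in> L2 K" using assms(1) by (simp add: L2_def)
  have "(l2_norm K f)\<^sup>2 \<le> e\<^sup>2" using assms(2) unfolding nn_integral_norm_sq[OF f] by simp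
  then show "l2_norm K f \<le> e" using assms(3) by (rule power2_le_imp_le)
qed

text \<open>
  On a set of finite measure an \<open>L2\<close> Cauchy sequence is Cauchy in \<open>L1\<close>, so a subsequence converges
  almost everywhere, and Fatou's lemma turns that into convergence in \<open>L2\<close>.
\<close>

lemma L2_complete:
  fixes s :: "nat \<Rightarrow> point \<Rightarrow> 'b::euclidean_space"
  assumes K: "K \<in> lmeasurable" and s: "\<And>n. s n \<in> L2 K"
    and Cauchy: "\<And>e. e > 0 \<Longrightarrow> \<exists>N. \<forall>m\<ge>N. \<forall>n\<ge>N. l2_norm K (\<lambda>x. s m x - s n x) < e"
  obtains f where "f \<in> L2 K" "(\<lambda>n. l2_norm K (\<lambda>x. s n x - f x)) \<longlonglongrightarrow> 0"
proof -
  note [measurable] = L2_measurable[OF s]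
  have "\<exists>N. \<forall>i\<ge>N. \<forall>j\<ge>N. (LINT x|lebesgue_on K. norm (s i x - s j x)) < e" if "e > 0" for e
  proof -
    let ?c = "sqrt (measure lebesgue K) + 1"
    have c: "?c > 0" by (smt (verit) measure_nonneg real_sqrt_ge_zero)
    have "e / ?c > 0" using c that by (rule divide_pos_pos[rotated])
    from Cauchy[OF this] obtain N
      where N: "\<And>m n. m \<ge> N \<Longrightarrow> n \<ge> N \<Longrightarrow> l2_norm K (\<lambda>x. s m x - s n x) < e / ?c"
      by blast
    have "(LINT x|lebesgue_on K. norm (s i x - s j x)) < e" if "i \<ge> N" "j \<ge> N" for i j
    proof -
      have "(LINT x|lebesgue_on K. norm (s i x - s j x)) \<le> sqrt (measure lebesgue K) * l2_norm K (\<lambda>x. s i x - s j x)"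
        by (rule L2_integrable(2)[OF K L2_diff[OF s s]])
      also have "\<dots> \<le> ?c * l2_norm K (\<lambda>x. s i x - s j x)"
        by (intro mult_right_mono l2_norm_nonneg) auto
      also have "\<dots> < ?c * (e / ?c)" by (rule mult_strict_left_mono[OF N[OF that] c])
      finally show ?thesis using c by simp
    qed
    then show ?thesis by blast
  qed
  then obtain r where r: "strict_mono r" "AE x in lebesgue_on K. Cauchy (\<lambda>i. s (r i) x)"
    using cauchy_L1_AE_cauchy_subseq[of "lebesgue_on K" s] L2_integrable(1)[OF K s] by blast
  define f where "f x = lim (\<lambda>i. s (r i) x)" for x
  have fm[measurable]: "f \<in> borel_measurable (lebesgue_on K)" unfolding f_def by measurable
  have lim: "AE x in lebesgue_on K. (\<lambda>i. s (r i) x) \<longlonglongrightarrow> f x"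
    using r(2) unfolding f_def by (auto elim!: eventually_mono simp: Cauchy_convergent_iff convergent_LIMSEQ_iff)
  have key: "(\<lambda>x. s n x - f x) \<in> L2 K \<and> l2_norm K (\<lambda>x. s n x - f x) \<le> e"
    if e: "e > 0" and N: "\<And>m n. m \<ge> N \<Longrightarrow> n \<ge> N \<Longrightarrow> l2_norm K (\<lambda>x. s m x - s n x) < e" and n: "n \<ge> N" for e N n
  proof -
    have "(\<integral>\<^sup>+x. ennreal ((norm (s n x - f x))\<^sup>2) \<partial>lebesgue_on K)
        = (\<integral>\<^sup>+x. liminf (\<lambda>k. ennreal ((norm (s n x - s (r k) x))\<^sup>2)) \<partial>lebesgue_on K)"
    proof (rule nn_integral_cong_AE)
      show "AE x in lebesgue_on K. ennreal ((norm (s n x - f x))\<^sup>2) = liminf (\<lambda>k. ennreal ((norm (s n x - s (r k) x))\<^sup>2))"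
        using lim
      proof eventually_elim
        case (elim x)
        have "(\<lambda>k. ennreal ((norm (s n x - s (r k) x))\<^sup>2)) \<longlonglongrightarrow> ennreal ((norm (s n x - f x))\<^sup>2)"
          by (intro tendsto_intros tendsto_ennrealI elim)
        then show ?case by (intro lim_imp_Liminf[symmetric]) auto
      qed
    qed
    also have "\<dots> \<le> liminf (\<lambda>k. \<integral>\<^sup>+x. ennreal ((norm (s n x - s (r k) x))\<^sup>2) \<partial>lebesgue_on K)"
      by (rule nn_integral_liminf) measurable
    also have "\<dots> \<le> ennreal (e\<^sup>2)"
    proof (rule Liminf_le)
      show "\<forall>\<^sub>F k in sequentially. (\<integral>\<^sup>+x. ennreal ((norm (s n x - s (r k) x))\<^sup>2) \<partial>lebesgue_on K) \<le> ennreal (e\<^sup>2)"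
        using eventually_ge_at_top[of N]
      proof eventually_elim
        case (elim k)
        then have "r k \<ge> N" using r(1) seq_suble order_trans by blast
        then have "l2_norm K (\<lambda>x. s n x - s (r k) x) \<le> e" using N[OF n] by (simp add: less_imp_le)
        then show ?case
          unfolding nn_integral_norm_sq[OF L2_diff[OF s s]]
          using l2_norm_nonneg by (intro ennreal_leI power_mono) auto
      qed
    qed simp
    finally show ?thesis
      using L2_nn_integral[of "\<lambda>x. s n x - f x" K e] e by (auto simp: less_imp_le)
  qed
  show thesis
  proof (rule that[of f])
    obtain N where N: "\<And>m n. m \<ge> N \<Longrightarrow> n \<ge> N \<Longrightarrow> l2_norm K (\<lambda>x. s m x - s n x) < 1"
      using Cauchy[of 1] by auto
    have "(\<lambda>x. s N x - f x) \<in> L2 K" using key[of 1 N N] N by auto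
    from L2_diff[OF s this, of N] show "f \<in> L2 K" by simp
    show "(\<lambda>n. l2_norm K (\<lambda>x. s n x - f x)) \<longlonglongrightarrow> 0"
    proof (rule LIMSEQ_I)
      fix e :: real assume "e > 0"
      then obtain N where N: "\<And>m n. m \<ge> N \<Longrightarrow> n \<ge> N \<Longrightarrow> l2_norm K (\<lambda>x. s m x - s n x) < e / 2"
        using Cauchy[of "e/2"] by auto
      have "l2_norm K (\<lambda>x. s n x - f x) < e" if "n \<ge> N" for n
        using key[of "e/2" N n] N that \<open>e > 0\<close> by fastforce
      then show "\<exists>N. \<forall>n\<ge>N. norm (l2_norm K (\<lambda>x. s n x - f x) - 0) < e"
        by (intro exI[of _ N]) (simp add: abs_of_nonneg[OF l2_norm_nonneg])
    qed
  qed
qed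

text \<open>
  Riesz representation on a subspace of \<open>L2\<close> that need not be closed: the representing function is
  a limit of elements of the subspace. It minimises the energy \<open>\<parallel>f\<parallel>\<^sup>2 - 2 l f\<close>; a minimising sequence
  is Cauchy by the parallelogram identity.
\<close>

lemma L2_Riesz:
  fixes V :: "(point \<Rightarrow> 'b::euclidean_space) set" and l :: "(point \<Rightarrow> 'b) \<Rightarrow> real"
  assumes K: "K \<in> lmeasurable" and V: "V \<subseteq> L2 K" "V \<noteq> {}"
    and Vadd: "\<And>f g. f \<in> V \<Longrightarrow> g \<in> V \<Longrightarrow> (\<lambda>x. f x + g x) \<in> V"
    and Vsc: "\<And>c f. f \<in> V \<Longrightarrow> (\<lambda>x. c *\<^sub>R f x) \<in> V"
    and ladd: "\<And>f g. f \<in> V \<Longrightarrow> g \<in> V \<Longrightarrow> l (\<lambda>x. f x + g x) = l f + l g"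
    and lsc: "\<And>c f. f \<in> V \<Longrightarrow> l (\<lambda>x. c *\<^sub>R f x) = c * l f"
    and lb: "\<And>f. f \<in> V \<Longrightarrow> \<bar>l f\<bar> \<le> C * l2_norm K f"
  obtains g s where "g \<in> L2 K" "\<And>n. s n \<in> V" "(\<lambda>n. l2_norm K (\<lambda>x. s n x - g x)) \<longlonglongrightarrow> 0"
    "\<And>f. f \<in> V \<Longrightarrow> l f = l2_inner K g f"
proof -
  define J where "J f = (l2_norm K f)\<^sup>2 - 2 * l f" for f
  have Jb: "J f \<ge> - C\<^sup>2" if "f \<in> V" for f
  proof -
    have "0 \<le> (l2_norm K f - C)\<^sup>2" by simp
    then have "2 * (C * l2_norm K f) \<le> (l2_norm K f)\<^sup>2 + C\<^sup>2" by (simp add: power2_diff algebra_simps)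
    then show ?thesis using lb[OF that] unfolding J_def by linarith
  qed
  define m where "m = Inf (J ` V)"
  have bdd: "bdd_below (J ` V)" using Jb by (auto intro!: bdd_belowI)
  have mle: "m \<le> J f" if "f \<in> V" for f unfolding m_def using that bdd by (intro cInf_lower) auto
  have "\<exists>f\<in>V. J f < m + 1 / Suc n" for n
    using cInf_lessD[of "J ` V" "m + 1 / Suc n"] V(2) unfolding m_def by auto
  then obtain s where s: "\<And>n. s n \<in> V" "\<And>n. J (s n) < m + 1 / Suc n" by metis
  have sL: "s n \<in> L2 K" for n using s(1) V(1) by blast
  have par: "(l2_norm K (\<lambda>x. f x - g x))\<^sup>2 \<le> 2 * J f + 2 * J g - 4 * m" if "f \<in> V" "g \<in> V" for f g
  proof -
    have L: "f \<in> L2 K" "g \<in> L2 K" using that V(1) by auto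
    define h where "h = (\<lambda>x. (1/2) *\<^sub>R (f x + g x))"
    have h: "h \<in> V" unfolding h_def by (intro Vsc Vadd that)
    have lh: "l h = (l f + l g) / 2" unfolding h_def by (simp add: lsc[OF Vadd[OF that]] ladd[OF that])
    have "(l2_norm K h)\<^sup>2 = (1/4) * (l2_norm K (\<lambda>x. f x + g x))\<^sup>2"
      unfolding h_def l2_norm_scaleR by (simp add: power2_eq_square)
    then have nh: "4 * (l2_norm K h)\<^sup>2 = (l2_norm K f)\<^sup>2 + 2 * l2_inner K f g + (l2_norm K g)\<^sup>2"
      by (simp add: l2_norm_add_sq[OF L])
    have "(l2_norm K (\<lambda>x. f x - g x))\<^sup>2 = (l2_norm K f)\<^sup>2 - 2 * l2_inner K f g + (l2_norm K g)\<^sup>2"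
      using l2_norm_add_sq[OF L(1) L2_scaleR[OF L(2), of "-1"]] l2_norm_scaleR[of K "-1" g]
        l2_inner_scaleR_right[of K f "-1" g] by simp
    then have "(l2_norm K (\<lambda>x. f x - g x))\<^sup>2 = 2 * J f + 2 * J g - 4 * J h"
      using nh lh by (simp add: J_def)
    then show ?thesis using mle[OF h] by simp
  qed
  have cauchy: "\<exists>N. \<forall>m\<ge>N. \<forall>n\<ge>N. l2_norm K (\<lambda>x. s m x - s n x) < e" if "e > 0" for e
  proof -
    obtain N where N: "1 / real (Suc N) < e\<^sup>2 / 4"
      using reals_Archimedean[of "e\<^sup>2 / 4"] \<open>e > 0\<close> by (auto simp: inverse_eq_divide)
    have "l2_norm K (\<lambda>x. s i x - s j x) < e" if "i \<ge> N" "j \<ge> N" for i j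
    proof -
      have "1 / real (Suc i) \<le> 1 / real (Suc N)" "1 / real (Suc j) \<le> 1 / real (Suc N)"
        using that by (auto intro!: divide_left_mono mult_pos_pos)
      then have "(l2_norm K (\<lambda>x. s i x - s j x))\<^sup>2 < e\<^sup>2"
        using par[OF s(1) s(1), of i j] s(2)[of i] s(2)[of j] N by linarith
      then show ?thesis using \<open>e > 0\<close> by (simp add: power2_less_imp_less)
    qed
    then show ?thesis by blast
  qed
  obtain g where g: "g \<in> L2 K" "(\<lambda>n. l2_norm K (\<lambda>x. s n x - g x)) \<longlonglongrightarrow> 0"
    by (rule L2_complete[OF K sL cauchy])
  have "l f = l2_inner K g f" if f: "f \<in> V" for f
  proof -
    have fL: "f \<in> L2 K" using f V(1) by blast
    define B where "B = (l2_norm K f)\<^sup>2"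
    have Bn: "B \<ge> 0" by (simp add: B_def)
    define a where "a = l2_inner K g f - l f"
    \<comment> \<open>moving the minimiser in direction \<open>f\<close> does not decrease the energy; hence the linear term \<open>a\<close> is zero\<close>
    have q: "0 \<le> 2 * t * a + t\<^sup>2 * B" for t
    proof (rule LIMSEQ_le[OF tendsto_const])
      have "(\<lambda>n. 1 / real (Suc n) + 2 * t * (l2_inner K f (s n) - l f) + t\<^sup>2 * B) \<longlonglongrightarrow>
          0 + 2 * t * (l2_inner K f g - l f) + t\<^sup>2 * B"
        by (intro tendsto_intros l2_inner_tendsto sL g fL) (use LIMSEQ_inverse_real_of_nat in \<open>simp add: inverse_eq_divide\<close>)
      then show "(\<lambda>n. 1 / real (Suc n) + 2 * t * (l2_inner K f (s n) - l f) + t\<^sup>2 * B) \<longlonglongrightarrow> 2 * t * a + t\<^sup>2 * B"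
        by (simp add: a_def l2_inner_commute)
      have "0 \<le> 1 / real (Suc n) + 2 * t * (l2_inner K f (s n) - l f) + t\<^sup>2 * B" for n
      proof -
        have "m \<le> J (\<lambda>x. s n x + t *\<^sub>R f x)" by (intro mle Vadd Vsc s f)
        also have "\<dots> = J (s n) + 2 * t * (l2_inner K f (s n) - l f) + t\<^sup>2 * B"
          unfolding J_def l2_norm_add_sq[OF sL L2_scaleR[OF fL]] ladd[OF s(1) Vsc[OF f]] lsc[OF f]
            l2_inner_scaleR_right l2_norm_scaleR
          by (simp add: B_def power_mult_distrib algebra_simps l2_inner_commute)
        finally show ?thesis using s(2)[of n] by linarith
      qed
      then show "\<exists>N. \<forall>n\<ge>N. 0 \<le> 1 / real (Suc n) + 2 * t * (l2_inner K f (s n) - l f) + t\<^sup>2 * B" by blast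
    qed
    have "a = 0"
    proof (rule ccontr)
      assume "a \<noteq> 0"
      have "2 * (-a / (B + 1)) * a + (-a / (B + 1))\<^sup>2 * B = - (a\<^sup>2) * (B + 2) / (B + 1)\<^sup>2"
        using Bn by (simp add: divide_simps) (simp add: power2_eq_square algebra_simps)
      moreover have "a\<^sup>2 * (B + 2) / (B + 1)\<^sup>2 > 0" using \<open>a \<noteq> 0\<close> Bn by simp
      ultimately show False using q[of "-a / (B + 1)"] by simp
    qed
    then show ?thesis by (simp add: a_def)
  qed
  then show thesis using that g s(1) by blast
qed

section \<open>Jets: a vector field paired with its gradient\<close>

text \<open>
  An element \<open>u\<close> of \<open>H1\<close> is represented by the jet \<open>(u, \<nabla>u)\<close> and an element \<open>\<sigma>\<close> of \<open>Hdiv\<close> by the jet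
  \<open>(div \<sigma>, \<sigma>)\<close>. Both Sobolev norms become the norm of \<open>L2\<close>, and the boundary pairing of Green's formula,
  \<open>(\<sigma>, \<nabla>u) + (div \<sigma>, u)\<close>, becomes the inner product of the two jets. \<open>imul\<close> is multiplication by the
  imaginary unit; with it the complex inner product \<open>cdot\<close> is recovered from the real one of the
  Euclidean space of jets.
\<close>

type_synonym jet = "(complex^3) \<times> (complex^3^3)"

definition imul :: "jet \<Rightarrow> jet" where
  "imul p = ((\<chi> i. \<i> * fst p $ i), (\<chi> i j. \<i> * snd p $ i $ j))"

definition cdot :: "jet \<Rightarrow> jet \<Rightarrow> complex" where
  "cdot p q = (\<Sum>i\<in>UNIV. fst p $ i * cnj (fst q $ i)) + (\<Sum>i\<in>UNIV. \<Sum>j\<in>UNIV. snd p $ i $ j * cnj (snd q $ i $ j))"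

definition cinner :: "point set \<Rightarrow> (point \<Rightarrow> jet) \<Rightarrow> (point \<Rightarrow> jet) \<Rightarrow> complex" where
  "cinner K p q = (LINT x|lebesgue_on K. cdot (p x) (q x))"

lemma complex_inner: "(a::complex) \<bullet> b = Re (a * cnj b)"
  by (simp add: inner_complex_def)

lemma Re_cdot: "Re (cdot p q) = p \<bullet> q"
  by (simp add: cdot_def inner_prod_def inner_vec_def complex_inner)

lemma Im_cdot: "Im (cdot p q) = p \<bullet> imul q"
  by (simp add: cdot_def imul_def inner_prod_def inner_vec_def inner_complex_def algebra_simps)

lemma cdot_eq: "cdot p q = Complex (p \<bullet> q) (p \<bullet> imul q)"
  by (simp add: complex_eq_iff Re_cdot Im_cdot)

lemma norm_imul: "norm (imul p) = norm p"
proof -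
  have "imul p \<bullet> imul p = p \<bullet> p"
    by (simp add: imul_def inner_prod_def inner_vec_def inner_complex_def add.commute)
  then show ?thesis by (simp add: norm_eq_sqrt_inner)
qed

lemma bounded_linear_imul: "bounded_linear imul"
  by (rule bounded_linear_intro[where K=1])
     (auto simp: imul_def vec_eq_iff algebra_simps norm_imul[unfolded imul_def] scaleR_conv_of_real)

lemma L2_imul: "p \<in> L2 K \<Longrightarrow> (\<lambda>x. imul (p x)) \<in> L2 K"
  by (rule L2_linear[OF bounded_linear_imul])

lemma l2_norm_imul: "l2_norm K (\<lambda>x. imul (p x)) = l2_norm K p"
  by (simp add: l2_norm_def l2_inner_def power2_norm_eq_inner[symmetric] norm_imul)

lemma cdot_measurable:
  assumes [measurable]: "p \<in> borel_measurable M" "q \<in> borel_measurable M"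
  shows "(\<lambda>x. cdot (p x) (q x)) \<in> borel_measurable M"
proof -
  have [measurable]: "(\<lambda>x. imul (q x)) \<in> borel_measurable M"
    using measurable_compose[OF assms(2) borel_measurable_continuous_onI[of imul]]
      linear_continuous_on[OF bounded_linear_imul] by blast
  show ?thesis unfolding cdot_eq by (subst borel_measurable_complex_iff) simp
qed

text \<open>
  The factor 2 comes from estimating real and imaginary part separately; it enters the final
  constant but is otherwise harmless.
\<close>

lemma norm_cdot_le: "norm (cdot p q) \<le> 2 * norm p * norm q"
  using abs_le_D1[OF order_refl] cmod_le[of "cdot p q"] Cauchy_Schwarz_ineq2[of p q] Cauchy_Schwarz_ineq2[of p "imul q"]
  by (simp add: Re_cdot Im_cdot norm_imul)

lemma cdot_integrable:
  assumes "p \<in> L2 K" "q \<in> L2 K"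
  shows "integrable (lebesgue_on K) (\<lambda>x. cdot (p x) (q x))"
  by (rule L2_integrable_mult[OF L2_scaleR[OF assms(1), of 2] assms(2)])
     (use norm_cdot_le cdot_measurable[OF L2_measurable L2_measurable, OF assms] in auto)

lemma cinner_eq:
  assumes "p \<in> L2 K" "q \<in> L2 K"
  shows "cinner K p q = Complex (l2_inner K p q) (l2_inner K p (\<lambda>x. imul (q x)))"
  unfolding complex_eq_iff cinner_def l2_inner_def complex.sel
  using integral_Re[OF cdot_integrable[OF assms]] integral_Im[OF cdot_integrable[OF assms]]
  by (simp add: Re_cdot Im_cdot)

lemma Re_cinner: "p \<in> L2 K \<Longrightarrow> q \<in> L2 K \<Longrightarrow> Re (cinner K p q) = l2_inner K p q"
  by (simp add: cinner_eq)

lemma norm_cinner_le: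
  assumes "p \<in> L2 K" "q \<in> L2 K"
  shows "norm (cinner K p q) \<le> 2 * l2_norm K p * l2_norm K q"
  using cmod_le[of "cinner K p q"] l2_Cauchy_Schwarz[OF assms] l2_Cauchy_Schwarz[OF assms(1) L2_imul[OF assms(2)]]
  by (simp add: cinner_eq[OF assms] l2_norm_imul)

lemma cinner_add_right:
  assumes "p \<in> L2 K" "q \<in> L2 K" "r \<in> L2 K"
  shows "cinner K p (\<lambda>x. q x + r x) = cinner K p q + cinner K p r"
proof -
  have "cdot a (b + c) = cdot a b + cdot a c" for a b c
    by (simp add: cdot_def algebra_simps sum.distrib)
  then show ?thesis using cdot_integrable[OF assms(1,2)] cdot_integrable[OF assms(1,3)]
    by (simp add: cinner_def)
qed

lemma cinner_diff_right:
  assumes "p \<in> L2 K" "q \<in> L2 K" "r \<in> L2 K"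
  shows "cinner K p (\<lambda>x. q x - r x) = cinner K p q - cinner K p r"
  using cinner_add_right[OF assms(1) L2_diff[OF assms(2,3)] assms(3)] by simp

lemma cinner_diff_left:
  assumes "p \<in> L2 K" "q \<in> L2 K" "r \<in> L2 K"
  shows "cinner K (\<lambda>x. q x - r x) p = cinner K q p - cinner K r p"
proof -
  have "cdot (b - c) a = cdot b a - cdot c a" for a b c
    by (simp add: cdot_def algebra_simps sum_subtractf)
  then show ?thesis using cdot_integrable[OF assms(2,1)] cdot_integrable[OF assms(3,1)]
    by (simp add: cinner_def)
qed

lemma cinner_cong_AE:
  assumes "p \<in> L2 K" "p' \<in> L2 K" "q \<in> L2 K" "q' \<in> L2 K"
    "AE x in lebesgue_on K. p x = p' x" "AE x in lebesgue_on K. q x = q' x"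
  shows "cinner K p q = cinner K p' q'"
  unfolding cinner_def
proof (rule integral_cong_AE)
  show "AE x in lebesgue_on K. cdot (p x) (q x) = cdot (p' x) (q' x)"
    using assms(5,6) by eventually_elim simp
qed (intro borel_measurable_integrable cdot_integrable assms)+

section \<open>Weak derivatives\<close>

lemma L2_continuous:
  fixes f :: "point \<Rightarrow> 'b::euclidean_space"
  assumes "open K" "bounded K" "continuous_on UNIV f"
  shows "f \<in> L2 K"
proof -
  have "compact (closure K)" using assms(2) by (simp add: compact_closure)
  then have "bounded (f ` closure K)"
    using assms(3) by (intro compact_imp_bounded compact_continuous_image) (auto intro: continuous_on_subset)
  then obtain B where "\<And>x. x \<in> closure K \<Longrightarrow> norm (f x) \<le> B" by (auto simp: bounded_iff)
  then show ?thesis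
    using closure_subset[of K] assms
    by (intro L2_bounded[of K f B] lmeasurable_open continuous_imp_measurable_on_sets_lebesgue
        continuous_on_subset[OF assms(3)]) (auto intro: lmeasurable_open fmeasurableD)
qed

lemma test_fun_C1: "test_fun K \<phi> \<Longrightarrow> C1 \<phi>"
  by (simp add: test_fun_def)

lemma test_fun_mono: "test_fun K \<phi> \<Longrightarrow> K \<subseteq> L \<Longrightarrow> test_fun L \<phi>"
  by (auto simp: test_fun_def)

lemma test_fun_zero: "test_fun K \<phi> \<Longrightarrow> x \<notin> K \<Longrightarrow> \<phi> x = 0"
  unfolding test_fun_def using closure_subset[of "{x. \<phi> x \<noteq> 0}"] by auto

lemma has_derivative_zero_off_support:
  fixes f :: "point \<Rightarrow> 'b::real_normed_vector"
  assumes "x \<notin> closure {x. f x \<noteq> 0}"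
  shows "(f has_derivative (\<lambda>h. 0)) (at x)"
proof (rule has_derivative_transform_within_open[OF has_derivative_const open_Compl[OF closed_closure]])
  show "x \<in> - closure {x. f x \<noteq> 0}" using assms by simp
  show "0 = f y" if "y \<in> - closure {x. f x \<noteq> 0}" for y
    using that closure_subset[of "{x. f x \<noteq> 0}"] by auto
qed

lemma partial_zero_off_support: "x \<notin> closure {x. \<phi> x \<noteq> 0} \<Longrightarrow> partial j \<phi> x = 0"
  unfolding partial_def using frechet_derivative_at[OF has_derivative_zero_off_support] by metis

lemma test_fun_partial_zero: "test_fun K \<phi> \<Longrightarrow> x \<notin> K \<Longrightarrow> partial j \<phi> x = 0"
  by (rule partial_zero_off_support) (auto simp: test_fun_def)

lemma continuous_partial: "C1 \<phi> \<Longrightarrow> continuous_on UNIV (partial j \<phi>)"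
  unfolding partial_def[abs_def] by (rule C1_continuous_derivative)

lemma compact_support_integrable:
  fixes f :: "point \<Rightarrow> real"
  assumes "continuous_on UNIV f" "compact S" "\<And>x. x \<notin> S \<Longrightarrow> f x = 0"
  shows "integrable lborel f"
proof -
  have "integrable lborel (\<lambda>x. indicator S x *\<^sub>R f x)"
    using assms by (intro borel_integrable_compact[unfolded set_integrable_def]) (auto intro: continuous_on_subset)
  moreover have "(\<lambda>x. indicator S x *\<^sub>R f x) = f" using assms(3) by (auto simp: indicator_def fun_eq_iff)
  ultimately show ?thesis by simp
qed

text \<open>
  Difference quotients of a compactly supported function have integral zero by translation
  invariance, and they converge boundedly to the partial derivative.
\<close>

lemma integral_partial_zero:
  assumes "C1 \<phi>" "compact (closure {x. \<phi> x \<noteq> 0})"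
  shows "(LINT x|lborel. partial j \<phi> x) = 0"
proof -
  let ?S = "closure {x. \<phi> x \<noteq> 0}"
  define e :: point where "e = axis j 1"
  have supp: "\<phi> x = 0" if "x \<notin> ?S" for x using that closure_subset[of "{x. \<phi> x \<noteq> 0}"] by auto
  have int: "integrable lborel \<phi>"
    by (rule compact_support_integrable[OF C1_continuous[OF assms(1)] assms(2) supp])
  obtain R where R: "R > 0" "?S \<subseteq> ball 0 R"
    using compact_imp_bounded[OF assms(2)] by (meson bounded_subset_ballD)
  have "bounded (partial j \<phi> ` cball 0 R)"
    by (intro compact_imp_bounded compact_continuous_image continuous_on_subset[OF continuous_partial[OF assms(1)]]) auto
  then obtain B where "\<forall>y\<in>partial j \<phi> ` cball 0 R. norm y \<le> B" unfolding bounded_iff by blast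
  then have B: "\<bar>partial j \<phi> x\<bar> \<le> B" if "x \<in> cball 0 R" for x using that by simp
  have B': "\<bar>partial j \<phi> x\<bar> \<le> \<bar>B\<bar>" for x
  proof (cases "x \<in> cball 0 R")
    case True then show ?thesis using B[OF True] by linarith
  next
    case False
    then have "partial j \<phi> x = 0" using R(2) by (intro partial_zero_off_support) auto
    then show ?thesis by simp
  qed
  define f where "f n x = real (Suc n) * (\<phi> (x + (1 / real (Suc n)) *\<^sub>R e) - \<phi> x)" for n x
  have mv: "\<exists>z. 0 < z \<and> z < 1 / real (Suc n) \<and> f n x = partial j \<phi> (x + z *\<^sub>R e)" for n x
  proof -
    have "((\<lambda>t. \<phi> (x + t *\<^sub>R e)) has_real_derivative partial j \<phi> (x + t *\<^sub>R e)) (at t)" for t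
    proof -
      have "((\<lambda>t. \<phi> (x + t *\<^sub>R e)) has_derivative (\<lambda>h. frechet_derivative \<phi> (at (x + t *\<^sub>R e)) (h *\<^sub>R e))) (at t)"
        by (rule has_derivative_compose[of "\<lambda>t. x + t *\<^sub>R e" "\<lambda>h. h *\<^sub>R e", OF _ C1_has_derivative[OF assms(1)]])
           (auto intro!: derivative_eq_intros)
      moreover have "frechet_derivative \<phi> (at y) (h *\<^sub>R e) = partial j \<phi> y * h" for y h
        unfolding partial_def e_def
        using linear_cmul[OF has_derivative_linear[OF C1_has_derivative[OF assms(1)]]] by simp
      ultimately show ?thesis by (simp add: has_field_derivative_def)
    qed
    then obtain z where "0 < z" "z < 1 / real (Suc n)"
        "\<phi> (x + (1 / real (Suc n)) *\<^sub>R e) - \<phi> (x + 0 *\<^sub>R e) = (1 / real (Suc n) - 0) * partial j \<phi> (x + z *\<^sub>R e)"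
      using MVT2[of 0 "1 / real (Suc n)" "\<lambda>t. \<phi> (x + t *\<^sub>R e)" "\<lambda>t. partial j \<phi> (x + t *\<^sub>R e)"] by auto
    then show ?thesis by (intro exI[of _ z]) (simp add: f_def)
  qed
  have "(\<lambda>n. LINT x|lborel. f n x) \<longlonglongrightarrow> (LINT x|lborel. partial j \<phi> x)"
  proof (rule integral_dominated_convergence[where w = "\<lambda>x. \<bar>B\<bar> * indicator (cball 0 (R + 1)) x"])
    show "partial j \<phi> \<in> borel_measurable lborel"
      using borel_measurable_continuous_onI[OF continuous_partial[OF assms(1)]] by simp
    show "f n \<in> borel_measurable lborel" for n
    proof -
      have [measurable]: "\<phi> \<in> borel_measurable borel"
        by (rule borel_measurable_continuous_onI[OF C1_continuous[OF assms(1)]])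
      show ?thesis unfolding f_def[abs_def] by measurable
    qed
    show "integrable lborel (\<lambda>x. \<bar>B\<bar> * indicator (cball (0::point) (R + 1)) x)"
      by (intro integrable_mult_right integrable_real_indicator) (simp_all add: emeasure_bounded_finite[OF bounded_cball, unfolded infinity_ennreal_def])
    show "AE x in lborel. (\<lambda>n. f n x) \<longlonglongrightarrow> partial j \<phi> x"
    proof (rule AE_I2)
      fix x
      obtain z where z: "\<And>n. 0 < z n" "\<And>n. z n < 1 / real (Suc n)" "\<And>n. f n x = partial j \<phi> (x + z n *\<^sub>R e)"
        using mv[of _ x] by metis
      have "z \<longlonglongrightarrow> 0"
        by (rule tendsto_sandwich[OF _ _ tendsto_const LIMSEQ_inverse_real_of_nat])
           (use z in \<open>auto intro!: always_eventually less_imp_le simp: inverse_eq_divide\<close>)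
      then have "(\<lambda>n. x + z n *\<^sub>R e) \<longlonglongrightarrow> x + 0 *\<^sub>R e" by (intro tendsto_intros)
      then have "(\<lambda>n. partial j \<phi> (x + z n *\<^sub>R e)) \<longlonglongrightarrow> partial j \<phi> x"
        by (intro continuous_on_tendsto_compose[OF continuous_partial[OF assms(1)]]) auto
      then show "(\<lambda>n. f n x) \<longlonglongrightarrow> partial j \<phi> x" using z(3) by simp
    qed
    fix n show "AE x in lborel. norm (f n x) \<le> \<bar>B\<bar> * indicator (cball 0 (R + 1)) x"
    proof (rule AE_I2)
      fix x
      obtain z where z: "0 < z" "z < 1 / real (Suc n)" "f n x = partial j \<phi> (x + z *\<^sub>R e)" using mv by blast
      show "norm (f n x) \<le> \<bar>B\<bar> * indicator (cball 0 (R + 1)) x"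
      proof (cases "x \<in> cball 0 (R + 1)")
        case True then show ?thesis using z(3) B' by simp
      next
        case False
        have "z < 1" using z(2) by (rule less_le_trans) simp
        have "x + z *\<^sub>R e \<notin> ?S"
        proof
          assume "x + z *\<^sub>R e \<in> ?S"
          then have "norm (x + z *\<^sub>R e) < R" using R(2) by auto
          moreover have "norm (z *\<^sub>R e) < 1" using z(1) \<open>z < 1\<close> by (simp add: e_def)
          ultimately have "norm x < R + 1" using norm_triangle_ineq4[of "x + z *\<^sub>R e" "z *\<^sub>R e"] by simp
          then show False using False by simp
        qed
        then show ?thesis using z(3) partial_zero_off_support[of "x + z *\<^sub>R e"] by simp
      qed
    qed
  qed
  moreover have "(LINT x|lborel. f n x) = 0" for n
  proof -
    let ?c = "(1 / real (Suc n)) *\<^sub>R e"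
    have d: "lborel = distr lborel borel ((+) ?c)" by (rule lborel_distr_plus[symmetric])
    have ms: "\<phi> \<in> borel_measurable borel"
      by (rule borel_measurable_continuous_onI[OF C1_continuous[OF assms(1)]])
    have i: "integrable lborel (\<lambda>x. \<phi> (?c + x))"
      using int by (subst (asm) d, subst (asm) integrable_distr_eq) (auto intro: ms)
    have "(LINT x|lborel. \<phi> (?c + x)) = (LINT x|lborel. \<phi> x)"
      by (subst (2) d, subst integral_distr) (auto intro: ms)
    then have "(LINT x|lborel. \<phi> (?c + x) - \<phi> x) = 0"
      by (subst Bochner_Integration.integral_diff[OF i int]) simp
    then show ?thesis unfolding f_def by (simp add: add.commute)
  qed
  ultimately show ?thesis using LIMSEQ_unique[OF tendsto_const] by fastforce
qed

lemma integral_lebesgue_on_eq_lborel: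
  fixes f :: "point \<Rightarrow> 'b::euclidean_space"
  assumes "open K" "\<And>x. x \<notin> K \<Longrightarrow> f x = 0" "f \<in> borel_measurable borel"
  shows "(LINT x|lebesgue_on K. f x) = (LINT x|lborel. f x)"
proof -
  have "(LINT x|lebesgue_on K. f x) = (LINT x|lebesgue. indicator K x *\<^sub>R f x)"
    using assms(1) by (intro integral_restrict_space) auto
  also have "(\<lambda>x. indicator K x *\<^sub>R f x) = f" using assms(2) by (auto simp: indicator_def fun_eq_iff)
  also have "(LINT x|lebesgue. f x) = (LINT x|lborel. f x)"
    using assms(3) by (intro integral_completion) simp
  finally show ?thesis .
qed

lemma partial_mult:
  assumes "C1 f" "C1 g"
  shows "partial j (\<lambda>x. f x * g x) x = f x * partial j g x + partial j f x * g x"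
  unfolding partial_def
  by (subst frechet_derivative_at[symmetric, OF has_derivative_mult[OF C1_has_derivative C1_has_derivative]])
     (use assms in auto)

text \<open>
  The product of \<open>g\<close> with a test function has compact support, so the integral of its derivative is
  zero.
\<close>

lemma integration_by_parts:
  assumes "open K" "C1 g" "test_fun K \<phi>"
  shows "(LINT x|lebesgue_on K. g x * partial j \<phi> x) = - (LINT x|lebesgue_on K. partial j g x * \<phi> x)"
proof -
  have \<phi>: "C1 \<phi>" "compact (closure {x. \<phi> x \<noteq> 0})" using assms(3) by (auto simp: test_fun_def)
  have sub: "closure {x. g x * \<phi> x \<noteq> 0} \<subseteq> closure {x. \<phi> x \<noteq> 0}" by (rule closure_mono) auto
  have comp: "compact (closure {x. g x * \<phi> x \<noteq> 0})"
    using compact_Int_closed[OF \<phi>(2) closed_closure[of "{x. g x * \<phi> x \<noteq> 0}"]]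
    unfolding Int_absorb1[OF sub] .
  have z: "(LINT x|lborel. g x * partial j \<phi> x + partial j g x * \<phi> x) = 0"
    using integral_partial_zero[OF C1_mult[OF assms(2) \<phi>(1)] comp, of j]
    unfolding partial_mult[OF assms(2) \<phi>(1)] .
  have cont: "continuous_on UNIV (\<lambda>x. g x * partial j \<phi> x)" "continuous_on UNIV (\<lambda>x. partial j g x * \<phi> x)"
    by (intro continuous_intros continuous_partial C1_continuous assms \<phi>)+
  have supp: "\<phi> x = 0" "partial j \<phi> x = 0" if "x \<notin> closure {x. \<phi> x \<noteq> 0}" for x
    using that partial_zero_off_support closure_subset[of "{x. \<phi> x \<noteq> 0}"] by auto
  have int: "integrable lborel (\<lambda>x. g x * partial j \<phi> x)"
    by (rule compact_support_integrable[OF cont(1) \<phi>(2)]) (metis supp(2) mult_zero_right)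
  have int': "integrable lborel (\<lambda>x. partial j g x * \<phi> x)"
    by (rule compact_support_integrable[OF cont(2) \<phi>(2)]) (metis supp(1) mult_zero_right)
  have "(LINT x|lborel. g x * partial j \<phi> x) + (LINT x|lborel. partial j g x * \<phi> x) = 0"
    using z by (simp add: Bochner_Integration.integral_add[OF int int'])
  moreover have "(LINT x|lebesgue_on K. g x * partial j \<phi> x) = (LINT x|lborel. g x * partial j \<phi> x)"
    by (rule integral_lebesgue_on_eq_lborel[OF assms(1)])
       (simp_all add: test_fun_partial_zero[OF assms(3)] borel_measurable_continuous_onI[OF cont(1)])
  moreover have "(LINT x|lebesgue_on K. partial j g x * \<phi> x) = (LINT x|lborel. partial j g x * \<phi> x)"
    by (rule integral_lebesgue_on_eq_lborel[OF assms(1)])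
       (simp_all add: test_fun_zero[OF assms(3)] borel_measurable_continuous_onI[OF cont(2)])
  ultimately show ?thesis by simp
qed

subsection \<open>The fundamental lemma\<close>

lemma test_fun_cutoff:
  assumes "compact C" "d > 0" "\<And>x y. x \<in> C \<Longrightarrow> dist y x < d \<Longrightarrow> y \<in> K" "10 * \<delta> < d" "\<delta> > 0"
    "C1 \<psi>" "\<And>x. \<psi> x \<noteq> 0 \<Longrightarrow> \<exists>y\<in>C. dist x y \<le> 10 * \<delta>"
  shows "test_fun K \<psi>"
proof (cases "C = {}")
  case True
  then have "{x. \<psi> x \<noteq> 0} = {}" using assms(7) by auto
  then show ?thesis using assms(6) by (simp add: test_fun_def)
next
  case False
  have sub: "closure {x. \<psi> x \<noteq> 0} \<subseteq> {x. infdist x C \<le> 10 * \<delta>}"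
  proof (rule closure_minimal)
    show "{x. \<psi> x \<noteq> 0} \<subseteq> {x. infdist x C \<le> 10 * \<delta>}"
      using assms(7) infdist_le2 by fastforce
    show "closed {x. infdist x C \<le> 10 * \<delta>}" by (intro closed_Collect_le continuous_intros)
  qed
  have "{x. infdist x C \<le> 10 * \<delta>} \<subseteq> K"
  proof
    fix x assume x: "x \<in> {x. infdist x C \<le> 10 * \<delta>}"
    obtain y where "y \<in> C" "infdist x C = dist x y"
      using infdist_attains_inf[OF compact_imp_closed[OF assms(1)] False] by blast
    then show "x \<in> K" using x assms(3,4) by fastforce
  qed
  moreover have "bounded {x. infdist x C \<le> 10 * \<delta>}"
  proof -
    obtain B where B: "\<And>y. y \<in> C \<Longrightarrow> norm y \<le> B" using compact_imp_bounded[OF assms(1)] by (auto simp: bounded_iff)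
    have "norm x \<le> B + 10 * \<delta>" if "infdist x C \<le> 10 * \<delta>" for x
    proof -
      obtain y where y: "y \<in> C" "infdist x C = dist x y"
        using infdist_attains_inf[OF compact_imp_closed[OF assms(1)] False] by blast
      then show ?thesis using B[OF y(1)] that norm_triangle_sub[of x y] by (simp add: dist_norm)
    qed
    then show ?thesis by (auto simp: bounded_iff)
  qed
  ultimately show ?thesis
    using sub assms(6) bounded_subset[of "{x. infdist x C \<le> 10 * \<delta>}"]
    by (auto simp: test_fun_def compact_eq_bounded_closed)
qed

lemma compact_in_open_margin:
  fixes C K :: "point set"
  assumes "compact C" "open K" "C \<subseteq> K"
  obtains d where "d > 0" "\<And>x y. x \<in> C \<Longrightarrow> dist y x < d \<Longrightarrow> y \<in> K"
proof -
  obtain d where d: "d > 0" "\<forall>x\<in>C. \<forall>y\<in>-K. d \<le> dist x y"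
    using separate_compact_closed[OF assms(1), of "-K"] assms by auto
  show thesis
    by (rule that[OF d(1)]) (use d(2) in \<open>force simp: dist_commute not_le[symmetric]\<close>)
qed

text \<open>
  Cutoffs of shrinking width tend to the indicator of \<open>C\<close>, boundedly; they are admissible once
  \<open>10 \<delta>\<close> is less than the distance from \<open>C\<close> to the complement of \<open>K\<close>.
\<close>

lemma test_fun_integral_zero_compact:
  fixes f :: "point \<Rightarrow> real"
  assumes "open K" "integrable (lebesgue_on K) f"
    "\<And>\<phi>. test_fun K \<phi> \<Longrightarrow> (LINT x|lebesgue_on K. f x * \<phi> x) = 0" "compact C" "C \<subseteq> K"
  shows "(LINT x|lebesgue_on K. f x * indicator C x) = 0"
proof -
  obtain d where d: "d > 0" "\<And>x y. x \<in> C \<Longrightarrow> dist y x < d \<Longrightarrow> y \<in> K"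
    using compact_in_open_margin[OF assms(4,1,5)] by blast
  define \<delta> where "\<delta> n = d / (20 * real (Suc n))" for n
  have \<delta>: "\<delta> n > 0" "10 * \<delta> n < d" for n using d(1) by (auto simp: \<delta>_def divide_simps)
  have "\<exists>\<psi> :: point \<Rightarrow> real. C1 \<psi> \<and> (\<forall>x. 0 \<le> \<psi> x \<and> \<psi> x \<le> 1) \<and> (\<forall>x\<in>C. \<psi> x = 1) \<and>
      (\<forall>x. \<psi> x \<noteq> 0 \<longrightarrow> (\<exists>y\<in>C. dist x y \<le> 10 * \<delta> n))" for n
  proof (rule C1_cutoff[OF compact_imp_bounded[OF assms(4)] \<delta>(1)[of n]])
    fix \<psi> :: "point \<Rightarrow> real"
    assume a: "C1 \<psi>" "\<And>x. 0 \<le> \<psi> x" "\<And>x. \<psi> x \<le> 1" and one: "\<And>x y. y \<in> C \<Longrightarrow> dist x y \<le> \<delta> n \<Longrightarrow> \<psi> x = 1"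
      and b: "\<And>x. \<psi> x \<noteq> 0 \<Longrightarrow> \<exists>y\<in>C. dist x y \<le> 10 * \<delta> n"
    have "\<psi> x = 1" if "x \<in> C" for x using one[OF that, of x] \<delta>(1)[of n] by simp
    then show ?thesis using a b by (intro exI[of _ \<psi>]) auto
  qed
  then obtain \<psi> :: "nat \<Rightarrow> point \<Rightarrow> real" where \<psi>: "\<And>n. C1 (\<psi> n)" "\<And>n x. 0 \<le> \<psi> n x \<and> \<psi> n x \<le> 1" "\<And>n x. x \<in> C \<Longrightarrow> \<psi> n x = 1"
      "\<And>n x. \<psi> n x \<noteq> 0 \<Longrightarrow> \<exists>y\<in>C. dist x y \<le> 10 * \<delta> n"
    by metis
  have tf: "test_fun K (\<psi> n)" for n
    by (rule test_fun_cutoff[OF assms(4) d \<delta>(2,1) \<psi>(1,4)])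
  have [measurable]: "f \<in> borel_measurable (lebesgue_on K)" using assms(2) by auto
  have [measurable]: "\<psi> n \<in> borel_measurable (lebesgue_on K)" for n
    using borel_measurable_continuous_onI[OF C1_continuous[OF \<psi>(1)]]
    by (intro measurable_restrict_space1 measurable_completion) simp
  have CM: "C \<in> sets lebesgue" using assms(4) by (simp add: compact_imp_closed)
  have [measurable]: "indicator C \<in> borel_measurable (lebesgue_on K)"
    using CM by (intro measurable_restrict_space1 borel_measurable_indicator)
  have "(\<lambda>n. LINT x|lebesgue_on K. f x * \<psi> n x) \<longlonglongrightarrow> (LINT x|lebesgue_on K. f x * indicator C x)"
  proof (rule integral_dominated_convergence[where w = "\<lambda>x. norm (f x)"])
    show "AE x in lebesgue_on K. (\<lambda>n. f x * \<psi> n x) \<longlonglongrightarrow> f x * indicator C x"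
    proof (rule AE_I2)
      fix x
      have "(\<lambda>n. \<psi> n x) \<longlonglongrightarrow> indicator C x"
      proof (cases "x \<in> C")
        case True then show ?thesis using \<psi>(3) by simp
      next
        case False
        show ?thesis
        proof (cases "C = {}")
          case True then show ?thesis using \<psi>(4) by (auto intro!: tendsto_eventually always_eventually)
        next
          case C: False
          have pos: "infdist x C > 0"
            using False C compact_imp_closed[OF assms(4)] infdist_pos_not_in_closed by blast
          have eq: "10 * \<delta> n = d / 2 * inverse (real (Suc n))" for n
            unfolding \<delta>_def by (simp add: field_simps)
          have "(\<lambda>n. 10 * \<delta> n) \<longlonglongrightarrow> d / 2 * 0"
            unfolding eq by (intro tendsto_mult tendsto_const LIMSEQ_inverse_real_of_nat)
          then have "\<forall>\<^sub>F n in sequentially. 10 * \<delta> n < infdist x C" using pos by (intro order_tendstoD(2)) auto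
          then have "\<forall>\<^sub>F n in sequentially. \<psi> n x = 0"
          proof eventually_elim
            case (elim n)
            show ?case
            proof (rule ccontr)
              assume "\<psi> n x \<noteq> 0"
              from \<psi>(4)[OF this] obtain y where "y \<in> C" "dist x y \<le> 10 * \<delta> n" by blast
              then show False using elim infdist_le[of y C x] by simp
            qed
          qed
          then show ?thesis using False by (simp add: tendsto_eventually)
        qed
      qed
      then show "(\<lambda>n. f x * \<psi> n x) \<longlonglongrightarrow> f x * indicator C x" by (rule tendsto_mult_left)
    qed
    show "AE x in lebesgue_on K. norm (f x * \<psi> n x) \<le> norm (f x)" for n
      using \<psi>(2)[of n] by (intro AE_I2) (simp add: abs_mult mult_left_le)
  qed (use assms(2) in auto)
  then show ?thesis using assms(3)[OF tf] by (simp add: LIMSEQ_const_iff)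
qed

text \<open>
  Were \<open>f\<close> positive on a set of positive measure, it would be so on a compact subset of positive
  measure, over which its integral vanishes.
\<close>

lemma fundamental_lemma_nonpos:
  fixes f :: "point \<Rightarrow> real"
  assumes "open K" "bounded K" "integrable (lebesgue_on K) f"
    "\<And>\<phi>. test_fun K \<phi> \<Longrightarrow> (LINT x|lebesgue_on K. f x * \<phi> x) = 0"
  shows "AE x in lebesgue_on K. f x \<le> 0"
proof -
  have fm[measurable]: "f \<in> borel_measurable (lebesgue_on K)" using assms(3) by auto
  have KL: "K \<in> sets lebesgue" using assms(1) by simp
  define P where "P = {x\<in>K. f x > 0}"
  have "{x \<in> space (lebesgue_on K). f x > 0} \<in> sets (lebesgue_on K)" by measurable
  then have PL: "P \<in> sets lebesgue" using KL by (simp add: P_def sets_restrict_space_iff)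
  have small: "emeasure lebesgue P \<le> ennreal e" if e: "e > 0" for e
  proof -
    obtain T where T: "closed T" "T \<subseteq> P" "P - T \<in> lmeasurable" "emeasure lebesgue (P - T) < ennreal e"
      by (rule sets_lebesgue_inner_closed[OF PL e])
    have TK: "T \<subseteq> K" using T(2) by (auto simp: P_def)
    have cT: "compact T" using T(1) TK bounded_subset[OF assms(2)] by (auto simp: compact_eq_bounded_closed)
    have TL: "T \<in> sets lebesgue" using T(1) by simp
    have z: "(LINT x|lebesgue_on K. f x * indicator T x) = 0"
      by (rule test_fun_integral_zero_compact[OF assms(1,3,4) cT TK])
    have i: "integrable (lebesgue_on K) (\<lambda>x. f x * indicator T x)"
      using assms(3) TL by (intro integrable_real_mult_indicator) (auto simp: sets_restrict_space_iff KL TK)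
    have "AE x in lebesgue_on K. f x * indicator T x = 0"
      using z i T(2) by (subst (asm) integral_nonneg_eq_0_iff_AE)
        (auto intro!: AE_I2 simp: P_def indicator_def)
    then have "AE x in lebesgue_on K. x \<notin> T"
      by (rule eventually_mono) (use T(2) in \<open>auto simp: P_def indicator_def split: if_splits\<close>)
    then have "AE x in lebesgue. x \<notin> T"
      using KL TK by (subst (asm) AE_restrict_space_iff) (auto elim!: eventually_mono)
    then have "emeasure lebesgue T = 0" using TL by (subst (asm) AE_iff_measurable[of T]) auto
    then have "emeasure lebesgue P \<le> emeasure lebesgue (P - T)"
      using emeasure_subadditive[of T lebesgue "P - T"] TL PL T(2) by (simp add: Un_absorb1)
    then show ?thesis using T(4) by simp
  qed
  then have "emeasure lebesgue P = 0"
    by (metis ennreal_le_epsilon add_0 le_zero_eq)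
  then have "AE x in lebesgue. x \<notin> P" using PL by (subst AE_iff_measurable[of P]) auto
  then show ?thesis using KL by (subst AE_restrict_space_iff) (auto simp: P_def elim!: eventually_mono)
qed

lemma fundamental_lemma:
  fixes f :: "point \<Rightarrow> complex"
  assumes "open K" "bounded K" "integrable (lebesgue_on K) f"
    "\<And>\<phi>. test_fun K \<phi> \<Longrightarrow> (LINT x|lebesgue_on K. f x * of_real (\<phi> x)) = 0"
  shows "AE x in lebesgue_on K. f x = 0"
proof -
  have z: "(LINT x|lebesgue_on K. Re (f x) * \<phi> x) = 0" "(LINT x|lebesgue_on K. Im (f x) * \<phi> x) = 0"
    if \<phi>: "test_fun K \<phi>" for \<phi>
  proof -
    have "bounded (range \<phi>)"
    proof -
      have "bounded (\<phi> ` closure K)"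
        using assms(2) C1_continuous[OF test_fun_C1[OF \<phi>]]
        by (intro compact_imp_bounded compact_continuous_image) (auto intro: continuous_on_subset simp: compact_closure)
      then have "bounded (insert 0 (\<phi> ` closure K))" by simp
      moreover have "range \<phi> \<subseteq> insert 0 (\<phi> ` closure K)"
        using test_fun_zero[OF \<phi>] closure_subset[of K] by auto
      ultimately show ?thesis by (rule bounded_subset)
    qed
    then obtain B where B: "\<And>x. \<bar>\<phi> x\<bar> \<le> B" by (auto simp: bounded_iff)
    have [measurable]: "\<phi> \<in> borel_measurable (lebesgue_on K)"
      using borel_measurable_continuous_onI[OF C1_continuous[OF test_fun_C1[OF \<phi>]]]
      by (intro measurable_restrict_space1 measurable_completion) simp
    have [measurable]: "f \<in> borel_measurable (lebesgue_on K)" using assms(3) by auto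
    have i: "integrable (lebesgue_on K) (\<lambda>x. f x * of_real (\<phi> x))"
    proof (rule Bochner_Integration.integrable_bound[where f = "\<lambda>x. B * norm (f x)"])
      show "AE x in lebesgue_on K. norm (f x * of_real (\<phi> x)) \<le> norm (B * norm (f x))"
        using B abs_ge_self order_trans by (intro AE_I2) (fastforce simp: norm_mult abs_mult mult.commute[of B] intro!: mult_left_mono)
    qed (use assms(3) in auto)
    show "(LINT x|lebesgue_on K. Re (f x) * \<phi> x) = 0" "(LINT x|lebesgue_on K. Im (f x) * \<phi> x) = 0"
      using integral_Re[OF i] integral_Im[OF i] assms(4)[OF \<phi>] by simp_all
  qed
  have iR: "integrable (lebesgue_on K) (\<lambda>x. Re (f x))" and iI: "integrable (lebesgue_on K) (\<lambda>x. Im (f x))"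
    using assms(3) by auto
  have "AE x in lebesgue_on K. Re (f x) \<le> 0" "AE x in lebesgue_on K. - Re (f x) \<le> 0"
    "AE x in lebesgue_on K. Im (f x) \<le> 0" "AE x in lebesgue_on K. - Im (f x) \<le> 0"
    by (rule fundamental_lemma_nonpos[OF assms(1,2)]; use iR iI z in simp)+
  then show ?thesis by eventually_elim (simp add: complex_eq_iff)
qed

section \<open>Weakly differentiable jets\<close>

definition jets :: "point set \<Rightarrow> (point \<Rightarrow> jet) set" where
  "jets K = {p \<in> L2 K. weak_grad K (\<lambda>x. fst (p x)) (\<lambda>x. snd (p x))}"

definition div_jets :: "point set \<Rightarrow> (point \<Rightarrow> jet) set" where
  "div_jets K = {q \<in> L2 K. weak_div K (\<lambda>x. snd (q x)) (\<lambda>x. fst (q x))}"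

text \<open>
  Testing a weak gradient with \<open>\<phi>\<close> in the component \<open>(i, j)\<close>, or a weak divergence in the component
  \<open>i\<close>, is pairing with a fixed jet.
\<close>

definition grad_test :: "(point \<Rightarrow> real) \<Rightarrow> 3 \<Rightarrow> 3 \<Rightarrow> point \<Rightarrow> jet" where
  "grad_test \<phi> i j x = ((\<chi> k. if k = i then of_real (partial j \<phi> x) else 0),
     (\<chi> k l. if k = i \<and> l = j then of_real (\<phi> x) else 0))"

definition div_test :: "(point \<Rightarrow> real) \<Rightarrow> 3 \<Rightarrow> point \<Rightarrow> jet" where
  "div_test \<phi> i x = ((\<chi> k. if k = i then of_real (\<phi> x) else 0),
     (\<chi> k l. if k = i then of_real (partial l \<phi> x) else 0))"

lemma cdot_grad_test:
  "cdot p (grad_test \<phi> i j x) = fst p $ i * of_real (partial j \<phi> x) + snd p $ i $ j * of_real (\<phi> x)"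
proof -
  have "(\<Sum>k\<in>UNIV. \<Sum>l\<in>UNIV. snd p $ k $ l * cnj (if k = i \<and> l = j then of_real (\<phi> x) else 0))
      = (\<Sum>k\<in>UNIV. if k = i then snd p $ k $ j * of_real (\<phi> x) else 0)"
    by (intro sum.cong refl) (auto simp: if_distrib sum.delta cong: if_cong)
  moreover have "(\<Sum>k\<in>UNIV. fst p $ k * cnj (if k = i then of_real (partial j \<phi> x) else 0))
      = (\<Sum>k\<in>UNIV. if k = i then fst p $ k * of_real (partial j \<phi> x) else 0)"
    by (intro sum.cong refl) auto
  ultimately show ?thesis by (simp add: cdot_def grad_test_def)
qed

lemma cdot_div_test:
  "cdot q (div_test \<phi> i x) = (\<Sum>j\<in>UNIV. snd q $ i $ j * of_real (partial j \<phi> x)) + fst q $ i * of_real (\<phi> x)"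
proof -
  have "(\<Sum>k\<in>UNIV. \<Sum>l\<in>UNIV. snd q $ k $ l * cnj (if k = i then of_real (partial l \<phi> x) else 0))
      = (\<Sum>k\<in>UNIV. if k = i then (\<Sum>l\<in>UNIV. snd q $ k $ l * of_real (partial l \<phi> x)) else 0)"
    by (intro sum.cong refl) auto
  moreover have "(\<Sum>k\<in>UNIV. fst q $ k * cnj (if k = i then of_real (\<phi> x) else 0))
      = (\<Sum>k\<in>UNIV. if k = i then fst q $ k * of_real (\<phi> x) else 0)"
    by (intro sum.cong refl) auto
  ultimately show ?thesis by (simp add: cdot_def div_test_def)
qed

lemma continuous_on_if_const: "continuous_on S f \<Longrightarrow> continuous_on S (\<lambda>x. if P then f x else 0)"
  by (cases P) auto

lemma grad_test_L2: "open K \<Longrightarrow> bounded K \<Longrightarrow> C1 \<phi> \<Longrightarrow> grad_test \<phi> i j \<in> L2 K"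
  unfolding grad_test_def[abs_def]
  by (intro L2_continuous continuous_on_Pair continuous_on_vec_lambda continuous_on_if_const continuous_on_of_real
      continuous_partial C1_continuous)

lemma div_test_L2: "open K \<Longrightarrow> bounded K \<Longrightarrow> C1 \<phi> \<Longrightarrow> div_test \<phi> i \<in> L2 K"
  unfolding div_test_def[abs_def]
  by (intro L2_continuous continuous_on_Pair continuous_on_vec_lambda continuous_on_if_const continuous_on_of_real
      continuous_partial C1_continuous)

lemma L2_fst_zero: fixes p :: "point \<Rightarrow> jet" shows "p \<in> L2 K \<Longrightarrow> (\<lambda>x. (fst (p x), 0) :: jet) \<in> L2 K"
  by (rule L2_Pair[OF L2_fst L2_zero])

lemma L2_snd_zero: fixes p :: "point \<Rightarrow> jet" shows "p \<in> L2 K \<Longrightarrow> (\<lambda>x. (0, snd (p x)) :: jet) \<in> L2 K"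
  by (rule L2_Pair[OF L2_zero L2_snd])

lemma cinner_eq_0_iff_weak_grad:
  assumes "open K" "bounded K" "p \<in> L2 K"
  shows "weak_grad K (\<lambda>x. fst (p x)) (\<lambda>x. snd (p x)) \<longleftrightarrow>
    (\<forall>\<phi>. test_fun K \<phi> \<longrightarrow> (\<forall>i j. cinner K p (grad_test \<phi> i j) = 0))"
proof -
  have "cinner K p (grad_test \<phi> i j) =
      (LINT x|lebesgue_on K. fst (p x) $ i * of_real (partial j \<phi> x)) +
      (LINT x|lebesgue_on K. snd (p x) $ i $ j * of_real (\<phi> x))" if "test_fun K \<phi>" for \<phi> i j
  proof -
    have t: "grad_test \<phi> i j \<in> L2 K" by (rule grad_test_L2[OF assms(1,2) test_fun_C1[OF that]])
    have "integrable (lebesgue_on K) (\<lambda>x. fst (p x) $ i * of_real (partial j \<phi> x))"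
      using cdot_integrable[OF L2_fst_zero[OF assms(3)] t] by (simp add: cdot_grad_test)
    moreover have "integrable (lebesgue_on K) (\<lambda>x. snd (p x) $ i $ j * of_real (\<phi> x))"
      using cdot_integrable[OF L2_snd_zero[OF assms(3)] t] by (simp add: cdot_grad_test)
    ultimately show ?thesis by (simp add: cinner_def cdot_grad_test)
  qed
  then show ?thesis by (simp add: weak_grad_def add_eq_0_iff2)
qed

lemma cinner_eq_0_iff_weak_div:
  assumes "open K" "bounded K" "q \<in> L2 K"
  shows "weak_div K (\<lambda>x. snd (q x)) (\<lambda>x. fst (q x)) \<longleftrightarrow>
    (\<forall>\<phi>. test_fun K \<phi> \<longrightarrow> (\<forall>i. cinner K q (div_test \<phi> i) = 0))"
proof -
  have "cinner K q (div_test \<phi> i) =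
      (LINT x|lebesgue_on K. (\<Sum>j\<in>UNIV. snd (q x) $ i $ j * of_real (partial j \<phi> x))) +
      (LINT x|lebesgue_on K. fst (q x) $ i * of_real (\<phi> x))" if "test_fun K \<phi>" for \<phi> i
  proof -
    have t: "div_test \<phi> i \<in> L2 K" by (rule div_test_L2[OF assms(1,2) test_fun_C1[OF that]])
    have "integrable (lebesgue_on K) (\<lambda>x. fst (q x) $ i * of_real (\<phi> x))"
      using cdot_integrable[OF L2_fst_zero[OF assms(3)] t] by (simp add: cdot_div_test)
    moreover have "integrable (lebesgue_on K) (\<lambda>x. \<Sum>j\<in>UNIV. snd (q x) $ i $ j * of_real (partial j \<phi> x))"
      using cdot_integrable[OF L2_snd_zero[OF assms(3)] t] by (simp add: cdot_div_test)
    ultimately show ?thesis by (simp add: cinner_def cdot_div_test)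
  qed
  then show ?thesis by (simp add: weak_div_def add_eq_0_iff2)
qed

lemma cinner_imul_right:
  assumes "p \<in> L2 K" "q \<in> L2 K"
  shows "cinner K p (\<lambda>x. imul (q x)) = - \<i> * cinner K p q"
proof -
  have "cdot a (imul b) = - \<i> * cdot a b" for a b
    by (simp add: cdot_def imul_def sum_distrib_left algebra_simps)
  then show ?thesis by (simp add: cinner_def)
qed

lemma cinner_imul_left:
  assumes "p \<in> L2 K" "q \<in> L2 K"
  shows "cinner K (\<lambda>x. imul (p x)) q = \<i> * cinner K p q"
proof -
  have "cdot (imul a) b = \<i> * cdot a b" for a b
    by (simp add: cdot_def imul_def sum_distrib_left algebra_simps)
  then show ?thesis by (simp add: cinner_def)
qed

lemma cinner_scaleR_left: "cinner K (\<lambda>x. c *\<^sub>R p x) q = of_real c * cinner K p q"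
proof -
  have "cdot (c *\<^sub>R a) b = of_real c * cdot a b" for a b
    by (simp add: cdot_def scaleR_conv_of_real[where 'a=complex] vector_scaleR_component sum_distrib_left algebra_simps)
  then show ?thesis by (simp add: cinner_def)
qed

lemma cinner_add_left:
  assumes "p \<in> L2 K" "q \<in> L2 K" "r \<in> L2 K"
  shows "cinner K (\<lambda>x. q x + r x) p = cinner K q p + cinner K r p"
proof -
  have "cdot (b + c) a = cdot b a + cdot c a" for a b c
    by (simp add: cdot_def algebra_simps sum.distrib)
  then show ?thesis using cdot_integrable[OF assms(2,1)] cdot_integrable[OF assms(3,1)]
    by (simp add: cinner_def)
qed

lemma cinner_sum_right:
  assumes "finite I" "p \<in> L2 K" "\<And>i. i \<in> I \<Longrightarrow> q i \<in> L2 K"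
  shows "cinner K p (\<lambda>x. \<Sum>i\<in>I. q i x) = (\<Sum>i\<in>I. cinner K p (q i)) \<and> (\<lambda>x. \<Sum>i\<in>I. q i x) \<in> L2 K"
  using assms(1,3)
proof (induction I rule: finite_induct)
  case empty
  have "cdot a 0 = 0" for a by (simp add: cdot_def)
  then show ?case by (simp add: cinner_def L2_zero)
next
  case (insert i I)
  then show ?case using cinner_add_right[OF assms(2), of "q i" "\<lambda>x. \<Sum>i\<in>I. q i x"]
    by (simp add: L2_add)
qed

lemma cinner_zero_limit:
  assumes "\<And>n. s n \<in> L2 K" "p \<in> L2 K" "t \<in> L2 K" "(\<lambda>n. l2_norm K (\<lambda>x. s n x - p x)) \<longlonglongrightarrow> 0"
    "\<And>n. cinner K (s n) t = 0"
  shows "cinner K p t = 0"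
proof -
  have "norm (cinner K p t) \<le> 2 * l2_norm K (\<lambda>x. s n x - p x) * l2_norm K t" for n
    using norm_cinner_le[OF L2_diff[OF assms(1,2)] assms(3), of n] cinner_diff_left[OF assms(3) assms(1,2), of n]
    by (simp add: assms(5))
  moreover have "(\<lambda>n. 2 * l2_norm K (\<lambda>x. s n x - p x) * l2_norm K t) \<longlonglongrightarrow> 2 * 0 * l2_norm K t"
    by (intro tendsto_intros assms(4))
  ultimately have "norm (cinner K p t) \<le> 0"
    by (intro LIMSEQ_le_const[where a = "norm (cinner K p t)"]) auto
  then show ?thesis by simp
qed

lemma jets_L2: "p \<in> jets K \<Longrightarrow> p \<in> L2 K" by (simp add: jets_def)
lemma div_jets_L2: "p \<in> div_jets K \<Longrightarrow> p \<in> L2 K" by (simp add: div_jets_def)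

context
  fixes K :: "point set"
  assumes K: "open K" "bounded K"
begin

text \<open>
  Membership is orthogonality to square integrable jets that come from test functions; linearity and
  closedness of \<open>jets\<close> in \<open>L2\<close> follow without returning to weak derivatives.
\<close>

lemma jets_iff: "p \<in> jets K \<longleftrightarrow> p \<in> L2 K \<and> (\<forall>\<phi>. test_fun K \<phi> \<longrightarrow> (\<forall>i j. cinner K p (grad_test \<phi> i j) = 0))"
  unfolding jets_def using cinner_eq_0_iff_weak_grad[OF K] by auto

lemma div_jets_iff: "q \<in> div_jets K \<longleftrightarrow> q \<in> L2 K \<and> (\<forall>\<phi>. test_fun K \<phi> \<longrightarrow> (\<forall>i. cinner K q (div_test \<phi> i) = 0))"
  unfolding div_jets_def using cinner_eq_0_iff_weak_div[OF K] by auto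

lemma grad_test_L2': "test_fun K \<phi> \<Longrightarrow> grad_test \<phi> i j \<in> L2 K"
  using grad_test_L2[OF K] test_fun_C1 by blast

lemma jets_add: "p \<in> jets K \<Longrightarrow> q \<in> jets K \<Longrightarrow> (\<lambda>x. p x + q x) \<in> jets K"
  unfolding jets_iff by (simp add: L2_add cinner_add_left grad_test_L2')

lemma jets_scaleR: "p \<in> jets K \<Longrightarrow> (\<lambda>x. c *\<^sub>R p x) \<in> jets K"
  unfolding jets_iff by (simp add: L2_scaleR cinner_scaleR_left)

lemma jets_imul: "p \<in> jets K \<Longrightarrow> (\<lambda>x. imul (p x)) \<in> jets K"
  unfolding jets_iff by (simp add: L2_imul cinner_imul_left grad_test_L2')

lemma jets_diff: "p \<in> jets K \<Longrightarrow> q \<in> jets K \<Longrightarrow> (\<lambda>x. p x - q x) \<in> jets K"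
  using jets_add[of p "\<lambda>x. (-1) *\<^sub>R q x"] jets_scaleR[of q "-1"] by simp

lemma jets_limit:
  assumes "\<And>n. s n \<in> jets K" "p \<in> L2 K" "(\<lambda>n. l2_norm K (\<lambda>x. s n x - p x)) \<longlonglongrightarrow> 0"
  shows "p \<in> jets K"
  unfolding jets_iff using assms cinner_zero_limit[of s K p] grad_test_L2' unfolding jets_iff by blast

lemma lmeasurable_K: "K \<in> lmeasurable" using K by (rule lmeasurable_open[rotated])

text \<open>
  The jet chosen by \<open>grad\<close> may be replaced by any other one with the same field, so \<open>grad\<close> and
  \<open>dvg\<close>, which are given by Hilbert choice, can be computed from any representative.
\<close>

lemma jets_unique:
  assumes "p \<in> jets K" "q \<in> jets K" "AE x in lebesgue_on K. fst (p x) = fst (q x)"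
  shows "AE x in lebesgue_on K. p x = q x"
proof -
  define r where "r x = p x - q x" for x
  have r: "r \<in> jets K" unfolding r_def[abs_def] by (rule jets_diff[OF assms(1,2)])
  have rL: "r \<in> L2 K" using r by (rule jets_L2)
  have r0: "AE x in lebesgue_on K. fst (r x) = 0" using assms(3) by (simp add: r_def)
  have "AE x in lebesgue_on K. snd (r x) $ i $ j = 0" for i j
  proof (rule fundamental_lemma[OF K])
    have "bounded_linear (\<lambda>p::jet. snd p $ i $ j)"
      by (intro bounded_linear_compose[OF bounded_linear_vec_nth] bounded_linear_snd)
    from L2_linear[OF this rL] show "integrable (lebesgue_on K) (\<lambda>x. snd (r x) $ i $ j)"
      by (rule L2_integrable(1)[OF lmeasurable_K])
    fix \<phi> assume \<phi>: "test_fun K \<phi>"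
    have t: "grad_test \<phi> i j \<in> L2 K" using \<phi> by (rule grad_test_L2')
    have "(LINT x|lebesgue_on K. fst (r x) $ i * of_real (partial j \<phi> x)) = (LINT x|lebesgue_on K. 0)"
    proof (rule integral_cong_AE)
      show "(\<lambda>x. fst (r x) $ i * of_real (partial j \<phi> x)) \<in> borel_measurable (lebesgue_on K)"
        using borel_measurable_integrable[OF cdot_integrable[OF L2_fst_zero[OF rL] t]] by (simp add: cdot_grad_test)
      show "AE x in lebesgue_on K. fst (r x) $ i * of_real (partial j \<phi> x) = (0::complex)"
        using r0 by eventually_elim simp
    qed simp
    moreover have "weak_grad K (\<lambda>x. fst (r x)) (\<lambda>x. snd (r x))" using r by (simp add: jets_def)
    ultimately show "(LINT x|lebesgue_on K. snd (r x) $ i $ j * of_real (\<phi> x)) = 0"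
      using \<phi> by (simp add: weak_grad_def)
  qed
  then have "AE x in lebesgue_on K. \<forall>i j. snd (r x) $ i $ j = 0" by (simp add: AE_all_countable)
  with r0 show ?thesis
    by eventually_elim (simp add: r_def vec_eq_iff prod_eq_iff)
qed

lemma div_jets_unique:
  assumes "p \<in> div_jets K" "q \<in> div_jets K" "AE x in lebesgue_on K. snd (p x) = snd (q x)"
  shows "AE x in lebesgue_on K. p x = q x"
proof -
  define r where "r x = p x - q x" for x
  have pq: "p \<in> L2 K" "q \<in> L2 K" using assms div_jets_L2 by auto
  have rL: "r \<in> L2 K" unfolding r_def[abs_def] by (intro L2_diff pq)
  have r0: "AE x in lebesgue_on K. snd (r x) = 0" using assms(3) by (simp add: r_def)
  have "AE x in lebesgue_on K. fst (r x) $ i = 0" for i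
  proof (rule fundamental_lemma[OF K])
    have "bounded_linear (\<lambda>p::jet. fst p $ i)"
      by (intro bounded_linear_compose[OF bounded_linear_vec_nth] bounded_linear_fst)
    from L2_linear[OF this rL] show "integrable (lebesgue_on K) (\<lambda>x. fst (r x) $ i)"
      by (rule L2_integrable(1)[OF lmeasurable_K])
    fix \<phi> assume \<phi>: "test_fun K \<phi>"
    have t: "div_test \<phi> i \<in> L2 K" using \<phi> test_fun_C1 div_test_L2[OF K] by blast
    have "cinner K r (div_test \<phi> i) = 0"
      unfolding r_def[abs_def] using assms(1,2) \<phi> unfolding div_jets_iff
      by (subst cinner_diff_left[OF t pq]) simp
    moreover have "cinner K r (div_test \<phi> i) = cinner K (\<lambda>x. (fst (r x), 0)) (div_test \<phi> i)"
    proof (rule cinner_cong_AE[OF rL L2_fst_zero[OF rL] t t])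
      show "AE x in lebesgue_on K. r x = (fst (r x), 0)"
        using r0 by eventually_elim (simp add: prod_eq_iff)
    qed simp
    ultimately show "(LINT x|lebesgue_on K. fst (r x) $ i * of_real (\<phi> x)) = 0"
      by (simp add: cinner_def cdot_div_test)
  qed
  then have "AE x in lebesgue_on K. \<forall>i. fst (r x) $ i = 0" by (simp add: AE_all_countable)
  with r0 show ?thesis
    by eventually_elim (simp add: r_def vec_eq_iff prod_eq_iff)
qed

end

lemma cinner_split:
  assumes "p \<in> L2 K" "q \<in> L2 K"
  shows "cinner K p q = ipv K (\<lambda>x. fst (p x)) (\<lambda>x. fst (q x)) + ipm K (\<lambda>x. snd (p x)) (\<lambda>x. snd (q x))"
proof -
  have "integrable (lebesgue_on K) (\<lambda>x. \<Sum>i\<in>UNIV. fst (p x) $ i * cnj (fst (q x) $ i))"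
    using cdot_integrable[OF L2_fst_zero[OF assms(1)] assms(2)] by (simp add: cdot_def)
  moreover have "integrable (lebesgue_on K) (\<lambda>x. \<Sum>i\<in>UNIV. \<Sum>j\<in>UNIV. snd (p x) $ i $ j * cnj (snd (q x) $ i $ j))"
    using cdot_integrable[OF L2_snd_zero[OF assms(1)] assms(2)] by (simp add: cdot_def)
  ultimately show ?thesis by (simp add: cinner_def cdot_def ipv_def ipm_def)
qed

definition jet_of :: "point set \<Rightarrow> vfield \<Rightarrow> point \<Rightarrow> jet" where
  "jet_of K u x = (u x, grad K u x)"

definition div_jet_of :: "point set \<Rightarrow> mfield \<Rightarrow> point \<Rightarrow> jet" where
  "div_jet_of K \<sigma> x = (dvg K \<sigma> x, \<sigma> x)"

lemma H1_jet_of: "u \<in> H1 K \<Longrightarrow> jet_of K u \<in> jets K"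
proof -
  assume "u \<in> H1 K"
  then have u: "u \<in> L2 K" "\<exists>G. G \<in> L2 K \<and> weak_grad K u G" by (auto simp: H1_def)
  from someI_ex[OF u(2)] have "grad K u \<in> L2 K \<and> weak_grad K u (grad K u)"
    unfolding grad_def by simp
  then show ?thesis using u(1) by (simp add: jets_def jet_of_def[abs_def] L2_Pair)
qed

lemma jets_H1: "p \<in> jets K \<Longrightarrow> (\<lambda>x. fst (p x)) \<in> H1 K"
  unfolding jets_def H1_def using L2_fst L2_snd by blast

lemma Hdiv_div_jet_of: "\<sigma> \<in> Hdiv K \<Longrightarrow> div_jet_of K \<sigma> \<in> div_jets K"
proof -
  assume "\<sigma> \<in> Hdiv K"
  then have s: "\<sigma> \<in> L2 K" "\<exists>d. d \<in> L2 K \<and> weak_div K \<sigma> d" by (auto simp: Hdiv_def)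
  from someI_ex[OF s(2)] have "dvg K \<sigma> \<in> L2 K \<and> weak_div K \<sigma> (dvg K \<sigma>)"
    unfolding dvg_def by simp
  then show ?thesis using s(1) by (simp add: div_jets_def div_jet_of_def[abs_def] L2_Pair)
qed

lemma div_jets_Hdiv: "q \<in> div_jets K \<Longrightarrow> (\<lambda>x. snd (q x)) \<in> Hdiv K"
  unfolding div_jets_def Hdiv_def using L2_fst L2_snd by blast

lemma jet_of_unique:
  assumes "open K" "bounded K" "p \<in> jets K"
  shows "AE x in lebesgue_on K. jet_of K (\<lambda>x. fst (p x)) x = p x"
  by (rule jets_unique[OF assms(1,2) H1_jet_of[OF jets_H1[OF assms(3)]] assms(3)]) (simp add: jet_of_def)

lemma div_jet_of_unique:
  assumes "open K" "bounded K" "q \<in> div_jets K"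
  shows "AE x in lebesgue_on K. div_jet_of K (\<lambda>x. snd (q x)) x = q x"
  by (rule div_jets_unique[OF assms(1,2) Hdiv_div_jet_of[OF div_jets_Hdiv[OF assms(3)]] assms(3)])
     (simp add: div_jet_of_def)

lemma H1_norm_jet_of: "u \<in> H1 K \<Longrightarrow> H1_norm K u = l2_norm K (jet_of K u)"
  using cinner_split[OF jets_L2 jets_L2, OF H1_jet_of H1_jet_of] Re_cinner[OF jets_L2 jets_L2, OF H1_jet_of H1_jet_of]
  by (simp add: H1_norm_def l2_norm_def jet_of_def)

lemma H1_norm_jets:
  assumes "open K" "bounded K" "p \<in> jets K"
  shows "H1_norm K (\<lambda>x. fst (p x)) = l2_norm K p"
  unfolding H1_norm_jet_of[OF jets_H1[OF assms(3)]]
  by (rule l2_norm_cong_AE[OF jets_L2[OF H1_jet_of[OF jets_H1]] jets_L2 jet_of_unique]) (use assms in auto)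

lemma Hdiv_norm_div_jet_of: "\<sigma> \<in> Hdiv K \<Longrightarrow> Hdiv_norm K \<sigma> = l2_norm K (div_jet_of K \<sigma>)"
  using cinner_split[OF div_jets_L2 div_jets_L2, OF Hdiv_div_jet_of Hdiv_div_jet_of]
    Re_cinner[OF div_jets_L2 div_jets_L2, OF Hdiv_div_jet_of Hdiv_div_jet_of]
  by (simp add: Hdiv_norm_def l2_norm_def div_jet_of_def add.commute)

lemma Hdiv_norm_div_jets:
  assumes "open K" "bounded K" "q \<in> div_jets K"
  shows "Hdiv_norm K (\<lambda>x. snd (q x)) = l2_norm K q"
  unfolding Hdiv_norm_div_jet_of[OF div_jets_Hdiv[OF assms(3)]]
  by (rule l2_norm_cong_AE[OF div_jets_L2[OF Hdiv_div_jet_of[OF div_jets_Hdiv]] div_jets_L2 div_jet_of_unique]) (use assms in auto)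

subsection \<open>Restriction to subdomains\<close>

lemma integral_lebesgue_on_restrict:
  fixes f :: "point \<Rightarrow> 'b::euclidean_space"
  assumes "K \<in> sets lebesgue" "L \<in> sets lebesgue" "K \<subseteq> L" "\<And>x. x \<in> L - K \<Longrightarrow> f x = 0"
  shows "(LINT x|lebesgue_on K. f x) = (LINT x|lebesgue_on L. f x)"
proof -
  have "(LINT x|lebesgue_on K. f x) = (LINT x|lebesgue. indicator K x *\<^sub>R f x)"
    using assms by (intro integral_restrict_space) auto
  also have "(\<lambda>x. indicator K x *\<^sub>R f x) = (\<lambda>x. indicator L x *\<^sub>R f x)"
    using assms(3,4) by (auto simp: indicator_def fun_eq_iff)
  also have "(LINT x|lebesgue. indicator L x *\<^sub>R f x) = (LINT x|lebesgue_on L. f x)"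
    using assms by (intro integral_restrict_space[symmetric]) auto
  finally show ?thesis .
qed

lemma integrable_lebesgue_on_subset:
  fixes f :: "point \<Rightarrow> 'b::euclidean_space"
  assumes "K \<in> sets lebesgue" "L \<in> sets lebesgue" "K \<subseteq> L" "integrable (lebesgue_on L) f"
  shows "integrable (lebesgue_on K) f"
proof -
  have "integrable lebesgue (\<lambda>x. indicator L x *\<^sub>R f x)"
    using assms(2,4) integrable_restrict_space[of L lebesgue f] by simp
  then have "integrable lebesgue (\<lambda>x. indicator K x *\<^sub>R indicator L x *\<^sub>R f x)"
    using assms(1) by (rule integrable_mult_indicator[rotated])
  moreover have "(\<lambda>x. indicator K x *\<^sub>R indicator L x *\<^sub>R f x) = (\<lambda>x. indicator K x *\<^sub>R f x)"
    using assms(3) by (auto simp: indicator_def fun_eq_iff)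
  ultimately show ?thesis using assms(1) integrable_restrict_space[of K lebesgue f] by simp
qed

lemma L2_subset:
  fixes f :: "point \<Rightarrow> 'b::euclidean_space"
  assumes "K \<in> sets lebesgue" "L \<in> sets lebesgue" "K \<subseteq> L" "f \<in> L2 L"
  shows "f \<in> L2 K"
  using assms(4) integrable_lebesgue_on_subset[OF assms(1-3)] measurable_restrict_mono[OF _ assms(3)]
  by (auto simp: L2_def)

text \<open>
  Test functions on the smaller set are test functions on the larger one.
\<close>

lemma jets_subset:
  assumes "open K" "open L" "K \<subseteq> L" "p \<in> jets L"
  shows "p \<in> jets K"
proof -
  have "weak_grad L (\<lambda>x. fst (p x)) (\<lambda>x. snd (p x))" using assms(4) by (simp add: jets_def)
  then have "weak_grad K (\<lambda>x. fst (p x)) (\<lambda>x. snd (p x))"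
    unfolding weak_grad_def
  proof (intro allI impI)
    fix \<phi> i j
    assume L: "\<forall>\<phi>. test_fun L \<phi> \<longrightarrow> (\<forall>i j. (LINT x|lebesgue_on L. fst (p x) $ i * of_real (partial j \<phi> x)) =
        - (LINT x|lebesgue_on L. snd (p x) $ i $ j * of_real (\<phi> x)))" and \<phi>: "test_fun K \<phi>"
    have "(LINT x|lebesgue_on K. fst (p x) $ i * of_real (partial j \<phi> x)) =
        (LINT x|lebesgue_on L. fst (p x) $ i * of_real (partial j \<phi> x))"
      by (rule integral_lebesgue_on_restrict) (use assms test_fun_partial_zero[OF \<phi>] in auto)
    moreover have "(LINT x|lebesgue_on K. snd (p x) $ i $ j * of_real (\<phi> x)) =
        (LINT x|lebesgue_on L. snd (p x) $ i $ j * of_real (\<phi> x))"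
      by (rule integral_lebesgue_on_restrict) (use assms test_fun_zero[OF \<phi>] in auto)
    ultimately show "(LINT x|lebesgue_on K. fst (p x) $ i * of_real (partial j \<phi> x)) =
        - (LINT x|lebesgue_on K. snd (p x) $ i $ j * of_real (\<phi> x))"
      using L test_fun_mono[OF \<phi> assms(3)] by simp
  qed
  then show ?thesis using assms L2_subset[of K L p] by (auto simp: jets_def)
qed

lemma div_jets_subset:
  assumes "open K" "open L" "K \<subseteq> L" "q \<in> div_jets L"
  shows "q \<in> div_jets K"
proof -
  have "weak_div L (\<lambda>x. snd (q x)) (\<lambda>x. fst (q x))" using assms(4) by (simp add: div_jets_def)
  then have "weak_div K (\<lambda>x. snd (q x)) (\<lambda>x. fst (q x))"
    unfolding weak_div_def
  proof (intro allI impI)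
    fix \<phi> i
    assume L: "\<forall>\<phi>. test_fun L \<phi> \<longrightarrow> (\<forall>i. (LINT x|lebesgue_on L. (\<Sum>j\<in>UNIV. snd (q x) $ i $ j * of_real (partial j \<phi> x))) =
        - (LINT x|lebesgue_on L. fst (q x) $ i * of_real (\<phi> x)))" and \<phi>: "test_fun K \<phi>"
    have "(LINT x|lebesgue_on K. (\<Sum>j\<in>UNIV. snd (q x) $ i $ j * of_real (partial j \<phi> x))) =
        (LINT x|lebesgue_on L. (\<Sum>j\<in>UNIV. snd (q x) $ i $ j * of_real (partial j \<phi> x)))"
      by (rule integral_lebesgue_on_restrict) (use assms test_fun_partial_zero[OF \<phi>] in auto)
    moreover have "(LINT x|lebesgue_on K. fst (q x) $ i * of_real (\<phi> x)) =
        (LINT x|lebesgue_on L. fst (q x) $ i * of_real (\<phi> x))"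
      by (rule integral_lebesgue_on_restrict) (use assms test_fun_zero[OF \<phi>] in auto)
    ultimately show "(LINT x|lebesgue_on K. (\<Sum>j\<in>UNIV. snd (q x) $ i $ j * of_real (partial j \<phi> x))) =
        - (LINT x|lebesgue_on K. fst (q x) $ i * of_real (\<phi> x))"
      using L test_fun_mono[OF \<phi> assms(3)] by simp
  qed
  then show ?thesis using assms L2_subset[of K L q] by (auto simp: div_jets_def)
qed

subsection \<open>Classical gradients\<close>

text \<open>
  The trace is defined by approximation with \<open>C1\<close> functions, whose jets are formed with the
  pointwise gradient; integration by parts identifies it with the weak one.
\<close>

definition cgrad :: "vfield \<Rightarrow> mfield" where
  "cgrad w x = (\<chi> i j. frechet_derivative w (at x) (axis j 1) $ i)"

definition cjet :: "vfield \<Rightarrow> point \<Rightarrow> jet" where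
  "cjet w x = (w x, cgrad w x)"

lemma continuous_cjet: "C1 w \<Longrightarrow> continuous_on UNIV (cjet w)"
  unfolding cjet_def[abs_def] cgrad_def
  by (intro continuous_on_Pair continuous_on_vec_lambda continuous_on_component C1_continuous
      C1_continuous_derivative)

lemma partial_component:
  assumes "C1 w" "bounded_linear T"
  shows "partial j (\<lambda>x. T (w x $ i)) x = T (cgrad w x $ i $ j)"
proof -
  have "((\<lambda>x. T (w x $ i)) has_derivative (\<lambda>h. T (frechet_derivative w (at x) h $ i))) (at x)"
    by (intro bounded_linear.has_derivative[OF assms(2)] bounded_linear.has_derivative[OF bounded_linear_vec_nth]
        C1_has_derivative assms)
  from frechet_derivative_at[OF this, symmetric] show ?thesis
    by (simp add: partial_def cgrad_def)
qed

lemma C1_component: "C1 w \<Longrightarrow> bounded_linear T \<Longrightarrow> C1 (\<lambda>x. T (w x $ i))"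
  by (rule C1_linear, assumption, rule C1_linear[OF bounded_linear_vec_nth])

lemma cjet_jets:
  assumes "open K" "bounded K" "C1 w"
  shows "cjet w \<in> jets K"
proof -
  have wL: "cjet w \<in> L2 K" by (rule L2_continuous[OF assms(1,2) continuous_cjet[OF assms(3)]])
  have "weak_grad K w (cgrad w)"
    unfolding weak_grad_def
  proof (intro allI impI)
    fix \<phi> i j assume \<phi>: "test_fun K \<phi>"
    have t: "grad_test \<phi> i j \<in> L2 K" by (rule grad_test_L2[OF assms(1,2) test_fun_C1[OF \<phi>]])
    have i1: "integrable (lebesgue_on K) (\<lambda>x. w x $ i * of_real (partial j \<phi> x))"
      using cdot_integrable[OF L2_fst_zero[OF wL] t] by (simp add: cdot_grad_test cjet_def)
    have i2: "integrable (lebesgue_on K) (\<lambda>x. cgrad w x $ i $ j * of_real (\<phi> x))"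
      using cdot_integrable[OF L2_snd_zero[OF wL] t] by (simp add: cdot_grad_test cjet_def)
    show "(LINT x|lebesgue_on K. w x $ i * of_real (partial j \<phi> x)) =
        - (LINT x|lebesgue_on K. cgrad w x $ i $ j * of_real (\<phi> x))"
    proof (rule complex_eqI)
      show "Re (LINT x|lebesgue_on K. w x $ i * of_real (partial j \<phi> x)) =
        Re (- (LINT x|lebesgue_on K. cgrad w x $ i $ j * of_real (\<phi> x)))"
        using integration_by_parts[OF assms(1) C1_component[OF assms(3) bounded_linear_Re] \<phi>, of i j]
        by (simp add: partial_component[OF assms(3) bounded_linear_Re] flip: integral_Re[OF i1] integral_Re[OF i2])
      show "Im (LINT x|lebesgue_on K. w x $ i * of_real (partial j \<phi> x)) =
        Im (- (LINT x|lebesgue_on K. cgrad w x $ i $ j * of_real (\<phi> x)))"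
        using integration_by_parts[OF assms(1) C1_component[OF assms(3) bounded_linear_Im] \<phi>, of i j]
        by (simp add: partial_component[OF assms(3) bounded_linear_Im] flip: integral_Im[OF i1] integral_Im[OF i2])
    qed
  qed
  then show ?thesis using wL by (simp add: jets_def cjet_def)
qed

text \<open>
  The real and imaginary parts of the components of \<open>v\<close> are test functions for the weak divergence.
\<close>

lemma green_compact_support:
  assumes "open K" "bounded K" "q \<in> div_jets K"
    "C1 v" "compact (closure {x. v x \<noteq> 0})" "closure {x. v x \<noteq> 0} \<subseteq> K"
  shows "cinner K q (cjet v) = 0"
proof -
  have tf: "test_fun K (\<lambda>x. T (v x $ i))" if "bounded_linear T" for T :: "complex \<Rightarrow> real" and i
  proof -
    have sub: "closure {x. T (v x $ i) \<noteq> 0} \<subseteq> closure {x. v x \<noteq> 0}"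
      using linear_0[OF bounded_linear.linear[OF that]] by (intro closure_mono) auto
    have "compact (closure {x. T (v x $ i) \<noteq> 0})"
      using compact_Int_closed[OF assms(5) closed_closure[of "{x. T (v x $ i) \<noteq> 0}"]]
      unfolding Int_absorb1[OF sub] .
    then show ?thesis
      using sub assms(6) C1_component[OF assms(4) that] by (auto simp: test_fun_def)
  qed
  define a where "a i = (\<lambda>x. Re (v x $ i))" for i
  define b where "b i = (\<lambda>x. Im (v x $ i))" for i
  have ta: "test_fun K (a i)" and tb: "test_fun K (b i)" for i
    unfolding a_def b_def by (intro tf bounded_linear_Re bounded_linear_Im)+
  have qL: "q \<in> L2 K" using assms(3) by (rule div_jets_L2)
  note La = div_test_L2[OF assms(1,2) test_fun_C1[OF ta]] div_test_L2[OF assms(1,2) test_fun_C1[OF tb]]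
  have pa: "partial j (a i) x = Re (cgrad v x $ i $ j)" "partial j (b i) x = Im (cgrad v x $ i $ j)" for i j x
    unfolding a_def b_def by (intro partial_component assms bounded_linear_Re bounded_linear_Im)+
  have eq: "cjet v = (\<lambda>x. \<Sum>i\<in>UNIV. div_test (a i) i x + imul (div_test (b i) i x))"
  proof
    fix x
    have c: "complex_of_real (Re z) + \<i> * complex_of_real (Im z) = z" for z by (simp add: complex_eq_iff)
    have "(\<Sum>i\<in>UNIV. div_test (a i) i x + imul (div_test (b i) i x)) =
        (\<Sum>i\<in>UNIV. ((\<chi> k. if k = i then v x $ i else 0), (\<chi> k l. if k = i then cgrad v x $ i $ l else 0)))"
      by (intro sum.cong refl) (auto simp: div_test_def imul_def prod_eq_iff vec_eq_iff pa[unfolded a_def b_def] a_def b_def c)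
    also have "\<dots> = cjet v x"
      by (simp add: cjet_def prod_eq_iff vec_eq_iff fst_sum snd_sum if_distrib[of "\<lambda>z. z $ _"] cong: if_cong)
    finally show "cjet v x = (\<Sum>i\<in>UNIV. div_test (a i) i x + imul (div_test (b i) i x))" by simp
  qed
  have z: "cinner K q (\<lambda>x. div_test (a i) i x + imul (div_test (b i) i x)) = 0" for i
    using assms(3) ta tb unfolding cinner_add_right[OF qL La(1) L2_imul[OF La(2)]] cinner_imul_right[OF qL La(2)]
      div_jets_iff[OF assms(1,2)] by simp
  show ?thesis
    unfolding eq using cinner_sum_right[of UNIV q K "\<lambda>i x. div_test (a i) i x + imul (div_test (b i) i x)"]
    by (simp add: z qL La L2_add L2_imul)
qed

section \<open>Traces near a Lipschitz boundary\<close>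

definition vec3 :: "(real \<times> real) \<times> real \<Rightarrow> point" where
  "vec3 z = vector [fst (fst z), snd (fst z), snd z]"

lemma vec3_nth [simp]: "vec3 z $ 1 = fst (fst z)" "vec3 z $ 2 = snd (fst z)" "vec3 z $ 3 = snd z"
  by (simp_all add: vec3_def)

lemma linear_vec3: "linear vec3"
  by (rule linearI) (auto simp: vec_eq_iff forall_3)

lemma norm_vec3: "norm (vec3 z) = norm z"
  by (simp add: norm_eq_sqrt_inner inner_vec_def inner_prod_def sum_3)

lemma vec3_measurable: "vec3 \<in> borel_measurable borel"
  using linear_vec3 by (intro borel_measurable_continuous_onI linear_continuous_on linear_conv_bounded_linear[THEN iffD1])

lemma prod_UNIV_3: "(\<Prod>i\<in>UNIV. f i) = f 1 * f 2 * (f (3::3) :: real)"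
  unfolding UNIV_3 by (simp add: mult.assoc)

text \<open>
  Fubini's theorem is available on products, so Euclidean space is identified with a product of lines
  by \<open>vec3\<close>, an isometry which preserves Lebesgue measure.
\<close>

lemma lborel_distr_vec3: "distr lborel borel vec3 = lborel"
proof (rule lborel_eqI[symmetric])
  fix l u :: point assume le: "\<And>b. b \<in> Basis \<Longrightarrow> l \<bullet> b \<le> u \<bullet> b"
  have lu: "l $ i \<le> u $ i" for i using le[of "axis i 1"] by (simp add: inner_axis axis_in_Basis_iff)
  let ?l = "((l $ 1, l $ 2), l $ 3)" and ?u = "((u $ 1, u $ 2), u $ 3)"
  have eq: "vec3 -` box l u = box ?l ?u"
    by (auto simp: mem_box_cart forall_3 mem_box Basis_prod_def)
  have "emeasure (distr lborel borel vec3) (box l u) = emeasure lborel (box ?l ?u)"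
    using vec3_measurable by (subst emeasure_distr) (auto simp: eq)
  also have "\<dots> = (\<Prod>b\<in>Basis. (?u - ?l) \<bullet> b)"
    by (rule emeasure_lborel_box) (use lu in \<open>auto simp: Basis_prod_def\<close>)
  also have "(\<Prod>b\<in>Basis. (?u - ?l) \<bullet> b) = (u $ 1 - l $ 1) * (u $ 2 - l $ 2) * (u $ 3 - l $ 3)"
  proof -
    have B: "Basis = {((1, 0), 0), ((0, 1), 0), ((0, 0), 1 :: real)} \<union> ({} :: ((real \<times> real) \<times> real) set)"
      by (auto simp: Basis_prod_def zero_prod_def)
    show ?thesis unfolding B by simp
  qed
  also have "\<dots> = (\<Prod>b\<in>Basis. (u - l) \<bullet> b)"
  proof -
    have B: "(Basis :: point set) = (\<lambda>i. axis i 1) ` UNIV" by (auto simp: Basis_vec_def)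
    have "inj (\<lambda>i::3. axis i (1::real))" by (auto simp: inj_on_def axis_eq_axis)
    then have "(\<Prod>b\<in>Basis. (u - l) \<bullet> b) = (\<Prod>i\<in>(UNIV::3 set). (u - l) \<bullet> axis i 1)"
      unfolding B by (subst prod.reindex) simp_all
    then show ?thesis by (simp add: inner_axis prod_UNIV_3)
  qed
  finally show "emeasure (distr lborel borel vec3) (box l u) = (\<Prod>b\<in>Basis. (u - l) \<bullet> b)" .
qed simp

lemma lborel_distr_orthogonal:
  fixes f :: "point \<Rightarrow> point"
  assumes "orthogonal_transformation f"
  shows "distr lborel borel f = lborel"
proof (rule lborel_eqI[symmetric])
  fix l u :: point assume le: "\<And>b. b \<in> Basis \<Longrightarrow> l \<bullet> b \<le> u \<bullet> b"
  have cont: "continuous_on UNIV f"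
    using orthogonal_transformation_linear[OF assms] by (simp add: linear_continuous_on linear_conv_bounded_linear)
  have fm: "f \<in> borel_measurable borel" using cont by (rule borel_measurable_continuous_onI)
  have bij: "bij f" by (rule orthogonal_transformation_bij[OF assms])
  have im: "f ` (f -` box l u) = box l u" using bij by (simp add: bij_is_surj surj_image_vimage_eq)
  have op: "open (f -` box l u)" by (rule open_vimage[OF open_box cont])
  have "bounded (f -` box l u)"
  proof -
    have "bounded (box l u)" by (rule bounded_box)
    then obtain B where "\<And>x. x \<in> box l u \<Longrightarrow> norm x \<le> B" by (auto simp: bounded_iff)
    then have "norm x \<le> B" if "x \<in> f -` box l u" for x
      using that orthogonal_transformation_norm[OF assms, of x] by (metis vimageE)
    then show ?thesis by (auto simp: bounded_iff)
  qed
  then have lm: "f -` box l u \<in> lmeasurable" using op by (rule lmeasurable_open)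
  have "emeasure (distr lborel borel f) (box l u) = emeasure lborel (f -` box l u)"
    using fm by (subst emeasure_distr) auto
  also have "\<dots> = emeasure lebesgue (f -` box l u)" using op by simp
  also have "\<dots> = ennreal (measure lebesgue (f -` box l u))" using lm by (rule emeasure_eq_measure2)
  also have "\<dots> = ennreal (measure lebesgue (box l u))"
    using measure_orthogonal_image[OF assms lm] unfolding im by simp
  also have "\<dots> = emeasure lborel (box l u)"
    using emeasure_eq_measure2[OF lmeasurable_open[OF bounded_box open_box], of l u] by simp
  also have "\<dots> = (\<Prod>b\<in>Basis. (u - l) \<bullet> b)" using le by (rule emeasure_lborel_box)
  finally show "emeasure (distr lborel borel f) (box l u) = (\<Prod>b\<in>Basis. (u - l) \<bullet> b)" .
qed simp

text \<open>
  The one-dimensional trace inequality, read backwards: on a short segment a function is controlled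
  by its value at one end point and, with a factor of second order in the length, by its derivative.
\<close>

lemma nn_integral_segment_trace:
  fixes h h' :: "real \<Rightarrow> 'b::euclidean_space"
  assumes "\<tau> > 0" and d: "\<And>t. (h has_vector_derivative h' t) (at t)" and c: "continuous_on UNIV h'"
  shows "(\<integral>\<^sup>+t. indicator {0..\<tau>} t * ennreal ((norm (h t))\<^sup>2) \<partial>lborel) \<le>
     ennreal (2 * \<tau> * (norm (h 0))\<^sup>2) +
     ennreal (4 * \<tau>\<^sup>2) * (\<integral>\<^sup>+t. indicator {0..\<tau>} t * ennreal ((norm (h' t))\<^sup>2) \<partial>lborel)"
proof -
  have ch: "continuous_on UNIV h"
    using d by (meson continuous_at_imp_continuous_on has_vector_derivative_continuous)
  define A where "A = integral {0..\<tau>} (\<lambda>t. (norm (h t))\<^sup>2)"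
  define B where "B = integral {0..\<tau>} (\<lambda>t. (norm (h' t))\<^sup>2)"
  have iA: "((\<lambda>t. (norm (h t))\<^sup>2) has_integral A) {0..\<tau>}" unfolding A_def
    by (intro integrable_integral integrable_continuous_real continuous_intros continuous_on_subset[OF ch]) auto
  have iB: "((\<lambda>t. (norm (h' t))\<^sup>2) has_integral B) {0..\<tau>}" unfolding B_def
    by (intro integrable_integral integrable_continuous_real continuous_intros continuous_on_subset[OF c]) auto
  have Bn: "B \<ge> 0" using has_integral_nonneg[OF iB] by simp
  \<comment> \<open>integrate the derivative of \<open>(t - \<tau>) |h t|\<^sup>2\<close>, which vanishes at \<open>\<tau>\<close>\<close>
  have i1: "((\<lambda>t. h t \<bullet> h t + (t - \<tau>) * (2 * (h t \<bullet> h' t))) has_integral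
      (\<tau> - \<tau>) * (h \<tau> \<bullet> h \<tau>) - (0 - \<tau>) * (h 0 \<bullet> h 0)) {0..\<tau>}"
  proof (rule fundamental_theorem_of_calculus)
    fix t
    have "((\<lambda>t. (t - \<tau>) * (h t \<bullet> h t)) has_vector_derivative h t \<bullet> h t + (t - \<tau>) * (2 * (h t \<bullet> h' t))) (at t)"
    proof -
      have hd: "(h has_derivative (\<lambda>s. s *\<^sub>R h' t)) (at t)" using d[of t] by (simp add: has_vector_derivative_def)
      have "((\<lambda>t. (t - \<tau>) * (h t \<bullet> h t)) has_derivative
          (\<lambda>s. (t - \<tau>) * (h t \<bullet> (s *\<^sub>R h' t) + (s *\<^sub>R h' t) \<bullet> h t) + s * (h t \<bullet> h t))) (at t)"
        by (intro has_derivative_mult has_derivative_inner hd) (auto intro!: derivative_eq_intros)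
      then show ?thesis unfolding has_vector_derivative_def
        by (rule has_derivative_eq_rhs) (simp add: fun_eq_iff inner_commute algebra_simps)
    qed
    then show "((\<lambda>t. (t - \<tau>) * (h t \<bullet> h t)) has_vector_derivative h t \<bullet> h t + (t - \<tau>) * (2 * (h t \<bullet> h' t))) (at t within {0..\<tau>})"
      by (rule has_vector_derivative_at_within)
  qed (use assms in simp)
  have i2: "((\<lambda>t. (1/2) * (norm (h t))\<^sup>2 - (2 * \<tau>\<^sup>2) * (norm (h' t))\<^sup>2) has_integral (1/2) * A - (2 * \<tau>\<^sup>2) * B) {0..\<tau>}"
    by (intro has_integral_diff has_integral_mult_right iA iB)
  have "(1/2) * A - (2 * \<tau>\<^sup>2) * B \<le> (\<tau> - \<tau>) * (h \<tau> \<bullet> h \<tau>) - (0 - \<tau>) * (h 0 \<bullet> h 0)"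
  proof (rule has_integral_le[OF i2 i1])
    fix t assume t: "t \<in> {0..\<tau>}"
    have "\<bar>(t - \<tau>) * (2 * (h t \<bullet> h' t))\<bar> \<le> \<tau> * (2 * (norm (h t) * norm (h' t)))"
      unfolding abs_mult using t Cauchy_Schwarz_ineq2[of "h t" "h' t"] by (intro mult_mono) auto
    also have "\<dots> = 2 * norm (h t) * (\<tau> * norm (h' t))" by simp
    also have "\<dots> \<le> (1/2) * (norm (h t))\<^sup>2 + 2 * (\<tau> * norm (h' t))\<^sup>2"
      using zero_le_power2[of "norm (h t) - 2 * (\<tau> * norm (h' t))"]
      by (simp add: power2_diff power_mult_distrib algebra_simps)
    finally show "(1/2) * (norm (h t))\<^sup>2 - (2 * \<tau>\<^sup>2) * (norm (h' t))\<^sup>2 \<le> h t \<bullet> h t + (t - \<tau>) * (2 * (h t \<bullet> h' t))"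
      by (simp add: power2_norm_eq_inner[symmetric] power_mult_distrib abs_le_iff)
  qed
  then have le: "A \<le> 2 * \<tau> * (norm (h 0))\<^sup>2 + 4 * \<tau>\<^sup>2 * B" by (simp add: power2_norm_eq_inner)
  have nA: "(\<integral>\<^sup>+t. indicator {0..\<tau>} t * ennreal ((norm (h t))\<^sup>2) \<partial>lborel) = ennreal A"
    using nn_integral_has_integral_lebesgue[OF _ iA] by (simp add: ennreal_mult' ennreal_indicator)
  have nB: "(\<integral>\<^sup>+t. indicator {0..\<tau>} t * ennreal ((norm (h' t))\<^sup>2) \<partial>lborel) = ennreal B"
    using nn_integral_has_integral_lebesgue[OF _ iB] by (simp add: ennreal_mult' ennreal_indicator)
  show ?thesis unfolding nA nB using ennreal_leI[OF le] Bn \<open>\<tau> > 0\<close>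
    by (simp add: ennreal_plus ennreal_mult)
qed

definition strip :: "point set \<Rightarrow> real \<Rightarrow> point set" where
  "strip K \<delta> = {y \<in> K. \<exists>b\<in>frontier K. dist y b \<le> \<delta>}"

lemma strip_mono: "\<delta> \<le> \<epsilon> \<Longrightarrow> strip K \<delta> \<subseteq> strip K \<epsilon>"
  unfolding strip_def by force

lemma strip_borel:
  assumes "open K" "bounded K" shows "strip K \<delta> \<in> sets borel"
proof -
  have "compact (frontier K)" using assms(2) by (simp add: compact_frontier_bounded)
  then have "compact {b + z | b z. b \<in> frontier K \<and> z \<in> cball 0 \<delta>}" by (intro compact_sums) auto
  moreover have "{b + z | b z. b \<in> frontier K \<and> z \<in> cball 0 \<delta>} = {y. \<exists>b\<in>frontier K. dist y b \<le> \<delta>}"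
  proof (intro set_eqI iffI; clarsimp)
    fix y b assume "b \<in> frontier K" "dist y b \<le> \<delta>"
    then show "\<exists>b' z. y = b' + z \<and> b' \<in> frontier K \<and> norm z \<le> \<delta>"
      by (intro exI[of _ b] exI[of _ "y - b"]) (simp add: dist_norm)
  next
    fix b and z :: point assume "b \<in> frontier K" "norm z \<le> \<delta>"
    then show "\<exists>b'\<in>frontier K. dist (b + z) b' \<le> \<delta>" by (intro bexI[of _ b]) (simp_all add: dist_norm)
  qed
  ultimately have "{y. \<exists>b\<in>frontier K. dist y b \<le> \<delta>} \<in> sets borel" by (simp add: borel_compact)
  moreover have "strip K \<delta> = K \<inter> {y. \<exists>b\<in>frontier K. dist y b \<le> \<delta>}" by (auto simp: strip_def)
  ultimately show ?thesis using assms(1) by simp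
qed

lemma norm_matrix_mult_le:
  fixes M :: "complex^3^3" and e :: point
  shows "norm (\<chi> i. \<Sum>j\<in>UNIV. of_real (e $ j) * M $ i $ j) \<le> norm M * norm e"
proof -
  have "norm (\<Sum>j\<in>UNIV. of_real (e $ j) * M $ i $ j) \<le> norm (M $ i) * norm e" for i
  proof -
    have "norm (\<Sum>j\<in>UNIV. of_real (e $ j) * M $ i $ j) \<le> (\<Sum>j\<in>UNIV. \<bar>norm (M $ i $ j)\<bar> * \<bar>e $ j\<bar>)"
      by (rule order_trans[OF norm_sum]) (simp add: norm_mult mult.commute)
    also have "\<dots> \<le> L2_set (\<lambda>j. norm (M $ i $ j)) UNIV * L2_set (\<lambda>j. e $ j) UNIV"
      by (rule L2_set_mult_ineq)
    also have "\<dots> = norm (M $ i) * norm e" by (simp add: norm_vec_def L2_set_def)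
    finally show ?thesis .
  qed
  then have "L2_set (\<lambda>i. norm (\<Sum>j\<in>UNIV. of_real (e $ j) * M $ i $ j)) UNIV \<le> L2_set (\<lambda>i. norm (M $ i) * norm e) UNIV"
    by (intro L2_set_mono) auto
  also have "\<dots> = L2_set (\<lambda>i. norm (M $ i)) UNIV * norm e" by (simp add: L2_set_left_distrib)
  finally show ?thesis by (simp add: norm_vec_def)
qed

lemma C1_derivative_cgrad:
  assumes "C1 w"
  shows "frechet_derivative w (at x) e = (\<chi> i. \<Sum>j\<in>UNIV. of_real (e $ j) * cgrad w x $ i $ j)"
proof -
  have lin: "linear (frechet_derivative w (at x))"
    using C1_has_derivative[OF assms] by (rule has_derivative_linear)
  have "frechet_derivative w (at x) e = frechet_derivative w (at x) (\<Sum>j\<in>UNIV. e $ j *\<^sub>R axis j 1)"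
    using basis_expansion[of e] by (simp add: scalar_mult_eq_scaleR)
  also have "\<dots> = (\<Sum>j\<in>UNIV. e $ j *\<^sub>R frechet_derivative w (at x) (axis j 1))"
    by (simp add: linear_sum[OF lin] linear_cmul[OF lin])
  finally show ?thesis
    by (simp add: vec_eq_iff cgrad_def scaleR_conv_of_real[where 'a = complex])
qed

lemma norm_C1_derivative_le:
  assumes "C1 w" shows "norm (frechet_derivative w (at x) e) \<le> norm (cgrad w x) * norm e"
  unfolding C1_derivative_cgrad[OF assms] by (rule norm_matrix_mult_le)

locale lipschitz_chart =
  fixes K :: "point set" and x0 :: point and r L :: real and \<Phi> :: "point \<Rightarrow> point" and \<gamma> :: "real \<times> real \<Rightarrow> real"
  assumes K: "open K" and r: "r > 0" and \<Phi>: "orthogonal_transformation \<Phi>" and lip: "L-lipschitz_on UNIV \<gamma>"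
    and chart: "K \<inter> ball x0 r = {y \<in> ball x0 r. \<gamma> (\<Phi> y $ 1, \<Phi> y $ 2) < \<Phi> y $ 3}"
begin

text \<open>
  \<open>Q\<close> maps chart coordinates to points; in them the boundary is the graph of \<open>\<gamma>\<close> over the plane, and
  \<open>up\<close> is the vertical direction pointing into the domain.
\<close>

definition Q :: "(real \<times> real) \<times> real \<Rightarrow> point" where "Q z = inv \<Phi> (vec3 z)"

definition graph :: "real \<times> real \<Rightarrow> point" where "graph y = Q (y, \<gamma> y)"

definition up :: point where "up = Q ((0, 0), 1)"

lemma orthogonal_inv: "orthogonal_transformation (inv \<Phi>)"
  using orthogonal_transformation_inv[OF \<Phi>] .

lemma linear_Q: "linear Q"
  using linear_compose[OF linear_vec3 orthogonal_transformation_linear[OF orthogonal_inv]]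
  by (simp add: Q_def[abs_def] comp_def)

lemma norm_Q: "norm (Q z) = norm z"
  by (simp add: Q_def orthogonal_transformation_norm[OF orthogonal_inv] norm_vec3)

lemma dist_Q: "dist (Q z) (Q z') = dist z z'"
  using norm_Q[of "z - z'"] by (simp add: dist_norm linear_diff[OF linear_Q])

lemma \<Phi>_Q: "\<Phi> (Q z) = vec3 z"
  unfolding Q_def using surj_f_inv_f[OF orthogonal_transformation_surj[OF \<Phi>]] by simp

lemma Q_\<Phi>: "Q ((\<Phi> y $ 1, \<Phi> y $ 2), \<Phi> y $ 3) = y"
proof -
  have "vec3 ((\<Phi> y $ 1, \<Phi> y $ 2), \<Phi> y $ 3) = \<Phi> y" by (simp add: vec_eq_iff forall_3)
  then show ?thesis unfolding Q_def using inv_f_f[OF orthogonal_transformation_inj[OF \<Phi>]] by simp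
qed

lemma continuous_Q: "continuous_on S Q"
  using linear_Q by (simp add: linear_continuous_on linear_conv_bounded_linear)

lemma norm_up: "norm up = 1" by (simp add: up_def norm_Q norm_Pair)

lemma Q_up: "Q (y, s + t) = Q (y, s) + t *\<^sub>R up"
proof -
  have "(y, s + t) = (y, s) + t *\<^sub>R ((0, 0), 1)" by (simp add: zero_prod_def[symmetric])
  then show ?thesis unfolding up_def using linear_add[OF linear_Q] linear_cmul[OF linear_Q] by metis
qed

lemma in_chart_iff: "Q (y, s) \<in> ball x0 r \<Longrightarrow> Q (y, s) \<in> K \<longleftrightarrow> \<gamma> y < s"
proof -
  assume "Q (y, s) \<in> ball x0 r"
  then have "Q (y, s) \<in> K \<longleftrightarrow> Q (y, s) \<in> K \<inter> ball x0 r" by simp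
  also have "\<dots> \<longleftrightarrow> \<gamma> y < s" unfolding chart using \<open>Q (y, s) \<in> ball x0 r\<close> by (simp add: \<Phi>_Q)
  finally show ?thesis .
qed

lemma continuous_\<gamma>: "continuous_on S \<gamma>"
  using lipschitz_on_continuous_on[OF lip] continuous_on_subset by blast

lemma continuous_graph: "continuous_on S graph"
  unfolding graph_def by (intro continuous_on_compose2[OF continuous_Q] continuous_intros continuous_\<gamma>) auto

lemma graph_frontier: "graph y \<in> ball x0 r \<Longrightarrow> graph y \<in> frontier K"
proof -
  assume b: "graph y \<in> ball x0 r"
  have "graph y \<notin> K" using in_chart_iff[of y "\<gamma> y"] b by (simp add: graph_def)
  moreover have "graph y \<in> closure K"
  proof -
    have lim: "(\<lambda>n. Q (y, \<gamma> y + 1 / real (Suc n))) \<longlonglongrightarrow> Q (y, \<gamma> y + 0)"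
      by (intro continuous_on_tendsto_compose[OF continuous_Q[of UNIV]] tendsto_intros)
         (use LIMSEQ_inverse_real_of_nat in \<open>auto simp: inverse_eq_divide\<close>)
    then have "\<forall>\<^sub>F n in sequentially. Q (y, \<gamma> y + 1 / real (Suc n)) \<in> ball x0 r"
      using b by (intro topological_tendstoD) (auto simp: graph_def)
    then have "\<forall>\<^sub>F n in sequentially. Q (y, \<gamma> y + 1 / real (Suc n)) \<in> closure K"
    proof eventually_elim
      case (elim n)
      then show ?case using in_chart_iff[OF elim] closure_subset[of K] by auto
    qed
    then show ?thesis using Lim_in_closed_set[OF closed_closure _ _ lim] by (simp add: graph_def)
  qed
  ultimately show ?thesis using K by (simp add: frontier_def interior_open)
qed

lemma frontier_graph:
  assumes "b \<in> frontier K" "b \<in> ball x0 r"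
  shows "b = graph (\<Phi> b $ 1, \<Phi> b $ 2)"
proof -
  have "b \<notin> K" using assms(1) K by (simp add: frontier_def interior_open)
  then have ge: "\<Phi> b $ 3 \<le> \<gamma> (\<Phi> b $ 1, \<Phi> b $ 2)" using chart assms(2) by (metis (mono_tags, lifting) IntI mem_Collect_eq Int_iff not_le)
  have "b \<in> closure (K \<inter> ball x0 r)"
    using assms open_Int_closure_subset[OF open_ball, of x0 r K] by (auto simp: frontier_def Int_commute)
  also have "closure (K \<inter> ball x0 r) \<subseteq> {y. \<gamma> (\<Phi> y $ 1, \<Phi> y $ 2) \<le> \<Phi> y $ 3}"
  proof (rule closure_minimal)
    show "K \<inter> ball x0 r \<subseteq> {y. \<gamma> (\<Phi> y $ 1, \<Phi> y $ 2) \<le> \<Phi> y $ 3}" unfolding chart by auto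
    have "continuous_on UNIV \<Phi>"
      using orthogonal_transformation_linear[OF \<Phi>] by (simp add: linear_continuous_on linear_conv_bounded_linear)
    then show "closed {y. \<gamma> (\<Phi> y $ 1, \<Phi> y $ 2) \<le> \<Phi> y $ 3}"
      by (intro closed_Collect_le continuous_on_compose2[OF continuous_\<gamma>] continuous_intros) auto
  qed
  finally have "\<gamma> (\<Phi> b $ 1, \<Phi> b $ 2) = \<Phi> b $ 3" using ge by simp
  then show ?thesis using Q_\<Phi>[of b] by (simp add: graph_def)
qed

text \<open>
  Chart coordinates measured from the graph, \<open>graph y + t up\<close>, preserve volume: \<open>\<Phi>\<close> is orthogonal, and
  the vertical shift by \<open>\<gamma> y\<close> is a translation on each line. No change of variables
  formula with Jacobian is involved although \<open>\<gamma>\<close> is only Lipschitz.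
\<close>

lemma nn_integral_chart:
  assumes [measurable]: "f \<in> borel_measurable borel"
  shows "(\<integral>\<^sup>+y. f y \<partial>lborel) = (\<integral>\<^sup>+y. (\<integral>\<^sup>+t. f (graph y + t *\<^sub>R up) \<partial>lborel) \<partial>lborel)"
proof -
  have iM: "inv \<Phi> \<in> borel_measurable borel"
    using orthogonal_transformation_linear[OF orthogonal_inv]
    by (intro borel_measurable_continuous_onI linear_continuous_on) (simp add: linear_conv_bounded_linear)
  have QM[measurable]: "Q \<in> borel_measurable borel"
    by (rule borel_measurable_continuous_onI[OF continuous_Q])
  have dQ: "distr lborel borel Q = lborel"
  proof -
    have "distr lborel borel Q = distr (distr lborel borel vec3) borel (inv \<Phi>)"
      using iM vec3_measurable by (subst distr_distr) (auto simp: Q_def[abs_def] comp_def)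
    then show ?thesis by (simp add: lborel_distr_vec3 lborel_distr_orthogonal[OF orthogonal_inv])
  qed
  have "(\<integral>\<^sup>+y. f y \<partial>lborel) = (\<integral>\<^sup>+y. f y \<partial>(distr lborel borel Q))" by (simp add: dQ)
  also have "\<dots> = (\<integral>\<^sup>+z. f (Q z) \<partial>lborel)" by (rule nn_integral_distr) auto
  also have "\<dots> = (\<integral>\<^sup>+z. f (Q z) \<partial>(lborel \<Otimes>\<^sub>M lborel))" by (simp add: lborel_prod)
  also have "\<dots> = (\<integral>\<^sup>+y. (\<integral>\<^sup>+s. f (Q (y, s)) \<partial>lborel) \<partial>lborel)"
    by (rule lborel.nn_integral_fst[symmetric]) (simp add: lborel_prod)
  also have "\<dots> = (\<integral>\<^sup>+y. (\<integral>\<^sup>+t. f (graph y + t *\<^sub>R up) \<partial>lborel) \<partial>lborel)"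
  proof (rule nn_integral_cong)
    fix y :: "real \<times> real"
    have "(\<lambda>s. f (Q (y, s))) \<in> borel_measurable borel"
      by (rule measurable_compose[OF borel_measurable_continuous_onI assms])
         (intro continuous_on_compose2[OF continuous_Q[of UNIV]] continuous_intros, auto)
    from nn_integral_real_affine[OF this, of 1 "\<gamma> y"]
    show "(\<integral>\<^sup>+s. f (Q (y, s)) \<partial>lborel) = (\<integral>\<^sup>+t. f (graph y + t *\<^sub>R up) \<partial>lborel)"
      by (simp add: Q_up graph_def)
  qed
  finally show ?thesis .
qed

text \<open>
  Each vertical line meets the boundary in at most one point of the chart.
\<close>

lemma frontier_null_chart: "emeasure lborel (frontier K \<inter> ball x0 r) = 0"
proof -
  have B: "frontier K \<inter> ball x0 r \<in> sets borel" by (simp add: borel_closed)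
  have zero: "indicator (frontier K \<inter> ball x0 r) (graph y + t *\<^sub>R up) \<le> (indicator {0} t :: ennreal)" for y t
  proof (cases "graph y + t *\<^sub>R up \<in> frontier K \<inter> ball x0 r")
    case True
    let ?b = "graph y + t *\<^sub>R up"
    have b: "?b = Q (y, \<gamma> y + t)" by (simp add: graph_def Q_up)
    have "?b = graph (\<Phi> ?b $ 1, \<Phi> ?b $ 2)" using frontier_graph True by blast
    also have "(\<Phi> ?b $ 1, \<Phi> ?b $ 2) = y" unfolding b \<Phi>_Q by simp
    finally have "t *\<^sub>R up = 0" by simp
    then have "t = 0" using norm_up by auto
    then show ?thesis by (simp add: indicator_def)
  qed simp
  have "emeasure lborel (frontier K \<inter> ball x0 r) = (\<integral>\<^sup>+y. indicator (frontier K \<inter> ball x0 r) y \<partial>lborel)"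
    using B by simp
  also have "\<dots> = (\<integral>\<^sup>+y. (\<integral>\<^sup>+t. indicator (frontier K \<inter> ball x0 r) (graph y + t *\<^sub>R up) \<partial>lborel) \<partial>lborel)"
    using B by (intro nn_integral_chart borel_measurable_indicator)
  also have "\<dots> \<le> nn_integral lborel (\<lambda>y :: real \<times> real. \<integral>\<^sup>+t. indicator {0::real} t \<partial>lborel)"
    by (intro nn_integral_mono zero)
  also have "\<dots> = 0" by simp
  finally show ?thesis by simp
qed

text \<open>
  Projecting a set of diameter \<open>d\<close> along \<open>up\<close> gives a set contained in a square of side \<open>2 d\<close>; so
  the area of the shadow of a piece of the graph is controlled by its Hausdorff measure.
\<close>

lemma graph_shadow_le: "ennreal (pi / 16) * emeasure lborel (graph -` B) \<le> hausdorff2 B"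
proof -
  have "ennreal (pi / 16) * emeasure lborel (graph -` B) \<le> hausdorff2_delta 1 B"
    unfolding hausdorff2_delta_def
  proof (rule INF_greatest, clarify)
    fix C :: "nat \<Rightarrow> point set"
    assume C: "B \<subseteq> (\<Union>i. C i)" "\<forall>i. bounded (C i) \<and> diameter (C i) \<le> 1"
    define d where "d i = diameter (C i)" for i
    have d0: "d i \<ge> 0" for i unfolding d_def using C(2) by (simp add: diameter_ge_0)
    have "\<exists>c. graph -` C i \<subseteq> cbox (c - (d i, d i)) (c + (d i, d i))" for i
    proof (cases "graph -` C i = {}")
      case False
      then obtain c where c: "graph c \<in> C i" by blast
      have "y \<in> cbox (c - (d i, d i)) (c + (d i, d i))" if "graph y \<in> C i" for y
      proof -
        have "dist y c \<le> dist (graph y) (graph c)"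
          unfolding graph_def dist_Q by (simp add: dist_Pair_Pair)
        also have "\<dots> \<le> d i" unfolding d_def using that c C(2) by (intro diameter_bounded_bound) auto
        finally have "dist y c \<le> d i" .
        then have "\<bar>fst y - fst c\<bar> \<le> d i" "\<bar>snd y - snd c\<bar> \<le> d i"
          using dist_fst_le[of y c] dist_snd_le[of y c] by (simp_all add: dist_real_def)
        then show ?thesis by (auto simp: mem_box Basis_prod_def abs_le_iff inner_prod_def)
      qed
      then show ?thesis by blast
    qed auto
    then obtain c where c: "\<And>i. graph -` C i \<subseteq> cbox (c i - (d i, d i)) (c i + (d i, d i))" by metis
    have em: "emeasure lborel (cbox (c i - (d i, d i)) (c i + (d i, d i))) = ennreal (4 * (d i)\<^sup>2)" for i
    proof -
      have B: "Basis = {(1, 0), (0, 1 :: real)} \<union> ({} :: (real \<times> real) set)" by (auto simp: Basis_prod_def)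
      have "emeasure lborel (cbox (c i - (d i, d i)) (c i + (d i, d i))) =
          (\<Prod>b\<in>Basis. ((c i + (d i, d i)) - (c i - (d i, d i))) \<bullet> b)"
        by (rule emeasure_lborel_cbox) (use d0 in \<open>auto simp: Basis_prod_def inner_prod_def\<close>)
      also have "\<dots> = ennreal (4 * (d i)\<^sup>2)" unfolding B by (simp add: inner_prod_def power2_eq_square)
      finally show ?thesis .
    qed
    have "graph -` B \<subseteq> (\<Union>i. cbox (c i - (d i, d i)) (c i + (d i, d i)))" using C(1) c by fastforce
    then have "emeasure lborel (graph -` B) \<le> emeasure lborel (\<Union>i. cbox (c i - (d i, d i)) (c i + (d i, d i)))"
      by (intro emeasure_mono) auto
    also have "\<dots> \<le> (\<Sum>i. emeasure lborel (cbox (c i - (d i, d i)) (c i + (d i, d i))))"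
      by (intro emeasure_subadditive_countably) auto
    also have "\<dots> = (\<Sum>i. ennreal (4 * (d i)\<^sup>2))" by (simp add: em)
    finally have "ennreal (pi / 16) * emeasure lborel (graph -` B) \<le> ennreal (pi / 16) * (\<Sum>i. ennreal (4 * (d i)\<^sup>2))"
      by (rule mult_left_mono) simp
    also have "\<dots> = (\<Sum>i. ennreal (pi / 16) * ennreal (4 * (d i)\<^sup>2))" by (rule ennreal_suminf_cmult[symmetric])
    also have "\<dots> = (\<Sum>i. ennreal (pi / 4 * (diameter (C i))\<^sup>2))"
      by (simp add: ennreal_mult[symmetric] d_def)
    finally show "ennreal (pi / 16) * emeasure lborel (graph -` B) \<le> (\<Sum>i. ennreal (pi / 4 * (diameter (C i))\<^sup>2))" .
  qed
  also have "\<dots> \<le> hausdorff2 B" by (rule hausdorff2_delta_le_hausdorff2) simp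
  finally show ?thesis .
qed

lemma nn_integral_graph_le:
  assumes f: "f \<in> borel_measurable borel"
  shows "ennreal (pi / 16) * (\<integral>\<^sup>+y. f (graph y) \<partial>lborel) \<le> (\<integral>\<^sup>+y. f y \<partial>surface)"
proof -
  have gm: "graph \<in> borel_measurable borel" by (rule borel_measurable_continuous_onI[OF continuous_graph])
  let ?M = "scale_measure (ennreal (pi / 16)) (distr lborel borel graph)"
  have sets: "sets ?M = sets surface" by simp
  have "?M \<le> surface"
    unfolding le_measure[OF sets] using graph_shadow_le gm by (auto simp: emeasure_surface emeasure_distr)
  then have "nn_integral ?M f \<le> nn_integral surface f" by (intro nn_integral_mono_measure) auto
  moreover have "nn_integral ?M f = ennreal (pi / 16) * (\<integral>\<^sup>+y. f (graph y) \<partial>lborel)"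
    using f gm by (subst nn_integral_scale_measure) (auto simp: nn_integral_distr)
  ultimately show ?thesis by simp
qed

text \<open>
  Each vertical line enters the domain at the graph, so the one-dimensional inequality applies on it
  with the boundary value at one end; integrating over the lines gives the volume integrals. The
  shadow of the graph is compared with surface measure, which turns \<open>2 \<tau>\<close> into
  \<open>2 \<tau> / (pi / 16) = 32 / pi * \<tau>\<close>. The bound \<open>\<tau> \<le> r / 4\<close> keeps the segments over points of the half
  ball inside the chart.
\<close>

lemma strip_estimate_chart:
  assumes w: "C1 (w :: vfield)" and \<tau>: "0 < \<tau>" "\<tau> \<le> r / 4" and bK: "bounded K"
    and S: "S \<in> sets borel" "S \<subseteq> K \<inter> ball x0 (r / 2)" "\<And>y. y \<in> S \<Longrightarrow> \<Phi> y $ 3 - \<gamma> (\<Phi> y $ 1, \<Phi> y $ 2) \<le> \<tau>"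
  shows "(\<integral>\<^sup>+y. indicator S y * ennreal ((norm (w y))\<^sup>2) \<partial>lborel) \<le>
     ennreal (32 / pi * \<tau>) * (\<integral>\<^sup>+y. indicator (frontier K) y * ennreal ((norm (w y))\<^sup>2) \<partial>surface) +
     ennreal (4 * \<tau>\<^sup>2) * (\<integral>\<^sup>+y. indicator (strip K \<tau>) y * ennreal ((norm (cgrad w y))\<^sup>2) \<partial>lborel)"
proof -
  define Y where "Y = {y. graph y \<in> ball x0 (3 * r / 4)}"
  have YB[measurable]: "Y \<in> sets borel"
  proof -
    have "Y = graph -` ball x0 (3 * r / 4)" by (auto simp: Y_def)
    then have "open Y" using open_vimage[OF open_ball continuous_graph[of UNIV]] by simp
    then show ?thesis by simp
  qed
  have Yf: "graph y \<in> frontier K" if "y \<in> Y" for y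
    using that r by (intro graph_frontier) (auto simp: Y_def)
  have [measurable]: "w \<in> borel_measurable borel" by (rule borel_measurable_continuous_onI[OF C1_continuous[OF w]])
  have [measurable]: "cgrad w \<in> borel_measurable borel"
    using continuous_on_snd[OF continuous_cjet[OF w]] by (intro borel_measurable_continuous_onI) (simp add: cjet_def)
  have [measurable]: "graph \<in> borel_measurable borel" by (rule borel_measurable_continuous_onI[OF continuous_graph])
  have [measurable]: "S \<in> sets borel" by fact
  have [measurable]: "frontier K \<in> sets borel" by (simp add: borel_closed)
  have SB[measurable]: "strip K \<tau> \<in> sets borel" by (rule strip_borel[OF K bK])
  have inS: "y \<in> Y \<and> t \<in> {0..\<tau>}" if "graph y + t *\<^sub>R up \<in> S" for y t
  proof -
    let ?p = "graph y + t *\<^sub>R up"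
    have p: "?p = Q (y, \<gamma> y + t)" by (simp add: graph_def Q_up)
    have pb: "?p \<in> ball x0 (r / 2)" "?p \<in> K" using that S(2) by auto
    then have "Q (y, \<gamma> y + t) \<in> ball x0 r" using r unfolding p by auto
    then have "\<gamma> y < \<gamma> y + t" using in_chart_iff pb(2) unfolding p by blast
    moreover have "t \<le> \<tau>" using S(3)[OF that] unfolding p \<Phi>_Q by simp
    ultimately have t: "0 < t" "t \<le> \<tau>" by auto
    have "dist (graph y) ?p = t" using t norm_up by (simp add: dist_norm)
    then have "dist x0 (graph y) < 3 * r / 4"
      using pb(1) dist_triangle[of x0 "graph y" ?p] t \<tau> by (simp add: dist_commute)
    then show ?thesis using t by (simp add: Y_def)
  qed
  have inStrip: "graph y + t *\<^sub>R up \<in> strip K \<tau>" if "y \<in> Y" "0 < t" "t \<le> \<tau>" for y t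
  proof -
    let ?p = "graph y + t *\<^sub>R up"
    have p: "?p = Q (y, \<gamma> y + t)" by (simp add: graph_def Q_up)
    have d: "dist ?p (graph y) = t" using that norm_up by (simp add: dist_norm)
    have "dist x0 ?p < r"
      using that d dist_triangle[of x0 ?p "graph y"] \<tau> by (simp add: Y_def dist_commute)
    then have "?p \<in> K" using in_chart_iff[of y "\<gamma> y + t"] that(2) unfolding p by simp
    then show ?thesis using Yf[OF that(1)] d that(3) by (auto simp: strip_def intro!: bexI[of _ "graph y"])
  qed
  define D where "D y t = frechet_derivative w (at (graph y + t *\<^sub>R up)) up" for y t
  have vd: "((\<lambda>t. w (graph y + t *\<^sub>R up)) has_vector_derivative D y t) (at t)" for y t
  proof -
    have "((\<lambda>t. w (graph y + t *\<^sub>R up)) has_derivative (\<lambda>h. frechet_derivative w (at (graph y + t *\<^sub>R up)) (h *\<^sub>R up))) (at t)"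
      by (rule has_derivative_compose[of "\<lambda>t. graph y + t *\<^sub>R up" "\<lambda>h. h *\<^sub>R up", OF _ C1_has_derivative[OF w]])
         (auto intro!: derivative_eq_intros)
    then show ?thesis unfolding has_vector_derivative_def D_def
      using linear_cmul[OF has_derivative_linear[OF C1_has_derivative[OF w]]] by simp
  qed
  have cD: "continuous_on UNIV (D y)" for y unfolding D_def
    by (intro continuous_on_compose2[OF C1_continuous_derivative[OF w]] continuous_intros) auto
  have Dle: "norm (D y t) \<le> norm (cgrad w (graph y + t *\<^sub>R up))" for y t
    unfolding D_def using norm_C1_derivative_le[OF w, of _ up] norm_up by simp
  have "(\<integral>\<^sup>+y. indicator S y * ennreal ((norm (w y))\<^sup>2) \<partial>lborel) =
      (\<integral>\<^sup>+y. (\<integral>\<^sup>+t. indicator S (graph y + t *\<^sub>R up) * ennreal ((norm (w (graph y + t *\<^sub>R up)))\<^sup>2) \<partial>lborel) \<partial>lborel)"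
    by (rule nn_integral_chart) measurable
  also have "\<dots> \<le> (\<integral>\<^sup>+y. ennreal (2 * \<tau>) * (indicator (frontier K) (graph y) * ennreal ((norm (w (graph y)))\<^sup>2)) +
      ennreal (4 * \<tau>\<^sup>2) * (\<integral>\<^sup>+t. indicator (strip K \<tau>) (graph y + t *\<^sub>R up) * ennreal ((norm (cgrad w (graph y + t *\<^sub>R up)))\<^sup>2) \<partial>lborel) \<partial>lborel)"
  proof (rule nn_integral_mono)
    fix y
    show "(\<integral>\<^sup>+t. indicator S (graph y + t *\<^sub>R up) * ennreal ((norm (w (graph y + t *\<^sub>R up)))\<^sup>2) \<partial>lborel)
      \<le> ennreal (2 * \<tau>) * (indicator (frontier K) (graph y) * ennreal ((norm (w (graph y)))\<^sup>2)) +
      ennreal (4 * \<tau>\<^sup>2) * (\<integral>\<^sup>+t. indicator (strip K \<tau>) (graph y + t *\<^sub>R up) * ennreal ((norm (cgrad w (graph y + t *\<^sub>R up)))\<^sup>2) \<partial>lborel)"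
    proof (cases "y \<in> Y")
      case False
      then have "indicator S (graph y + t *\<^sub>R up) = (0::ennreal)" for t using inS[of y t] by (auto simp: indicator_def)
      then show ?thesis by simp
    next
      case True
      have "(\<integral>\<^sup>+t. indicator S (graph y + t *\<^sub>R up) * ennreal ((norm (w (graph y + t *\<^sub>R up)))\<^sup>2) \<partial>lborel)
        \<le> (\<integral>\<^sup>+t. indicator {0..\<tau>} t * ennreal ((norm (w (graph y + t *\<^sub>R up)))\<^sup>2) \<partial>lborel)"
        using inS by (intro nn_integral_mono mult_right_mono) (auto simp: indicator_def)
      also have "\<dots> \<le> ennreal (2 * \<tau> * (norm (w (graph y + 0 *\<^sub>R up)))\<^sup>2) +
          ennreal (4 * \<tau>\<^sup>2) * (\<integral>\<^sup>+t. indicator {0..\<tau>} t * ennreal ((norm (D y t))\<^sup>2) \<partial>lborel)"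
        by (rule nn_integral_segment_trace[OF \<tau>(1) vd cD])
      also have "\<dots> \<le> ennreal (2 * \<tau>) * (indicator (frontier K) (graph y) * ennreal ((norm (w (graph y)))\<^sup>2)) +
          ennreal (4 * \<tau>\<^sup>2) * (\<integral>\<^sup>+t. indicator (strip K \<tau>) (graph y + t *\<^sub>R up) * ennreal ((norm (cgrad w (graph y + t *\<^sub>R up)))\<^sup>2) \<partial>lborel)"
      proof (intro add_mono mult_left_mono nn_integral_mono_AE)
        show "ennreal (2 * \<tau> * (norm (w (graph y + 0 *\<^sub>R up)))\<^sup>2)
            \<le> ennreal (2 * \<tau>) * (indicator (frontier K) (graph y) * ennreal ((norm (w (graph y)))\<^sup>2))"
          using Yf[OF True] \<tau>(1) by (simp add: ennreal_mult)
        show "AE t in lborel. indicator {0..\<tau>} t * ennreal ((norm (D y t))\<^sup>2)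
            \<le> indicator (strip K \<tau>) (graph y + t *\<^sub>R up) * ennreal ((norm (cgrad w (graph y + t *\<^sub>R up)))\<^sup>2)"
          using AE_lborel_singleton[of 0]
        proof eventually_elim
          case (elim t)
          show ?case
          proof (cases "t \<in> {0..\<tau>}")
            case t: True
            then have "graph y + t *\<^sub>R up \<in> strip K \<tau>" using inStrip[OF True] elim by auto
            then show ?thesis using t power_mono[OF Dle norm_ge_zero, of y t 2] by (simp add: ennreal_leI)
          qed simp
        qed
      qed auto
      finally show ?thesis .
    qed
  qed
  also have "\<dots> = ennreal (2 * \<tau>) * (\<integral>\<^sup>+y. indicator (frontier K) (graph y) * ennreal ((norm (w (graph y)))\<^sup>2) \<partial>lborel) +
      ennreal (4 * \<tau>\<^sup>2) * (\<integral>\<^sup>+y. (\<integral>\<^sup>+t. indicator (strip K \<tau>) (graph y + t *\<^sub>R up) * ennreal ((norm (cgrad w (graph y + t *\<^sub>R up)))\<^sup>2) \<partial>lborel) \<partial>lborel)"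
    by (subst nn_integral_add) (measurable, simp add: nn_integral_cmult)
  also have "(\<integral>\<^sup>+y. (\<integral>\<^sup>+t. indicator (strip K \<tau>) (graph y + t *\<^sub>R up) * ennreal ((norm (cgrad w (graph y + t *\<^sub>R up)))\<^sup>2) \<partial>lborel) \<partial>lborel)
      = (\<integral>\<^sup>+y. indicator (strip K \<tau>) y * ennreal ((norm (cgrad w y))\<^sup>2) \<partial>lborel)"
    by (rule nn_integral_chart[symmetric]) measurable
  also have "ennreal (2 * \<tau>) * (\<integral>\<^sup>+y. indicator (frontier K) (graph y) * ennreal ((norm (w (graph y)))\<^sup>2) \<partial>lborel)
      = ennreal (32 / pi * \<tau>) * (ennreal (pi / 16) * (\<integral>\<^sup>+y. indicator (frontier K) (graph y) * ennreal ((norm (w (graph y)))\<^sup>2) \<partial>lborel))"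
    using \<tau>(1) by (simp add: mult.assoc[symmetric] ennreal_mult[symmetric])
  also have "\<dots> \<le> ennreal (32 / pi * \<tau>) * (\<integral>\<^sup>+y. indicator (frontier K) y * ennreal ((norm (w y))\<^sup>2) \<partial>surface)"
    by (intro mult_left_mono nn_integral_graph_le) (auto simp: borel_closed)
  finally show ?thesis by (simp add: add_right_mono)
qed

end

lemma lipschitz_domain_open: "lipschitz_domain K \<Longrightarrow> open K"
  and lipschitz_domain_bounded: "lipschitz_domain K \<Longrightarrow> bounded K"
  by (simp_all add: lipschitz_domain_def)

lemma lipschitz_domain_chart:
  assumes "lipschitz_domain K" "x \<in> frontier K"
  obtains r L \<Phi> \<gamma> where "lipschitz_chart K x r L \<Phi> \<gamma>"
  using assms unfolding lipschitz_domain_def lipschitz_chart_def by blast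

lemma frontier_lipschitz_domain_null:
  assumes "lipschitz_domain K"
  shows "frontier K \<in> null_sets lborel"
proof -
  have "\<exists>r>0. emeasure lborel (frontier K \<inter> ball x r) = 0" if "x \<in> frontier K" for x
    using lipschitz_domain_chart[OF assms that] lipschitz_chart.frontier_null_chart lipschitz_chart.r by metis
  then obtain \<rho> where \<rho>: "\<And>x. x \<in> frontier K \<Longrightarrow> \<rho> x > 0"
      "\<And>x. x \<in> frontier K \<Longrightarrow> emeasure lborel (frontier K \<inter> ball x (\<rho> x)) = 0"
    by metis
  have "compact (frontier K)" using lipschitz_domain_bounded[OF assms] by (simp add: compact_frontier_bounded)
  then obtain F where F: "F \<subseteq> frontier K" "finite F" "frontier K \<subseteq> (\<Union>x\<in>F. ball x (\<rho> x))"
    using \<rho>(1) by (elim compactE_image[where C = "frontier K" and f = "\<lambda>x. ball x (\<rho> x)"]) force+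
  have "(\<Union>x\<in>F. frontier K \<inter> ball x (\<rho> x)) \<in> null_sets lborel"
    using F \<rho>(2) by (intro null_sets.finite_UN) (auto intro!: null_setsI borel_closed sets.Int simp: subset_iff)
  moreover have "(\<Union>x\<in>F. frontier K \<inter> ball x (\<rho> x)) = frontier K" using F(3) by blast
  ultimately show ?thesis by simp
qed

abbreviation bdry_sq :: "point set \<Rightarrow> vfield \<Rightarrow> ennreal" where
  "bdry_sq K w \<equiv> \<integral>\<^sup>+y. indicator (frontier K) y * ennreal ((norm (w y))\<^sup>2) \<partial>surface"

abbreviation strip_sq :: "point set \<Rightarrow> real \<Rightarrow> (point \<Rightarrow> 'b::real_normed_vector) \<Rightarrow> ennreal" where
  "strip_sq K \<delta> f \<equiv> \<integral>\<^sup>+y. indicator (strip K \<delta>) y * ennreal ((norm (f y))\<^sup>2) \<partial>lborel"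

lemma strip_sq_mono: "\<delta> \<le> \<epsilon> \<Longrightarrow> strip_sq K \<delta> f \<le> strip_sq K \<epsilon> f"
  using strip_mono[of \<delta> \<epsilon> K] by (intro nn_integral_mono mult_right_mono) (auto simp: indicator_def)

text \<open>
  Distance to the boundary and height above the graph are comparable: the nearest boundary point
  lies on the graph, whose slope is at most \<open>L\<close>.
\<close>

lemma (in lipschitz_chart) strip_height:
  assumes "y \<in> strip K \<delta>" "y \<in> ball x0 (r / 2)" "\<delta> < r / 2"
  shows "\<Phi> y $ 3 - \<gamma> (\<Phi> y $ 1, \<Phi> y $ 2) \<le> (1 + L) * \<delta>"
proof -
  obtain b where b: "b \<in> frontier K" "dist y b \<le> \<delta>" using assms(1) by (auto simp: strip_def)
  have "b \<in> ball x0 r" using assms(2,3) b(2) dist_triangle[of x0 b y] by (simp add: dist_commute)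
  then have bg: "b = graph (\<Phi> b $ 1, \<Phi> b $ 2)" using b(1) frontier_graph by blast
  have b3: "\<Phi> b $ 3 = \<gamma> (\<Phi> b $ 1, \<Phi> b $ 2)" using arg_cong[OF bg, of "\<lambda>b. \<Phi> b $ 3"] by (simp add: graph_def \<Phi>_Q)
  have d: "dist ((\<Phi> y $ 1, \<Phi> y $ 2), \<Phi> y $ 3) ((\<Phi> b $ 1, \<Phi> b $ 2), \<Phi> b $ 3) \<le> \<delta>"
    using b(2) dist_Q[of "((\<Phi> y $ 1, \<Phi> y $ 2), \<Phi> y $ 3)" "((\<Phi> b $ 1, \<Phi> b $ 2), \<Phi> b $ 3)"] by (simp add: Q_\<Phi>)
  have d1: "dist (\<Phi> y $ 1, \<Phi> y $ 2) (\<Phi> b $ 1, \<Phi> b $ 2) \<le> \<delta>" and d3: "\<bar>\<Phi> y $ 3 - \<Phi> b $ 3\<bar> \<le> \<delta>"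
    using order_trans[OF dist_fst_le d] order_trans[OF dist_snd_le d] by (simp_all add: dist_real_def)
  have "\<bar>\<gamma> (\<Phi> y $ 1, \<Phi> y $ 2) - \<gamma> (\<Phi> b $ 1, \<Phi> b $ 2)\<bar> \<le> L * dist (\<Phi> y $ 1, \<Phi> y $ 2) (\<Phi> b $ 1, \<Phi> b $ 2)"
    using lipschitz_onD[OF lip, of "(\<Phi> y $ 1, \<Phi> y $ 2)" "(\<Phi> b $ 1, \<Phi> b $ 2)"] by (simp add: dist_real_def)
  also have "\<dots> \<le> L * \<delta>" using d1 lipschitz_on_nonneg[OF lip] by (rule mult_left_mono)
  finally show ?thesis using d3 b3 by (simp add: algebra_simps abs_le_iff)
qed

lemma (in lipschitz_chart) strip_estimate_local:
  assumes w: "C1 (w :: vfield)" and \<delta>: "0 < \<delta>" "(1 + L) * \<delta> \<le> r / 4" and bK: "bounded K"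
  shows "(\<integral>\<^sup>+y. indicator (strip K \<delta> \<inter> ball x0 (r / 2)) y * ennreal ((norm (w y))\<^sup>2) \<partial>lborel) \<le>
     ennreal (32 / pi * ((1 + L) * \<delta>)) * bdry_sq K w + ennreal (4 * ((1 + L) * \<delta>)\<^sup>2) * strip_sq K ((1 + L) * \<delta>) (cgrad w)"
proof (rule strip_estimate_chart[OF w _ \<delta>(2) bK])
  have L0: "L \<ge> 0" by (rule lipschitz_on_nonneg[OF lip])
  show "0 < (1 + L) * \<delta>" using L0 \<delta>(1) by (simp add: add_pos_nonneg)
  show "strip K \<delta> \<inter> ball x0 (r / 2) \<in> sets borel" using strip_borel[OF K bK] by simp
  show "strip K \<delta> \<inter> ball x0 (r / 2) \<subseteq> K \<inter> ball x0 (r / 2)" by (auto simp: strip_def)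
  have "\<delta> \<le> (1 + L) * \<delta>" using L0 \<delta>(1) by (simp add: distrib_right)
  then have "\<delta> < r / 2" using \<delta>(2) r by simp
  then show "\<Phi> y $ 3 - \<gamma> (\<Phi> y $ 1, \<Phi> y $ 2) \<le> (1 + L) * \<delta>" if "y \<in> strip K \<delta> \<inter> ball x0 (r / 2)" for y
    using that strip_height by blast
qed

text \<open>
  The boundary strip of width \<open>\<delta>\<close> carries little of a \<open>C1\<close> function whose boundary values are
  small: integrate along the vertical lines of finitely many charts.
\<close>

lemma strip_estimate:
  assumes "lipschitz_domain K"
  obtains C c \<delta>0 where "C \<ge> 0" "c \<ge> 1" "\<delta>0 > 0"
    "\<And>\<delta> w. 0 < \<delta> \<Longrightarrow> \<delta> < \<delta>0 \<Longrightarrow> C1 (w :: vfield) \<Longrightarrow>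
       strip_sq K \<delta> w \<le> ennreal (C * \<delta>) * bdry_sq K w + ennreal (C * \<delta>\<^sup>2) * strip_sq K (c * \<delta>) (cgrad w)"
proof -
  note Kop = lipschitz_domain_open[OF assms] and Kb = lipschitz_domain_bounded[OF assms]
  define P where "P x r L \<longleftrightarrow> r > 0 \<and> L \<ge> 0 \<and> (\<forall>\<delta> w. 0 < \<delta> \<longrightarrow> (1 + L) * \<delta> \<le> r / 4 \<longrightarrow> C1 (w :: vfield) \<longrightarrow>
      (\<integral>\<^sup>+y. indicator (strip K \<delta> \<inter> ball x (r / 2)) y * ennreal ((norm (w y))\<^sup>2) \<partial>lborel) \<le>
      ennreal (32 / pi * ((1 + L) * \<delta>)) * bdry_sq K w + ennreal (4 * ((1 + L) * \<delta>)\<^sup>2) * strip_sq K ((1 + L) * \<delta>) (cgrad w))"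
    for x r L
  have "\<exists>r L. P x r L" if "x \<in> frontier K" for x
  proof (rule lipschitz_domain_chart[OF assms that])
    fix r L \<Phi> \<gamma> assume "lipschitz_chart K x r L \<Phi> \<gamma>"
    then interpret lipschitz_chart K x r L \<Phi> \<gamma> .
    show ?thesis unfolding P_def using r lipschitz_on_nonneg[OF lip] strip_estimate_local[OF _ _ _ Kb] by blast
  qed
  then obtain r L where PrL: "\<And>x. x \<in> frontier K \<Longrightarrow> P x (r x) (L x)" by metis
  have rL: "\<And>x. x \<in> frontier K \<Longrightarrow> r x > 0" "\<And>x. x \<in> frontier K \<Longrightarrow> L x \<ge> 0"
    using PrL unfolding P_def by blast+
  have est: "\<And>x \<delta> w. x \<in> frontier K \<Longrightarrow> 0 < \<delta> \<Longrightarrow> (1 + L x) * \<delta> \<le> r x / 4 \<Longrightarrow> C1 (w :: vfield) \<Longrightarrow>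
      (\<integral>\<^sup>+y. indicator (strip K \<delta> \<inter> ball x (r x / 2)) y * ennreal ((norm (w y))\<^sup>2) \<partial>lborel) \<le>
      ennreal (32 / pi * ((1 + L x) * \<delta>)) * bdry_sq K w + ennreal (4 * ((1 + L x) * \<delta>)\<^sup>2) * strip_sq K ((1 + L x) * \<delta>) (cgrad w)"
    using PrL unfolding P_def by blast
  have "compact (frontier K)" using Kb by (simp add: compact_frontier_bounded)
  then obtain F where F: "F \<subseteq> frontier K" "finite F" "frontier K \<subseteq> (\<Union>x\<in>F. ball x (r x / 4))"
    using rL(1) by (elim compactE_image[where C = "frontier K" and f = "\<lambda>x. ball x (r x / 4)"]) force+
  have FL: "L x \<ge> 0" "r x > 0" if "x \<in> F" for x using that F(1) rL by auto
  define a where "a x = 32 / pi * (1 + L x)" for x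
  define b where "b x = 4 * (1 + L x)\<^sup>2" for x
  have ab: "a x \<ge> 0" "b x \<ge> 0" if "x \<in> F" for x using FL[OF that] by (simp_all add: a_def b_def)
  define C where "C = (\<Sum>x\<in>F. a x + b x)"
  define c where "c = 1 + (\<Sum>x\<in>F. L x)"
  define \<delta>0 where "\<delta>0 = Min (insert 1 ((\<lambda>x. r x / (4 * (1 + L x))) ` F))"
  have cL: "1 + L x \<le> c" if "x \<in> F" for x
    unfolding c_def using member_le_sum[of x F L] that FL F(2) by auto
  have Cab: "(\<Sum>x\<in>F. a x) \<le> C" "(\<Sum>x\<in>F. b x) \<le> C"
    unfolding C_def using ab by (intro sum_mono, simp)+
  show thesis
  proof (rule that[of C c \<delta>0])
    show "C \<ge> 0" unfolding C_def using ab by (intro sum_nonneg) (simp add: add_nonneg_nonneg)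
    show "c \<ge> 1" unfolding c_def using FL by (simp add: sum_nonneg)
    show "\<delta>0 > 0" unfolding \<delta>0_def using F(2) FL by (subst Min_gr_iff) (auto intro!: divide_pos_pos simp: add_pos_nonneg)
    fix \<delta> :: real and w :: vfield assume \<delta>: "0 < \<delta>" "\<delta> < \<delta>0" and w: "C1 w"
    have \<delta>x: "(1 + L x) * \<delta> \<le> r x / 4" if "x \<in> F" for x
    proof -
      have "\<delta> \<le> r x / (4 * (1 + L x))" using \<delta>(2) F(2) that unfolding \<delta>0_def by (simp add: less_imp_le)
      then show ?thesis using FL[OF that] by (simp add: pos_le_divide_eq add_pos_nonneg field_simps)
    qed
    have [measurable]: "w \<in> borel_measurable borel" by (rule borel_measurable_continuous_onI[OF C1_continuous[OF w]])
    have [measurable]: "strip K \<delta> \<in> sets borel" by (rule strip_borel[OF Kop Kb])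
    have cov: "strip K \<delta> \<subseteq> (\<Union>x\<in>F. strip K \<delta> \<inter> ball x (r x / 2))"
    proof
      fix y assume y: "y \<in> strip K \<delta>"
      then obtain b where b: "b \<in> frontier K" "dist y b \<le> \<delta>" by (auto simp: strip_def)
      then obtain x where x: "x \<in> F" "dist x b < r x / 4" using F(3) by auto
      have "\<delta> \<le> (1 + L x) * \<delta>" using FL[OF x(1)] \<delta>(1) by (simp add: distrib_right)
      then have "\<delta> \<le> r x / 4" using \<delta>x[OF x(1)] by linarith
      then have "dist x y < r x / 2" using x(2) b(2) dist_triangle[of x y b] by (simp add: dist_commute)
      then show "y \<in> (\<Union>x\<in>F. strip K \<delta> \<inter> ball x (r x / 2))" using x(1) y by auto
    qed
    \<comment> \<open>points may lie in several charts, hence an inequality\<close>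
    have "strip_sq K \<delta> w \<le> (\<integral>\<^sup>+y. (\<Sum>x\<in>F. indicator (strip K \<delta> \<inter> ball x (r x / 2)) y * ennreal ((norm (w y))\<^sup>2)) \<partial>lborel)"
    proof (rule nn_integral_mono)
      fix y
      show "indicator (strip K \<delta>) y * ennreal ((norm (w y))\<^sup>2)
          \<le> (\<Sum>x\<in>F. indicator (strip K \<delta> \<inter> ball x (r x / 2)) y * ennreal ((norm (w y))\<^sup>2))"
      proof (cases "y \<in> strip K \<delta>")
        case True
        then obtain x where x: "x \<in> F" "y \<in> strip K \<delta> \<inter> ball x (r x / 2)" using cov by blast
        have "indicator (strip K \<delta>) y * ennreal ((norm (w y))\<^sup>2)
            = indicator (strip K \<delta> \<inter> ball x (r x / 2)) y * ennreal ((norm (w y))\<^sup>2)" using x True by simp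
        also have "\<dots> \<le> (\<Sum>x\<in>F. indicator (strip K \<delta> \<inter> ball x (r x / 2)) y * ennreal ((norm (w y))\<^sup>2))"
          using x(1) F(2) by (intro member_le_sum) auto
        finally show ?thesis .
      qed simp
    qed
    also have "\<dots> = (\<Sum>x\<in>F. \<integral>\<^sup>+y. indicator (strip K \<delta> \<inter> ball x (r x / 2)) y * ennreal ((norm (w y))\<^sup>2) \<partial>lborel)"
    proof (rule nn_integral_sum)
      fix x
      have [measurable]: "strip K \<delta> \<inter> ball x (r x / 2) \<in> sets borel" by (intro sets.Int strip_borel[OF Kop Kb]) simp
      have "(\<lambda>y. indicator (strip K \<delta> \<inter> ball x (r x / 2)) y * ennreal ((norm (w y))\<^sup>2)) \<in> borel_measurable borel"
        by measurable
      then show "(\<lambda>y. indicator (strip K \<delta> \<inter> ball x (r x / 2)) y * ennreal ((norm (w y))\<^sup>2)) \<in> borel_measurable lborel"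
        by simp
    qed
    also have "\<dots> \<le> (\<Sum>x\<in>F. ennreal (a x * \<delta>) * bdry_sq K w + ennreal (b x * \<delta>\<^sup>2) * strip_sq K (c * \<delta>) (cgrad w))"
    proof (rule sum_mono)
      fix x assume x: "x \<in> F"
      have "(\<integral>\<^sup>+y. indicator (strip K \<delta> \<inter> ball x (r x / 2)) y * ennreal ((norm (w y))\<^sup>2) \<partial>lborel) \<le>
        ennreal (32 / pi * ((1 + L x) * \<delta>)) * bdry_sq K w + ennreal (4 * ((1 + L x) * \<delta>)\<^sup>2) * strip_sq K ((1 + L x) * \<delta>) (cgrad w)"
        using x F(1) \<delta> \<delta>x w by (intro est) auto
      also have "\<dots> \<le> ennreal (a x * \<delta>) * bdry_sq K w + ennreal (b x * \<delta>\<^sup>2) * strip_sq K (c * \<delta>) (cgrad w)"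
      proof -
        have "32 / pi * ((1 + L x) * \<delta>) = a x * \<delta>" "4 * ((1 + L x) * \<delta>)\<^sup>2 = b x * \<delta>\<^sup>2"
          by (simp_all add: a_def b_def power_mult_distrib)
        moreover have "(1 + L x) * \<delta> \<le> c * \<delta>" using cL[OF x] \<delta>(1) by (intro mult_right_mono) auto
        ultimately show ?thesis by (simp only:) (intro add_left_mono mult_left_mono strip_sq_mono, auto)
      qed
      finally show "(\<integral>\<^sup>+y. indicator (strip K \<delta> \<inter> ball x (r x / 2)) y * ennreal ((norm (w y))\<^sup>2) \<partial>lborel)
        \<le> ennreal (a x * \<delta>) * bdry_sq K w + ennreal (b x * \<delta>\<^sup>2) * strip_sq K (c * \<delta>) (cgrad w)" .
    qed
    also have "\<dots> = ennreal ((\<Sum>x\<in>F. a x) * \<delta>) * bdry_sq K w + ennreal ((\<Sum>x\<in>F. b x) * \<delta>\<^sup>2) * strip_sq K (c * \<delta>) (cgrad w)"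
      using ab \<delta>(1) by (simp add: sum.distrib sum_distrib_right[symmetric] sum_ennreal flip: sum_distrib_right)
    also have "\<dots> \<le> ennreal (C * \<delta>) * bdry_sq K w + ennreal (C * \<delta>\<^sup>2) * strip_sq K (c * \<delta>) (cgrad w)"
      using Cab \<delta>(1) by (intro add_mono mult_right_mono ennreal_leI) auto
    finally show "strip_sq K \<delta> w \<le> ennreal (C * \<delta>) * bdry_sq K w + ennreal (C * \<delta>\<^sup>2) * strip_sq K (c * \<delta>) (cgrad w)" .
  qed
qed

section \<open>Green's formula for vanishing traces\<close>

text \<open>
  Product rule. The extra term \<open>w \<otimes> \<nabla>\<psi>\<close> has squared norm at most \<open>3 B\<^sup>2 \<bar>w\<bar>\<^sup>2\<close>, one summand for
  each partial derivative; the factor 2 in front of it is from squaring a sum of two terms.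
\<close>

lemma cjet_scaleR_bound:
  assumes "C1 (\<psi> :: point \<Rightarrow> real)" "C1 w" "0 \<le> \<psi> x" "\<psi> x \<le> 1" "\<And>j. \<bar>partial j \<psi> x\<bar> \<le> B"
  shows "(norm (cjet (\<lambda>x. \<psi> x *\<^sub>R w x) x))\<^sup>2 \<le> 2 * (norm (cjet w x))\<^sup>2 + 6 * B\<^sup>2 * (norm (w x))\<^sup>2"
proof -
  define R :: "complex^3^3" where "R = (\<chi> i j. of_real (partial j \<psi> x) * w x $ i)"
  have cg: "cgrad (\<lambda>x. \<psi> x *\<^sub>R w x) x = \<psi> x *\<^sub>R cgrad w x + R"
    using frechet_derivative_at[OF C1_scaleR_has_derivative[OF assms(1,2)], symmetric]
    by (simp add: vec_eq_iff cgrad_def R_def partial_def scaleR_conv_of_real[where 'a = complex])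
  have nR: "(norm R)\<^sup>2 \<le> 3 * B\<^sup>2 * (norm (w x))\<^sup>2"
  proof -
    have sq: "(norm v)\<^sup>2 = (\<Sum>i\<in>UNIV. (norm (v $ i))\<^sup>2)" for v :: "'c::real_normed_vector^3"
      by (simp add: norm_vec_def L2_set_def sum_nonneg)
    have "(norm R)\<^sup>2 = (\<Sum>i\<in>UNIV. \<Sum>j\<in>UNIV. (partial j \<psi> x)\<^sup>2 * (norm (w x $ i))\<^sup>2)"
      by (simp add: sq R_def norm_mult power_mult_distrib)
    also have "\<dots> \<le> (\<Sum>i\<in>UNIV. \<Sum>j\<in>(UNIV::3 set). B\<^sup>2 * (norm (w x $ i))\<^sup>2)"
    proof (intro sum_mono mult_right_mono)
      fix j :: 3
      show "(partial j \<psi> x)\<^sup>2 \<le> B\<^sup>2" using power_mono[OF assms(5)[of j], of 2] by simp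
    qed simp
    also have "\<dots> = 3 * B\<^sup>2 * (norm (w x))\<^sup>2" by (simp add: sq[of "w x"] sum_distrib_left mult.assoc)
    finally show ?thesis .
  qed
  have p2: "(\<psi> x)\<^sup>2 \<le> 1" using assms(3,4) by (simp add: power_le_one)
  have "(norm (cjet (\<lambda>x. \<psi> x *\<^sub>R w x) x))\<^sup>2 = (\<psi> x)\<^sup>2 * (norm (w x))\<^sup>2 + (norm (\<psi> x *\<^sub>R cgrad w x + R))\<^sup>2"
    by (simp add: cjet_def norm_Pair cg power_mult_distrib)
  also have "\<dots> \<le> (\<psi> x)\<^sup>2 * (norm (w x))\<^sup>2 + (2 * ((\<psi> x)\<^sup>2 * (norm (cgrad w x))\<^sup>2) + 2 * (norm R)\<^sup>2)"
    using norm_add_sq_le[of "\<psi> x *\<^sub>R cgrad w x" R] by (simp add: power_mult_distrib)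
  also have "\<dots> \<le> 1 * (norm (w x))\<^sup>2 + (2 * (1 * (norm (cgrad w x))\<^sup>2) + 2 * (3 * B\<^sup>2 * (norm (w x))\<^sup>2))"
    by (intro add_mono mult_left_mono mult_right_mono p2 nR) auto
  also have "\<dots> \<le> 2 * (norm (cjet w x))\<^sup>2 + 6 * B\<^sup>2 * (norm (w x))\<^sup>2"
    by (simp add: cjet_def norm_Pair)
  finally show ?thesis .
qed

lemma nn_integral_lebesgue_on_strip:
  assumes "open K"
  shows "strip_sq K \<delta> f = (\<integral>\<^sup>+y. indicator (strip K \<delta>) y * ennreal ((norm (f y))\<^sup>2) \<partial>lebesgue_on K)"
proof -
  have "(\<integral>\<^sup>+y. indicator (strip K \<delta>) y * ennreal ((norm (f y))\<^sup>2) \<partial>lebesgue_on K)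
      = (\<integral>\<^sup>+y. indicator (strip K \<delta>) y * ennreal ((norm (f y))\<^sup>2) * indicator K y \<partial>lebesgue)"
    using assms by (intro nn_integral_restrict_space) auto
  also have "\<dots> = (\<integral>\<^sup>+y. indicator (strip K \<delta>) y * ennreal ((norm (f y))\<^sup>2) \<partial>lebesgue)"
    by (intro nn_integral_cong) (auto simp: indicator_def strip_def)
  finally show ?thesis by (simp add: nn_integral_completion)
qed

lemma strip_sq_tendsto_0:
  fixes p :: "point \<Rightarrow> 'b::euclidean_space"
  assumes "open K" "bounded K" "p \<in> L2 K" "c > 0"
  shows "(\<lambda>n. strip_sq K (c / real (Suc n)) p) \<longlonglongrightarrow> 0"
proof -
  have Kl: "K \<in> sets lebesgue" using assms(1) by simp
  have sb: "strip K \<delta> \<in> sets (lebesgue_on K)" for \<delta>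
    using strip_borel[OF assms(1,2), of \<delta>] Kl by (auto simp: sets_restrict_space_iff strip_def)
  note [measurable] = sb L2_measurable[OF assms(3)]
  have "(\<lambda>n. strip_sq K (c / real (Suc n)) p) \<longlonglongrightarrow> (\<integral>\<^sup>+y. 0 \<partial>lebesgue_on K)"
    unfolding nn_integral_lebesgue_on_strip[OF assms(1)]
  proof (rule nn_integral_dominated_convergence[where w = "\<lambda>y. ennreal ((norm (p y))\<^sup>2)"])
    show "(\<integral>\<^sup>+y. ennreal ((norm (p y))\<^sup>2) \<partial>lebesgue_on K) < \<infinity>"
      unfolding nn_integral_norm_sq[OF assms(3)] by simp
    show "AE y in lebesgue_on K. indicator (strip K (c / real (Suc n))) y * ennreal ((norm (p y))\<^sup>2) \<le> ennreal ((norm (p y))\<^sup>2)" for n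
      by (intro AE_I2) (auto simp: indicator_def)
    show "AE y in lebesgue_on K. (\<lambda>n. indicator (strip K (c / real (Suc n))) y * ennreal ((norm (p y))\<^sup>2)) \<longlonglongrightarrow> 0"
    proof (rule AE_I2)
      fix y assume "y \<in> space (lebesgue_on K)"
      then have "y \<in> K" by simp
      then obtain e where e: "e > 0" "ball y e \<subseteq> K" using assms(1) openE by blast
      have nf: "b \<notin> frontier K" if "dist y b < e" for b
        using that e(2) assms(1) by (auto simp: frontier_def interior_open)
      have "(\<lambda>n. c * inverse (real (Suc n))) \<longlonglongrightarrow> c * 0"
        by (intro tendsto_mult tendsto_const LIMSEQ_inverse_real_of_nat)
      then have "\<forall>\<^sub>F n in sequentially. c * inverse (real (Suc n)) < e" using e(1) by (intro order_tendstoD(2)) auto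
      then have "\<forall>\<^sub>F n in sequentially. indicator (strip K (c / real (Suc n))) y * ennreal ((norm (p y))\<^sup>2) = 0"
      proof eventually_elim
        case (elim n)
        then have "y \<notin> strip K (c / real (Suc n))"
          using nf unfolding strip_def divide_inverse by (auto dest: le_less_trans)
        then show ?case by simp
      qed
      then show "(\<lambda>n. indicator (strip K (c / real (Suc n))) y * ennreal ((norm (p y))\<^sup>2)) \<longlonglongrightarrow> 0"
        by (rule tendsto_eventually)
    qed
  qed measurable
  then show ?thesis by simp
qed

text \<open>
  Lets the strip integral of an approximating function be replaced by that of its limit.
\<close>

lemma strip_sq_le_diff:
  fixes p q :: "point \<Rightarrow> 'b::euclidean_space"
  assumes "open K" "bounded K" "p \<in> L2 K" "q \<in> L2 K"
  shows "strip_sq K \<delta> q \<le> 2 * strip_sq K \<delta> p + ennreal (2 * (l2_norm K (\<lambda>x. q x - p x))\<^sup>2)"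
proof -
  have Kl: "K \<in> sets lebesgue" using assms(1) by simp
  have sb: "strip K \<delta> \<in> sets (lebesgue_on K)"
    using strip_borel[OF assms(1,2), of \<delta>] Kl by (auto simp: sets_restrict_space_iff strip_def)
  note [measurable] = sb L2_measurable[OF assms(3)] L2_measurable[OF assms(4)]
  have "strip_sq K \<delta> q \<le> (\<integral>\<^sup>+y. 2 * (indicator (strip K \<delta>) y * ennreal ((norm (p y))\<^sup>2)) + 2 * ennreal ((norm (q y - p y))\<^sup>2) \<partial>lebesgue_on K)"
    unfolding nn_integral_lebesgue_on_strip[OF assms(1)]
  proof (rule nn_integral_mono)
    fix y
    have "ennreal ((norm (q y))\<^sup>2) \<le> ennreal (2 * (norm (p y))\<^sup>2 + 2 * (norm (q y - p y))\<^sup>2)"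
      using norm_add_sq_le[of "p y" "q y - p y"] by (intro ennreal_leI) simp
    also have "\<dots> = 2 * ennreal ((norm (p y))\<^sup>2) + 2 * ennreal ((norm (q y - p y))\<^sup>2)"
      by (simp add: ennreal_mult)
    finally show "indicator (strip K \<delta>) y * ennreal ((norm (q y))\<^sup>2)
        \<le> 2 * (indicator (strip K \<delta>) y * ennreal ((norm (p y))\<^sup>2)) + 2 * ennreal ((norm (q y - p y))\<^sup>2)"
      by (auto simp: indicator_def)
  qed
  also have "\<dots> = 2 * strip_sq K \<delta> p + 2 * ennreal ((l2_norm K (\<lambda>x. q x - p x))\<^sup>2)"
    unfolding nn_integral_lebesgue_on_strip[OF assms(1)] nn_integral_norm_sq[OF L2_diff[OF assms(4,3)], symmetric]
    by (subst nn_integral_add) (measurable, simp add: nn_integral_cmult)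
  finally show ?thesis by (simp add: ennreal_mult)
qed

text \<open>
  Cutting a \<open>C1\<close> function off in a boundary strip of width \<open>\<delta>\<close> costs a gradient of size \<open>1 / \<delta>\<close>;
  by the strip estimate this is compensated if the boundary values are small compared with \<open>\<delta>\<close>.
\<close>

lemma cutoff_estimate:
  assumes "lipschitz_domain K"
  obtains A c \<delta>0 where "A \<ge> 0" "c > 0" "\<delta>0 > 0"
    "\<And>\<delta> w. 0 < \<delta> \<Longrightarrow> \<delta> < \<delta>0 \<Longrightarrow> C1 (w :: vfield) \<Longrightarrow>
      \<exists>v. C1 v \<and> compact (closure {x. v x \<noteq> 0}) \<and> closure {x. v x \<noteq> 0} \<subseteq> K \<and>
        ennreal ((l2_norm K (\<lambda>x. cjet w x - cjet v x))\<^sup>2)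
          \<le> ennreal A * strip_sq K (c * \<delta>) (cjet w) + ennreal (A / \<delta>) * bdry_sq K w"
proof -
  note Kop = lipschitz_domain_open[OF assms] and Kb = lipschitz_domain_bounded[OF assms]
  have Kl: "K \<in> sets lebesgue" using Kop by simp
  obtain C c \<delta>0 where C: "C \<ge> 0" "c \<ge> 1" "\<delta>0 > 0" and est:
    "\<And>\<delta> w. 0 < \<delta> \<Longrightarrow> \<delta> < \<delta>0 \<Longrightarrow> C1 (w :: vfield) \<Longrightarrow>
       strip_sq K \<delta> w \<le> ennreal (C * \<delta>) * bdry_sq K w + ennreal (C * \<delta>\<^sup>2) * strip_sq K (c * \<delta>) (cgrad w)"
    using strip_estimate[OF assms] by blast
  show thesis
  \<comment> \<open>\<open>\<psi>\<close> lives in the strip of width \<open>10 \<delta>\<close>, and \<open>\<bar>\<nabla>\<psi>\<bar>\<^sup>2\<close> contributes \<open>6 * (2 / \<delta>)\<^sup>2 = 24 / \<delta>\<^sup>2\<close>; with the strip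
      estimate at width \<open>10 \<delta>\<close> the gradient term has the factor \<open>24 / \<delta>\<^sup>2 * C * (10 * \<delta>)\<^sup>2 = 2400 * C\<close>\<close>
  proof (rule that[of "2 + 2400 * C" "c * 10" "\<delta>0 / 10"])
    show "0 \<le> 2 + 2400 * C" "0 < c * 10" "0 < \<delta>0 / 10" using C by auto
    fix \<delta> :: real and w :: vfield assume \<delta>: "0 < \<delta>" "\<delta> < \<delta>0 / 10" and w: "C1 w"
    have "bounded (frontier K)" using Kb by (simp add: compact_frontier_bounded compact_imp_bounded)
    then obtain \<psi> :: "point \<Rightarrow> real" where \<psi>: "C1 \<psi>" "\<And>x. 0 \<le> \<psi> x" "\<And>x. \<psi> x \<le> 1"
      "\<And>x y. y \<in> frontier K \<Longrightarrow> dist x y \<le> \<delta> \<Longrightarrow> \<psi> x = 1"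
      "\<And>x. \<psi> x \<noteq> 0 \<Longrightarrow> \<exists>y\<in>frontier K. dist x y \<le> 10 * \<delta>"
      "\<And>j x. \<bar>partial j \<psi> x\<bar> \<le> 2 / \<delta>"
      using C1_cutoff[OF _ \<delta>(1)] by metis
    define g where "g x = \<psi> x *\<^sub>R w x" for x
    define h where "h x = w x - g x" for x
    \<comment> \<open>outside \<open>K\<close> the cut off function is replaced by zero; it vanishes near the boundary anyway\<close>
    define v where "v x = (if x \<in> K then h x else 0)" for x
    have g: "C1 g" unfolding g_def by (rule C1_scaleR[OF \<psi>(1) w])
    have h: "C1 h" unfolding h_def by (rule C1_diff[OF w g])
    define N where "N = {x. \<exists>y\<in>frontier K. dist x y < \<delta>}"
    have Nop: "open N"
    proof -
      have "N = (\<Union>y\<in>frontier K. ball y \<delta>)" by (auto simp: N_def dist_commute)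
      then show ?thesis by auto
    qed
    have hN: "h x = 0" if "x \<in> N" for x
      using that \<psi>(4)[of _ x] by (auto simp: N_def h_def g_def less_imp_le)
    have vN: "v x = 0" if "x \<in> N" for x using hN[OF that] by (simp add: v_def)
    have sv: "closure {x. v x \<noteq> 0} \<subseteq> K"
    proof
      fix x assume x: "x \<in> closure {x. v x \<noteq> 0}"
      have "closure {x. v x \<noteq> 0} \<subseteq> closure K" by (rule closure_mono) (auto simp: v_def)
      moreover have "closure {x. v x \<noteq> 0} \<subseteq> - N" using vN Nop by (intro closure_minimal) auto
      ultimately have "x \<in> closure K" "x \<notin> N" using x by auto
      moreover have "frontier K \<subseteq> N" 
      proof
        fix y assume "y \<in> frontier K"
        then show "y \<in> N" unfolding N_def using \<delta>(1) by (intro CollectI bexI[of _ y]) simp_all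
      qed
      ultimately show "x \<in> K" using Kop by (auto simp: frontier_def interior_open)
    qed
    have cv: "compact (closure {x. v x \<noteq> 0})"
      using Kb bounded_subset[OF Kb sv] by (simp add: compact_eq_bounded_closed)
    have dv: "(v has_derivative (if x \<in> K then frechet_derivative h (at x) else (\<lambda>h. 0))) (at x)" for x
    proof (cases "x \<in> K")
      case True
      then show ?thesis using has_derivative_transform_within_open[OF C1_has_derivative[OF h] Kop True, of v]
        by (simp add: v_def)
    next
      case False
      then have "x \<notin> closure {x. v x \<noteq> 0}" using sv by auto
      then have "(v has_derivative (\<lambda>h. 0)) (at x)" by (rule has_derivative_zero_off_support)
      then show ?thesis using False by simp
    qed
    have vh: "frechet_derivative v (at x) = frechet_derivative h (at x)" if "x \<in> K" for x
      using frechet_derivative_at[OF dv[of x]] that by simp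
    have v: "C1 v"
    proof (rule C1I[OF dv])
      fix e
      have "isCont (\<lambda>x. (if x \<in> K then frechet_derivative h (at x) else (\<lambda>h. 0)) e) x" for x
      proof (cases "x \<in> K")
        case True
        have "\<forall>\<^sub>F y in nhds x. (if y \<in> K then frechet_derivative h (at y) else (\<lambda>h. 0)) e = frechet_derivative h (at y) e"
          using eventually_nhds_in_open[OF Kop True] by eventually_elim simp
        moreover have "isCont (\<lambda>y. frechet_derivative h (at y) e) x"
          using C1_continuous_derivative[OF h] by (simp add: continuous_on_eq_continuous_at)
        ultimately show ?thesis using isCont_cong by force
      next
        case False
        then have x: "x \<in> - closure {x. v x \<noteq> 0}" using sv by auto
        have "\<forall>\<^sub>F y in nhds x. (if y \<in> K then frechet_derivative h (at y) else (\<lambda>h. 0)) e = 0"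
          using eventually_nhds_in_open[OF open_Compl[OF closed_closure] x]
        proof eventually_elim
          case (elim y)
          have "(v has_derivative (\<lambda>h. 0)) (at y)"
            using elim by (intro has_derivative_zero_off_support) simp
          from has_derivative_unique[OF dv this] show ?case by (metis (full_types))
        qed
        then show ?thesis using isCont_cong[of _ "\<lambda>y. 0"] by force
      qed
      then show "continuous_on UNIV (\<lambda>x. (if x \<in> K then frechet_derivative h (at x) else (\<lambda>h. 0)) e)"
        by (intro continuous_at_imp_continuous_on) auto
    qed
    have eqK: "cjet w x - cjet v x = cjet g x" if "x \<in> K" for x
    proof -
      have "(h has_derivative (\<lambda>e. frechet_derivative w (at x) e - frechet_derivative g (at x) e)) (at x)"
        unfolding h_def by (intro has_derivative_diff C1_has_derivative w g)
      from frechet_derivative_at[OF this, symmetric] show ?thesis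
        using that by (simp add: cjet_def cgrad_def vh v_def h_def vec_eq_iff)
    qed
    have off: "cjet g x = 0" if "x \<in> K - strip K (10 * \<delta>)" for x
    proof -
      have "compact (frontier K)" using Kb by (simp add: compact_frontier_bounded)
      have "x \<notin> closure {x. g x \<noteq> 0}"
      proof
        assume x: "x \<in> closure {x. g x \<noteq> 0}"
        have ne: "frontier K \<noteq> {}" using \<psi>(5) x by (metis (mono_tags, lifting) closure_empty empty_Collect_eq empty_iff g_def scaleR_eq_0_iff)
        have "closure {x. g x \<noteq> 0} \<subseteq> {x. infdist x (frontier K) \<le> 10 * \<delta>}"
        proof (rule closure_minimal)
          show "{x. g x \<noteq> 0} \<subseteq> {x. infdist x (frontier K) \<le> 10 * \<delta>}"
            using \<psi>(5) infdist_le2 by (fastforce simp: g_def)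
          show "closed {x. infdist x (frontier K) \<le> 10 * \<delta>}" by (intro closed_Collect_le continuous_intros)
        qed
        then have "infdist x (frontier K) \<le> 10 * \<delta>" using x by auto
        moreover obtain y where "y \<in> frontier K" "infdist x (frontier K) = dist x y"
          using infdist_attains_inf[OF frontier_closed ne] by blast
        ultimately have "x \<in> strip K (10 * \<delta>)" using that by (auto simp: strip_def)
        then show False using that by simp
      qed
      then have "(g has_derivative (\<lambda>h. 0)) (at x)" "g x = 0"
        using closure_subset[of "{x. g x \<noteq> 0}"] has_derivative_zero_off_support[of x g] by auto
      moreover have "frechet_derivative g (at x) = (\<lambda>h. 0)"
        using calculation(1) by (rule frechet_derivative_at[symmetric])
      ultimately show ?thesis by (simp add: cjet_def cgrad_def vec_eq_iff zero_prod_def)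
    qed
    have gL: "cjet g \<in> L2 K" by (rule L2_continuous[OF Kop Kb continuous_cjet[OF g]])
    have sb: "strip K s \<in> sets borel" for s by (rule strip_borel[OF Kop Kb])
    have [measurable]: "w \<in> borel_measurable borel" by (rule borel_measurable_continuous_onI[OF C1_continuous[OF w]])
    have [measurable]: "cjet w \<in> borel_measurable borel" by (rule borel_measurable_continuous_onI[OF continuous_cjet[OF w]])
    have "ennreal ((l2_norm K (\<lambda>x. cjet w x - cjet v x))\<^sup>2) = ennreal ((l2_norm K (cjet g))\<^sup>2)"
      unfolding l2_norm_sq_integral by (intro arg_cong[where f = ennreal] Bochner_Integration.integral_cong) (auto simp: eqK)
    also have "\<dots> = (\<integral>\<^sup>+x. ennreal ((norm (cjet g x))\<^sup>2) \<partial>lebesgue_on K)"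
      by (rule nn_integral_norm_sq[OF gL, symmetric])
    also have "\<dots> = strip_sq K (10 * \<delta>) (cjet g)"
      unfolding nn_integral_lebesgue_on_strip[OF Kop] by (intro nn_integral_cong) (use off in \<open>auto simp: indicator_def\<close>)
    also have "\<dots> \<le> (\<integral>\<^sup>+x. 2 * (indicator (strip K (10 * \<delta>)) x * ennreal ((norm (cjet w x))\<^sup>2)) +
        ennreal (24 / \<delta>\<^sup>2) * (indicator (strip K (10 * \<delta>)) x * ennreal ((norm (w x))\<^sup>2)) \<partial>lborel)"
    proof (rule nn_integral_mono)
      fix x
      have "ennreal ((norm (cjet g x))\<^sup>2) \<le> ennreal (2 * (norm (cjet w x))\<^sup>2 + 24 / \<delta>\<^sup>2 * (norm (w x))\<^sup>2)"
        unfolding g_def using cjet_scaleR_bound[OF \<psi>(1) w \<psi>(2,3,6), of x]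
        by (intro ennreal_leI) (simp add: power_divide)
      also have "\<dots> = 2 * ennreal ((norm (cjet w x))\<^sup>2) + ennreal (24 / \<delta>\<^sup>2) * ennreal ((norm (w x))\<^sup>2)"
      proof -
        have "ennreal (2 * (norm (cjet w x))\<^sup>2 + 24 / \<delta>\<^sup>2 * (norm (w x))\<^sup>2) =
            ennreal (2 * (norm (cjet w x))\<^sup>2) + ennreal (24 / \<delta>\<^sup>2 * (norm (w x))\<^sup>2)"
          by (rule ennreal_plus) auto
        also have "ennreal (24 / \<delta>\<^sup>2 * (norm (w x))\<^sup>2) = ennreal (24 / \<delta>\<^sup>2) * ennreal ((norm (w x))\<^sup>2)"
          by (rule ennreal_mult) auto
        finally show ?thesis by (simp add: ennreal_mult)
      qed
      finally show "indicator (strip K (10 * \<delta>)) x * ennreal ((norm (cjet g x))\<^sup>2)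
          \<le> 2 * (indicator (strip K (10 * \<delta>)) x * ennreal ((norm (cjet w x))\<^sup>2)) +
        ennreal (24 / \<delta>\<^sup>2) * (indicator (strip K (10 * \<delta>)) x * ennreal ((norm (w x))\<^sup>2))"
        by (auto simp: indicator_def)
    qed
    also have "\<dots> = 2 * strip_sq K (10 * \<delta>) (cjet w) + ennreal (24 / \<delta>\<^sup>2) * strip_sq K (10 * \<delta>) w"
      using sb by (subst nn_integral_add) (auto simp: nn_integral_cmult)
    also have "\<dots> \<le> 2 * strip_sq K (c * 10 * \<delta>) (cjet w) + ennreal (24 / \<delta>\<^sup>2) *
        (ennreal (C * (10 * \<delta>)) * bdry_sq K w + ennreal (C * (10 * \<delta>)\<^sup>2) * strip_sq K (c * 10 * \<delta>) (cjet w))"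
    proof (intro add_mono mult_left_mono)
      show "strip_sq K (10 * \<delta>) (cjet w) \<le> strip_sq K (c * 10 * \<delta>) (cjet w)"
        using C(2) \<delta>(1) by (intro strip_sq_mono) simp
      have "strip_sq K (10 * \<delta>) w \<le> ennreal (C * (10 * \<delta>)) * bdry_sq K w + ennreal (C * (10 * \<delta>)\<^sup>2) * strip_sq K (c * (10 * \<delta>)) (cgrad w)"
        using \<delta> w by (intro est) auto
      also have "\<dots> \<le> ennreal (C * (10 * \<delta>)) * bdry_sq K w + ennreal (C * (10 * \<delta>)\<^sup>2) * strip_sq K (c * 10 * \<delta>) (cjet w)"
        by (intro add_left_mono mult_left_mono nn_integral_mono) (auto intro!: mult_left_mono ennreal_leI simp: cjet_def norm_Pair mult.assoc)
      finally show "strip_sq K (10 * \<delta>) w \<le> ennreal (C * (10 * \<delta>)) * bdry_sq K w + ennreal (C * (10 * \<delta>)\<^sup>2) * strip_sq K (c * 10 * \<delta>) (cjet w)" .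
    qed auto
    also have "\<dots> = 2 * strip_sq K (c * 10 * \<delta>) (cjet w) + (ennreal (240 * C / \<delta>) * bdry_sq K w + ennreal (2400 * C) * strip_sq K (c * 10 * \<delta>) (cjet w))"
    proof -
      have eq: "24 / \<delta>\<^sup>2 * (C * (10 * \<delta>)) = 240 * C / \<delta>" "24 / \<delta>\<^sup>2 * (C * (10 * \<delta>)\<^sup>2) = 2400 * C"
        using \<delta>(1) by (simp_all add: power2_eq_square field_simps)
      have "ennreal (24 / \<delta>\<^sup>2) * ennreal (C * (10 * \<delta>)) = ennreal (24 / \<delta>\<^sup>2 * (C * (10 * \<delta>)))"
        by (rule ennreal_mult[symmetric]) (use C(1) \<delta>(1) in simp_all)
      moreover have "ennreal (24 / \<delta>\<^sup>2) * ennreal (C * (10 * \<delta>)\<^sup>2) = ennreal (24 / \<delta>\<^sup>2 * (C * (10 * \<delta>)\<^sup>2))"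
        by (rule ennreal_mult[symmetric]) (use C(1) \<delta>(1) in simp_all)
      ultimately show ?thesis unfolding eq by (simp only: distrib_left mult.assoc[symmetric])
    qed
    also have "\<dots> \<le> ennreal (2 + 2400 * C) * strip_sq K (c * 10 * \<delta>) (cjet w) + ennreal ((2 + 2400 * C) / \<delta>) * bdry_sq K w"
    proof -
      have "ennreal (240 * C / \<delta>) * bdry_sq K w \<le> ennreal ((2 + 2400 * C) / \<delta>) * bdry_sq K w"
        using C(1) \<delta>(1) by (intro mult_right_mono ennreal_leI divide_right_mono) auto
      moreover have "ennreal (2 + 2400 * C) * X = 2 * X + ennreal (2400 * C) * X" for X
        using C(1) by (simp add: ennreal_plus distrib_right)
      ultimately show ?thesis by (simp add: add.assoc add.commute add.left_commute add_mono)
    qed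
    finally show "\<exists>v. C1 v \<and> compact (closure {x. v x \<noteq> 0}) \<and> closure {x. v x \<noteq> 0} \<subseteq> K \<and>
        ennreal ((l2_norm K (\<lambda>x. cjet w x - cjet v x))\<^sup>2)
          \<le> ennreal (2 + 2400 * C) * strip_sq K (c * 10 * \<delta>) (cjet w) + ennreal ((2 + 2400 * C) / \<delta>) * bdry_sq K w"
      using v cv sv by blast
  qed
qed

text \<open>
  Green's formula holds for functions with compact support in \<open>K\<close>, so it remains to approximate \<open>p\<close> by
  such functions. Take \<open>C1\<close> functions \<open>w n\<close> tending to \<open>p\<close> with boundary values tending to zero, and
  cut them off at width \<open>\<delta>\<close>. The error consists of the part of \<open>p\<close> in a strip and of the boundary values
  of \<open>w n\<close> amplified by \<open>1 / \<delta>\<close>. For fixed \<open>\<delta>\<close> the second part disappears as \<open>n\<close> grows; only then \<open>\<delta>\<close>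
  tends to zero, and the strip integral of the fixed function \<open>p\<close> with it.
\<close>

lemma green_trace_zero:
  assumes "lipschitz_domain K" "q \<in> div_jets K" "p \<in> jets K"
    "has_trace K (frontier K) (\<lambda>x. fst (p x)) (\<lambda>x. 0)"
  shows "cinner K q p = 0"
proof -
  note Kop = lipschitz_domain_open[OF assms(1)] and Kb = lipschitz_domain_bounded[OF assms(1)]
  have qL: "q \<in> L2 K" and pL: "p \<in> L2 K" using assms(2,3) div_jets_L2 jets_L2 by auto
  obtain w :: "nat \<Rightarrow> vfield" where w: "\<And>n. C1 (w n)"
    and wp: "(\<lambda>n. H1_norm K (\<lambda>x. w n x - fst (p x))) \<longlonglongrightarrow> 0"
    and wb: "(\<lambda>n. \<integral>\<^sup>+x\<in>frontier K. ennreal ((norm (w n x - 0))\<^sup>2) \<partial>surface) \<longlonglongrightarrow> 0"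
    using assms(4) unfolding has_trace_def by blast
  have wL: "cjet (w n) \<in> L2 K" for n by (rule L2_continuous[OF Kop Kb continuous_cjet[OF w]])
  have bd: "(\<lambda>n. bdry_sq K (w n)) \<longlonglongrightarrow> 0" using wb by (simp add: mult.commute)
  define X where "X n = l2_norm K (\<lambda>x. cjet (w n) x - p x)" for n
  have Xn: "H1_norm K (\<lambda>x. w n x - fst (p x)) = X n" for n
    using H1_norm_jets[OF Kop Kb jets_diff[OF Kop Kb cjet_jets[OF Kop Kb w[of n]] assms(3)]]
    by (simp add: X_def cjet_def)
  have X0: "X \<longlonglongrightarrow> 0" using wp unfolding Xn .
  have X2: "(\<lambda>n. (X n)\<^sup>2) \<longlonglongrightarrow> 0" using tendsto_power[OF X0, of 2] by simp
  obtain A c \<delta>0 where A: "A \<ge> 0" "c > 0" "\<delta>0 > 0" and cut: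
    "\<And>\<delta> w. 0 < \<delta> \<Longrightarrow> \<delta> < \<delta>0 \<Longrightarrow> C1 (w :: vfield) \<Longrightarrow>
      \<exists>v. C1 v \<and> compact (closure {x. v x \<noteq> 0}) \<and> closure {x. v x \<noteq> 0} \<subseteq> K \<and>
        ennreal ((l2_norm K (\<lambda>x. cjet w x - cjet v x))\<^sup>2)
          \<le> ennreal A * strip_sq K (c * \<delta>) (cjet w) + ennreal (A / \<delta>) * bdry_sq K w"
    using cutoff_estimate[OF assms(1)] by blast
  \<comment> \<open>the square of the factor 2 in \<open>norm_cinner_le\<close>, times 2 for squaring a sum of two terms\<close>
  define N where "N = 8 * (l2_norm K q)\<^sup>2"
  have N0: "N \<ge> 0" by (simp add: N_def)
  let ?z = "(norm (cinner K q p))\<^sup>2"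
  have step: "ennreal ?z \<le> ennreal N * (ennreal ((X n)\<^sup>2) +
      (ennreal A * (2 * strip_sq K (c * \<delta>) p + ennreal (2 * (X n)\<^sup>2)) + ennreal (A / \<delta>) * bdry_sq K (w n)))"
    if \<delta>: "0 < \<delta>" "\<delta> < \<delta>0" for n \<delta>
  proof -
    obtain v where v: "C1 v" "compact (closure {x. v x \<noteq> 0})" "closure {x. v x \<noteq> 0} \<subseteq> K"
      and est: "ennreal ((l2_norm K (\<lambda>x. cjet (w n) x - cjet v x))\<^sup>2)
          \<le> ennreal A * strip_sq K (c * \<delta>) (cjet (w n)) + ennreal (A / \<delta>) * bdry_sq K (w n)"
      using cut[OF \<delta> w[of n]] by blast
    have vL: "cjet v \<in> L2 K" by (rule L2_continuous[OF Kop Kb continuous_cjet[OF v(1)]])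
    have "cinner K q p = cinner K q (\<lambda>x. p x - cjet v x)"
      using cinner_diff_right[OF qL pL vL] green_compact_support[OF Kop Kb assms(2) v] by simp
    then have "norm (cinner K q p) \<le> 2 * l2_norm K q * l2_norm K (\<lambda>x. p x - cjet v x)"
      using norm_cinner_le[OF qL L2_diff[OF pL vL]] by simp
    also have "\<dots> \<le> 2 * l2_norm K q * (X n + l2_norm K (\<lambda>x. cjet (w n) x - cjet v x))"
      using l2_triangle_diff[OF pL wL vL, of n] l2_norm_nonneg[of K q] l2_norm_minus_commute[of K p "cjet (w n)"]
      by (intro mult_left_mono) (auto simp: X_def)
    finally have "?z \<le> (2 * l2_norm K q * (X n + l2_norm K (\<lambda>x. cjet (w n) x - cjet v x)))\<^sup>2"
      by (rule power_mono) simp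
    also have "\<dots> \<le> N * ((X n)\<^sup>2 + (l2_norm K (\<lambda>x. cjet (w n) x - cjet v x))\<^sup>2)"
    proof -
      have sq: "(a + b)\<^sup>2 \<le> 2 * (a\<^sup>2 + b\<^sup>2)" for a b :: real
        using sum_squares_bound[of a b] by (simp add: power2_sum)
      have "4 * (l2_norm K q)\<^sup>2 * (X n + l2_norm K (\<lambda>x. cjet (w n) x - cjet v x))\<^sup>2
          \<le> 4 * (l2_norm K q)\<^sup>2 * (2 * ((X n)\<^sup>2 + (l2_norm K (\<lambda>x. cjet (w n) x - cjet v x))\<^sup>2))"
        by (intro mult_left_mono sq) simp
      then show ?thesis unfolding N_def power_mult_distrib by (simp add: algebra_simps)
    qed
    finally have "ennreal ?z \<le> ennreal (N * ((X n)\<^sup>2 + (l2_norm K (\<lambda>x. cjet (w n) x - cjet v x))\<^sup>2))"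
      by (rule ennreal_leI)
    also have "\<dots> = ennreal N * (ennreal ((X n)\<^sup>2) + ennreal ((l2_norm K (\<lambda>x. cjet (w n) x - cjet v x))\<^sup>2))"
      using N0 by (simp add: ennreal_mult ennreal_plus)
    also have "\<dots> \<le> ennreal N * (ennreal ((X n)\<^sup>2) +
      (ennreal A * strip_sq K (c * \<delta>) (cjet (w n)) + ennreal (A / \<delta>) * bdry_sq K (w n)))"
      by (intro mult_left_mono add_left_mono est) auto
    also have "\<dots> \<le> ennreal N * (ennreal ((X n)\<^sup>2) +
      (ennreal A * (2 * strip_sq K (c * \<delta>) p + ennreal (2 * (X n)\<^sup>2)) + ennreal (A / \<delta>) * bdry_sq K (w n)))"
      unfolding X_def by (intro mult_left_mono add_left_mono add_right_mono strip_sq_le_diff[OF Kop Kb pL wL]) auto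
    finally show ?thesis .
  qed
  have fixd: "ennreal ?z \<le> ennreal N * (ennreal A * (2 * strip_sq K (c * \<delta>) p))" if \<delta>: "0 < \<delta>" "\<delta> < \<delta>0" for \<delta>
  proof -
    have "(\<lambda>n. ennreal N * (ennreal ((X n)\<^sup>2) +
      (ennreal A * (2 * strip_sq K (c * \<delta>) p + ennreal (2 * (X n)\<^sup>2)) + ennreal (A / \<delta>) * bdry_sq K (w n))))
      \<longlonglongrightarrow> ennreal N * (ennreal 0 + (ennreal A * (2 * strip_sq K (c * \<delta>) p + ennreal (2 * 0)) + ennreal (A / \<delta>) * 0))"
      by (intro ennreal_tendsto_cmult tendsto_add tendsto_ennrealI tendsto_const bd X2 tendsto_mult) auto
    from LIMSEQ_le_const[OF this] step[OF \<delta>] show ?thesis by simp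
  qed
  have "(\<lambda>n. ennreal N * (ennreal A * (2 * strip_sq K ((c * \<delta>0 / 2) / real (Suc n)) p))) \<longlonglongrightarrow> ennreal N * (ennreal A * (2 * 0))"
    using A by (intro ennreal_tendsto_cmult strip_sq_tendsto_0[OF Kop Kb pL]) (auto simp: less_top[symmetric])
  moreover have "ennreal ?z \<le> ennreal N * (ennreal A * (2 * strip_sq K ((c * \<delta>0 / 2) / real (Suc n)) p))" for n
  proof -
    have "\<delta>0 / 2 / real (Suc n) \<le> \<delta>0 / 2 / 1" using A(3) by (intro divide_left_mono) auto
    also have "\<dots> < \<delta>0" using A(3) by simp
    finally have "\<delta>0 / 2 / real (Suc n) < \<delta>0" .
    moreover have "0 < \<delta>0 / 2 / real (Suc n)" using A(3) by simp
    ultimately show ?thesis using fixd[of "\<delta>0 / 2 / real (Suc n)"] by simp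
  qed
  ultimately have "ennreal ?z \<le> ennreal N * (ennreal A * (2 * 0))" by (intro LIMSEQ_le_const) auto
  then have "?z \<le> 0" by (simp add: ennreal_eq_0_iff)
  then show ?thesis by simp
qed

section \<open>Well-definedness and linearity of traces\<close>

text \<open>
  Multiplication of a jet by a complex scalar, in terms of the real structure in which the spaces of
  jets are known to be closed.
\<close>

definition cmul :: "complex \<Rightarrow> jet \<Rightarrow> jet" where
  "cmul c p = Re c *\<^sub>R p + Im c *\<^sub>R imul p"

lemma fst_cmul: "fst (cmul c p) = c *s fst p"
  by (simp add: cmul_def imul_def vec_eq_iff complex_eq_iff)

lemma norm_cmul: "norm (cmul c p) = cmod c * norm p"
proof -
  have "Im (cdot p p) = 0"
    by (simp add: cdot_def complex_mult_cnj)
  then have z: "p \<bullet> imul p = 0" by (simp add: Im_cdot)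
  have i: "imul p \<bullet> imul p = p \<bullet> p" using norm_imul[of p] by (simp add: norm_eq_sqrt_inner)
  have "(norm (cmul c p))\<^sup>2 = (cmod c * norm p)\<^sup>2"
    unfolding power_mult_distrib power2_norm_eq_inner[of "cmul c p"] power2_norm_eq_inner[of p] cmod_power2
    by (simp add: cmul_def inner_add_left inner_add_right z i inner_commute[of "imul p" p] power2_eq_square algebra_simps)
  then show ?thesis by (simp add: power2_eq_iff_nonneg)
qed

lemma l2_norm_cmul: "l2_norm K (\<lambda>x. cmul c (p x)) = cmod c * l2_norm K p"
  by (simp add: l2_norm_def l2_inner_def power2_norm_eq_inner[symmetric] norm_cmul power_mult_distrib real_sqrt_mult)

lemma jets_cmul:
  assumes "open K" "bounded K" "p \<in> jets K"
  shows "(\<lambda>x. cmul c (p x)) \<in> jets K"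
  unfolding cmul_def using assms by (intro jets_add jets_scaleR jets_imul)

lemma C1_cmul: "C1 w \<Longrightarrow> C1 (\<lambda>x. c *s w x :: complex^3)"
proof -
  assume "C1 w"
  moreover have "bounded_linear (\<lambda>v :: complex^3. c *s v)"
    by (rule linear_conv_bounded_linear[THEN iffD1], rule linearI)
       (simp_all add: vec_eq_iff algebra_simps scaleR_conv_of_real[where 'a = complex])
  ultimately show ?thesis by (rule C1_linear[rotated])
qed

lemma has_trace_zero_iff:
  assumes "open K" "bounded K" "p \<in> jets K"
  shows "has_trace K \<Gamma> (\<lambda>x. fst (p x)) (\<lambda>x. 0) \<longleftrightarrow>
    (\<exists>w :: nat \<Rightarrow> vfield. (\<forall>n. C1 (w n)) \<and> (\<lambda>n. l2_norm K (\<lambda>x. cjet (w n) x - p x)) \<longlonglongrightarrow> 0 \<and>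
       (\<lambda>n. \<integral>\<^sup>+x\<in>\<Gamma>. ennreal ((norm (w n x))\<^sup>2) \<partial>surface) \<longlonglongrightarrow> 0)"
proof -
  have "H1_norm K (\<lambda>x. w x - fst (p x)) = l2_norm K (\<lambda>x. cjet w x - p x)" if "C1 w" for w
    using H1_norm_jets[OF assms(1,2) jets_diff[OF assms(1,2) cjet_jets[OF assms(1,2) that] assms(3)]]
    by (simp add: cjet_def)
  then show ?thesis unfolding has_trace_def by (auto cong: conj_cong)
qed

lemma has_trace_zero_add:
  assumes "open K" "bounded K" "p \<in> jets K" "q \<in> jets K" "\<Gamma> \<in> sets borel"
    "has_trace K \<Gamma> (\<lambda>x. fst (p x)) (\<lambda>x. 0)" "has_trace K \<Gamma> (\<lambda>x. fst (q x)) (\<lambda>x. 0)"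
  shows "has_trace K \<Gamma> (\<lambda>x. fst (p x + q x)) (\<lambda>x. 0)"
proof -
  obtain w where w: "\<And>n. C1 (w n :: vfield)" "(\<lambda>n. l2_norm K (\<lambda>x. cjet (w n) x - p x)) \<longlonglongrightarrow> 0"
      "(\<lambda>n. \<integral>\<^sup>+x\<in>\<Gamma>. ennreal ((norm (w n x))\<^sup>2) \<partial>surface) \<longlonglongrightarrow> 0"
    using assms(6) unfolding has_trace_zero_iff[OF assms(1-3)] by blast
  obtain v where v: "\<And>n. C1 (v n :: vfield)" "(\<lambda>n. l2_norm K (\<lambda>x. cjet (v n) x - q x)) \<longlonglongrightarrow> 0"
      "(\<lambda>n. \<integral>\<^sup>+x\<in>\<Gamma>. ennreal ((norm (v n x))\<^sup>2) \<partial>surface) \<longlonglongrightarrow> 0"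
    using assms(7) unfolding has_trace_zero_iff[OF assms(1,2,4)] by blast
  have pq: "p \<in> L2 K" "q \<in> L2 K" using assms jets_L2 by auto
  have L: "cjet (w n) \<in> L2 K" "cjet (v n) \<in> L2 K" for n
    using L2_continuous[OF assms(1,2) continuous_cjet] w(1) v(1) by auto
  have J: "cjet (\<lambda>x. w n x + v n x) x = cjet (w n) x + cjet (v n) x" for n x
    using frechet_derivative_at[OF has_derivative_add[OF C1_has_derivative[OF w(1)] C1_has_derivative[OF v(1)]], symmetric]
    by (simp add: cjet_def cgrad_def vec_eq_iff)
  show ?thesis
    unfolding has_trace_zero_iff[OF assms(1,2) jets_add[OF assms(1-4)]]
  proof (intro exI[of _ "\<lambda>n x. w n x + v n x"] conjI allI)
    show "C1 (\<lambda>x. w n x + v n x)" for n by (rule C1_add[OF w(1) v(1)])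
    show "(\<lambda>n. l2_norm K (\<lambda>x. cjet (\<lambda>x. w n x + v n x) x - (p x + q x))) \<longlonglongrightarrow> 0"
    proof (rule tendsto_sandwich[OF _ _ tendsto_const])
      show "\<forall>\<^sub>F n in sequentially. l2_norm K (\<lambda>x. cjet (\<lambda>x. w n x + v n x) x - (p x + q x)) \<le>
          l2_norm K (\<lambda>x. cjet (w n) x - p x) + l2_norm K (\<lambda>x. cjet (v n) x - q x)"
      proof (intro always_eventually allI)
        fix n
        show "l2_norm K (\<lambda>x. cjet (\<lambda>x. w n x + v n x) x - (p x + q x)) \<le>
          l2_norm K (\<lambda>x. cjet (w n) x - p x) + l2_norm K (\<lambda>x. cjet (v n) x - q x)"
          unfolding J add_diff_add by (rule l2_triangle[OF L2_diff[OF L(1) pq(1)] L2_diff[OF L(2) pq(2)]])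
      qed
      show "(\<lambda>n. l2_norm K (\<lambda>x. cjet (w n) x - p x) + l2_norm K (\<lambda>x. cjet (v n) x - q x)) \<longlonglongrightarrow> 0"
        using tendsto_add[OF w(2) v(2)] by simp
    qed (simp add: l2_norm_nonneg)
    have [measurable]: "w n \<in> borel_measurable borel" "v n \<in> borel_measurable borel" "\<Gamma> \<in> sets borel" for n
      using borel_measurable_continuous_onI[OF C1_continuous] w(1) v(1) assms(5) by auto
    show "(\<lambda>n. \<integral>\<^sup>+x\<in>\<Gamma>. ennreal ((norm (w n x + v n x))\<^sup>2) \<partial>surface) \<longlonglongrightarrow> 0"
    proof (rule tendsto_sandwich[OF _ _ tendsto_const])
      show "\<forall>\<^sub>F n in sequentially. (\<integral>\<^sup>+x\<in>\<Gamma>. ennreal ((norm (w n x + v n x))\<^sup>2) \<partial>surface) \<le>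
          2 * (\<integral>\<^sup>+x\<in>\<Gamma>. ennreal ((norm (w n x))\<^sup>2) \<partial>surface) + 2 * (\<integral>\<^sup>+x\<in>\<Gamma>. ennreal ((norm (v n x))\<^sup>2) \<partial>surface)"
      proof (intro always_eventually allI)
        fix n
        have "(\<integral>\<^sup>+x\<in>\<Gamma>. ennreal ((norm (w n x + v n x))\<^sup>2) \<partial>surface) \<le>
          (\<integral>\<^sup>+x. 2 * (ennreal ((norm (w n x))\<^sup>2) * indicator \<Gamma> x) + 2 * (ennreal ((norm (v n x))\<^sup>2) * indicator \<Gamma> x) \<partial>surface)"
        proof (rule nn_integral_mono)
          fix x
          have "ennreal ((norm (w n x + v n x))\<^sup>2) \<le> ennreal (2 * (norm (w n x))\<^sup>2 + 2 * (norm (v n x))\<^sup>2)"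
            by (intro ennreal_leI norm_add_sq_le)
          also have "\<dots> = 2 * ennreal ((norm (w n x))\<^sup>2) + 2 * ennreal ((norm (v n x))\<^sup>2)" by (simp add: ennreal_mult)
          finally show "ennreal ((norm (w n x + v n x))\<^sup>2) * indicator \<Gamma> x \<le>
            2 * (ennreal ((norm (w n x))\<^sup>2) * indicator \<Gamma> x) + 2 * (ennreal ((norm (v n x))\<^sup>2) * indicator \<Gamma> x)"
            by (auto simp: indicator_def)
        qed
        also have "\<dots> = 2 * (\<integral>\<^sup>+x\<in>\<Gamma>. ennreal ((norm (w n x))\<^sup>2) \<partial>surface) + 2 * (\<integral>\<^sup>+x\<in>\<Gamma>. ennreal ((norm (v n x))\<^sup>2) \<partial>surface)"
          by (subst nn_integral_add) (measurable, simp add: nn_integral_cmult)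
        finally show "(\<integral>\<^sup>+x\<in>\<Gamma>. ennreal ((norm (w n x + v n x))\<^sup>2) \<partial>surface) \<le>
          2 * (\<integral>\<^sup>+x\<in>\<Gamma>. ennreal ((norm (w n x))\<^sup>2) \<partial>surface) + 2 * (\<integral>\<^sup>+x\<in>\<Gamma>. ennreal ((norm (v n x))\<^sup>2) \<partial>surface)" .
      qed
      have "(\<lambda>n. 2 * (\<integral>\<^sup>+x\<in>\<Gamma>. ennreal ((norm (w n x))\<^sup>2) \<partial>surface) + 2 * (\<integral>\<^sup>+x\<in>\<Gamma>. ennreal ((norm (v n x))\<^sup>2) \<partial>surface)) \<longlonglongrightarrow> 2 * 0 + 2 * 0"
        by (intro tendsto_add ennreal_tendsto_cmult w(3) v(3)) auto
      then show "(\<lambda>n. 2 * (\<integral>\<^sup>+x\<in>\<Gamma>. ennreal ((norm (w n x))\<^sup>2) \<partial>surface) + 2 * (\<integral>\<^sup>+x\<in>\<Gamma>. ennreal ((norm (v n x))\<^sup>2) \<partial>surface)) \<longlonglongrightarrow> 0"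
        by simp
    qed simp
  qed
qed

lemma has_trace_zero_cmul:
  assumes "open K" "bounded K" "p \<in> jets K" "\<Gamma> \<in> sets borel" "has_trace K \<Gamma> (\<lambda>x. fst (p x)) (\<lambda>x. 0)"
  shows "has_trace K \<Gamma> (\<lambda>x. fst (cmul c (p x))) (\<lambda>x. 0)"
proof -
  obtain w where w: "\<And>n. C1 (w n :: vfield)" "(\<lambda>n. l2_norm K (\<lambda>x. cjet (w n) x - p x)) \<longlonglongrightarrow> 0"
      "(\<lambda>n. \<integral>\<^sup>+x\<in>\<Gamma>. ennreal ((norm (w n x))\<^sup>2) \<partial>surface) \<longlonglongrightarrow> 0"
    using assms(5) unfolding has_trace_zero_iff[OF assms(1-3)] by blast
  have bl: "bounded_linear (\<lambda>v :: complex^3. c *s v)"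
    by (rule linear_conv_bounded_linear[THEN iffD1], rule linearI)
       (simp_all add: vec_eq_iff algebra_simps scaleR_conv_of_real[where 'a = complex])
  have J: "cjet (\<lambda>x. c *s w n x) x = cmul c (cjet (w n) x)" for n x
    using frechet_derivative_at[OF bounded_linear.has_derivative[OF bl C1_has_derivative[OF w(1)]], symmetric]
    by (simp add: cjet_def cgrad_def vec_eq_iff cmul_def imul_def prod_eq_iff complex_eq_iff)
  have D: "cmul c a - cmul c b = cmul c (a - b)" for a b
    by (simp add: cmul_def linear_diff[OF bounded_linear.linear[OF bounded_linear_imul]] algebra_simps)
  have nsm: "norm (c *s v) = cmod c * norm v" for v :: "complex^3"
    by (simp add: norm_vec_def L2_set_right_distrib norm_mult)
  show ?thesis
    unfolding has_trace_zero_iff[OF assms(1,2) jets_cmul[OF assms(1-3)]]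
  proof (intro exI[of _ "\<lambda>n x. c *s w n x"] conjI allI)
    show "C1 (\<lambda>x. c *s w n x)" for n by (rule C1_cmul[OF w(1)])
    show "(\<lambda>n. l2_norm K (\<lambda>x. cjet (\<lambda>x. c *s w n x) x - cmul c (p x))) \<longlonglongrightarrow> 0"
      unfolding J D l2_norm_cmul using tendsto_mult_right_zero[OF w(2)] .
    have [measurable]: "w n \<in> borel_measurable borel" "\<Gamma> \<in> sets borel" for n
      using borel_measurable_continuous_onI[OF C1_continuous] w(1) assms(4) by auto
    have "(\<integral>\<^sup>+x\<in>\<Gamma>. ennreal ((norm (c *s w n x))\<^sup>2) \<partial>surface) = ennreal ((cmod c)\<^sup>2) * (\<integral>\<^sup>+x\<in>\<Gamma>. ennreal ((norm (w n x))\<^sup>2) \<partial>surface)" for n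
      by (subst nn_integral_cmult[symmetric], measurable)
         (simp add: nsm power_mult_distrib ennreal_mult mult.assoc)
    moreover have "(\<lambda>n. ennreal ((cmod c)\<^sup>2) * (\<integral>\<^sup>+x\<in>\<Gamma>. ennreal ((norm (w n x))\<^sup>2) \<partial>surface)) \<longlonglongrightarrow> ennreal ((cmod c)\<^sup>2) * 0"
      by (intro ennreal_tendsto_cmult w(3)) simp
    ultimately show "(\<lambda>n. \<integral>\<^sup>+x\<in>\<Gamma>. ennreal ((norm (c *s w n x))\<^sup>2) \<partial>surface) \<longlonglongrightarrow> 0" by simp
  qed
qed

lemma has_trace_zero_C1:
  assumes "open K" "bounded K" "C1 w" "\<And>x. x \<in> \<Gamma> \<Longrightarrow> w x = 0"
  shows "has_trace K \<Gamma> w (\<lambda>x. 0)"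
proof -
  have "(\<integral>\<^sup>+x\<in>\<Gamma>. ennreal ((norm (w x))\<^sup>2) \<partial>surface) = (\<integral>\<^sup>+x. 0 \<partial>surface)"
    by (intro nn_integral_cong) (use assms(4) in \<open>auto simp: indicator_def\<close>)
  then have "has_trace K \<Gamma> (\<lambda>x. fst (cjet w x)) (\<lambda>x. 0)"
    unfolding has_trace_zero_iff[OF assms(1,2) cjet_jets[OF assms(1-3)]]
    by (intro exI[of _ "\<lambda>n. w"]) (simp add: assms(3) l2_norm_zero)
  then show ?thesis by (simp add: cjet_def)
qed

lemma zero_trace: "open K \<Longrightarrow> bounded K \<Longrightarrow> has_trace K \<Gamma> (\<lambda>x. 0) (\<lambda>x. 0)"
  by (rule has_trace_zero_C1) (auto intro: C1_const)

text \<open>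
  Two functions with the same boundary values differ by one of trace zero, for which
  Green's formula gives zero. So the description in \<open>normal_trace\<close> determines exactly one number.
\<close>

lemma normal_trace_tr0:
  assumes K: "lipschitz_domain K" and "\<sigma> \<in> Hdiv K" "v \<in> H1 K"
  shows "normal_trace K \<sigma> (tr0 K v) = cinner K (div_jet_of K \<sigma>) (jet_of K v)"
proof -
  note Kop = lipschitz_domain_open[OF K] and Kb = lipschitz_domain_bounded[OF K]
  have q: "div_jet_of K \<sigma> \<in> div_jets K" by (rule Hdiv_div_jet_of[OF assms(2)])
  have F: "ipm K \<sigma> (grad K u) + ipv K (dvg K \<sigma>) u = cinner K (div_jet_of K \<sigma>) (jet_of K u)" if "u \<in> H1 K" for u
    using cinner_split[OF div_jets_L2[OF q] jets_L2[OF H1_jet_of[OF that]]] by (simp add: div_jet_of_def jet_of_def)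
  have eq: "cinner K (div_jet_of K \<sigma>) (jet_of K u) = cinner K (div_jet_of K \<sigma>) (jet_of K v)"
    if u: "u \<in> H1 K" "tr0 K u = tr0 K v" for u
  proof -
    have "u \<in> tr0 K u" using u(1) zero_trace[OF Kop Kb] by (simp add: tr0_def)
    then have "has_trace K (frontier K) (\<lambda>x. u x - v x) (\<lambda>x. 0)" unfolding u(2) by (simp add: tr0_def)
    then have "has_trace K (frontier K) (\<lambda>x. fst (jet_of K u x - jet_of K v x)) (\<lambda>x. 0)" by (simp add: jet_of_def)
    then have "cinner K (div_jet_of K \<sigma>) (\<lambda>x. jet_of K u x - jet_of K v x) = 0"
      by (intro green_trace_zero[OF K q] jets_diff[OF Kop Kb] H1_jet_of u(1) assms(3))
    then show ?thesis
      using cinner_diff_right[OF div_jets_L2[OF q] jets_L2[OF H1_jet_of[OF u(1)]] jets_L2[OF H1_jet_of[OF assms(3)]]] by simp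
  qed
  have mem: "tr0 K v \<in> Hhalf K" using assms(3) by (simp add: Hhalf_def)
  have "(THE c. \<forall>u\<in>H1 K. tr0 K u = tr0 K v \<longrightarrow> c = ipm K \<sigma> (grad K u) + ipv K (dvg K \<sigma>) u)
      = cinner K (div_jet_of K \<sigma>) (jet_of K v)"
  proof (rule the_equality)
    show "\<forall>u\<in>H1 K. tr0 K u = tr0 K v \<longrightarrow> cinner K (div_jet_of K \<sigma>) (jet_of K v) = ipm K \<sigma> (grad K u) + ipv K (dvg K \<sigma>) u"
      using F eq by simp
    show "c = cinner K (div_jet_of K \<sigma>) (jet_of K v)"
      if "\<forall>u\<in>H1 K. tr0 K u = tr0 K v \<longrightarrow> c = ipm K \<sigma> (grad K u) + ipv K (dvg K \<sigma>) u" for c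
      using that assms(3) F by simp
  qed
  then show ?thesis using mem by (simp add: normal_trace_def)
qed

section \<open>Meshes\<close>

lemma L2_cong: "(\<And>x. x \<in> K \<Longrightarrow> f x = g x) \<Longrightarrow> f \<in> L2 K \<longleftrightarrow> g \<in> L2 K"
proof -
  assume eq: "\<And>x. x \<in> K \<Longrightarrow> f x = g x"
  have "f \<in> borel_measurable (lebesgue_on K) \<longleftrightarrow> g \<in> borel_measurable (lebesgue_on K)"
    by (rule measurable_cong) (simp add: eq)
  moreover have "integrable (lebesgue_on K) (\<lambda>x. (norm (f x))\<^sup>2) \<longleftrightarrow> integrable (lebesgue_on K) (\<lambda>x. (norm (g x))\<^sup>2)"
    by (rule Bochner_Integration.integrable_cong) (simp_all add: eq)
  ultimately show ?thesis by (simp add: L2_def)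
qed

lemma weak_grad_cong:
  assumes "\<And>x. x \<in> K \<Longrightarrow> u x = u' x" "\<And>x. x \<in> K \<Longrightarrow> G x = G' x"
  shows "weak_grad K u G \<longleftrightarrow> weak_grad K u' G'"
proof -
  have "(LINT x|lebesgue_on K. u x $ i * of_real (partial j \<phi> x)) = (LINT x|lebesgue_on K. u' x $ i * of_real (partial j \<phi> x))"
    "(LINT x|lebesgue_on K. G x $ i $ j * of_real (\<phi> x)) = (LINT x|lebesgue_on K. G' x $ i $ j * of_real (\<phi> x))" for i j \<phi>
    by (intro Bochner_Integration.integral_cong; simp add: assms)+
  then show ?thesis by (simp add: weak_grad_def)
qed

lemma grad_cong: "(\<And>x. x \<in> K \<Longrightarrow> u x = u' x) \<Longrightarrow> grad K u = grad K u'"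
  unfolding grad_def using weak_grad_cong[of K u u'] by simp

lemma H1_cong: "(\<And>x. x \<in> K \<Longrightarrow> u x = u' x) \<Longrightarrow> u \<in> H1 K \<longleftrightarrow> u' \<in> H1 K"
  unfolding H1_def using weak_grad_cong[of K u u'] L2_cong[of K u u'] by simp

lemma jets_cong: "(\<And>x. x \<in> K \<Longrightarrow> p x = q x) \<Longrightarrow> p \<in> jets K \<longleftrightarrow> q \<in> jets K"
  unfolding jets_def
  using weak_grad_cong[of K "\<lambda>x. fst (p x)" "\<lambda>x. fst (q x)" "\<lambda>x. snd (p x)" "\<lambda>x. snd (q x)"] L2_cong[of K p q] by simp

lemma H1_norm_cong:
  assumes "\<And>x. x \<in> K \<Longrightarrow> u x = u' x" shows "H1_norm K u = H1_norm K u'"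
proof -
  have "ipv K u u = ipv K u' u'" unfolding ipv_def by (intro Bochner_Integration.integral_cong) (simp_all add: assms)
  then show ?thesis using grad_cong[OF assms] by (simp add: H1_norm_def)
qed

lemma tr0_cong:
  assumes "\<And>x. x \<in> K \<Longrightarrow> u x = u' x" shows "tr0 K u = tr0 K u'"
proof -
  have "H1_norm K (\<lambda>x. w n x - (v x - u x)) = H1_norm K (\<lambda>x. w n x - (v x - u' x))" for w :: "nat \<Rightarrow> vfield" and n v
    by (rule H1_norm_cong) (simp add: assms)
  then show ?thesis by (simp add: tr0_def has_trace_def)
qed

lemma l2_norm_cong: "(\<And>x. x \<in> K \<Longrightarrow> p x = q x) \<Longrightarrow> l2_norm K p = l2_norm K q"
  unfolding l2_norm_def l2_inner_def by (intro arg_cong[where f = sqrt] Bochner_Integration.integral_cong) simp_all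

lemma cinner_cong: "(\<And>x. x \<in> K \<Longrightarrow> p x = p' x) \<Longrightarrow> (\<And>x. x \<in> K \<Longrightarrow> q x = q' x) \<Longrightarrow> cinner K p q = cinner K p' q'"
  unfolding cinner_def by (intro Bochner_Integration.integral_cong) simp_all

text \<open>
  The elementwise gradients are glued by indicator functions, so that broken fields are treated by
  the theory of square integrable jets on the whole domain. On the skeleton of the mesh, a null set,
  the gradient part is zero.
\<close>

definition mesh_jet :: "point set set \<Rightarrow> vfield \<Rightarrow> point \<Rightarrow> jet" where
  "mesh_jet T v x = (v x, \<Sum>K\<in>T. indicator K x *\<^sub>R grad K v x)"

definition mesh_jets :: "point set \<Rightarrow> point set set \<Rightarrow> (point \<Rightarrow> jet) set" where
  "mesh_jets \<Omega> T = {p \<in> L2 \<Omega>. \<forall>K\<in>T. p \<in> jets K}"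

locale lipschitz_mesh =
  fixes \<Omega> :: "point set" and T :: "point set set"
  assumes \<Omega>: "lipschitz_domain \<Omega>" and mesh: "mesh \<Omega> T"
begin

lemma \<Omega>_open: "open \<Omega>" and \<Omega>_bounded: "bounded \<Omega>"
  using \<Omega> lipschitz_domain_open lipschitz_domain_bounded by auto

lemma finite_mesh: "finite T" using mesh by (simp add: mesh_def)

lemma mesh_lipschitz: "K \<in> T \<Longrightarrow> lipschitz_domain K" using mesh by (simp add: mesh_def)

lemma mesh_open: "K \<in> T \<Longrightarrow> open K" using mesh_lipschitz lipschitz_domain_open by blast
lemma mesh_bounded: "K \<in> T \<Longrightarrow> bounded K" using mesh_lipschitz lipschitz_domain_bounded by blast
lemma mesh_subset: "K \<in> T \<Longrightarrow> K \<subseteq> \<Omega>" using mesh by (simp add: mesh_def)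

lemma mesh_disjoint: "K \<in> T \<Longrightarrow> K' \<in> T \<Longrightarrow> x \<in> K \<Longrightarrow> x \<in> K' \<Longrightarrow> K = K'"
  using mesh by (auto simp: mesh_def disjoint_def)

lemma \<Omega>_sets: "\<Omega> \<in> sets lebesgue" using \<Omega>_open by simp
lemma mesh_sets: "K \<in> T \<Longrightarrow> K \<in> sets lebesgue" using mesh_open by simp

text \<open>
  The closures of the elements cover the domain, and the boundaries of the elements are null sets
  because they are locally graphs.
\<close>

lemma mesh_AE: "AE x in lebesgue. x \<in> \<Omega> \<longrightarrow> x \<in> \<Union>T"
proof -
  have "(\<Union>K\<in>T. frontier K) \<in> null_sets lborel"
    using finite_mesh frontier_lipschitz_domain_null[OF mesh_lipschitz] by (intro null_sets.finite_UN) auto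
  then have "AE x in lebesgue. x \<notin> (\<Union>K\<in>T. frontier K)"
    by (intro AE_completion AE_not_in)
  then show ?thesis
  proof eventually_elim
    case (elim x)
    show ?case
    proof
      assume "x \<in> \<Omega>"
      then have "x \<in> (\<Union>K\<in>T. closure K)" using mesh closure_subset[of \<Omega>] by (auto simp: mesh_def)
      then obtain K where K: "K \<in> T" "x \<in> closure K" by blast
      then have "x \<in> K" using elim mesh_open[OF K(1)] by (auto simp: frontier_def interior_open)
      then show "x \<in> \<Union>T" using K by blast
    qed
  qed
qed

lemma mesh_sum_indicator:
  fixes f :: "point set \<Rightarrow> 'b::real_vector"
  assumes "K \<in> T" "x \<in> K"
  shows "(\<Sum>K\<in>T. indicator K x *\<^sub>R f K) = f K"
proof -
  have "(\<Sum>K'\<in>T. indicator K' x *\<^sub>R f K') = (\<Sum>K'\<in>{K}. indicator K' x *\<^sub>R f K')"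
  proof (rule sum.mono_neutral_right[OF finite_mesh])
    show "\<forall>K'\<in>T - {K}. indicator K' x *\<^sub>R f K' = 0"
    proof
      fix K' assume "K' \<in> T - {K}"
      then have "x \<notin> K'" using mesh_disjoint[OF assms(1) _ assms(2)] by blast
      then show "indicator K' x *\<^sub>R f K' = 0" by simp
    qed
  qed (use assms in simp)
  then show ?thesis using assms by simp
qed

lemma mesh_AE_glue:
  assumes "\<And>K. K \<in> T \<Longrightarrow> AE x in lebesgue_on K. P x"
  shows "AE x in lebesgue_on \<Omega>. P x"
proof -
  have "AE x in lebesgue. \<forall>K\<in>T. x \<in> K \<longrightarrow> P x"
    using finite_mesh assms mesh_sets by (subst AE_finite_all) (auto simp: AE_restrict_space_iff)
  with mesh_AE have "AE x in lebesgue. x \<in> \<Omega> \<longrightarrow> P x"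
    by eventually_elim auto
  then show ?thesis using \<Omega>_sets by (subst AE_restrict_space_iff) auto
qed

lemma mesh_sum_AE:
  fixes f :: "point \<Rightarrow> 'b::euclidean_space"
  shows "AE x in lebesgue. (\<Sum>K\<in>T. indicator K x *\<^sub>R f x) = indicator \<Omega> x *\<^sub>R f x"
  using mesh_AE
proof eventually_elim
  case (elim x)
  show ?case
  proof (cases "x \<in> \<Omega>")
    case True
    then obtain K where K: "K \<in> T" "x \<in> K" using elim by blast
    from mesh_sum_indicator[OF this, of "\<lambda>_. f x"] show ?thesis using True by simp
  next
    case False
    then show ?thesis using mesh_subset by (intro trans[OF sum.neutral]) (auto simp: indicator_def)
  qed
qed

lemma integrable_mesh:
  fixes f :: "point \<Rightarrow> 'b::euclidean_space"
  assumes "integrable (lebesgue_on \<Omega>) f"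
  shows "(\<Sum>K\<in>T. LINT x|lebesgue_on K. f x) = (LINT x|lebesgue_on \<Omega>. f x)"
proof -
  have iK: "integrable lebesgue (\<lambda>x. indicator K x *\<^sub>R f x)" if "K \<in> T" for K
    using integrable_lebesgue_on_subset[OF mesh_sets[OF that] \<Omega>_sets mesh_subset[OF that] assms]
      integrable_restrict_space[of K lebesgue f] mesh_sets[OF that] by simp
  have i\<Omega>: "integrable lebesgue (\<lambda>x. indicator \<Omega> x *\<^sub>R f x)"
    using assms integrable_restrict_space[of \<Omega> lebesgue f] \<Omega>_sets by simp
  have "(\<Sum>K\<in>T. LINT x|lebesgue_on K. f x) = (\<Sum>K\<in>T. LINT x|lebesgue. indicator K x *\<^sub>R f x)"
    by (intro sum.cong refl integral_restrict_space) (use mesh_sets in auto)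
  also have "\<dots> = (LINT x|lebesgue. (\<Sum>K\<in>T. indicator K x *\<^sub>R f x))"
    by (rule Bochner_Integration.integral_sum[symmetric]) (rule iK)
  also have "\<dots> = (LINT x|lebesgue. indicator \<Omega> x *\<^sub>R f x)"
  proof (rule integral_cong_AE[OF _ _ mesh_sum_AE])
    show "(\<lambda>x. \<Sum>K\<in>T. indicator K x *\<^sub>R f x) \<in> borel_measurable lebesgue"
      using iK by (intro borel_measurable_sum) auto
    show "(\<lambda>x. indicator \<Omega> x *\<^sub>R f x) \<in> borel_measurable lebesgue" using i\<Omega> by auto
  qed
  also have "\<dots> = (LINT x|lebesgue_on \<Omega>. f x)"
    by (rule integral_restrict_space[symmetric]) (use \<Omega>_sets in auto)
  finally show ?thesis .
qed

lemma L2_mesh: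
  fixes f :: "point \<Rightarrow> 'b::euclidean_space"
  assumes "\<And>K. K \<in> T \<Longrightarrow> f \<in> L2 K"
  shows "f \<in> L2 \<Omega>"
proof -
  have "(\<lambda>x. \<Sum>K\<in>T. indicator K x *\<^sub>R f x) \<in> borel_measurable lebesgue"
    using L2_measurable[OF assms] mesh_sets
    by (intro borel_measurable_sum) (auto simp: borel_measurable_restrict_space_iff)
  then have "(\<lambda>x. indicator \<Omega> x *\<^sub>R f x) \<in> borel_measurable lebesgue"
    by (rule borel_measurable_AE[OF _ mesh_sum_AE])
  then have m: "f \<in> borel_measurable (lebesgue_on \<Omega>)"
    using \<Omega>_sets by (subst borel_measurable_restrict_space_iff) auto
  have "integrable lebesgue (\<lambda>x. \<Sum>K\<in>T. indicator K x *\<^sub>R (norm (f x))\<^sup>2)"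
    using L2_integrable_sq[OF assms] mesh_sets integrable_restrict_space[of _ lebesgue "\<lambda>x. (norm (f x))\<^sup>2"]
    by (intro Bochner_Integration.integrable_sum) auto
  then have "integrable lebesgue (\<lambda>x. indicator \<Omega> x *\<^sub>R (norm (f x))\<^sup>2)"
  proof (rule integrable_cong_AE_imp)
    have "(\<lambda>x. (norm (f x))\<^sup>2) \<in> borel_measurable (lebesgue_on \<Omega>)" using m by measurable
    then show "(\<lambda>x. indicator \<Omega> x *\<^sub>R (norm (f x))\<^sup>2) \<in> borel_measurable lebesgue"
      using \<Omega>_sets by (subst (asm) borel_measurable_restrict_space_iff) auto
    show "AE x in lebesgue. (\<Sum>K\<in>T. indicator K x *\<^sub>R (norm (f x))\<^sup>2) = indicator \<Omega> x *\<^sub>R (norm (f x))\<^sup>2"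
      by (rule mesh_sum_AE)
  qed
  then have "integrable (lebesgue_on \<Omega>) (\<lambda>x. (norm (f x))\<^sup>2)"
    using \<Omega>_sets integrable_restrict_space[of \<Omega> lebesgue "\<lambda>x. (norm (f x))\<^sup>2"] by simp
  with m show ?thesis by (simp add: L2_def)
qed

lemma L2_mesh_element: "f \<in> L2 \<Omega> \<Longrightarrow> K \<in> T \<Longrightarrow> (f :: point \<Rightarrow> 'b::euclidean_space) \<in> L2 K"
  by (rule L2_subset[OF mesh_sets \<Omega>_sets mesh_subset])

lemma cinner_mesh: "p \<in> L2 \<Omega> \<Longrightarrow> q \<in> L2 \<Omega> \<Longrightarrow> (\<Sum>K\<in>T. cinner K p q) = cinner \<Omega> p q"
  unfolding cinner_def by (intro integrable_mesh cdot_integrable)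

lemma l2_norm_mesh: "(p :: point \<Rightarrow> jet) \<in> L2 \<Omega> \<Longrightarrow> (\<Sum>K\<in>T. (l2_norm K p)\<^sup>2) = (l2_norm \<Omega> p)\<^sup>2"
  unfolding l2_norm_sq_integral by (intro integrable_mesh L2_integrable_sq)

lemma mesh_jet_on: "K \<in> T \<Longrightarrow> x \<in> K \<Longrightarrow> mesh_jet T v x = jet_of K v x"
  using mesh_sum_indicator[of K x "\<lambda>K. grad K v x"] by (simp add: mesh_jet_def jet_of_def)

lemma mesh_jet_mesh_jets:
  assumes "v \<in> H1_broken T" shows "mesh_jet T v \<in> mesh_jets \<Omega> T"
proof -
  have j: "mesh_jet T v \<in> jets K" if "K \<in> T" for K
    using jets_cong[of K "mesh_jet T v" "jet_of K v", OF mesh_jet_on[OF that]] H1_jet_of[of v K] assms that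
    by (simp add: H1_broken_def)
  have "mesh_jet T v \<in> L2 \<Omega>" by (rule L2_mesh) (rule jets_L2[OF j])
  then show ?thesis using j by (simp add: mesh_jets_def)
qed

lemma mesh_jets_L2: "p \<in> mesh_jets \<Omega> T \<Longrightarrow> p \<in> L2 \<Omega>" by (simp add: mesh_jets_def)

lemma mesh_jet_L2: "v \<in> H1_broken T \<Longrightarrow> mesh_jet T v \<in> L2 \<Omega>"
  using mesh_jet_mesh_jets mesh_jets_L2 by blast

lemma fst_mesh_jets: "p \<in> mesh_jets \<Omega> T \<Longrightarrow> (\<lambda>x. fst (p x)) \<in> H1_broken T"
  using jets_H1 by (auto simp: mesh_jets_def H1_broken_def)

lemma fst_mesh_jet: "fst (mesh_jet T v x) = v x" by (simp add: mesh_jet_def)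

lemma mesh_jet_unique:
  assumes "p \<in> mesh_jets \<Omega> T"
  shows "AE x in lebesgue_on \<Omega>. mesh_jet T (\<lambda>x. fst (p x)) x = p x"
proof (rule mesh_AE_glue)
  fix K assume K: "K \<in> T"
  have "p \<in> jets K" using assms K by (simp add: mesh_jets_def)
  from jet_of_unique[OF mesh_open[OF K] mesh_bounded[OF K] this]
  have "AE x in lebesgue_on K. jet_of K (\<lambda>x. fst (p x)) x = p x" .
  moreover have "AE x in lebesgue_on K. x \<in> K" by (intro AE_I2) simp
  ultimately show "AE x in lebesgue_on K. mesh_jet T (\<lambda>x. fst (p x)) x = p x"
    by eventually_elim (simp add: mesh_jet_on[OF K])
qed

lemma cinner_mesh_jet:
  assumes "q \<in> L2 \<Omega>" "p \<in> mesh_jets \<Omega> T"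
  shows "cinner \<Omega> q (mesh_jet T (\<lambda>x. fst (p x))) = cinner \<Omega> q p"
  by (rule cinner_cong_AE[OF assms(1,1) mesh_jet_L2[OF fst_mesh_jets[OF assms(2)]] mesh_jets_L2[OF assms(2)] _ mesh_jet_unique[OF assms(2)]]) simp

lemma H1_broken_norm_mesh_jet:
  assumes "v \<in> H1_broken T" shows "H1_broken_norm T v = l2_norm \<Omega> (mesh_jet T v)"
proof -
  have "(\<Sum>K\<in>T. (H1_norm K v)\<^sup>2) = (\<Sum>K\<in>T. (l2_norm K (mesh_jet T v))\<^sup>2)"
  proof (rule sum.cong[OF refl])
    fix K assume K: "K \<in> T"
    then have "v \<in> H1 K" using assms by (simp add: H1_broken_def)
    then show "(H1_norm K v)\<^sup>2 = (l2_norm K (mesh_jet T v))\<^sup>2"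
      using l2_norm_cong[of K "mesh_jet T v" "jet_of K v", OF mesh_jet_on[OF K]] by (simp add: H1_norm_jet_of)
  qed
  then show ?thesis
    using l2_norm_mesh[OF mesh_jet_L2[OF assms]] by (simp add: H1_broken_norm_def l2_norm_nonneg)
qed

lemma H1_broken_norm_mesh_jets:
  assumes "p \<in> mesh_jets \<Omega> T" shows "H1_broken_norm T (\<lambda>x. fst (p x)) = l2_norm \<Omega> p"
  unfolding H1_broken_norm_mesh_jet[OF fst_mesh_jets[OF assms]]
  by (rule l2_norm_cong_AE[OF mesh_jet_L2[OF fst_mesh_jets[OF assms]] mesh_jets_L2[OF assms] mesh_jet_unique[OF assms]])

lemma mesh_jets_add: "p \<in> mesh_jets \<Omega> T \<Longrightarrow> q \<in> mesh_jets \<Omega> T \<Longrightarrow> (\<lambda>x. p x + q x) \<in> mesh_jets \<Omega> T"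
  unfolding mesh_jets_def using L2_add jets_add mesh_open mesh_bounded by auto

lemma mesh_jets_scaleR: "p \<in> mesh_jets \<Omega> T \<Longrightarrow> (\<lambda>x. c *\<^sub>R p x) \<in> mesh_jets \<Omega> T"
  unfolding mesh_jets_def using L2_scaleR jets_scaleR mesh_open mesh_bounded by auto

lemma mesh_jets_imul: "p \<in> mesh_jets \<Omega> T \<Longrightarrow> (\<lambda>x. imul (p x)) \<in> mesh_jets \<Omega> T"
  unfolding mesh_jets_def using L2_imul jets_imul mesh_open mesh_bounded by auto

lemma mesh_jets_cmul: "p \<in> mesh_jets \<Omega> T \<Longrightarrow> (\<lambda>x. cmul c (p x)) \<in> mesh_jets \<Omega> T"
  unfolding cmul_def by (intro mesh_jets_add mesh_jets_scaleR mesh_jets_imul)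

lemma mesh_jets_limit:
  assumes "\<And>n. s n \<in> mesh_jets \<Omega> T" "p \<in> L2 \<Omega>" "(\<lambda>n. l2_norm \<Omega> (\<lambda>x. s n x - p x)) \<longlonglongrightarrow> 0"
  shows "p \<in> mesh_jets \<Omega> T"
proof -
  have "p \<in> jets K" if K: "K \<in> T" for K
  proof (rule jets_limit[OF mesh_open[OF K] mesh_bounded[OF K]])
    show "s n \<in> jets K" for n using assms(1) K by (simp add: mesh_jets_def)
    show "p \<in> L2 K" by (rule L2_mesh_element[OF assms(2) K])
    have "l2_norm K (\<lambda>x. s n x - p x) \<le> l2_norm \<Omega> (\<lambda>x. s n x - p x)" for n
    proof -
      have L: "(\<lambda>x. s n x - p x) \<in> L2 \<Omega>" using assms mesh_jets_L2 by (intro L2_diff) auto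
      have "(l2_norm K (\<lambda>x. s n x - p x))\<^sup>2 \<le> (\<Sum>K\<in>T. (l2_norm K (\<lambda>x. s n x - p x))\<^sup>2)"
        using K finite_mesh by (intro member_le_sum) auto
      then show ?thesis unfolding l2_norm_mesh[OF L] using l2_norm_nonneg by (rule power2_le_imp_le)
    qed
    then show "(\<lambda>n. l2_norm K (\<lambda>x. s n x - p x)) \<longlonglongrightarrow> 0"
      by (intro tendsto_sandwich[OF _ _ tendsto_const assms(3)]) (auto simp: l2_norm_nonneg)
  qed
  then show ?thesis using assms(2) by (simp add: mesh_jets_def)
qed

lemma jets_mesh_jets: "p \<in> jets \<Omega> \<Longrightarrow> p \<in> mesh_jets \<Omega> T"
  using jets_subset[OF mesh_open \<Omega>_open mesh_subset] jets_L2 by (auto simp: mesh_jets_def)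

lemma H1_H1_broken: "u \<in> H1 \<Omega> \<Longrightarrow> u \<in> H1_broken T"
  using fst_mesh_jets[OF jets_mesh_jets[OF H1_jet_of]] by (simp add: jet_of_def)

lemma mesh_jet_jet_of:
  assumes "u \<in> H1 \<Omega>" shows "AE x in lebesgue_on \<Omega>. mesh_jet T u x = jet_of \<Omega> u x"
  using mesh_jet_unique[OF jets_mesh_jets[OF H1_jet_of[OF assms]]] by (simp add: jet_of_def)

lemma H1_broken_norm_H1: "u \<in> H1 \<Omega> \<Longrightarrow> H1_broken_norm T u = H1_norm \<Omega> u"
  using H1_broken_norm_mesh_jets[OF jets_mesh_jets[OF H1_jet_of]] H1_norm_jet_of by (simp add: jet_of_def)

text \<open>
  Green's formula on all elements at once: a field in \<open>Hdiv \<Omega>\<close> has one divergence on \<open>\<Omega>\<close>, which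
  restricts to its divergence on the elements, so the sum of the element boundary pairings is a single
  inner product over \<open>\<Omega>\<close>.
\<close>

lemma b_hat_tr2_mesh:
  assumes "\<sigma> \<in> Hdiv \<Omega>" "v \<in> H1_broken T"
  shows "b_hat T (tr2_mesh T \<sigma>) v = - cinner \<Omega> (div_jet_of \<Omega> \<sigma>) (mesh_jet T v)"
proof -
  let ?q = "div_jet_of \<Omega> \<sigma>"
  have q: "?q \<in> div_jets \<Omega>" by (rule Hdiv_div_jet_of[OF assms(1)])
  have "pair_mesh T (tr2_mesh T \<sigma>) (tr0_mesh T v) = (\<Sum>K\<in>T. normal_trace K \<sigma> (tr0 K v))"
    by (simp add: pair_mesh_def tr2_mesh_def tr0_mesh_def)
  also have "\<dots> = (\<Sum>K\<in>T. cinner K ?q (mesh_jet T v))"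
  proof (rule sum.cong[OF refl])
    fix K assume K: "K \<in> T"
    have qK: "?q \<in> div_jets K" by (rule div_jets_subset[OF mesh_open[OF K] \<Omega>_open mesh_subset[OF K] q])
    then have sK: "\<sigma> \<in> Hdiv K" using div_jets_Hdiv[OF qK] by (simp add: div_jet_of_def)
    have vK: "v \<in> H1 K" using assms(2) K by (simp add: H1_broken_def)
    have "normal_trace K \<sigma> (tr0 K v) = cinner K (div_jet_of K \<sigma>) (jet_of K v)"
      by (rule normal_trace_tr0[OF mesh_lipschitz[OF K] sK vK])
    also have "\<dots> = cinner K ?q (jet_of K v)"
    proof (rule cinner_cong_AE)
      show "AE x in lebesgue_on K. div_jet_of K \<sigma> x = ?q x"
        using div_jet_of_unique[OF mesh_open[OF K] mesh_bounded[OF K] qK] by (simp add: div_jet_of_def)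
    qed (use Hdiv_div_jet_of[OF sK] qK H1_jet_of[OF vK] div_jets_L2 jets_L2 in auto)
    also have "\<dots> = cinner K ?q (mesh_jet T v)"
      by (rule cinner_cong) (simp_all add: mesh_jet_on[OF K])
    finally show "normal_trace K \<sigma> (tr0 K v) = cinner K ?q (mesh_jet T v)" .
  qed
  also have "\<dots> = cinner \<Omega> ?q (mesh_jet T v)"
    by (rule cinner_mesh[OF div_jets_L2[OF q] mesh_jet_L2[OF assms(2)]])
  finally show ?thesis by (simp add: b_hat_def)
qed

end

section \<open>The sesquilinear forms\<close>

text \<open>
  The sesquilinear form \<open>b0\<close> is the inner product of \<open>material\<close>, applied pointwise to the jet of \<open>u\<close>, with
  the jet of \<open>v\<close>.
\<close>

definition material :: "real \<Rightarrow> real \<Rightarrow> (point \<Rightarrow> tensor4) \<Rightarrow> point \<Rightarrow> jet \<Rightarrow> jet" where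
  "material \<omega> \<rho> A x p = ((- (\<omega>\<^sup>2 * \<rho>)) *\<^sub>R fst p, ddot (A x) (snd p))"

text \<open>
  The constant counts entries: each of the 9 components of the result is a sum of 9 products.
\<close>

lemma norm_ddot_le: "norm (ddot B \<tau>) \<le> 81 * norm B * norm \<tau>"
proof -
  have c: "norm (\<Sum>k\<in>UNIV. \<Sum>l\<in>UNIV. B $ i $ j $ k $ l * \<tau> $ k $ l) \<le> 9 * norm B * norm \<tau>" for i j
  proof -
    have t: "norm (B $ i $ j $ k $ l * \<tau> $ k $ l) \<le> norm B * norm \<tau>" for k l
      unfolding norm_mult
    proof (rule mult_mono)
      show "cmod (B $ i $ j $ k $ l) \<le> norm B"
        using Finite_Cartesian_Product.norm_nth_le[of "B $ i $ j $ k" l] Finite_Cartesian_Product.norm_nth_le[of "B $ i $ j" k]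
          Finite_Cartesian_Product.norm_nth_le[of "B $ i" j] Finite_Cartesian_Product.norm_nth_le[of B i] by linarith
      show "cmod (\<tau> $ k $ l) \<le> norm \<tau>"
        using Finite_Cartesian_Product.norm_nth_le[of "\<tau> $ k" l] Finite_Cartesian_Product.norm_nth_le[of \<tau> k] by linarith
    qed auto
    have "norm (\<Sum>k\<in>UNIV. \<Sum>l\<in>UNIV. B $ i $ j $ k $ l * \<tau> $ k $ l) \<le> (\<Sum>k\<in>(UNIV::3 set). \<Sum>l\<in>(UNIV::3 set). norm B * norm \<tau>)"
      by (intro sum_norm_le t)
    then show ?thesis by simp
  qed
  have v: "norm w \<le> (\<Sum>i\<in>UNIV. norm (w $ i))" for w :: "'b::real_normed_vector^3"
    unfolding norm_vec_def by (rule L2_set_le_sum) simp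
  have "norm (ddot B \<tau>) \<le> (\<Sum>i\<in>UNIV. norm (ddot B \<tau> $ i))" by (rule v)
  also have "\<dots> \<le> (\<Sum>i\<in>(UNIV::3 set). \<Sum>j\<in>(UNIV::3 set). 9 * norm B * norm \<tau>)"
  proof (rule sum_mono)
    fix i
    have "norm (ddot B \<tau> $ i) \<le> (\<Sum>j\<in>UNIV. norm (ddot B \<tau> $ i $ j))" by (rule v)
    also have "\<dots> \<le> (\<Sum>j\<in>(UNIV::3 set). 9 * norm B * norm \<tau>)"
      by (intro sum_mono) (use c in \<open>simp add: ddot_def\<close>)
    finally show "norm (ddot B \<tau> $ i) \<le> (\<Sum>j\<in>(UNIV::3 set). 9 * norm B * norm \<tau>)" .
  qed
  finally show ?thesis by simp
qed

lemma material_bounded: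
  assumes "bounded (A ` \<Omega>)"
  obtains M where "M \<ge> 0" "\<And>x p. x \<in> \<Omega> \<Longrightarrow> norm (material \<omega> \<rho> A x p) \<le> M * norm p"
proof -
  obtain a where a: "\<And>x. x \<in> \<Omega> \<Longrightarrow> norm (A x) \<le> a" using assms by (auto simp: bounded_iff)
  show thesis
  proof (rule that[of "\<bar>\<omega>\<^sup>2 * \<rho>\<bar> + 81 * \<bar>a\<bar>"])
    fix x p assume x: "x \<in> \<Omega>"
    have "norm (material \<omega> \<rho> A x p) \<le> \<bar>\<omega>\<^sup>2 * \<rho>\<bar> * norm (fst p) + norm (ddot (A x) (snd p))"
      using norm_Pair_le[of "(- (\<omega>\<^sup>2 * \<rho>)) *\<^sub>R fst p" "ddot (A x) (snd p)"] by (simp add: material_def)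
    also have "norm (ddot (A x) (snd p)) \<le> 81 * norm (A x) * norm (snd p)" by (rule norm_ddot_le)
    also have "\<dots> \<le> 81 * \<bar>a\<bar> * norm p"
      using a[OF x] norm_snd_le[of "snd p" "fst p"] by (intro mult_mono) auto
    also have "\<bar>\<omega>\<^sup>2 * \<rho>\<bar> * norm (fst p) \<le> \<bar>\<omega>\<^sup>2 * \<rho>\<bar> * norm p" using norm_fst_le[of "fst p" "snd p"] by (intro mult_left_mono) auto
    finally show "norm (material \<omega> \<rho> A x p) \<le> (\<bar>\<omega>\<^sup>2 * \<rho>\<bar> + 81 * \<bar>a\<bar>) * norm p" by (simp add: distrib_right)
  qed simp
qed

lemma material_L2:
  assumes "A \<in> borel_measurable (lebesgue_on K)" "\<And>x p. x \<in> K \<Longrightarrow> norm (material \<omega> \<rho> A x p) \<le> M * norm p"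
    "M \<ge> 0" "p \<in> L2 K"
  shows "(\<lambda>x. material \<omega> \<rho> A x (p x)) \<in> L2 K"
    and "l2_norm K (\<lambda>x. material \<omega> \<rho> A x (p x)) \<le> M * l2_norm K p"
proof -
  have [measurable]: "p \<in> borel_measurable (lebesgue_on K)" by (rule L2_measurable[OF assms(4)])
  have "continuous_on UNIV (\<lambda>z :: tensor4 \<times> (complex^3^3). ddot (fst z) (snd z))"
    unfolding ddot_def by (intro continuous_on_vec_lambda continuous_on_sum continuous_on_mult continuous_on_component continuous_intros)
  then have "(\<lambda>x. ddot (A x) (snd (p x))) \<in> borel_measurable (lebesgue_on K)"
    using borel_measurable_continuous_Pair[of A "lebesgue_on K" "\<lambda>x. snd (p x)" ddot] assms(1)
      L2_measurable[OF L2_snd[OF assms(4)]] by (simp add: split_def)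
  moreover have "(\<lambda>x. (- (\<omega>\<^sup>2 * \<rho>)) *\<^sub>R fst (p x)) \<in> borel_measurable (lebesgue_on K)"
    using L2_measurable[OF L2_fst[OF assms(4)]] by simp
  ultimately have m: "(\<lambda>x. material \<omega> \<rho> A x (p x)) \<in> borel_measurable (lebesgue_on K)"
    unfolding material_def by (rule borel_measurable_Pair[rotated])
  have b: "(norm (material \<omega> \<rho> A x (p x)))\<^sup>2 \<le> M\<^sup>2 * (norm (p x))\<^sup>2" if "x \<in> K" for x
    using power_mono[OF assms(2)[OF that, of "p x"] norm_ge_zero, of 2] by (simp add: power_mult_distrib)
  have i: "integrable (lebesgue_on K) (\<lambda>x. M\<^sup>2 * (norm (p x))\<^sup>2)"
    using L2_integrable_sq[OF assms(4)] by simp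
  show L: "(\<lambda>x. material \<omega> \<rho> A x (p x)) \<in> L2 K" by (rule L2_dominated[OF m i b])
  have "(l2_norm K (\<lambda>x. material \<omega> \<rho> A x (p x)))\<^sup>2 \<le> (LINT x|lebesgue_on K. M\<^sup>2 * (norm (p x))\<^sup>2)"
    unfolding l2_norm_sq_integral by (rule integral_mono[OF L2_integrable_sq[OF L] i]) (use b in simp)
  also have "\<dots> = (M * l2_norm K p)\<^sup>2" by (simp add: power_mult_distrib l2_norm_sq_integral)
  finally show "l2_norm K (\<lambda>x. material \<omega> \<rho> A x (p x)) \<le> M * l2_norm K p"
    by (rule power2_le_imp_le) (intro mult_nonneg_nonneg assms(3) l2_norm_nonneg)
qed

section \<open>Antilinear functionals\<close>

text \<open>
  The real part of an antilinear functional determines it, and the real representation theorem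
  applies to the real part. The representing jet is a limit of elements of \<open>V\<close>, so evaluating the
  functional on them bounds its norm by \<open>C\<close>, without the factor 2 of \<open>norm_cinner_le\<close>.
\<close>

lemma complex_Riesz:
  fixes V :: "(point \<Rightarrow> jet) set" and l :: "(point \<Rightarrow> jet) \<Rightarrow> complex"
  assumes K: "K \<in> lmeasurable" and V: "V \<subseteq> L2 K" "V \<noteq> {}"
    and Vadd: "\<And>p q. p \<in> V \<Longrightarrow> q \<in> V \<Longrightarrow> (\<lambda>x. p x + q x) \<in> V"
    and Vsc: "\<And>c p. p \<in> V \<Longrightarrow> (\<lambda>x. c *\<^sub>R p x) \<in> V" and Vi: "\<And>p. p \<in> V \<Longrightarrow> (\<lambda>x. imul (p x)) \<in> V"
    and ladd: "\<And>p q. p \<in> V \<Longrightarrow> q \<in> V \<Longrightarrow> l (\<lambda>x. p x + q x) = l p + l q"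
    and lsc: "\<And>c p. p \<in> V \<Longrightarrow> l (\<lambda>x. c *\<^sub>R p x) = of_real c * l p"
    and li: "\<And>p. p \<in> V \<Longrightarrow> l (\<lambda>x. imul (p x)) = - \<i> * l p"
    and lb: "\<And>p. p \<in> V \<Longrightarrow> cmod (l p) \<le> C * l2_norm K p" and C: "C \<ge> 0"
  obtains g s where "g \<in> L2 K" "\<And>n. s n \<in> V" "(\<lambda>n. l2_norm K (\<lambda>x. s n x - g x)) \<longlonglongrightarrow> 0"
    "\<And>p. p \<in> V \<Longrightarrow> l p = cinner K g p" "l2_norm K g \<le> C"
proof -
  have rb: "\<bar>Re (l p)\<bar> \<le> C * l2_norm K p" if "p \<in> V" for p
    using lb[OF that] abs_Re_le_cmod[of "l p"] by linarith
  have radd: "Re (l (\<lambda>x. p x + q x)) = Re (l p) + Re (l q)" if "p \<in> V" "q \<in> V" for p q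
    using ladd[OF that] by simp
  have rsc: "Re (l (\<lambda>x. c *\<^sub>R p x)) = c * Re (l p)" if "p \<in> V" for c p
    using lsc[OF that] by simp
  obtain g s where g: "g \<in> L2 K" "\<And>n. s n \<in> V" "(\<lambda>n. l2_norm K (\<lambda>x. s n x - g x)) \<longlonglongrightarrow> 0"
    and rep: "\<And>p. p \<in> V \<Longrightarrow> Re (l p) = l2_inner K g p"
  proof (rule L2_Riesz[OF K V Vadd Vsc radd rsc rb])
    fix g s
    assume "g \<in> L2 K" "\<And>n. s n \<in> V" "(\<lambda>n. l2_norm K (\<lambda>x. s n x - g x)) \<longlonglongrightarrow> 0"
      "\<And>p. p \<in> V \<Longrightarrow> Re (l p) = l2_inner K g p"
    then show thesis by (rule that)
  qed
  have sL: "s n \<in> L2 K" for n using g(2) V(1) by blast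
  have eq: "l p = cinner K g p" if p: "p \<in> V" for p
  proof -
    have "Im (l p) = Re (l (\<lambda>x. imul (p x)))" using li[OF p] by simp
    then show ?thesis
      using rep[OF p] rep[OF Vi[OF p]] V(1) p by (subst cinner_eq[OF g(1)]) (auto simp: complex_eq_iff)
  qed
  have "l2_inner K g (s n) \<le> C * l2_norm K (s n)" for n
    using rep[OF g(2)] lb[OF g(2)] complex_Re_le_cmod order_trans by metis
  then have "l2_inner K g g \<le> C * l2_norm K g"
    using LIMSEQ_le[OF l2_inner_tendsto[OF sL g(1,1,3)] tendsto_mult_left[OF l2_norm_tendsto[OF sL g(1,3)]]] by blast
  then have "l2_norm K g * l2_norm K g \<le> C * l2_norm K g" by (simp add: l2_norm_sq[symmetric] power2_eq_square)
  then have "l2_norm K g \<le> C"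
    using C l2_norm_nonneg[of K g] by (cases "l2_norm K g = 0") auto
  with g eq show thesis using that by blast
qed

lemma antidual_bdd:
  assumes "l \<in> antidual V nV" "\<And>v. v \<in> V \<Longrightarrow> nV v \<ge> 0"
  shows "bdd_above {cmod (l v) | v. v \<in> V \<and> nV v \<le> 1}"
proof -
  obtain M where M: "\<And>v. v \<in> V \<Longrightarrow> cmod (l v) \<le> M * nV v"
    using assms(1) unfolding antidual_def by blast
  have "cmod (l v) \<le> \<bar>M\<bar>" if "v \<in> V" "nV v \<le> 1" for v
  proof -
    have "cmod (l v) \<le> M * nV v" by (rule M[OF that(1)])
    also have "\<dots> \<le> \<bar>M\<bar> * 1" using assms(2)[OF that(1)] that(2) by (intro mult_mono) auto
    finally show ?thesis by simp
  qed
  then show ?thesis by (intro bdd_aboveI) auto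
qed

lemma antidual_norm_le:
  assumes "\<And>v. v \<in> V \<Longrightarrow> cmod (l v) \<le> C * nV v" "C \<ge> 0" "z \<in> V" "nV z \<le> 1"
  shows "antidual_norm V nV l \<le> C"
  unfolding antidual_norm_def
proof (rule cSup_least)
  show "{cmod (l v) | v. v \<in> V \<and> nV v \<le> 1} \<noteq> {}" using assms by blast
  fix y assume "y \<in> {cmod (l v) | v. v \<in> V \<and> nV v \<le> 1}"
  then obtain v where v: "y = cmod (l v)" "v \<in> V" "nV v \<le> 1" by blast
  have "cmod (l v) \<le> C * nV v" by (rule assms(1)[OF v(2)])
  also have "\<dots> \<le> C * 1" using v(3) assms(2) by (rule mult_left_mono)
  finally show "y \<le> C" using v(1) by simp
qed

lemma antidual_norm_nonneg:
  assumes "l \<in> antidual V nV" "\<And>v. v \<in> V \<Longrightarrow> nV v \<ge> 0" "z \<in> V" "nV z \<le> 1"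
  shows "antidual_norm V nV l \<ge> 0"
proof -
  have "0 \<le> cmod (l z)" by simp
  also have "\<dots> \<le> antidual_norm V nV l"
    unfolding antidual_norm_def using assms(3,4) by (intro cSup_upper antidual_bdd[OF assms(1,2)]) auto
  finally show ?thesis .
qed

text \<open>
  If \<open>nV v\<close> is zero, scaling is impossible, but then \<open>l v = 0\<close> since \<open>l\<close> is bounded.
\<close>

lemma antidual_le:
  assumes l: "l \<in> antidual V nV" and nn: "\<And>v. v \<in> V \<Longrightarrow> nV v \<ge> 0" and v: "v \<in> V"
    and sc: "\<And>c v. v \<in> V \<Longrightarrow> (\<lambda>x. c *s v x) \<in> V" "\<And>c v. v \<in> V \<Longrightarrow> nV (\<lambda>x. c *s v x) = cmod c * nV v"
  shows "cmod (l v) \<le> antidual_norm V nV l * nV v"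
proof (cases "nV v = 0")
  case True
  then show ?thesis using l v by (auto simp: antidual_def)
next
  case False
  then have pos: "nV v > 0" using nn[OF v] by simp
  let ?c = "complex_of_real (1 / nV v)"
  have "cmod (l (\<lambda>x. ?c *s v x)) \<le> antidual_norm V nV l"
    unfolding antidual_norm_def using sc[OF v] pos
    by (intro cSup_upper antidual_bdd[OF l nn]) (auto simp: norm_divide)
  moreover have "l (\<lambda>x. ?c *s v x) = cnj ?c * l v" using l v by (simp add: antidual_def)
  ultimately show ?thesis using pos by (simp add: norm_mult norm_divide pos_divide_le_eq)
qed

section \<open>Broken and classical problems\<close>

locale viscoelastic_mesh = lipschitz_mesh +
  fixes \<Gamma>u :: "point set" and \<omega> \<rho> :: real and A :: "point \<Rightarrow> tensor4" and M :: real
  assumes \<Gamma>u: "\<Gamma>u \<in> sets borel" "\<Gamma>u \<subseteq> frontier \<Omega>"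
    and A: "A \<in> borel_measurable (lebesgue_on \<Omega>)"
    and M: "M \<ge> 0" "\<And>x p. x \<in> \<Omega> \<Longrightarrow> norm (material \<omega> \<rho> A x p) \<le> M * norm p"
begin

abbreviation "U \<equiv> H1_zero_on \<Omega> \<Gamma>u"
abbreviation "V \<equiv> H1_broken T"
abbreviation "J \<equiv> mesh_jet T"
abbreviation "U' \<equiv> antidual U (H1_norm \<Omega>)"
abbreviation "V' \<equiv> antidual V (H1_broken_norm T)"
abbreviation "normU' \<equiv> antidual_norm U (H1_norm \<Omega>)"
abbreviation "normV' \<equiv> antidual_norm V (H1_broken_norm T)"

lemma V_add: "v \<in> V \<Longrightarrow> w \<in> V \<Longrightarrow> (\<lambda>x. v x + w x) \<in> V"
  using fst_mesh_jets[OF mesh_jets_add[OF mesh_jet_mesh_jets mesh_jet_mesh_jets]] by (simp add: fst_mesh_jet)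

lemma V_cmul: "v \<in> V \<Longrightarrow> (\<lambda>x. c *s v x) \<in> V"
  using fst_mesh_jets[OF mesh_jets_cmul[OF mesh_jet_mesh_jets]] by (simp add: fst_mesh_jet fst_cmul)

lemma V_norm_cmul: "v \<in> V \<Longrightarrow> H1_broken_norm T (\<lambda>x. c *s v x) = cmod c * H1_broken_norm T v"
  using H1_broken_norm_mesh_jets[OF mesh_jets_cmul[OF mesh_jet_mesh_jets], of v c] H1_broken_norm_mesh_jet[of v]
  by (simp add: fst_mesh_jet fst_cmul l2_norm_cmul)

lemma V_norm_nonneg: "v \<in> V \<Longrightarrow> H1_broken_norm T v \<ge> 0"
  by (simp add: H1_broken_norm_mesh_jet l2_norm_nonneg)

lemma V'_le: "l \<in> V' \<Longrightarrow> v \<in> V \<Longrightarrow> cmod (l v) \<le> normV' l * H1_broken_norm T v"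
  by (rule antidual_le[OF _ V_norm_nonneg _ V_cmul V_norm_cmul])

lemma U_H1: "u \<in> U \<Longrightarrow> u \<in> H1 \<Omega>" by (simp add: H1_zero_on_def)
lemma U_V: "u \<in> U \<Longrightarrow> u \<in> V" using U_H1 H1_H1_broken by blast

lemma U_jet: "u \<in> U \<Longrightarrow> jet_of \<Omega> u \<in> jets \<Omega>" using U_H1 H1_jet_of by blast

lemma U_add: "u \<in> U \<Longrightarrow> v \<in> U \<Longrightarrow> (\<lambda>x. u x + v x) \<in> U"
  using has_trace_zero_add[OF \<Omega>_open \<Omega>_bounded U_jet U_jet \<Gamma>u(1), of u v]
    jets_H1[OF jets_add[OF \<Omega>_open \<Omega>_bounded U_jet U_jet], of u v]
  by (simp add: H1_zero_on_def jet_of_def)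

lemma U_cmul: "u \<in> U \<Longrightarrow> (\<lambda>x. c *s u x) \<in> U"
  using has_trace_zero_cmul[OF \<Omega>_open \<Omega>_bounded U_jet \<Gamma>u(1), of u c]
    jets_H1[OF jets_cmul[OF \<Omega>_open \<Omega>_bounded U_jet], of u c]
  by (simp add: H1_zero_on_def jet_of_def fst_cmul)

lemma U_norm_cmul: "u \<in> U \<Longrightarrow> H1_norm \<Omega> (\<lambda>x. c *s u x) = cmod c * H1_norm \<Omega> u"
  using V_norm_cmul[OF U_V] H1_broken_norm_H1[OF U_H1] H1_broken_norm_H1[OF U_H1[OF U_cmul]] by simp

lemma U_norm_nonneg: "u \<in> U \<Longrightarrow> H1_norm \<Omega> u \<ge> 0"
  using V_norm_nonneg[OF U_V] H1_broken_norm_H1[OF U_H1] by simp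

lemma U'_le: "l \<in> U' \<Longrightarrow> v \<in> U \<Longrightarrow> cmod (l v) \<le> normU' l * H1_norm \<Omega> v"
  by (rule antidual_le[OF _ U_norm_nonneg _ U_cmul U_norm_cmul])

lemma zero_jets: "(\<lambda>x. 0) \<in> jets \<Omega>"
  unfolding jets_iff[OF \<Omega>_open \<Omega>_bounded] by (simp add: L2_zero cinner_def cdot_def)

lemma U_zero: "(\<lambda>x. 0) \<in> U"
  using jets_H1[OF zero_jets] zero_trace[OF \<Omega>_open \<Omega>_bounded] by (simp add: H1_zero_on_def)

lemma H1_norm_zero: "H1_norm \<Omega> (\<lambda>x. 0) = 0"
  using H1_norm_jets[OF \<Omega>_open \<Omega>_bounded zero_jets] by (simp add: l2_norm_zero)

lemma V_zero: "(\<lambda>x. 0) \<in> V" and V_norm_zero: "H1_broken_norm T (\<lambda>x. 0) = 0"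
  using U_V[OF U_zero] H1_broken_norm_H1[OF U_H1[OF U_zero]] H1_norm_zero by auto

lemma normV'_le: "(\<And>v. v \<in> V \<Longrightarrow> cmod (l v) \<le> C * H1_broken_norm T v) \<Longrightarrow> C \<ge> 0 \<Longrightarrow> normV' l \<le> C"
  by (rule antidual_norm_le[OF _ _ V_zero]) (simp_all add: V_norm_zero)

lemma normU'_le: "(\<And>v. v \<in> U \<Longrightarrow> cmod (l v) \<le> C * H1_norm \<Omega> v) \<Longrightarrow> C \<ge> 0 \<Longrightarrow> normU' l \<le> C"
  by (rule antidual_norm_le[OF _ _ U_zero]) (simp_all add: H1_norm_zero)

lemma normV'_nonneg: "l \<in> V' \<Longrightarrow> normV' l \<ge> 0"
  by (rule antidual_norm_nonneg[OF _ V_norm_nonneg V_zero]) (simp_all add: V_norm_zero)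

lemma normU'_nonneg: "l \<in> U' \<Longrightarrow> normU' l \<ge> 0"
  by (rule antidual_norm_nonneg[OF _ U_norm_nonneg U_zero]) (simp_all add: H1_norm_zero)

lemma J_add: "v \<in> V \<Longrightarrow> w \<in> V \<Longrightarrow> AE x in lebesgue_on \<Omega>. J (\<lambda>x. v x + w x) x = J v x + J w x"
  using mesh_jet_unique[OF mesh_jets_add[OF mesh_jet_mesh_jets mesh_jet_mesh_jets], of v w] by (simp add: fst_mesh_jet)

lemma J_cmul: "v \<in> V \<Longrightarrow> AE x in lebesgue_on \<Omega>. J (\<lambda>x. c *s v x) x = cmul c (J v x)"
  using mesh_jet_unique[OF mesh_jets_cmul[OF mesh_jet_mesh_jets], of v c] by (simp add: fst_mesh_jet fst_cmul)

lemma cinner_cmul_right: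
  assumes "p \<in> L2 K" "q \<in> L2 K"
  shows "cinner K p (\<lambda>x. cmul c (q x)) = cnj c * cinner K p q"
proof -
  have "cdot a (cmul c b) = cnj c * cdot a b" for a b
  proof -
    have e: "fst (cmul c b) $ i = c * fst b $ i" "snd (cmul c b) $ i $ j = c * snd b $ i $ j" for i j
      by (simp_all add: cmul_def imul_def complex_eq_iff)
    show ?thesis by (simp add: cdot_def e sum_distrib_left algebra_simps)
  qed
  then show ?thesis by (simp add: cinner_def)
qed

lemma pairing_V':
  assumes g: "g \<in> L2 \<Omega>"
  shows "(\<lambda>v. cinner \<Omega> g (J v)) \<in> V'" and "normV' (\<lambda>v. cinner \<Omega> g (J v)) \<le> 2 * l2_norm \<Omega> g"
proof -
  have b: "cmod (cinner \<Omega> g (J v)) \<le> 2 * l2_norm \<Omega> g * H1_broken_norm T v" if "v \<in> V" for v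
    using norm_cinner_le[OF g mesh_jet_L2[OF that]] by (simp add: H1_broken_norm_mesh_jet[OF that])
  have add: "cinner \<Omega> g (J (\<lambda>x. v x + w x)) = cinner \<Omega> g (J v) + cinner \<Omega> g (J w)" if "v \<in> V" "w \<in> V" for v w
    using cinner_add_right[OF g mesh_jet_L2[OF that(1)] mesh_jet_L2[OF that(2)]]
      cinner_cong_AE[OF g g mesh_jet_L2[OF V_add[OF that]] L2_add[OF mesh_jet_L2[OF that(1)] mesh_jet_L2[OF that(2)]] _ J_add[OF that]]
    by simp
  have cm: "cinner \<Omega> g (J (\<lambda>x. c *s v x)) = cnj c * cinner \<Omega> g (J v)" if "v \<in> V" for c v
    using cinner_cmul_right[OF g mesh_jet_L2[OF that], of c]
      cinner_cong_AE[OF g g mesh_jet_L2[OF V_cmul[OF that]] mesh_jets_L2[OF mesh_jets_cmul[OF mesh_jet_mesh_jets[OF that]]] _ J_cmul[OF that, of c]]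
    by simp
  show "(\<lambda>v. cinner \<Omega> g (J v)) \<in> V'" unfolding antidual_def using b add cm by blast
  show "normV' (\<lambda>v. cinner \<Omega> g (J v)) \<le> 2 * l2_norm \<Omega> g"
    by (rule normV'_le[OF b]) (simp_all add: l2_norm_nonneg)
qed

text \<open>
  The broken space is closed in \<open>L2\<close> through its jets, so the representative is itself a broken field
  together with its elementwise gradient.
\<close>

lemma V'_Riesz:
  assumes l: "l \<in> V'"
  obtains g where "g \<in> mesh_jets \<Omega> T" "\<And>v. v \<in> V \<Longrightarrow> l v = cinner \<Omega> g (J v)" "l2_norm \<Omega> g \<le> normV' l"
proof -
  have la: "l (\<lambda>x. v x + w x) = l v + l w" if "v \<in> V" "w \<in> V" for v w using l that by (simp add: antidual_def)
  have lc: "l (\<lambda>x. c *s v x) = cnj c * l v" if "v \<in> V" for c v using l that by (simp add: antidual_def)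
  have \<Omega>m: "\<Omega> \<in> lmeasurable" by (rule lmeasurable_open[OF \<Omega>_bounded \<Omega>_open])
  have e1: "(\<lambda>x. fst (c *\<^sub>R p x)) = (\<lambda>x. of_real c *s fst (p x))" for c and p :: "point \<Rightarrow> jet"
    by (auto simp: fun_eq_iff vec_eq_iff scaleR_conv_of_real[where 'a = complex])
  have e2: "(\<lambda>x. fst (imul (p x))) = (\<lambda>x. \<i> *s fst (p x))" for p :: "point \<Rightarrow> jet"
    by (auto simp: fun_eq_iff vec_eq_iff imul_def)
  have ne: "mesh_jets \<Omega> T \<noteq> {}" using mesh_jet_mesh_jets[OF V_zero] by blast
  obtain g s where g: "g \<in> L2 \<Omega>" "\<And>n. s n \<in> mesh_jets \<Omega> T" "(\<lambda>n. l2_norm \<Omega> (\<lambda>x. s n x - g x)) \<longlonglongrightarrow> 0"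
    "\<And>p. p \<in> mesh_jets \<Omega> T \<Longrightarrow> l (\<lambda>x. fst (p x)) = cinner \<Omega> g p" "l2_norm \<Omega> g \<le> normV' l"
  proof (rule complex_Riesz[OF \<Omega>m _ ne mesh_jets_add mesh_jets_scaleR mesh_jets_imul, of "\<lambda>p. l (\<lambda>x. fst (p x))" "normV' l"])
    show "mesh_jets \<Omega> T \<subseteq> L2 \<Omega>" using mesh_jets_L2 by blast
    show "l (\<lambda>x. fst (p x + q x)) = l (\<lambda>x. fst (p x)) + l (\<lambda>x. fst (q x))" if "p \<in> mesh_jets \<Omega> T" "q \<in> mesh_jets \<Omega> T" for p q
      using la[OF fst_mesh_jets[OF that(1)] fst_mesh_jets[OF that(2)]] by simp
    show "l (\<lambda>x. fst (c *\<^sub>R p x)) = of_real c * l (\<lambda>x. fst (p x))" if "p \<in> mesh_jets \<Omega> T" for c p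
      unfolding e1 using lc[OF fst_mesh_jets[OF that]] by simp
    show "l (\<lambda>x. fst (imul (p x))) = - \<i> * l (\<lambda>x. fst (p x))" if "p \<in> mesh_jets \<Omega> T" for p
      unfolding e2 using lc[OF fst_mesh_jets[OF that]] by simp
    show "cmod (l (\<lambda>x. fst (p x))) \<le> normV' l * l2_norm \<Omega> p" if "p \<in> mesh_jets \<Omega> T" for p
      using V'_le[OF l fst_mesh_jets[OF that]] by (simp add: H1_broken_norm_mesh_jets[OF that])
    show "normV' l \<ge> 0" by (rule normV'_nonneg[OF l])
    fix g s
    assume "g \<in> L2 \<Omega>" "\<And>n. s n \<in> mesh_jets \<Omega> T" "(\<lambda>n. l2_norm \<Omega> (\<lambda>x. s n x - g x)) \<longlonglongrightarrow> 0"
      "\<And>p. p \<in> mesh_jets \<Omega> T \<Longrightarrow> l (\<lambda>x. fst (p x)) = cinner \<Omega> g p" "l2_norm \<Omega> g \<le> normV' l"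
    then show thesis by (rule that)
  qed
  show thesis
  proof (rule that[of g])
    show "g \<in> mesh_jets \<Omega> T" by (rule mesh_jets_limit[OF g(2,1,3)])
    show "l v = cinner \<Omega> g (J v)" if "v \<in> V" for v
      using g(4)[OF mesh_jet_mesh_jets[OF that]] by (simp add: fst_mesh_jet)
  qed (rule g(5))
qed

lemma U'_restrict:
  assumes "l \<in> V'" shows "l \<in> U'" and "normU' l \<le> normV' l"
proof -
  have b: "cmod (l v) \<le> normV' l * H1_norm \<Omega> v" if "v \<in> U" for v
    using V'_le[OF assms U_V[OF that]] by (simp add: H1_broken_norm_H1[OF U_H1[OF that]])
  show "l \<in> U'" using assms U_V b unfolding antidual_def by blast
  show "normU' l \<le> normV' l" by (rule normU'_le[OF b normV'_nonneg[OF assms]])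
qed

text \<open>
  A functional on \<open>U\<close> is represented by a square integrable jet \<open>g\<close>, and pairing with \<open>g\<close> makes
  sense on the whole broken space. This replaces the Hahn-Banach theorem, at the cost of a factor 2.
\<close>

lemma U'_extend:
  assumes l: "l \<in> U'"
  obtains l' where "l' \<in> V'" "\<And>v. v \<in> U \<Longrightarrow> l' v = l v" "normV' l' \<le> 2 * normU' l"
proof -
  define S where "S = {p \<in> jets \<Omega>. (\<lambda>x. fst (p x)) \<in> U}"
  have la: "l (\<lambda>x. v x + w x) = l v + l w" if "v \<in> U" "w \<in> U" for v w using l that by (simp add: antidual_def)
  have lc: "l (\<lambda>x. c *s v x) = cnj c * l v" if "v \<in> U" for c v using l that by (simp add: antidual_def)
  have \<Omega>m: "\<Omega> \<in> lmeasurable" by (rule lmeasurable_open[OF \<Omega>_bounded \<Omega>_open])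
  have e1: "(\<lambda>x. fst (c *\<^sub>R p x)) = (\<lambda>x. of_real c *s fst (p x))" for c and p :: "point \<Rightarrow> jet"
    by (auto simp: fun_eq_iff vec_eq_iff scaleR_conv_of_real[where 'a = complex])
  have e2: "(\<lambda>x. fst (imul (p x))) = (\<lambda>x. \<i> *s fst (p x))" for p :: "point \<Rightarrow> jet"
    by (auto simp: fun_eq_iff vec_eq_iff imul_def)
  have SU: "(\<lambda>x. fst (p x)) \<in> U" "p \<in> jets \<Omega>" if "p \<in> S" for p using that by (auto simp: S_def)
  have US: "jet_of \<Omega> u \<in> S" if "u \<in> U" for u using that U_jet by (simp add: S_def jet_of_def)
  have ne: "S \<noteq> {}" using US[OF U_zero] by blast
  obtain g s where g: "g \<in> L2 \<Omega>" "\<And>n. s n \<in> S" "(\<lambda>n. l2_norm \<Omega> (\<lambda>x. s n x - g x)) \<longlonglongrightarrow> 0"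
    "\<And>p. p \<in> S \<Longrightarrow> l (\<lambda>x. fst (p x)) = cinner \<Omega> g p" "l2_norm \<Omega> g \<le> normU' l"
  proof (rule complex_Riesz[OF \<Omega>m _ ne, of "\<lambda>p. l (\<lambda>x. fst (p x))" "normU' l"])
    show "S \<subseteq> L2 \<Omega>" using SU jets_L2 by blast
    show "(\<lambda>x. p x + q x) \<in> S" if "p \<in> S" "q \<in> S" for p q
      using U_add[OF SU(1)[OF that(1)] SU(1)[OF that(2)]] jets_add[OF \<Omega>_open \<Omega>_bounded SU(2)[OF that(1)] SU(2)[OF that(2)]]
      by (simp add: S_def)
    show "(\<lambda>x. c *\<^sub>R p x) \<in> S" if "p \<in> S" for c p
      using U_cmul[OF SU(1)[OF that], of "of_real c"] jets_scaleR[OF \<Omega>_open \<Omega>_bounded SU(2)[OF that], of c]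
      unfolding S_def mem_Collect_eq e1 by simp
    show "(\<lambda>x. imul (p x)) \<in> S" if "p \<in> S" for p
      using U_cmul[OF SU(1)[OF that], of \<i>] jets_imul[OF \<Omega>_open \<Omega>_bounded SU(2)[OF that]]
      unfolding S_def mem_Collect_eq e2 by simp
    show "l (\<lambda>x. fst (p x + q x)) = l (\<lambda>x. fst (p x)) + l (\<lambda>x. fst (q x))" if "p \<in> S" "q \<in> S" for p q
      using la[OF SU(1)[OF that(1)] SU(1)[OF that(2)]] by simp
    show "l (\<lambda>x. fst (c *\<^sub>R p x)) = of_real c * l (\<lambda>x. fst (p x))" if "p \<in> S" for c p
      unfolding e1 using lc[OF SU(1)[OF that]] by simp
    show "l (\<lambda>x. fst (imul (p x))) = - \<i> * l (\<lambda>x. fst (p x))" if "p \<in> S" for p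
      unfolding e2 using lc[OF SU(1)[OF that]] by simp
    show "cmod (l (\<lambda>x. fst (p x))) \<le> normU' l * l2_norm \<Omega> p" if "p \<in> S" for p
      using U'_le[OF l SU(1)[OF that]] by (simp add: H1_norm_jets[OF \<Omega>_open \<Omega>_bounded SU(2)[OF that]])
    show "normU' l \<ge> 0" by (rule normU'_nonneg[OF l])
    fix g s
    assume "g \<in> L2 \<Omega>" "\<And>n. s n \<in> S" "(\<lambda>n. l2_norm \<Omega> (\<lambda>x. s n x - g x)) \<longlonglongrightarrow> 0"
      "\<And>p. p \<in> S \<Longrightarrow> l (\<lambda>x. fst (p x)) = cinner \<Omega> g p" "l2_norm \<Omega> g \<le> normU' l"
    then show thesis by (rule that)
  qed
  show thesis
  proof (rule that[of "\<lambda>v. cinner \<Omega> g (J v)"])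
    show "(\<lambda>v. cinner \<Omega> g (J v)) \<in> V'" by (rule pairing_V'(1)[OF g(1)])
    show "normV' (\<lambda>v. cinner \<Omega> g (J v)) \<le> 2 * normU' l" using pairing_V'(2)[OF g(1)] g(5) by simp
    show "cinner \<Omega> g (J v) = l v" if "v \<in> U" for v
      using cinner_mesh_jet[OF g(1) jets_mesh_jets[OF U_jet[OF that]]] g(4)[OF US[OF that]] by (simp add: jet_of_def)
  qed
qed

lemma material_J: "u \<in> V \<Longrightarrow> (\<lambda>x. material \<omega> \<rho> A x (J u x)) \<in> L2 \<Omega>"
  and norm_material_J: "u \<in> V \<Longrightarrow> l2_norm \<Omega> (\<lambda>x. material \<omega> \<rho> A x (J u x)) \<le> M * H1_broken_norm T u"
  using material_L2[OF A M(2,1) mesh_jet_L2] by (simp_all add: H1_broken_norm_mesh_jet)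

lemma b0_eq_cinner:
  assumes "u \<in> V" "v \<in> V"
  shows "b0 \<omega> \<rho> A T u v = cinner \<Omega> (\<lambda>x. material \<omega> \<rho> A x (J u x)) (J v)"
proof -
  have "b0 \<omega> \<rho> A T u v = (\<Sum>K\<in>T. - of_real (\<omega>\<^sup>2 * \<rho>) * ipv K u v + ipm K (\<lambda>x. ddot (A x) (grad K u x)) (grad K v))"
    by (simp only: b0_def sum.distrib sum_distrib_left)
  also have "\<dots> = (\<Sum>K\<in>T. cinner K (\<lambda>x. material \<omega> \<rho> A x (J u x)) (J v))"
  proof (rule sum.cong[OF refl])
    fix K assume K: "K \<in> T"
    have uK: "u \<in> H1 K" "v \<in> H1 K" using assms K by (auto simp: H1_broken_def)
    have AK: "A \<in> borel_measurable (lebesgue_on K)" by (rule measurable_restrict_mono[OF A mesh_subset[OF K]])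
    have mK: "(\<lambda>x. material \<omega> \<rho> A x (jet_of K u x)) \<in> L2 K"
      using mesh_subset[OF K] by (intro material_L2(1)[OF AK M(2) M(1)] jets_L2[OF H1_jet_of[OF uK(1)]]) auto
    have "cinner K (\<lambda>x. material \<omega> \<rho> A x (J u x)) (J v) = cinner K (\<lambda>x. material \<omega> \<rho> A x (jet_of K u x)) (jet_of K v)"
      by (rule cinner_cong) (simp_all add: mesh_jet_on[OF K])
    also have "\<dots> = ipv K (\<lambda>x. (- (\<omega>\<^sup>2 * \<rho>)) *\<^sub>R u x) v + ipm K (\<lambda>x. ddot (A x) (grad K u x)) (grad K v)"
      using cinner_split[OF mK jets_L2[OF H1_jet_of[OF uK(2)]]] by (simp add: material_def jet_of_def)
    also have "ipv K (\<lambda>x. (- (\<omega>\<^sup>2 * \<rho>)) *\<^sub>R u x) v = - of_real (\<omega>\<^sup>2 * \<rho>) * ipv K u v"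
    proof -
      have "(\<Sum>i\<in>UNIV. ((- (\<omega>\<^sup>2 * \<rho>)) *\<^sub>R u x) $ i * cnj (v x $ i)) = - of_real (\<omega>\<^sup>2 * \<rho>) * (\<Sum>i\<in>UNIV. u x $ i * cnj (v x $ i))" for x
        unfolding sum_distrib_left by (intro sum.cong refl) (simp add: scaleR_conv_of_real[where 'a = complex])
      then show ?thesis unfolding ipv_def by (simp only: integral_mult_right_zero)
    qed
    finally show "- of_real (\<omega>\<^sup>2 * \<rho>) * ipv K u v + ipm K (\<lambda>x. ddot (A x) (grad K u x)) (grad K v)
        = cinner K (\<lambda>x. material \<omega> \<rho> A x (J u x)) (J v)" by simp
  qed
  also have "\<dots> = cinner \<Omega> (\<lambda>x. material \<omega> \<rho> A x (J u x)) (J v)"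
    by (rule cinner_mesh[OF material_J[OF assms(1)] mesh_jet_L2[OF assms(2)]])
  finally show ?thesis .
qed

lemma b0_H1:
  assumes "u \<in> H1 \<Omega>" "v \<in> H1 \<Omega>"
  shows "b0 \<omega> \<rho> A T u v = cinner \<Omega> (\<lambda>x. material \<omega> \<rho> A x (jet_of \<Omega> u x)) (jet_of \<Omega> v)"
  unfolding b0_eq_cinner[OF H1_H1_broken[OF assms(1)] H1_H1_broken[OF assms(2)]]
proof (rule cinner_cong_AE)
  show "AE x in lebesgue_on \<Omega>. material \<omega> \<rho> A x (J u x) = material \<omega> \<rho> A x (jet_of \<Omega> u x)"
    using mesh_jet_jet_of[OF assms(1)] by eventually_elim simp
  show "AE x in lebesgue_on \<Omega>. J v x = jet_of \<Omega> v x" by (rule mesh_jet_jet_of[OF assms(2)])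
  show "(\<lambda>x. material \<omega> \<rho> A x (J u x)) \<in> L2 \<Omega>" by (rule material_J[OF H1_H1_broken[OF assms(1)]])
  show "(\<lambda>x. material \<omega> \<rho> A x (jet_of \<Omega> u x)) \<in> L2 \<Omega>"
    by (rule material_L2(1)[OF A M(2,1) jets_L2[OF H1_jet_of[OF assms(1)]]])
  show "J v \<in> L2 \<Omega>" by (rule mesh_jet_L2[OF H1_H1_broken[OF assms(2)]])
  show "jet_of \<Omega> v \<in> L2 \<Omega>" by (rule jets_L2[OF H1_jet_of[OF assms(2)]])
qed

text \<open>
  For \<open>v \<in> U\<close> the pairings over the element boundaries add up to the pairing over the boundary of \<open>\<Omega>\<close>,
  which vanishes because \<open>v\<close> vanishes on \<open>\<Gamma>u\<close> and the normal trace of \<open>\<sigma>\<close> on the rest.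
\<close>

lemma normal_trace_vanishes:
  assumes "s \<in> Hmhalf_mesh \<Omega> \<Gamma>u T" "v \<in> U"
  shows "b_hat T s v = 0"
proof -
  obtain \<sigma> where \<sigma>: "\<sigma> \<in> Hdiv_Gamma \<Omega> \<Gamma>u" "s = tr2_mesh T \<sigma>" using assms(1) by (auto simp: Hmhalf_mesh_def)
  have h: "\<sigma> \<in> Hdiv \<Omega>" using \<sigma>(1) by (simp add: Hdiv_Gamma_def)
  have "b_hat T s v = - cinner \<Omega> (div_jet_of \<Omega> \<sigma>) (jet_of \<Omega> v)"
    unfolding \<sigma>(2) b_hat_tr2_mesh[OF h U_V[OF assms(2)]]
    using cinner_mesh_jet[OF div_jets_L2[OF Hdiv_div_jet_of[OF h]] jets_mesh_jets[OF U_jet[OF assms(2)]]] by (simp add: jet_of_def)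
  also have "\<dots> = - normal_trace \<Omega> \<sigma> (tr0 \<Omega> v)"
    by (simp add: normal_trace_tr0[OF \<Omega> h U_H1[OF assms(2)]])
  also have "\<dots> = 0" using \<sigma>(1) assms(2) by (simp add: Hdiv_Gamma_def)
  finally show ?thesis .
qed

text \<open>
  These fields make \<open>U\<close> large enough to detect the weak divergence.
\<close>

lemma test_field_U:
  assumes "test_fun \<Omega> \<phi>"
  shows "\<exists>v\<in>U. C1 v \<and> cjet v = div_test \<phi> i"
proof -
  define v :: vfield where "v x = \<phi> x *\<^sub>R axis i 1" for x
  have C: "C1 v" unfolding v_def by (rule C1_scaleR[OF test_fun_C1[OF assms] C1_const])
  have "cjet v x = div_test \<phi> i x" for x
  proof -
    have "frechet_derivative v (at x) = (\<lambda>h. frechet_derivative \<phi> (at x) h *\<^sub>R axis i 1)"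
      unfolding v_def[abs_def]
      using frechet_derivative_at[OF C1_scaleR_has_derivative[OF test_fun_C1[OF assms] C1_const[of "axis i 1 :: complex^3"]], of x, symmetric]
      by simp
    then show ?thesis
      by (simp add: cjet_def cgrad_def div_test_def v_def prod_eq_iff vec_eq_iff partial_def)
         (simp add: axis_def scaleR_conv_of_real[where 'a = complex])
  qed
  moreover have "v \<in> U"
  proof -
    have "v \<in> H1 \<Omega>" using jets_H1[OF cjet_jets[OF \<Omega>_open \<Omega>_bounded C]] by (simp add: cjet_def)
    moreover have "has_trace \<Omega> \<Gamma>u v (\<lambda>x. 0)"
    proof (rule has_trace_zero_C1[OF \<Omega>_open \<Omega>_bounded C])
      fix x assume "x \<in> \<Gamma>u"
      then have "x \<notin> \<Omega>" using \<Gamma>u(2) \<Omega>_open by (auto simp: frontier_def interior_open)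
      then show "v x = 0" using test_fun_zero[OF assms] by (simp add: v_def)
    qed
    ultimately show ?thesis by (simp add: H1_zero_on_def)
  qed
  ultimately show ?thesis using C by (intro bexI[of _ v]) auto
qed

text \<open>
  A functional on the broken space that vanishes on \<open>U\<close> is a normal trace: its Riesz representative
  \<open>(d, \<sigma>)\<close> consists of a field \<open>d\<close> and its broken gradient \<open>\<sigma>\<close>; testing with compactly supported
  functions shows that \<open>d\<close> is the divergence of \<open>\<sigma>\<close> on all of \<open>\<Omega>\<close>, testing with the rest of \<open>U\<close>
  that the normal trace of \<open>\<sigma>\<close> vanishes off \<open>\<Gamma>\<^sub>u\<close>.
\<close>

lemma annihilator_normal_trace:
  assumes r: "r \<in> V'" and zero: "\<And>v. v \<in> U \<Longrightarrow> r v = 0"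
  obtains s where "s \<in> Hmhalf_mesh \<Omega> \<Gamma>u T" "\<And>v. v \<in> V \<Longrightarrow> b_hat T s v = - r v"
    "Hmhalf_mesh_norm \<Omega> \<Gamma>u T s \<le> normV' r"
proof -
  obtain g where g: "g \<in> mesh_jets \<Omega> T" "\<And>v. v \<in> V \<Longrightarrow> r v = cinner \<Omega> g (J v)" "l2_norm \<Omega> g \<le> normV' r"
    using V'_Riesz[OF r] by blast
  have gL: "g \<in> L2 \<Omega>" by (rule mesh_jets_L2[OF g(1)])
  have gU: "cinner \<Omega> g (jet_of \<Omega> v) = 0" if "v \<in> U" for v
    using cinner_mesh_jet[OF gL jets_mesh_jets[OF U_jet[OF that]]] g(2)[OF U_V[OF that]] zero[OF that] by (simp add: jet_of_def)
  have gd: "g \<in> div_jets \<Omega>"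
    unfolding div_jets_iff[OF \<Omega>_open \<Omega>_bounded]
  proof (intro conjI allI impI gL)
    fix \<phi> i assume "test_fun \<Omega> \<phi>"
    then obtain v where v: "v \<in> U" "C1 v" "cjet v = div_test \<phi> i" using test_field_U by blast
    have "cinner \<Omega> g (J v) = cinner \<Omega> g (cjet v)"
      using cinner_mesh_jet[OF gL jets_mesh_jets[OF cjet_jets[OF \<Omega>_open \<Omega>_bounded v(2)]]] by (simp add: cjet_def)
    then show "cinner \<Omega> g (div_test \<phi> i) = 0"
      using g(2)[OF U_V[OF v(1)]] zero[OF v(1)] by (simp add: v(3))
  qed
  define \<sigma> where "\<sigma> = (\<lambda>x. snd (g x))"
  have h: "\<sigma> \<in> Hdiv \<Omega>" unfolding \<sigma>_def by (rule div_jets_Hdiv[OF gd])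
  have q: "AE x in lebesgue_on \<Omega>. div_jet_of \<Omega> \<sigma> x = g x"
    unfolding \<sigma>_def by (rule div_jet_of_unique[OF \<Omega>_open \<Omega>_bounded gd])
  have qL: "div_jet_of \<Omega> \<sigma> \<in> L2 \<Omega>" by (rule div_jets_L2[OF Hdiv_div_jet_of[OF h]])
  have cq: "cinner \<Omega> (div_jet_of \<Omega> \<sigma>) p = cinner \<Omega> g p" if "p \<in> L2 \<Omega>" for p
    by (rule cinner_cong_AE[OF qL gL that that q]) simp
  have \<sigma>: "\<sigma> \<in> Hdiv_Gamma \<Omega> \<Gamma>u"
    using h gU by (auto simp: Hdiv_Gamma_def normal_trace_tr0[OF \<Omega> h U_H1] cq[OF jets_L2[OF U_jet]])
  show thesis
  proof (rule that[of "tr2_mesh T \<sigma>"])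
    show "tr2_mesh T \<sigma> \<in> Hmhalf_mesh \<Omega> \<Gamma>u T" using \<sigma> by (simp add: Hmhalf_mesh_def)
    show "b_hat T (tr2_mesh T \<sigma>) v = - r v" if "v \<in> V" for v
      unfolding b_hat_tr2_mesh[OF h that] cq[OF mesh_jet_L2[OF that]] by (simp add: g(2)[OF that])
    have "Hmhalf_mesh_norm \<Omega> \<Gamma>u T (tr2_mesh T \<sigma>) \<le> Hdiv_norm \<Omega> \<sigma>"
      unfolding Hmhalf_mesh_norm_def
    proof (rule cInf_lower)
      show "Hdiv_norm \<Omega> \<sigma> \<in> {Hdiv_norm \<Omega> \<tau> |\<tau>. \<tau> \<in> Hdiv_Gamma \<Omega> \<Gamma>u \<and> tr2_mesh T \<tau> = tr2_mesh T \<sigma>}"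
        using \<sigma> by blast
      show "bdd_below {Hdiv_norm \<Omega> \<tau> |\<tau>. \<tau> \<in> Hdiv_Gamma \<Omega> \<Gamma>u \<and> tr2_mesh T \<tau> = tr2_mesh T \<sigma>}"
        by (rule bdd_belowI[of _ 0]) (auto simp: Hdiv_Gamma_def Hdiv_norm_div_jet_of l2_norm_nonneg)
    qed
    also have "\<dots> = l2_norm \<Omega> g"
      unfolding \<sigma>_def by (rule Hdiv_norm_div_jets[OF \<Omega>_open \<Omega>_bounded gd])
    finally show "Hmhalf_mesh_norm \<Omega> \<Gamma>u T (tr2_mesh T \<sigma>) \<le> normV' r" using g(3) by simp
  qed
qed

text \<open>
  Elements of the broken space may be prescribed on one element and zero on the others, so equality of
  the total pairings gives equality on every element boundary.
\<close>

lemma normal_traces_eqI: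
  assumes s: "s \<in> Hmhalf_mesh \<Omega> \<Gamma>u T" "s' \<in> Hmhalf_mesh \<Omega> \<Gamma>u T"
    and eq: "\<And>v. v \<in> V \<Longrightarrow> b_hat T s v = b_hat T s' v"
  shows "s = s'"
proof -
  obtain \<sigma> \<sigma>' where \<sigma>: "\<sigma> \<in> Hdiv \<Omega>" "s = tr2_mesh T \<sigma>" and \<sigma>': "\<sigma>' \<in> Hdiv \<Omega>" "s' = tr2_mesh T \<sigma>'"
    using s by (auto simp: Hmhalf_mesh_def Hdiv_Gamma_def)
  have HK: "\<tau> \<in> Hdiv K" if "\<tau> \<in> Hdiv \<Omega>" "K \<in> T" for \<tau> K
    using div_jets_Hdiv[OF div_jets_subset[OF mesh_open[OF that(2)] \<Omega>_open mesh_subset[OF that(2)] Hdiv_div_jet_of[OF that(1)]]]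
    by (simp add: div_jet_of_def)
  have z1: "(\<lambda>x. 0) \<in> H1 K" if "K \<in> T" for K using V_zero that by (simp add: H1_broken_def)
  have z0: "normal_trace K \<tau> (tr0 K (\<lambda>x. 0)) = 0" if "\<tau> \<in> Hdiv \<Omega>" "K \<in> T" for \<tau> K
  proof -
    note KK = mesh_open[OF that(2)] mesh_bounded[OF that(2)]
    have zj: "(\<lambda>x. 0) \<in> jets K" by (rule jets_subset[OF KK(1) \<Omega>_open mesh_subset[OF that(2)] zero_jets])
    have "cinner K (div_jet_of K \<tau>) (jet_of K (\<lambda>x. 0)) = cinner K (div_jet_of K \<tau>) (\<lambda>x. 0)"
    proof (rule cinner_cong_AE)
      show "AE x in lebesgue_on K. jet_of K (\<lambda>x. 0) x = 0" using jet_of_unique[OF KK zj] by simp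
    qed (use div_jets_L2[OF Hdiv_div_jet_of[OF HK[OF that]]] jets_L2[OF H1_jet_of[OF z1[OF that(2)]]] L2_zero in auto)
    then show ?thesis
      by (simp add: normal_trace_tr0[OF mesh_lipschitz[OF that(2)] HK[OF that] z1[OF that(2)]] cinner_def cdot_def)
  qed
  have "normal_trace K \<sigma> vh = normal_trace K \<sigma>' vh" if K: "K \<in> T" and vh: "vh \<in> Hhalf K" for K vh
  proof -
    obtain v0 where v0: "v0 \<in> H1 K" "vh = tr0 K v0" using vh by (auto simp: Hhalf_def)
    define v where "v x = (if x \<in> K then v0 x else 0)" for x
    have vK: "v x = v0 x" if "x \<in> K" for x using that by (simp add: v_def)
    have vK': "v x = 0" if "K' \<in> T" "K' \<noteq> K" "x \<in> K'" for K' x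
      using that mesh_disjoint[OF K that(1)] by (auto simp: v_def)
    have "v \<in> H1 K'" if K': "K' \<in> T" for K'
    proof (cases "K' = K")
      case True then show ?thesis using H1_cong[of K v v0, OF vK] v0(1) by simp
    next
      case False then show ?thesis using H1_cong[of K' v "\<lambda>x. 0", OF vK'[OF K']] z1[OF K'] by simp
    qed
    then have vV: "v \<in> V" by (simp add: H1_broken_def)
    have pair: "pair_mesh T (tr2_mesh T \<tau>) (tr0_mesh T v) = normal_trace K \<tau> vh" if "\<tau> \<in> Hdiv \<Omega>" for \<tau>
    proof -
      have "pair_mesh T (tr2_mesh T \<tau>) (tr0_mesh T v) = (\<Sum>K'\<in>T. normal_trace K' \<tau> (tr0 K' v))"
        by (simp add: pair_mesh_def tr2_mesh_def tr0_mesh_def)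
      also have "\<dots> = (\<Sum>K'\<in>{K}. normal_trace K' \<tau> (tr0 K' v))"
      proof (rule sum.mono_neutral_right[OF finite_mesh])
        show "\<forall>K'\<in>T - {K}. normal_trace K' \<tau> (tr0 K' v) = 0"
        proof
          fix K' assume K': "K' \<in> T - {K}"
          then have "tr0 K' v = tr0 K' (\<lambda>x. 0)" using vK' by (intro tr0_cong) auto
          then show "normal_trace K' \<tau> (tr0 K' v) = 0" using z0[OF that] K' by simp
        qed
      qed (use K in simp)
      finally show ?thesis using tr0_cong[of K v v0, OF vK] by (simp add: v0(2))
    qed
    show ?thesis using eq[OF vV] pair[OF \<sigma>(1)] pair[OF \<sigma>'(1)] by (simp add: b_hat_def \<sigma>(2) \<sigma>'(2))
  qed
  then have "normal_trace K \<sigma> = normal_trace K \<sigma>'" if "K \<in> T" for K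
    using that by (intro ext) (auto simp: normal_trace_def restrict_def)
  then show ?thesis unfolding \<sigma>(2) \<sigma>'(2) tr2_mesh_def by (intro restrict_ext) simp
qed

abbreviation "solves_broken \<equiv> solves (U_mesh \<Omega> \<Gamma>u T) V (b_mesh \<omega> \<rho> A T)"
abbreviation "solves_classical \<equiv> solves U U (b0 \<omega> \<rho> A T)"

lemma broken_solution_classical: "solves_broken l (u, s) \<Longrightarrow> solves_classical l u"
proof -
  assume "solves_broken l (u, s)"
  then have *: "u \<in> U" "s \<in> Hmhalf_mesh \<Omega> \<Gamma>u T" "\<And>v. v \<in> V \<Longrightarrow> b0 \<omega> \<rho> A T u v + b_hat T s v = l v"
    by (auto simp: solves_def U_mesh_def b_mesh_def)
  have "b0 \<omega> \<rho> A T u v = l v" if "v \<in> U" for v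
    using *(3)[OF U_V[OF that]] normal_trace_vanishes[OF *(2) that] by simp
  then show "solves_classical l u" using *(1) by (simp add: solves_def)
qed

text \<open>
  The residual of a classical solution \<open>u\<close>, the functional \<open>r v = b0 u v - l v\<close> on the broken space,
  vanishes on \<open>U\<close>; hence it is a normal trace \<open>s\<close>, and \<open>(u, s)\<close> solves the broken problem.
\<close>

lemma classical_solution_broken:
  assumes l: "l \<in> V'" and u: "solves_classical l u"
  obtains s where "solves_broken l (u, s)"
    "Hmhalf_mesh_norm \<Omega> \<Gamma>u T s \<le> 2 * (M * H1_norm \<Omega> u) + normV' l"
proof -
  have uU: "u \<in> U" and ul: "\<And>v. v \<in> U \<Longrightarrow> b0 \<omega> \<rho> A T u v = l v" using u by (auto simp: solves_def)
  note uV = U_V[OF uU]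
  define g where "g = (\<lambda>x. material \<omega> \<rho> A x (J u x))"
  define r where "r v = cinner \<Omega> g (J v) - l v" for v
  have gL: "g \<in> L2 \<Omega>" unfolding g_def by (rule material_J[OF uV])
  have gn: "l2_norm \<Omega> g \<le> M * H1_norm \<Omega> u"
    unfolding g_def using norm_material_J[OF uV] by (simp add: H1_broken_norm_H1[OF U_H1[OF uU]])
  have gV: "(\<lambda>v. cinner \<Omega> g (J v)) \<in> V'" by (rule pairing_V'(1)[OF gL])
  have bound: "cmod (r v) \<le> (2 * (M * H1_norm \<Omega> u) + normV' l) * H1_broken_norm T v" if "v \<in> V" for v
  proof -
    have "cmod (r v) \<le> cmod (cinner \<Omega> g (J v)) + cmod (l v)" unfolding r_def by (rule norm_triangle_ineq4)
    also have "\<dots> \<le> normV' (\<lambda>v. cinner \<Omega> g (J v)) * H1_broken_norm T v + normV' l * H1_broken_norm T v"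
      using V'_le[OF gV that] V'_le[OF l that] by (rule add_mono)
    also have "\<dots> \<le> 2 * (M * H1_norm \<Omega> u) * H1_broken_norm T v + normV' l * H1_broken_norm T v"
      using pairing_V'(2)[OF gL] gn V_norm_nonneg[OF that] by (intro add_right_mono mult_right_mono) auto
    finally show ?thesis by (simp add: distrib_right)
  qed
  have r: "r \<in> V'"
    unfolding antidual_def mem_Collect_eq
  proof (intro conjI ballI allI)
    show "\<exists>M. \<forall>v\<in>V. cmod (r v) \<le> M * H1_broken_norm T v" using bound by blast
  qed (use gV l in \<open>simp_all add: antidual_def r_def algebra_simps\<close>)
  have r0: "r v = 0" if "v \<in> U" for v
    using ul[OF that] b0_eq_cinner[OF uV U_V[OF that]] by (simp add: r_def g_def)
  obtain s where s: "s \<in> Hmhalf_mesh \<Omega> \<Gamma>u T" "\<And>v. v \<in> V \<Longrightarrow> b_hat T s v = - r v"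
    "Hmhalf_mesh_norm \<Omega> \<Gamma>u T s \<le> normV' r"
    using annihilator_normal_trace[OF r r0] by blast
  show thesis
  proof (rule that[of s])
    have "b_mesh \<omega> \<rho> A T (u, s) v = l v" if "v \<in> V" for v
      using s(2)[OF that] b0_eq_cinner[OF uV that] by (simp add: b_mesh_def r_def g_def)
    then show "solves_broken l (u, s)" using s(1) uU by (simp add: solves_def U_mesh_def)
    have "normV' r \<le> 2 * (M * H1_norm \<Omega> u) + normV' l"
      by (rule normV'_le[OF bound]) (use M(1) U_norm_nonneg[OF uU] normV'_nonneg[OF l] in auto)
    then show "Hmhalf_mesh_norm \<Omega> \<Gamma>u T s \<le> 2 * (M * H1_norm \<Omega> u) + normV' l" using s(3) by linarith
  qed
qed

lemma Hmhalf_mesh_norm_nonneg: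
  assumes "s \<in> Hmhalf_mesh \<Omega> \<Gamma>u T" shows "Hmhalf_mesh_norm \<Omega> \<Gamma>u T s \<ge> 0"
  unfolding Hmhalf_mesh_norm_def
proof (rule cInf_greatest)
  show "{Hdiv_norm \<Omega> \<tau> |\<tau>. \<tau> \<in> Hdiv_Gamma \<Omega> \<Gamma>u \<and> tr2_mesh T \<tau> = s} \<noteq> {}"
    using assms by (auto simp: Hmhalf_mesh_def)
qed (auto simp: Hdiv_Gamma_def Hdiv_norm_div_jet_of l2_norm_nonneg)

text \<open>
  \<open>u\<close> fixes \<open>b0 u v\<close> and with it \<open>b_hat T s v\<close> for all broken \<open>v\<close>, and so \<open>s\<close>.
\<close>

lemma b_hat_solution_unique:
  assumes "solves_broken l (u, s)" "solves_broken l (u', s')" "same_on \<Omega> u u'"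
  shows "s = s'"
proof (rule normal_traces_eqI)
  have uV: "u \<in> V" "u' \<in> V" and uH: "u \<in> H1 \<Omega>" "u' \<in> H1 \<Omega>"
    using assms(1,2) U_V U_H1 by (auto simp: solves_def U_mesh_def)
  show "s \<in> Hmhalf_mesh \<Omega> \<Gamma>u T" "s' \<in> Hmhalf_mesh \<Omega> \<Gamma>u T"
    using assms(1,2) by (auto simp: solves_def U_mesh_def)
  fix v assume v: "v \<in> V"
  have j: "AE x in lebesgue_on \<Omega>. jet_of \<Omega> u x = jet_of \<Omega> u' x"
    by (rule jets_unique[OF \<Omega>_open \<Omega>_bounded H1_jet_of[OF uH(1)] H1_jet_of[OF uH(2)]])
       (use assms(3) in \<open>simp add: same_on_def jet_of_def\<close>)
  have "AE x in lebesgue_on \<Omega>. material \<omega> \<rho> A x (J u x) = material \<omega> \<rho> A x (J u' x)"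
    using j mesh_jet_jet_of[OF uH(1)] mesh_jet_jet_of[OF uH(2)] by eventually_elim simp
  then have "b0 \<omega> \<rho> A T u v = b0 \<omega> \<rho> A T u' v"
    unfolding b0_eq_cinner[OF uV(1) v] b0_eq_cinner[OF uV(2) v]
    by (intro cinner_cong_AE material_J uV mesh_jet_L2 v) auto
  moreover have "b0 \<omega> \<rho> A T u v + b_hat T s v = l v" "b0 \<omega> \<rho> A T u' v + b_hat T s' v = l v"
    using assms(1,2) v by (auto simp: solves_def b_mesh_def)
  ultimately show "b_hat T s v = b_hat T s' v" by (metis add_left_cancel)
qed

lemma broken_unique_solution:
  assumes cwp: "classical_well_posed \<Omega> \<Gamma>u \<omega> \<rho> A T" and l: "l \<in> V'"
  shows "\<exists>x. solves_broken l x \<and> (\<forall>y. solves_broken l y \<longrightarrow> same_U_mesh \<Omega> x y)"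
proof -
  have lU: "l \<in> U'" by (rule U'_restrict(1)[OF l])
  then obtain u where u: "solves_classical l u" "\<And>w. solves_classical l w \<Longrightarrow> same_on \<Omega> u w"
    using cwp unfolding classical_well_posed_def well_posed_def by blast
  obtain s where s: "solves_broken l (u, s)" using classical_solution_broken[OF l u(1)] by blast
  have "same_U_mesh \<Omega> (u, s) y" if y: "solves_broken l y" for y
  proof -
    obtain w t where wt: "y = (w, t)" by (cases y)
    have "same_on \<Omega> u w" using u(2) broken_solution_classical y unfolding wt by blast
    moreover have "s = t" using b_hat_solution_unique[OF s _ calculation] y unfolding wt by blast
    ultimately show ?thesis by (simp add: same_U_mesh_def wt)
  qed
  with s show ?thesis by blast
qed

text \<open>
  The components of the solution are bounded by \<open>C\<close> and, through the residual, by \<open>2 M C + 1\<close>. Only the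
  constant \<open>C\<close> of the classical problem and the bound \<open>M\<close> of the material law enter.
\<close>

lemma broken_solution_bound:
  assumes cwp: "classical_well_posed \<Omega> \<Gamma>u \<omega> \<rho> A T" and C: "C \<ge> 0"
    and bound: "\<And>l u. l \<in> U' \<Longrightarrow> solves_classical l u \<Longrightarrow> H1_norm \<Omega> u \<le> C * normU' l"
    and l: "l \<in> V'" and y: "solves_broken l y"
  shows "U_mesh_norm \<Omega> \<Gamma>u T y \<le> (C + 2 * (M * C) + 1) * normV' l"
proof -
  obtain u t where ut: "y = (u, t)" by (cases y)
  have lU: "l \<in> U'" by (rule U'_restrict(1)[OF l])
  have u: "solves_classical l u" using broken_solution_classical y unfolding ut by blast
  then have uU: "u \<in> U" by (simp add: solves_def)
  have "H1_norm \<Omega> u \<le> C * normU' l" by (rule bound[OF lU u])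
  also have "\<dots> \<le> C * normV' l" by (rule mult_left_mono[OF U'_restrict(2)[OF l] C])
  finally have un: "H1_norm \<Omega> u \<le> C * normV' l" .
  obtain s where s: "solves_broken l (u, s)" "Hmhalf_mesh_norm \<Omega> \<Gamma>u T s \<le> 2 * (M * H1_norm \<Omega> u) + normV' l"
    using classical_solution_broken[OF l u] by blast
  have "s = t" using b_hat_solution_unique[OF s(1), of u t] y unfolding ut by (simp add: same_on_def)
  then have tn: "Hmhalf_mesh_norm \<Omega> \<Gamma>u T t \<le> 2 * (M * H1_norm \<Omega> u) + normV' l" using s(2) by simp
  have t0: "Hmhalf_mesh_norm \<Omega> \<Gamma>u T t \<ge> 0"
    using y unfolding ut by (intro Hmhalf_mesh_norm_nonneg) (simp add: solves_def U_mesh_def)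
  have "U_mesh_norm \<Omega> \<Gamma>u T y \<le> H1_norm \<Omega> u + Hmhalf_mesh_norm \<Omega> \<Gamma>u T t"
    unfolding ut U_mesh_norm_def prod.case using U_norm_nonneg[OF uU] t0 by (rule sqrt_sum_squares_le_sum)
  also have "\<dots> \<le> C * normV' l + (2 * (M * (C * normV' l)) + normV' l)"
    using un tn mult_left_mono[OF un M(1)] by linarith
  finally show ?thesis by (simp add: algebra_simps)
qed

lemma classical_well_posed_bound:
  assumes "classical_well_posed \<Omega> \<Gamma>u \<omega> \<rho> A T"
  obtains C where "C \<ge> 0" "\<And>l u. l \<in> U' \<Longrightarrow> solves_classical l u \<Longrightarrow> H1_norm \<Omega> u \<le> C * normU' l"
proof -
  obtain C where C: "\<And>l u. l \<in> U' \<Longrightarrow> solves_classical l u \<Longrightarrow> H1_norm \<Omega> u \<le> C * normU' l"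
    using assms unfolding classical_well_posed_def well_posed_def by blast
  show thesis
  proof (rule that[of "max C 0"])
    fix l u assume l: "l \<in> U'" and u: "solves_classical l u"
    have "C * normU' l \<le> max C 0 * normU' l" by (intro mult_right_mono normU'_nonneg[OF l]) simp
    then show "H1_norm \<Omega> u \<le> max C 0 * normU' l" using C[OF l u] by linarith
  qed simp
qed

lemma classical_imp_broken:
  assumes "classical_well_posed \<Omega> \<Gamma>u \<omega> \<rho> A T" shows "broken_well_posed \<Omega> \<Gamma>u \<omega> \<rho> A T"
proof -
  obtain C where C: "C \<ge> 0" "\<And>l u. l \<in> U' \<Longrightarrow> solves_classical l u \<Longrightarrow> H1_norm \<Omega> u \<le> C * normU' l"
    using classical_well_posed_bound[OF assms] by blast
  show ?thesis unfolding broken_well_posed_def well_posed_def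
    using broken_unique_solution[OF assms] broken_solution_bound[OF assms C] by blast
qed

text \<open>
  Extend the functional from \<open>U\<close> to the broken space. The solutions of the classical problem are then
  precisely the first components of the solutions of the broken problem.
\<close>

lemma broken_imp_classical:
  assumes "broken_well_posed \<Omega> \<Gamma>u \<omega> \<rho> A T" shows "classical_well_posed \<Omega> \<Gamma>u \<omega> \<rho> A T"
proof -
  obtain C where ex: "\<And>l. l \<in> V' \<Longrightarrow> \<exists>x. solves_broken l x \<and> (\<forall>y. solves_broken l y \<longrightarrow> same_U_mesh \<Omega> x y)"
    and C: "\<And>l x. l \<in> V' \<Longrightarrow> solves_broken l x \<Longrightarrow> U_mesh_norm \<Omega> \<Gamma>u T x \<le> C * normV' l"
    using assms unfolding broken_well_posed_def well_posed_def by blast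
  have ext: "solves_classical l = solves_classical l'" if "\<And>v. v \<in> U \<Longrightarrow> l' v = l v" for l l'
    using that by (auto simp: solves_def fun_eq_iff)
  have "\<exists>u. solves_classical l u \<and> (\<forall>w. solves_classical l w \<longrightarrow> same_on \<Omega> u w)" if l: "l \<in> U'" for l
  proof -
    obtain l' where l': "l' \<in> V'" "\<And>v. v \<in> U \<Longrightarrow> l' v = l v" using U'_extend[OF l] by blast
    obtain u s where us: "solves_broken l' (u, s)" "\<And>y. solves_broken l' y \<Longrightarrow> same_U_mesh \<Omega> (u, s) y"
      using ex[OF l'(1)] by (metis surj_pair)
    have "same_on \<Omega> u w" if w: "solves_classical l w" for w
    proof -
      have "solves_classical l' w" using w ext[OF l'(2)] by simp
      then obtain t where "solves_broken l' (w, t)" using classical_solution_broken[OF l'(1)] by metis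
      from us(2)[OF this] show ?thesis by (simp add: same_U_mesh_def)
    qed
    moreover have "solves_classical l u" using broken_solution_classical[OF us(1)] ext[OF l'(2)] by simp
    ultimately show ?thesis by blast
  qed
  moreover have "H1_norm \<Omega> u \<le> (2 * \<bar>C\<bar>) * normU' l" if l: "l \<in> U'" and u: "solves_classical l u" for l u
  proof -
    obtain l' where l': "l' \<in> V'" "\<And>v. v \<in> U \<Longrightarrow> l' v = l v" "normV' l' \<le> 2 * normU' l" using U'_extend[OF l] by blast
    have "solves_classical l' u" using u ext[OF l'(2)] by simp
    then obtain s where s: "solves_broken l' (u, s)" using classical_solution_broken[OF l'(1)] by metis
    have "H1_norm \<Omega> u \<le> U_mesh_norm \<Omega> \<Gamma>u T (u, s)"
      by (simp add: U_mesh_norm_def real_le_rsqrt)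
    also have "\<dots> \<le> C * normV' l'" by (rule C[OF l'(1) s])
    also have "\<dots> \<le> \<bar>C\<bar> * (2 * normU' l)" using l'(3) normV'_nonneg[OF l'(1)] by (intro mult_mono) auto
    finally show ?thesis by simp
  qed
  ultimately show ?thesis unfolding classical_well_posed_def well_posed_def by blast
qed

end

text \<open>
  For arguments in \<open>H1 \<Omega>\<close> the elementwise gradients agree with the gradient on \<open>\<Omega>\<close>, so \<open>b0\<close> is an integral
  over \<open>\<Omega>\<close> in which the mesh does not occur.
\<close>

lemma solves_classical_mesh_independent:
  assumes "viscoelastic_mesh \<Omega> T \<Gamma>u \<omega> \<rho> A M" "viscoelastic_mesh \<Omega> T' \<Gamma>u \<omega> \<rho> A M"
  shows "solves (H1_zero_on \<Omega> \<Gamma>u) (H1_zero_on \<Omega> \<Gamma>u) (b0 \<omega> \<rho> A T) =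
    solves (H1_zero_on \<Omega> \<Gamma>u) (H1_zero_on \<Omega> \<Gamma>u) (b0 \<omega> \<rho> A T')"
  using viscoelastic_mesh.b0_H1[OF assms(1)] viscoelastic_mesh.b0_H1[OF assms(2)]
  by (auto simp: solves_def fun_eq_iff H1_zero_on_def)

theorem theorem2p2:
  fixes \<Omega> \<Gamma>u \<Gamma>\<sigma> :: "(real^3) set" and \<omega> \<rho> :: real and A :: "real^3 \<Rightarrow> complex^3^3^3^3"
  assumes "lipschitz_domain \<Omega>"
    and "openin (top_of_set (frontier \<Omega>)) \<Gamma>u" and "openin (top_of_set (frontier \<Omega>)) \<Gamma>\<sigma>"
    and "closure (\<Gamma>u \<union> \<Gamma>\<sigma>) = frontier \<Omega>" and "\<Gamma>u \<inter> \<Gamma>\<sigma> = {}" and "\<Gamma>u \<noteq> {}"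
    and "\<rho> > 0"
    and "stiffness_field \<Omega> A"
  shows "(\<forall>T. mesh \<Omega> T \<longrightarrow>
            (broken_well_posed \<Omega> \<Gamma>u \<omega> \<rho> A T \<longleftrightarrow> classical_well_posed \<Omega> \<Gamma>u \<omega> \<rho> A T)) \<and>
         (\<exists>C>0. \<forall>T. mesh \<Omega> T \<longrightarrow> broken_well_posed \<Omega> \<Gamma>u \<omega> \<rho> A T \<longrightarrow>
            (\<forall>l\<in>antidual (H1_broken T) (H1_broken_norm T).
               \<exists>x. solves (U_mesh \<Omega> \<Gamma>u T) (H1_broken T) (b_mesh \<omega> \<rho> A T) l x \<and>
                   (\<forall>y. solves (U_mesh \<Omega> \<Gamma>u T) (H1_broken T) (b_mesh \<omega> \<rho> A T) l y
                        \<longrightarrow> same_U_mesh \<Omega> x y) \<and>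
                   U_mesh_norm \<Omega> \<Gamma>u T x
                     \<le> C * antidual_norm (H1_broken T) (H1_broken_norm T) l))"
proof -
  obtain M where M: "M \<ge> 0" "\<And>x p. x \<in> \<Omega> \<Longrightarrow> norm (material \<omega> \<rho> A x p) \<le> M * norm p"
    using material_bounded[of A \<Omega> \<omega> \<rho>] assms(8) by (auto simp: stiffness_field_def)
  obtain S where "open S" "\<Gamma>u = frontier \<Omega> \<inter> S" using assms(2) by (auto simp: openin_open)
  then have \<Gamma>u: "\<Gamma>u \<in> sets borel" "\<Gamma>u \<subseteq> frontier \<Omega>" by (auto intro!: sets.Int borel_closed)
  have vm: "viscoelastic_mesh \<Omega> T \<Gamma>u \<omega> \<rho> A M" if "mesh \<Omega> T" for T
    using assms(1,8) that \<Gamma>u M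
    by (intro viscoelastic_mesh.intro lipschitz_mesh.intro viscoelastic_mesh_axioms.intro) (auto simp: stiffness_field_def)
  have eqv: "broken_well_posed \<Omega> \<Gamma>u \<omega> \<rho> A T \<longleftrightarrow> classical_well_posed \<Omega> \<Gamma>u \<omega> \<rho> A T" if "mesh \<Omega> T" for T
    using viscoelastic_mesh.broken_imp_classical[OF vm[OF that]] viscoelastic_mesh.classical_imp_broken[OF vm[OF that]] by blast
  let ?P = "\<lambda>C T. \<forall>l\<in>antidual (H1_broken T) (H1_broken_norm T).
     \<exists>x. solves (U_mesh \<Omega> \<Gamma>u T) (H1_broken T) (b_mesh \<omega> \<rho> A T) l x \<and>
         (\<forall>y. solves (U_mesh \<Omega> \<Gamma>u T) (H1_broken T) (b_mesh \<omega> \<rho> A T) l y \<longrightarrow> same_U_mesh \<Omega> x y) \<and>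
         U_mesh_norm \<Omega> \<Gamma>u T x \<le> C * antidual_norm (H1_broken T) (H1_broken_norm T) l"
  have "\<exists>C>0. \<forall>T. mesh \<Omega> T \<longrightarrow> broken_well_posed \<Omega> \<Gamma>u \<omega> \<rho> A T \<longrightarrow> ?P C T"
  proof (cases "\<exists>T. mesh \<Omega> T \<and> broken_well_posed \<Omega> \<Gamma>u \<omega> \<rho> A T")
    case False
    \<comment> \<open>no mesh to consider, any positive constant will do\<close>
    then show ?thesis by (intro exI[of _ 1]) auto
  next
    case True
    \<comment> \<open>a constant for the classical problem, taken from one mesh, serves all others\<close>
    then obtain T0 where T0: "mesh \<Omega> T0" "classical_well_posed \<Omega> \<Gamma>u \<omega> \<rho> A T0" using eqv by blast
    obtain C where C: "C \<ge> 0" "\<And>l u. l \<in> antidual (H1_zero_on \<Omega> \<Gamma>u) (H1_norm \<Omega>) \<Longrightarrow>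
        solves (H1_zero_on \<Omega> \<Gamma>u) (H1_zero_on \<Omega> \<Gamma>u) (b0 \<omega> \<rho> A T0) l u \<Longrightarrow>
        H1_norm \<Omega> u \<le> C * antidual_norm (H1_zero_on \<Omega> \<Gamma>u) (H1_norm \<Omega>) l"
      using viscoelastic_mesh.classical_well_posed_bound[OF vm[OF T0(1)] T0(2)] by blast
    have "?P (C + 2 * (M * C) + 1) T" if T: "mesh \<Omega> T" "broken_well_posed \<Omega> \<Gamma>u \<omega> \<rho> A T" for T
    proof
      interpret viscoelastic_mesh \<Omega> T \<Gamma>u \<omega> \<rho> A M by (rule vm[OF T(1)])
      have cwp: "classical_well_posed \<Omega> \<Gamma>u \<omega> \<rho> A T" using T eqv by blast
      have CT: "H1_norm \<Omega> u \<le> C * normU' l" if "l \<in> U'" "solves_classical l u" for l u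
        using C(2)[OF that(1)] that(2) solves_classical_mesh_independent[OF vm[OF T0(1)] vm[OF T(1)]] by simp
      fix l assume l: "l \<in> V'"
      obtain x where x: "solves_broken l x" "\<forall>y. solves_broken l y \<longrightarrow> same_U_mesh \<Omega> x y"
        using broken_unique_solution[OF cwp l] by blast
      then show "\<exists>x. solves_broken l x \<and> (\<forall>y. solves_broken l y \<longrightarrow> same_U_mesh \<Omega> x y) \<and>
          U_mesh_norm \<Omega> \<Gamma>u T x \<le> (C + 2 * (M * C) + 1) * normV' l"
        using broken_solution_bound[OF cwp C(1) CT l x(1)] by blast
    qed
    moreover have "C + 2 * (M * C) + 1 > 0"
      using C(1) M(1) mult_nonneg_nonneg[OF M(1) C(1)] by linarith
    ultimately show ?thesis by blast
  qed
  with eqv show ?thesis by blast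
qed

end
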